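(* Let $n\ge2$. For any generalized tiling $T$ on $Z_n$, the spectrum $B_T$ is a semi-normal TP-basis. Conversely, for any semi-normal TP-basis $B\subseteq2^{[n]}$ there exists a generalized tiling $T$ on $Z_n$ with $B_T=B$.
   Context: Notation: $[n]=\{1,\dots,n\}$, $[p..q]=\{p,\dots,q\}$, $[q]=[1..q]$, $[0]=\emptyset$; $Xi=X\cup\{i\}$, $Xij=X\cup\{i,j\}$, etc. TP-bases. $f:2^{[n]}\to\mathbb R$ is a TP-function if $f(Xik)+f(Xj)=\max\{f(Xij)+f(Xk),f(Xi)+f(Xjk)\}$ for all $i<j<k$ and $X\subseteq[n]\setminus\{i,j,k\}$. $B\subseteq2^{[n]}$ is a TP-basis if restriction from TP-functions to $\mathbb R^B$ is bijective. $\mathcal I_n$ ($\emptyset$ and all intervals $[p..q]$) is a TP-basis. A flip: if a TP-basis $B$ contains $Xij,Xk,Xi,Xjk$ ($i<j<k$) and exactly one $Y\in\{Xj,Xik\}$, replace $Y$ by the other member (giving again a TP-basis). Semi-normal TP-bases are those obtained from $\mathcal I_n$ by finitely many flips. Zonogon and g-tilings. Fix $\xi_i=(a_i,1)$, $a_1<\dots<a_n$, all integer combinations distinct; identify $X\subseteq[n]$ with $\sum_{i\in X}\xi_i$. $Z_n=\{\sum\lambda_i\xi_i:0\le\lambda_i\le1\}$, with boundary segments joining $[i-1]$ to $[i]$ and $[i+1..n]$ to $[i..n]$. For $i<j$, $X\subseteq[n]\setminus\{i,j\}$, tile $\tau(X;i,j)$ is the parallelogram with vertices $b(\tau)=X$,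 $\ell(\tau)=Xi$, $r(\tau)=Xj$, $t(\tau)=Xij$; its sides are edges, an edge between $Y$ and $Yq$ directed from $Y$ to $Yq$. A g-tiling is a finite set $T$ of tiles partitioned into white and black with: (T1) tiles lie in $Z_n$; each boundary segment is an edge of exactly one tile; each other edge is an edge of exactly two tiles; no two tiles coincide; (T2) white tiles sharing an edge have no common interior point; a white and a black tile sharing an edge have a common interior point; no two black tiles share an edge; (T3) for black $\tau$: $b(\tau),t(\tau)$ are not vertices of another black tile, all edges at $b(\tau)$ leave it, all edges at $t(\tau)$ enter it; (T4) the union of the squares $\mathrm{conv}\{X,Xi,Xj,Xij\}\subset[0,1]^n$ over $\tau(X;i,j)\in T$ (sets viewed as 0/1 vectors) is homeomorphic to a closed disc. Terminal vertices: bottom and top vertices of black tiles. Spectrum $B_T$: set of non-terminal vertices.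
   Formalization: A generalized tiling is required to have at least one white tile; this only excludes, for n=2, the single tile coloured black, which satisfies (T1)–(T4) but has spectrum {{1},{2}}, not a TP-basis; for n≥3 the condition follows from (T1) and (T2). *)

theory Defs
  imports "HOL-Analysis.Analysis"
begin

section \<open>TP-functions, TP-bases and flips\<close>

definition TP_functions :: "nat \<Rightarrow> (nat set \<Rightarrow> real) set" where
  "TP_functions n = {f \<in> extensional (Pow {1..n}).
     \<forall>i j k X. i < j \<and> j < k \<and> {i, j, k} \<subseteq> {1..n} \<and> X \<subseteq> {1..n} - {i, j, k} \<longrightarrow>
       f (X \<union> {i, k}) + f (X \<union> {j}) =
         max (f (X \<union> {i, j}) + f (X \<union> {k})) (f (X \<union> {i}) + f (X \<union> {j, k}))}"

definition TP_basis :: "nat \<Rightarrow> nat set set \<Rightarrow> bool" where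
  "TP_basis n B \<longleftrightarrow> B \<subseteq> Pow {1..n} \<and>
     bij_betw (\<lambda>f. restrict f B) (TP_functions n) (extensional B)"

definition intervals :: "nat \<Rightarrow> nat set set" where
  "intervals n = insert {} {{p..q} | p q. 1 \<le> p \<and> p \<le> q \<and> q \<le> n}"

definition TP_flip :: "nat \<Rightarrow> nat set set \<Rightarrow> nat set set \<Rightarrow> bool" where
  "TP_flip n B B' \<longleftrightarrow> TP_basis n B \<and>
     (\<exists>i j k X. i < j \<and> j < k \<and> {i, j, k} \<subseteq> {1..n} \<and> X \<subseteq> {1..n} - {i, j, k} \<and>
        {X \<union> {i, j}, X \<union> {k}, X \<union> {i}, X \<union> {j, k}} \<subseteq> B \<and>
        (X \<union> {j} \<in> B \<and> X \<union> {i, k} \<notin> B \<and> B' = B - {X \<union> {j}} \<union> {X \<union> {i, k}} \<or>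
         X \<union> {i, k} \<in> B \<and> X \<union> {j} \<notin> B \<and> B' = B - {X \<union> {i, k}} \<union> {X \<union> {j}}))"

definition semi_normal_TP_basis :: "nat \<Rightarrow> nat set set \<Rightarrow> bool" where
  "semi_normal_TP_basis n B \<longleftrightarrow> TP_basis n B \<and> (TP_flip n)\<^sup>*\<^sup>* (intervals n) B"


section \<open>The zonogon and its tiles\<close>

definition gen_vec :: "(nat \<Rightarrow> real) \<Rightarrow> nat \<Rightarrow> real \<times> real" where
  "gen_vec a i = (a i, 1)"

definition generic_generators :: "nat \<Rightarrow> (nat \<Rightarrow> real) \<Rightarrow> bool" where
  "generic_generators n a \<longleftrightarrow> strict_mono_on {1..n} a \<and>
     (\<forall>c d :: nat \<Rightarrow> int.
        (\<Sum>i\<in>{1..n}. of_int (c i) *\<^sub>R gen_vec a i) = (\<Sum>i\<in>{1..n}. of_int (d i) *\<^sub>R gen_vec a i) \<longrightarrow>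
        (\<forall>i\<in>{1..n}. c i = d i))"

definition set_point :: "(nat \<Rightarrow> real) \<Rightarrow> nat set \<Rightarrow> real \<times> real" where
  "set_point a X = (\<Sum>i\<in>X. gen_vec a i)"

definition zonogon :: "nat \<Rightarrow> (nat \<Rightarrow> real) \<Rightarrow> (real \<times> real) set" where
  "zonogon n a = {\<Sum>i\<in>{1..n}. l i *\<^sub>R gen_vec a i | l. \<forall>i\<in>{1..n}. 0 \<le> l i \<and> l i \<le> 1}"

text \<open>
  Vertices are kept as subsets of \<open>{1..n}\<close> and a directed edge from \<open>Y\<close> to \<open>Y \<union> {q}\<close> as the pair
  of its ends. For generic generators \<^const>\<open>set_point\<close> is injective on these subsets, so equality
  of vertices, edges and tiles agrees with equality of the corresponding plane figures.
\<close>

datatype tile = Tile (tile_base: "nat set") (tile_fst: nat) (tile_snd: nat)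

definition tiles :: "nat \<Rightarrow> tile set" where
  "tiles n = {Tile X i j | X i j. i < j \<and> {i, j} \<subseteq> {1..n} \<and> X \<subseteq> {1..n} - {i, j}}"

definition bottom :: "tile \<Rightarrow> nat set" where
  "bottom \<tau> = tile_base \<tau>"

definition left :: "tile \<Rightarrow> nat set" where
  "left \<tau> = tile_base \<tau> \<union> {tile_fst \<tau>}"

definition right :: "tile \<Rightarrow> nat set" where
  "right \<tau> = tile_base \<tau> \<union> {tile_snd \<tau>}"

definition top_vertex :: "tile \<Rightarrow> nat set" where
  "top_vertex \<tau> = tile_base \<tau> \<union> {tile_fst \<tau>, tile_snd \<tau>}"

definition tile_vertices :: "tile \<Rightarrow> nat set set" where
  "tile_vertices \<tau> = {bottom \<tau>, left \<tau>, right \<tau>, top_vertex \<tau>}"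

definition tile_edges :: "tile \<Rightarrow> (nat set \<times> nat set) set" where
  "tile_edges \<tau> = {(bottom \<tau>, left \<tau>), (bottom \<tau>, right \<tau>),
                   (left \<tau>, top_vertex \<tau>), (right \<tau>, top_vertex \<tau>)}"

definition tile_region :: "(nat \<Rightarrow> real) \<Rightarrow> tile \<Rightarrow> (real \<times> real) set" where
  "tile_region a \<tau> = convex hull (set_point a ` tile_vertices \<tau>)"

definition boundary_edges :: "nat \<Rightarrow> (nat set \<times> nat set) set" where
  "boundary_edges n = {({1..i - 1}, {1..i}) | i. i \<in> {1..n}} \<union> {({i + 1..n}, {i..n}) | i. i \<in> {1..n}}"

text \<open>
  The convex hull of the 0/1 vectors of the four vertices. Vectors of \<open>\<real>\<^sup>n\<close> are functions on
  \<^typ>\<open>nat\<close> vanishing outside \<open>{1..n}\<close>; on these the product topology of \<^typ>\<open>nat \<Rightarrow> real\<close> induces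
  the Euclidean one.
\<close>

definition cube_square :: "tile \<Rightarrow> (nat \<Rightarrow> real) set" where
  "cube_square \<tau> = {(\<lambda>k. \<Sum>Y\<in>tile_vertices \<tau>. w Y * indicat_real Y k) | w.
     (\<forall>Y\<in>tile_vertices \<tau>. 0 \<le> w Y) \<and> (\<Sum>Y\<in>tile_vertices \<tau>. w Y) = 1}"


section \<open>Generalized tilings\<close>

text \<open>A tiling is given by its set \<open>W\<close> of white and its set \<open>K\<close> of black tiles.\<close>

definition edges_of :: "tile set \<Rightarrow> (nat set \<times> nat set) set" where
  "edges_of T = (\<Union>\<tau>\<in>T. tile_edges \<tau>)"

definition share_edge :: "tile \<Rightarrow> tile \<Rightarrow> bool" where
  "share_edge \<tau> \<tau>' \<longleftrightarrow> tile_edges \<tau> \<inter> tile_edges \<tau>' \<noteq> {}"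

definition overlap :: "(nat \<Rightarrow> real) \<Rightarrow> tile \<Rightarrow> tile \<Rightarrow> bool" where
  "overlap a \<tau> \<tau>' \<longleftrightarrow> interior (tile_region a \<tau>) \<inter> interior (tile_region a \<tau>') \<noteq> {}"

definition axiom_T1 :: "nat \<Rightarrow> (nat \<Rightarrow> real) \<Rightarrow> tile set \<Rightarrow> bool" where
  "axiom_T1 n a T \<longleftrightarrow>
     (\<forall>\<tau>\<in>T. tile_region a \<tau> \<subseteq> zonogon n a) \<and>
     (\<forall>e\<in>boundary_edges n. card {\<tau>\<in>T. e \<in> tile_edges \<tau>} = 1) \<and>
     (\<forall>e\<in>edges_of T - boundary_edges n. card {\<tau>\<in>T. e \<in> tile_edges \<tau>} = 2) \<and>
     (\<forall>\<tau>\<in>T. \<forall>\<tau>'\<in>T. \<tau> \<noteq> \<tau>' \<longrightarrow> tile_region a \<tau> \<noteq> tile_region a \<tau>')"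

definition axiom_T2 :: "(nat \<Rightarrow> real) \<Rightarrow> tile set \<Rightarrow> tile set \<Rightarrow> bool" where
  "axiom_T2 a W K \<longleftrightarrow>
     (\<forall>\<tau>\<in>W. \<forall>\<tau>'\<in>W. \<tau> \<noteq> \<tau>' \<and> share_edge \<tau> \<tau>' \<longrightarrow> \<not> overlap a \<tau> \<tau>') \<and>
     (\<forall>\<tau>\<in>W. \<forall>\<tau>'\<in>K. share_edge \<tau> \<tau>' \<longrightarrow> overlap a \<tau> \<tau>') \<and>
     (\<forall>\<tau>\<in>K. \<forall>\<tau>'\<in>K. \<tau> \<noteq> \<tau>' \<longrightarrow> \<not> share_edge \<tau> \<tau>')"

definition axiom_T3 :: "tile set \<Rightarrow> tile set \<Rightarrow> bool" where
  "axiom_T3 W K \<longleftrightarrow> (\<forall>\<tau>\<in>K.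
     (\<forall>\<tau>'\<in>K - {\<tau>}. bottom \<tau> \<notin> tile_vertices \<tau>' \<and> top_vertex \<tau> \<notin> tile_vertices \<tau>') \<and>
     (\<forall>(Y, Y')\<in>edges_of (W \<union> K). bottom \<tau> \<in> {Y, Y'} \<longrightarrow> Y = bottom \<tau>) \<and>
     (\<forall>(Y, Y')\<in>edges_of (W \<union> K). top_vertex \<tau> \<in> {Y, Y'} \<longrightarrow> Y' = top_vertex \<tau>))"

definition axiom_T4 :: "tile set \<Rightarrow> bool" where
  "axiom_T4 T \<longleftrightarrow> (\<Union>\<tau>\<in>T. cube_square \<tau>) homeomorphic cball (0 :: real \<times> real) 1"

text \<open>
  The requirement \<open>W \<noteq> {}\<close> only matters for \<open>n = 2\<close>. There the zonogon itself is the only tile, and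
  coloured black it satisfies T1--T4, but its spectrum \<open>{{1}, {2}}\<close> is not a TP-basis; the unique
  generalized tiling for \<open>n = 2\<close> is understood to be this tile coloured white. For \<open>n \<ge> 3\<close> the requirement
  follows from T1 and T2, see \<open>white_tile_exists\<close> below.
\<close>

definition g_tiling :: "nat \<Rightarrow> (nat \<Rightarrow> real) \<Rightarrow> tile set \<Rightarrow> tile set \<Rightarrow> bool" where
  "g_tiling n a W K \<longleftrightarrow>
     finite (W \<union> K) \<and> W \<union> K \<subseteq> tiles n \<and> W \<inter> K = {} \<and> W \<noteq> {} \<and>
     axiom_T1 n a (W \<union> K) \<and> axiom_T2 a W K \<and> axiom_T3 W K \<and> axiom_T4 (W \<union> K)"

definition terminal_vertices :: "tile set \<Rightarrow> nat set set" where
  "terminal_vertices K = bottom ` K \<union> top_vertex ` K"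

definition spectrum :: "tile set \<Rightarrow> tile set \<Rightarrow> nat set set" where
  "spectrum W K = (\<Union>\<tau>\<in>W \<union> K. tile_vertices \<tau>) - terminal_vertices K"

lemma white_tile_exists:
  assumes "3 \<le> n" "W \<union> K \<subseteq> tiles n" "axiom_T1 n a (W \<union> K)" "axiom_T2 a W K"
  shows "W \<noteq> {}"
proof
  assume W: "W = {}"
  have bd: "e \<in> boundary_edges n" if "\<tau> \<in> K" "e \<in> tile_edges \<tau>" for e \<tau>
  proof (rule ccontr)
    assume "e \<notin> boundary_edges n"
    then have "card {\<tau>\<in>K. e \<in> tile_edges \<tau>} = 2"
      using assms(3) W that by (auto simp: axiom_T1_def edges_of_def)
    then obtain s t where "{\<tau>\<in>K. e \<in> tile_edges \<tau>} = {s, t}" "s \<noteq> t"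
      by (auto simp: card_2_iff)
    then have "s \<in> K" "t \<in> K" "e \<in> tile_edges s" "e \<in> tile_edges t" "s \<noteq> t"
      by auto
    then show False
      using assms(4) unfolding axiom_T2_def share_edge_def by blast
  qed
  have "({}, {1}) \<in> boundary_edges n"
    using assms(1) unfolding boundary_edges_def by (intro UnI1 CollectI exI[of _ 1]) auto
  then have "card {\<tau>\<in>K. ({}, {1}) \<in> tile_edges \<tau>} = 1"
    using assms(3) W by (auto simp: axiom_T1_def)
  then have "{\<tau>\<in>K. ({}, {1}) \<in> tile_edges \<tau>} \<noteq> {}"
    by (metis card.empty zero_neq_one)
  then obtain \<tau> where \<tau>: "\<tau> \<in> K" "({}, {1}) \<in> tile_edges \<tau>"
    by auto
  then obtain X i j where t: "\<tau> = Tile X i j" "i < j" "{i, j} \<subseteq> {1..n}" "X \<subseteq> {1..n} - {i, j}"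
    using assms(2) by (auto simp: tiles_def)
  have X: "X = {}" "i = 1"
    using \<tau>(2) t by (auto simp: tile_edges_def bottom_def left_def right_def top_vertex_def)
  have "({j}, {1, j}) \<in> boundary_edges n"
    using bd[OF \<tau>(1)] t X by (auto simp: tile_edges_def left_def right_def top_vertex_def)
  then consider m where "{j} = {1..m - 1}" "m \<in> {1..n}" | m where "{j} = {m + 1..n}" "{1, j} = {m..n}" "m \<in> {1..n}"
    by (auto simp: boundary_edges_def)
  then show False
  proof cases
    case 1
    then have "1 \<in> {1..m - 1}"
      by (metis atLeastAtMost_iff atLeastatMost_empty_iff insert_not_empty order_refl)
    then show False
      using 1 t(2) X(2) by auto
  next
    case 2
    have "m = 1"
      using 2 t(2) X(2)
      by (metis atLeastAtMost_iff insertI1 le_antisym)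
    then have "2 \<in> {m + 1..n}" "3 \<in> {m + 1..n}"
      using assms(1) by auto
    then show False
      using 2(1) by (metis numeral_eq_iff semiring_norm(89) singletonD)
  qed
qed

end

theory Submission
  imports Defs
begin

text \<open>
  Counting the tiles on the two sides of every edge, with the sides of black tiles exchanged, turns T1--T3 into purely
  combinatorial axioms (locale \<open>gt\<close>) that do not mention the generators. If \<open>X \<union> {i, k}\<close> belongs to the spectrum
  and is surrounded by tiles in the right way, it can be lowered to \<open>X \<union> {j}\<close>; on the complex of squares this replaces
  a disc on the surface of a 3-cube by the complementary disc, so T4 is preserved.

  Every tiling whose spectrum is not the set of intervals can be lowered: if there are black tiles, one looks just
  below a black tile of minimal level, and lifts the tiling to piecewise linear surfaces over the line in order to
  exclude that other black tiles interfere. Each lowering decreases the sum of the sizes of the sets in the spectrum, so every spectrum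
  arises from the intervals by raising flips. The same induction shows that the spectrum is weakly separated, and
  weak separation forces the surrounding tiles needed for a lowering flip to be present. Hence lowering flips of
  the spectrum lift to tilings, and raising flips are lowering flips after complementing all sets.
\<close>

section \<open>TP-bases\<close>

text \<open>The obstacle is that a tiling folds back at its black tiles, so several tiles may lie
  over one point of the zonogon. What stays planar is the set of edges with both ends nonterminal:
  on each level they form one chain from left to right, and most local arguments compare neighbours
  in such a chain. The folded part is controlled by placing a vertex \<open>X\<close> at abscissa
  \<open>wsum a X\<close> and height \<open>wsum f X\<close> with \<open>f\<close> strictly concave;
  a tile with nonterminal bottom is then the lowest of its level over a generic point. As
  \<open>gt\<close> does not mention the generators, \<open>a\<close> and \<open>f\<close> can be
  chosen anew in every such argument: weights whose gaps double force two tiles to overlap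
  horizontally, and a sharp bend of \<open>f\<close> then puts them in the wrong vertical order. The
  intervals form a TP-basis because a positive multiplicative form of the TP-relation has solutions
  with arbitrary values on intervals, and scaled logarithms of such solutions converge to a
  TP-function.\<close>

lemma TP_functionsD:
 assumes "f:TP_functions n" "i < j" "j < k" "{i, j, k}<={1..n}" "X<={1..n} - {i, j, k}"
 shows "f (insert i (insert k X)) + f (insert j X) =
 max (f (insert i (insert j X)) + f (insert k X)) (f (insert i X) + f (insert j (insert k X)))"
 using assms unfolding TP_functions_def by auto

lemma subset_interval_cases:
 assumes X: "X<={1..n}" and ne: "X~:intervals n"
 obtains i j k Z where "i < j" "j < k" "{i, j, k}<={1..n}" "Z<={1..n} - {i, j, k}"
 "X = insert i (insert k Z)" "Min X = i" "Max X = k" "ALL z:Z. i < z & z < k"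
proof -
 have fin: "finite X" using X finite_subset by blast
 have X0: "X ~= {}" using ne by (auto simp: intervals_def)
 let ?i = "Min X" and ?k = "Max X"
 have mem: "?i:X" "?k:X" using fin X0 by auto
 have sub: "X<={?i..?k}" using fin by auto
 have "X ~= {?i..?k}"
 proof
 assume "X = {?i..?k}"
 moreover have "1<=?i" "?k<=n" "?i<=?k" using mem X sub by auto
 ultimately have "X:intervals n"
 unfolding intervals_def by blast
 thus False using ne by simp
 qed
 then obtain j where j: "j:{?i..?k}" "j~:X" using sub by blast
 have ij: "?i < j" "j < ?k" using j mem by (auto simp: order_less_le)
 let ?Z = "X - {?i, ?k}"
 show ?thesis
 proof (rule that[of ?i j ?k ?Z])
 show "{?i, j, ?k}<={1..n}" using mem X ij by auto
 show "ALL z:?Z. ?i < z & z < ?k" using sub by (auto simp: order_less_le)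
 qed (use ij mem X j in auto)
qed

text \<open>A set that is no interval is \<open>Zik\<close> with extreme elements \<open>i\<close>,
  \<open>k\<close> and a missing \<open>j\<close> between them. The TP-relation links it to five
  sets that are smaller, or equally large with a smaller spread \<open>Max - Min\<close>. Hence
  everything is determined by the intervals.\<close>

lemma span_induct [consumes 1, case_names interval step]:
 assumes "X<={1..n}"
 and int: "!!X. X:intervals n ==> P X"
 and step: "!!i j k X. i < j ==> j < k ==> {i, j, k}<={1..n} ==> X<={1..n} - {i, j, k} ==>
 P (insert j X) ==> P (insert i (insert j X)) ==> P (insert k X) ==> P (insert i X) ==>
 P (insert j (insert k X)) ==> P (insert i (insert k X))"
 shows "P X"
 using assms(1)
proof (induction X rule: wf_induct[OF wf_measures[of "[card, %X. Max X - Min X]"], rule_format])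
 case (1 X)
 show ?case
 proof (cases "X:intervals n")
 case True
 thus ?thesis by (rule int)
 next
 case False
 obtain i j k Z where Z: "i < j" "j < k" "{i, j, k}<={1..n}" "Z<={1..n} - {i, j, k}"
 "X = insert i (insert k Z)" "Min X = i" "Max X = k" and b: "ALL z:Z. i < z & z < k"
 using subset_interval_cases[OF 1(2) False] by blast
 have fin: "finite Z" using Z(4) finite_subset by blast
 have cX: "card X = Suc (Suc (card Z))" using Z fin by (simp add: card_insert_if subset_Diff_insert)
 have small: "P Y" if "card Y < card X" "Y<={1..n}" for Y using that 1(1) by auto
 have notin: "i~:Z" "j~:Z" "k~:Z" using Z by auto
 have "Min (insert i (insert j Z)) = i"
 by (rule Min_eqI) (use fin Z(1) b in auto)
 moreover have "Max (insert i (insert j Z)) < k" using fin Z(1,2) b by (subst Max_less_iff) auto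
 moreover have "i~:insert j Z" "j~:insert k Z" using notin Z(1,2) by auto
 hence cc: "card (insert i (insert j Z)) = card X" "card (insert j (insert k Z)) = card X"
 using fin notin cX by auto
 ultimately have "(insert i (insert j Z), X):measures [card, %X. Max X - Min X]"
 using Z(1,2,6,7) by (simp only: in_measures cc) linarith
 hence "P (insert i (insert j Z))"
 by (rule 1(1)) (use Z in auto)
 moreover have "Max (insert j (insert k Z)) = k"
 by (rule Max_eqI) (use fin Z(2) b in auto)
 moreover have "Min (insert j (insert k Z)) > i" using fin Z(1,2) b by (subst Min_gr_iff) auto
 hence "(insert j (insert k Z), X):measures [card, %X. Max X - Min X]"
 using Z(1,2,6,7) calculation(2) by (simp only: in_measures cc) linarith
 hence "P (insert j (insert k Z))"
 by (rule 1(1)) (use Z in auto)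
 moreover have "P (insert j Z)" "P (insert i Z)" "P (insert k Z)"
 using Z fin cX notin by (auto intro!: small)
 ultimately have "P (insert i (insert k Z))"
 using step[of i j k Z] Z by blast
 thus ?thesis using Z by simp
 qed
qed

section \<open>Positive solutions of the multiplicative relation\<close>

text \<open>The three-term relation of flag minors: the TP-relation with max replaced by sum and sum
  replaced by product. It can be solved recursively where max would lose information.\<close>

definition positive_TP :: "nat => (nat set => real) => bool" where
 "positive_TP n F \<longleftrightarrow> (ALL X<={1..n}. 0 < F X) &
 (ALL i j k X. i < j & j < k & {i, j, k}<={1..n} & X<={1..n} - {i, j, k} -->
 F (insert i (insert k X)) * F (insert j X) =
 F (insert i (insert j X)) * F (insert k X) + F (insert i X) * F (insert j (insert k X)))"

lemma card_swap: "finite Y ==> p:Y ==> q~:Y ==> card (insert q (Y - {p})) = card Y"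
 by (metis Diff_iff card_Suc_Diff1 card_insert_disjoint finite_Diff)

text \<open>These are identities for the quotients \<open>F(Xij) F(X) / (F(Xi) F(Xj))\<close>, the
  later \<open>c X i j\<close>. The first is the relation multiplied by
  \<open>F(X) / (F(Xi) F(Xj) F(Xk))\<close>, the second the relation multiplied by
  \<open>F(Xijk) / (F(Xij) F(Xik) F(Xjk))\<close>, with \<open>x\<close> standing for
  \<open>F(Xijk)\<close>.\<close>

lemma positive_relation_quotients:
 fixes x :: real
 assumes "0 < x" "0 < xi" "0 < xj" "0 < xk" "0 < xij" "0 < xik" "0 < xjk" "xik * xj = xij * xk + xi * xjk"
 shows "xik * x / (xi * xk) = xij * x / (xi * xj) + xjk * x / (xj * xk)"
 and "x * xj / (xij * xjk) = x * xi / (xij * xik) + x * xk / (xik * xjk)"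
 and "xij * xk * (x * xi / (xij * xik)) = xi * xjk * (x * xk / (xik * xjk))"
 and "xij * xk * (xjk * x / (xj * xk)) = xi * xjk * (xij * x / (xi * xj))"
proof -
 have "xik = (xij * xk + xi * xjk) / xj" using assms by (simp add: field_simps)
 thus "xik * x / (xi * xk) = xij * x / (xi * xj) + xjk * x / (xj * xk)"
 using assms(1-7) by (simp add: field_simps)
 have "xj = (xij * xk + xi * xjk) / xik" using assms by (simp add: field_simps)
 thus "x * xj / (xij * xjk) = x * xi / (xij * xik) + x * xk / (xik * xjk)"
 using assms(1-7) by (simp add: field_simps)
qed (use assms in "simp_all add: field_simps")

text \<open>The value at \<open>X\<close> becomes the quotient of the extended function at
  \<open>insert (n + 1) X\<close> by the given one at \<open>X\<close>. For this quotient
  \<open>H\<close>, the relation with \<open>k = n + 1\<close> divided by \<open>F(Xi) F(Xj)\<close>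
  reads \<open>H(Xi) = H(Xj) + c X i j H(X)\<close>. The recursion applies it to the smallest
  element and the largest gap; it stops at the intervals ending in \<open>n\<close> and at the empty
  set, where the values are free.\<close>

function raise_rec :: "nat => (nat set => nat => nat => real) => (nat => real) => nat set => real" where
 "raise_rec n c h Y =
 (if Y<={1..n} & Y ~= {} & {1..n} - Y ~= {} & Min Y < Max ({1..n} - Y)
 then raise_rec n c h (insert (Max ({1..n} - Y)) (Y - {Min Y})) +
 c (Y - {Min Y}) (Min Y) (Max ({1..n} - Y)) * raise_rec n c h (Y - {Min Y})
 else h (card Y))"
 by auto
termination
proof (relation "measures [%(n, c, h, Y). card Y, %(n, c, h, Y). \<Sum>y\<in>Y. n - y]", goal_cases)
 case 1
 thus ?case by simp
next
 case (2 n c h Y)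
 let ?a = "Min Y" and ?b = "Max ({1..n} - Y)"
 have fin: "finite Y" using 2 finite_subset by blast
 have a: "?a:Y" using 2 fin by auto
 have b: "?b:{1..n} - Y" using 2 by (intro Max_in) auto
 have "card (insert ?b (Y - {?a})) = card Y"
 using a b fin by (intro card_swap) auto
 moreover have "(\<Sum>y\<in>insert ?b (Y - {?a}). n - y) < (\<Sum>y\<in>Y. n - y)"
 proof -
 have "(\<Sum>y\<in>insert ?b (Y - {?a}). n - y) = (n - ?b) + (\<Sum>y\<in>Y - {?a}. n - y)"
 using fin b by (subst sum.insert) auto
 also have "\<dots> < (n - ?a) + (\<Sum>y\<in>Y - {?a}. n - y)"
 proof -
 have "?a < ?b" "?b<=n" using 2 b by auto
 hence "n - ?b < n - ?a" by arith
 thus ?thesis by arith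
 qed
 also have "\<dots> = (\<Sum>y\<in>Y. n - y)" using sum.remove[OF fin a, of "%y. n - y"] by simp
 finally show ?thesis .
 qed
 ultimately show ?case by simp
next
 case (3 n c h Y)
 have fin: "finite Y" using 3 finite_subset by blast
 hence "card (Y - {Min Y}) < card Y" using 3 by (intro card_Diff1_less) auto
 thus ?case by simp
qed

declare raise_rec.simps [simp del]

lemma raise_rec_unfold:
 assumes "Y<={1..n}" "i:Y" "j:{1..n} - Y" "i < j"
 obtains a b where "a:Y" "b:{1..n} - Y" "a<=i" "j<=b"
 "raise_rec n c h Y = raise_rec n c h (insert b (Y - {a})) + c (Y - {a}) a b * raise_rec n c h (Y - {a})"
proof -
 let ?a = "Min Y" and ?b = "Max ({1..n} - Y)"
 have fin: "finite Y" using assms finite_subset by blast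
 have "?a<=i" "j<=?b" using assms fin by auto
 moreover have "?a:Y" using assms(2) fin by (intro Min_in) auto
 moreover have "?b:{1..n} - Y" using assms(3) by (intro Max_in) blast+
 moreover have cnd: "Y<={1..n} & Y ~= {} & {1..n} - Y ~= {} & ?a < ?b"
 using assms calculation(1,2) by (intro conjI) (blast, blast, blast, linarith)
 have "raise_rec n c h Y = raise_rec n c h (insert ?b (Y - {?a})) + c (Y - {?a}) ?a ?b * raise_rec n c h (Y - {?a})"
 by (rule trans[OF raise_rec.simps if_P[OF cnd]])
 ultimately show ?thesis using that by blast
qed

text \<open>The recursion uses one extremal pair; T1 to T3 make every other pair give the same
  value. First the smaller label is changed from \<open>a\<close> to \<open>i\<close> by comparing
  the sets over \<open>Z = Y - {a, i}\<close> (\<open>to_b\<close>), then the larger one from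
  \<open>b\<close> to \<open>j\<close> by the additivity T1.\<close>

lemma raise_rec_diff:
 assumes T1: "!!X i j k. i < j ==> j < k ==> {i, j, k}<={1..n} ==> X<={1..n} - {i, j, k} ==>
 c X i k = c X i j + c X j k"
 and T2: "!!X i j k. i < j ==> j < k ==> {i, j, k}<={1..n} ==> X<={1..n} - {i, j, k} ==>
 c (insert j X) i k = c (insert i X) j k + c (insert k X) i j"
 and T3: "!!X i j k. i < j ==> j < k ==> {i, j, k}<={1..n} ==> X<={1..n} - {i, j, k} ==>
 c (insert i X) j k * c X i j = c (insert k X) i j * c X j k"
 shows "Y<={1..n} ==> i:Y ==> j:{1..n} - Y ==> i < j ==>
 raise_rec n c h Y = raise_rec n c h (insert j (Y - {i})) + c (Y - {i}) i j * raise_rec n c h (Y - {i})"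
proof (induction Y arbitrary: i j rule: wf_induct[OF wf_measures[of "[card, %Y. \<Sum>y\<in>Y. n - y]"], rule_format])
 case (1 Y)
 let ?H = "raise_rec n c h"
 have fin: "finite Y" using 1(2) finite_subset by blast
 have mless: "(insert q (Y - {p}), Y):measures [card, %Y. \<Sum>y\<in>Y. n - y]"
 if "p:Y" "q:{1..n} - Y" "p < q" for p q
 proof -
 have "card (insert q (Y - {p})) = card Y"
 using that fin by (intro card_swap) auto
 moreover have "(\<Sum>y\<in>insert q (Y - {p}). n - y) < (\<Sum>y\<in>Y. n - y)"
 proof -
 have "(\<Sum>y\<in>insert q (Y - {p}). n - y) = (n - q) + (\<Sum>y\<in>Y - {p}. n - y)"
 using fin that by (subst sum.insert) auto
 also have "\<dots> < (n - p) + (\<Sum>y\<in>Y - {p}. n - y)" using that by auto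
 also have "\<dots> = (\<Sum>y\<in>Y. n - y)" using sum.remove[OF fin that(1), of "%y. n - y"] by simp
 finally show ?thesis .
 qed
 ultimately show ?thesis by simp
 qed
 have IHm: "?H (insert q (Y - {p})) = ?H (insert j' (insert q (Y - {p}) - {i'})) +
 c (insert q (Y - {p}) - {i'}) i' j' * ?H (insert q (Y - {p}) - {i'})"
 if "p:Y" "q:{1..n} - Y" "p < q" "i':insert q (Y - {p})" "j':{1..n} - insert q (Y - {p})" "i' < j'"
 for p q i' j'
 using 1(1)[OF mless[OF that(1-3)], of i' j'] that 1(2) by auto
 obtain a b where ab: "a:Y" "b:{1..n} - Y" "a<=i" "j<=b"
 and D: "?H Y = ?H (insert b (Y - {a})) + c (Y - {a}) a b * ?H (Y - {a})"
 using raise_rec_unfold[OF 1(2-5)] by blast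
 have to_b: "?H Y = ?H (insert b (Y - {i})) + c (Y - {i}) i b * ?H (Y - {i})"
 proof (cases "i = a")
 case True
 thus ?thesis using D by simp
 next
 case False
 define Z where "Z = Y - {a, i}"
 have ai: "a < i" "i < b" using False ab 1(5) by auto
 have Z: "Z<={1..n} - {a, i, b}" "{a, i, b}<={1..n}" using 1(2) ab 1(3) by (auto simp: Z_def)
 have Y: "Y = insert a (insert i Z)" using ab 1(3) by (auto simp: Z_def)
 have Ya: "Y - {a} = insert i Z" "Y - {i} = insert a Z" using Z ai by (auto simp: Y)
 have s1: "?H (insert b (insert a Z)) = ?H (insert i (insert b Z)) + c (insert b Z) a i * ?H (insert b Z)"
 proof -
 have "insert b (insert a Z) - {a} = insert b Z" using Z ai by auto
 thus ?thesis
 using IHm[of i b a i] 1(2,3) ab ai Z by (auto simp: Ya)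
 qed
 have low: "?H (insert p Z) = ?H (insert q Z) + c Z p q * ?H Z"
 if "p < q" "{p, q}<={1..n}" "p~:Z" "q~:Z" for p q
 proof -
 have "finite Z" using fin by (simp add: Z_def)
 have "a~:insert i Z" "i~:Z" using Z ai by auto
 hence "card Y = Suc (Suc (card Z))" using Y `finite Z` by simp
 hence "(insert p Z, Y):measures [card, %Y. \<Sum>y\<in>Y. n - y]"
 using `finite Z` that by auto
 moreover have "insert p Z - {p} = Z" using that by auto
 ultimately show ?thesis using 1(1)[of "insert p Z" p q] that Z by auto
 qed
 have l1: "?H (insert a Z) = ?H (insert i Z) + c Z a i * ?H Z"
 and l2: "?H (insert i Z) = ?H (insert b Z) + c Z i b * ?H Z"
 by (rule low; use ai Z in auto)+
 have t2: "c (insert i Z) a b = c (insert a Z) i b + c (insert b Z) a i"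
 and t3: "c (insert a Z) i b * c Z a i = c (insert b Z) a i * c Z i b"
 using T2[of a i b Z] T3[of a i b Z] ai Z by auto
 have "?H Y = ?H (insert b (insert i Z)) + c (insert i Z) a b * ?H (insert i Z)"
 using D by (simp add: Ya)
 also have "\<dots> = ?H (insert b (insert a Z)) + c (insert a Z) i b * ?H (insert a Z)"
 proof -
 have "c (insert i Z) a b * ?H (insert i Z) =
 c (insert b Z) a i * ?H (insert b Z) + c (insert a Z) i b * ?H (insert a Z)"
 proof -
 have "c (insert a Z) i b * ?H (insert a Z) = c (insert a Z) i b * ?H (insert i Z) + c (insert a Z) i b * c Z a i * ?H Z"
 by (simp add: l1 algebra_simps)
 moreover have "c (insert b Z) a i * ?H (insert i Z) = c (insert b Z) a i * ?H (insert b Z) + c (insert b Z) a i * c Z i b * ?H Z"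
 by (simp add: l2 algebra_simps)
 ultimately show ?thesis using t3 by (simp add: t2 algebra_simps)
 qed
 thus ?thesis using s1 by (simp add: insert_commute)
 qed
 finally show ?thesis by (simp add: Ya)
 qed
 show ?case
 proof (cases "j = b")
 case True
 thus ?thesis using to_b by simp
 next
 case False
 hence jb: "j < b" using ab by simp
 have e: "insert j (Y - {i}) - {j} = Y - {i}" using 1 by auto
 have "?H (insert j (Y - {i})) = ?H (insert b (Y - {i})) + c (Y - {i}) j b * ?H (Y - {i})"
 using IHm[of i j j b] 1 ab jb e by auto
 moreover have "c (Y - {i}) i b = c (Y - {i}) i j + c (Y - {i}) j b"
 using 1(2-5) ab(2) jb by (intro T1) auto
 ultimately show ?thesis using to_b by (simp add: algebra_simps)
 qed
qed

lemma raise_rec_pos: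
 assumes "!!m. 0 < h m" "!!X i j. i < j ==> {i, j}<={1..n} ==> X<={1..n} - {i, j} ==> 0 < c X i j"
 shows "0 < raise_rec n c h Y"
 using assms
proof (induction n c h Y rule: raise_rec.induct)
 case (1 n c h Y)
 show ?case
 proof (cases "Y<={1..n} & Y ~= {} & {1..n} - Y ~= {} & Min Y < Max ({1..n} - Y)")
 case True
 have fin: "finite Y" using True finite_subset by blast
 have "Min Y:Y" using True fin by (intro Min_in) auto
 moreover have "Max ({1..n} - Y):{1..n} - Y" using True by (intro Max_in) blast+
 ultimately have "0 < c (Y - {Min Y}) (Min Y) (Max ({1..n} - Y))"
 using True by (intro 1(4)) auto
 thus ?thesis
 using 1(1)[OF True 1(3,4)] 1(2)[OF True 1(3,4)]
 by (subst raise_rec.simps, subst if_P[OF True]) (intro add_pos_pos mult_pos_pos)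
 next
 case False
 thus ?thesis using 1(3) by (subst raise_rec.simps) auto
 qed
qed

text \<open>A set with \<open>n + 1\<close> gets the value \<open>F(X) H(X)\<close>. Relations
  without \<open>n + 1\<close> are those of \<open>F\<close>, and relations with
  \<open>k = n + 1\<close> are the recursion of \<open>H\<close>. If \<open>n + 1\<close> lies in
  \<open>X\<close>, all values of \<open>H\<close> in the relation are expressed through
  \<open>y\<close>, \<open>z\<close> and \<open>hh\<close>.\<close>

lemma positive_TP_extend:
 assumes F: "positive_TP n F" and h: "!!p. p:{1..Suc n} ==> 0 < (h :: nat => real) p"
 obtains G where "positive_TP (Suc n) G" "!!X. X<={1..n} ==> G X = F X"
 "!!p. p:{1..Suc n} ==> G {p..Suc n} = h p"
proof -
 have Fp: "0 < F X" if "X<={1..n}" for X using F that by (auto simp: positive_TP_def)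
 have FT: "F (insert i (insert k X)) * F (insert j X) =
 F (insert i (insert j X)) * F (insert k X) + F (insert i X) * F (insert j (insert k X))"
 if "i < j" "j < k" "{i, j, k}<={1..n}" "X<={1..n} - {i, j, k}" for i j k X
 using F that unfolding positive_TP_def by blast
 define c where "c X i j = F (insert i (insert j X)) * F X / (F (insert i X) * F (insert j X))" for X i j
 \<comment> \<open>Terminal values are indexed by cardinality: \<open>{p..n}\<close> has
   \<open>Suc n - p\<close> elements, and \<open>p = Suc n\<close> stands for the empty set, that is
   for the interval \<open>{Suc n}\<close> after the extension.\<close>
 define g where "g m = (if m<=n then h (Suc n - m) / F {Suc n - m..n} else 1)" for m
 define H where "H = raise_rec n c g"
 have cp: "0 < c X i j" if "{i, j}<={1..n}" "X<={1..n}" for X i j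
 unfolding c_def using that by (intro divide_pos_pos mult_pos_pos Fp) auto
 have gp: "0 < g m" for m
 proof (cases "m<=n")
 case True
 hence "0 < h (Suc n - m)" "0 < F {Suc n - m..n}" using h[of "Suc n - m"] by (auto intro!: Fp)
 thus ?thesis using True by (simp add: g_def)
 qed (simp add: g_def)
 have Hp: "0 < H X" for X unfolding H_def by (rule raise_rec_pos) (rule gp, rule cp, auto)
 have eqs: "c X i k = c X i j + c X j k"
 "c (insert j X) i k = c (insert i X) j k + c (insert k X) i j"
 "c (insert i X) j k * c X i j = c (insert k X) i j * c X j k"
 if "i < j" "j < k" "{i, j, k}<={1..n}" "X<={1..n} - {i, j, k}" for X i j k
 proof -
 have p: "F X > 0" "F (insert i X) > 0" "F (insert j X) > 0" "F (insert k X) > 0"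
 "F (insert i (insert j X)) > 0" "F (insert i (insert k X)) > 0" "F (insert j (insert k X)) > 0"
 "F (insert i (insert j (insert k X))) > 0"
 using that by (auto intro!: Fp)
 have ic: "insert j (insert i Z) = insert i (insert j Z)" "insert k (insert i Z) = insert i (insert k Z)"
 "insert k (insert j Z) = insert j (insert k Z)" for Z by auto
 note q = positive_relation_quotients[OF _ p(2-7) FT[OF that]]
 show "c X i k = c X i j + c X j k"
 using q(1)[OF p(1)] unfolding c_def .
 show "c (insert j X) i k = c (insert i X) j k + c (insert k X) i j"
 using q(2)[OF p(8)] unfolding c_def ic .
 show "c (insert i X) j k * c X i j = c (insert k X) i j * c X j k"
 unfolding c_def ic using p by (simp add: field_simps)
 qed
 have Hd: "H (insert i X) = H (insert j X) + c X i j * H X"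
 if "i < j" "{i, j}<={1..n}" "X<={1..n} - {i, j}" for X i j
 proof -
 have e: "insert i X - {i} = X" using that by auto
 show ?thesis
 using raise_rec_diff[of n c "insert i X" i j g, OF eqs] that unfolding H_def[symmetric] e by auto
 qed
 have Hint: "H {p..n} = h p / F {p..n}" if "p:{1..Suc n}" for p
 proof -
 have "{1..n} - {p..n} = {1..<p}" using that by auto
 moreover have "~ (p<=n & 1 < p & Min {p..n} < Max {1..<p})"
 proof
 assume a: "p<=n & 1 < p & Min {p..n} < Max {1..<p}"
 hence "Min {p..n} >= p" by auto
 moreover have "Max {1..<p} < p" using a by auto
 ultimately show False using a by linarith
 qed
 ultimately have "H {p..n} = g (card {p..n})"
 unfolding H_def by (subst raise_rec.simps) auto
 moreover have "card {p..n} = Suc n - p" "Suc n - (Suc n - p) = p" "Suc n - p<=n" using that by auto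
 ultimately show ?thesis by (simp add: g_def)
 qed
 define G where "G X = (if Suc n:X then F (X - {Suc n}) * H (X - {Suc n}) else F X)" for X
 let ?N = "Suc n"
 have GN: "G (insert ?N X) = F X * H X" if "X<={1..n}" for X
 proof -
 have "insert ?N X - {?N} = X" using that by auto
 thus ?thesis by (simp add: G_def)
 qed
 have G0: "G X = F X" if "X<={1..n}" for X using that by (auto simp: G_def)
 have split: "X = insert ?N (X - {?N}) & X - {?N}<={1..n} | X<={1..n}" if "X<={1..?N}" for X
 using that by (cases "?N:X") (auto simp: atLeastAtMostSuc_conv)
 have "positive_TP ?N G"
 unfolding positive_TP_def
 proof (intro conjI allI impI)
 fix X assume "X<={1..?N}"
 from split[OF this] show "0 < G X"
 proof (elim disjE conjE)
 assume a: "X = insert ?N (X - {?N})" "X - {?N}<={1..n}"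
 have "G (insert ?N (X - {?N})) > 0" using GN[OF a(2)] Fp[OF a(2)] Hp[of "X - {?N}"] by simp
 thus ?thesis using a(1) by simp
 next
 assume "X<={1..n}"
 thus ?thesis using G0 Fp by simp
 qed
 next
 fix i j k X
 assume a: "i < j & j < k & {i, j, k}<={1..?N} & X<={1..?N} - {i, j, k}"
 show "G (insert i (insert k X)) * G (insert j X) =
 G (insert i (insert j X)) * G (insert k X) + G (insert i X) * G (insert j (insert k X))"
 proof (cases "k = ?N")
 case True
 have X: "X<={1..n} - {i, j}" "{i, j}<={1..n}" using a True by (auto simp: atLeastAtMostSuc_conv)
 have cm: "insert i (insert ?N X) = insert ?N (insert i X)" "insert j (insert ?N X) = insert ?N (insert j X)" by auto
 have p: "F X > 0" "F (insert i X) > 0" "F (insert j X) > 0" "F (insert i (insert j X)) > 0"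
 using X by (auto intro!: Fp)
 have d: "H (insert i X) = H (insert j X) + F (insert i (insert j X)) * F X / (F (insert i X) * F (insert j X)) * H X"
 using Hd[of i j X] X a by (auto simp: c_def)
 have "F (insert i X) * H (insert i X) * F (insert j X) =
 F (insert i (insert j X)) * (F X * H X) + F (insert i X) * (F (insert j X) * H (insert j X))"
 unfolding d using p by (simp add: field_simps)
 moreover have "insert i X<={1..n}" "insert j X<={1..n}" "X<={1..n}" "insert i (insert j X)<={1..n}"
 using X by auto
 ultimately show ?thesis
 unfolding True cm by (simp only: GN G0)
 next
 case False
 hence ijk: "{i, j, k}<={1..n}" using a by auto
 show ?thesis
 proof (cases "?N:X")
 case True
 define Z where "Z = X - {?N}"
 have Z: "X = insert ?N Z" "Z<={1..n} - {i, j, k}" using True a by (auto simp: Z_def atLeastAtMostSuc_conv)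
 have cm: "insert i (insert ?N Y) = insert ?N (insert i Y)" "insert j (insert ?N Y) = insert ?N (insert j Y)"
 "insert k (insert ?N Y) = insert ?N (insert k Y)" for Y by auto
 have p: "F Z > 0" "F (insert i Z) > 0" "F (insert j Z) > 0" "F (insert k Z) > 0"
 "F (insert i (insert j Z)) > 0" "F (insert i (insert k Z)) > 0" "F (insert j (insert k Z)) > 0"
 "F (insert i (insert j (insert k Z))) > 0"
 using ijk Z by (auto intro!: Fp)
 have ic: "insert k (insert i Z) = insert i (insert k Z)" "insert j (insert i Z) = insert i (insert j Z)"
 "insert k (insert j Z) = insert j (insert k Z)" by auto
 have d1: "H (insert i Z) = H (insert j Z) + c Z i j * H Z" "H (insert j Z) = H (insert k Z) + c Z j k * H Z"
 using Hd[of i j Z] Hd[of j k Z] a Z ijk by auto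
 have d2: "H (insert i (insert j Z)) = H (insert i (insert k Z)) + c (insert i Z) j k * H (insert i Z)"
 "H (insert i (insert k Z)) = H (insert j (insert k Z)) + c (insert k Z) i j * H (insert k Z)"
 using Hd[of j k "insert i Z"] Hd[of i j "insert k Z"] a Z ijk ic by auto
 have R: "F (insert i (insert k Z)) * F (insert j Z) =
 F (insert i (insert j Z)) * F (insert k Z) + F (insert i Z) * F (insert j (insert k Z))"
 using FT[of i j k Z] a ijk Z by auto
 note q = positive_relation_quotients[OF _ p(2-7) R]
 have ic': "insert j (insert i (insert k Z)) = insert i (insert j (insert k Z))" by auto
 have k1: "F (insert i (insert j Z)) * F (insert k Z) * c (insert i Z) j k =
 F (insert i Z) * F (insert j (insert k Z)) * c (insert k Z) i j"
 using q(3)[OF p(8)] unfolding c_def ic ic' .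
 have k2: "F (insert i (insert j Z)) * F (insert k Z) * c Z j k =
 F (insert i Z) * F (insert j (insert k Z)) * c Z i j"
 using q(4)[OF p(1)] unfolding c_def .
 define y z hh where "y = H (insert i (insert k Z))" and "z = H (insert j Z)" and "hh = H Z"
 define u w where "u = z + c Z i j * hh" and "w = z - c Z j k * hh"
 have hs: "H (insert i Z) = u" "H (insert k Z) = w"
 "H (insert i (insert j Z)) = y + c (insert i Z) j k * u" "H (insert j (insert k Z)) = y - c (insert k Z) i j * w"
 using d1 d2 by (auto simp: u_def w_def y_def z_def hh_def)
 define P Q where "P = F (insert i (insert j Z)) * F (insert k Z)" and "Q = F (insert i Z) * F (insert j (insert k Z))"
 \<comment> \<open>The terms with \<open>u * w\<close> cancel by \<open>k1\<close>, those with
   \<open>hh\<close> by \<open>k2\<close>.\<close>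
 have "P * (y + c (insert i Z) j k * u) * w + Q * u * (y - c (insert k Z) i j * w) =
 (P * c (insert i Z) j k - Q * c (insert k Z) i j) * (u * w) + y * (P * w + Q * u)"
 by (simp add: algebra_simps)
 also have "\<dots> = y * ((P + Q) * z + (Q * c Z i j - P * c Z j k) * hh)"
 using k1 by (simp add: P_def Q_def u_def w_def algebra_simps)
 also have "\<dots> = (P + Q) * y * z" using k2 by (simp add: P_def Q_def)
 finally have "P * (y + c (insert i Z) j k * u) * w + Q * u * (y - c (insert k Z) i j * w) = (P + Q) * y * z" .
 moreover have "P + Q = F (insert i (insert k Z)) * F (insert j Z)" using R by (simp add: P_def Q_def)
 moreover have "insert j Z<={1..n}" "insert i (insert j Z)<={1..n}" "insert k Z<={1..n}" "insert i Z<={1..n}"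
 "insert j (insert k Z)<={1..n}" "insert i (insert k Z)<={1..n}" using Z ijk by auto
 ultimately show ?thesis
 unfolding Z(1) cm by (simp only: GN hs P_def Q_def y_def[symmetric] z_def[symmetric]) (simp only: ac_simps)
 next
 case False
 hence "X<={1..n} - {i, j, k}" using a by (auto simp: atLeastAtMostSuc_conv)
 moreover from this have "insert j X<={1..n}" "insert i (insert j X)<={1..n}" "insert k X<={1..n}" "insert i X<={1..n}"
 "insert j (insert k X)<={1..n}" "insert i (insert k X)<={1..n}" using ijk by auto
 ultimately show ?thesis using FT[of i j k X] a ijk by (simp only: G0)
 qed
 qed
 qed
 moreover have "G {p..?N} = h p" if "p:{1..?N}" for p
 proof -
 have "{p..?N} = insert ?N {p..n}" using that by (auto simp: atLeastAtMostSuc_conv)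
 hence "G {p..?N} = F {p..n} * H {p..n}" using that GN[of "{p..n}"] by auto
 thus ?thesis using Hint[OF that] Fp[of "{p..n}"] that by auto
 qed
 ultimately show ?thesis using that G0 by blast
qed

lemma intervals_Suc:
 "I:intervals (Suc n) \<longleftrightarrow> I:intervals n | (EX p:{1..Suc n}. I = {p..Suc n})"
 unfolding intervals_def by (auto simp: le_Suc_eq)

lemma intervals_subset: "I:intervals n ==> I<={1..n}"
 unfolding intervals_def by auto

lemma positive_TP_exists:
 assumes "!!I. I:intervals n ==> 0 < (g :: nat set => real) I"
 obtains F where "positive_TP n F" "!!I. I:intervals n ==> F I = g I"
proof -
 have "EX F. positive_TP n F & (ALL I:intervals n. F I = g I)"
 using assms
 proof (induction n)
 case 0
 thus ?case by (intro exI[of _ g]) (auto simp: positive_TP_def intervals_def)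
 next
 case (Suc n)
 then obtain F where F: "positive_TP n F" "ALL I:intervals n. F I = g I"
 by (auto simp: intervals_Suc)
 have "!!p. p:{1..Suc n} ==> 0 < g {p..Suc n}"
 using Suc.prems by (auto simp: intervals_Suc)
 then obtain G where "positive_TP (Suc n) G" "!!X. X<={1..n} ==> G X = F X"
 "!!p. p:{1..Suc n} ==> G {p..Suc n} = g {p..Suc n}"
 using positive_TP_extend[OF F(1), of "%p. g {p..Suc n}"] by blast
 hence "positive_TP (Suc n) G & (ALL I:intervals (Suc n). G I = g I)"
 using F(2) intervals_subset by (metis intervals_Suc)
 thus ?case by blast
 qed
 thus ?thesis using that by blast
qed

section \<open>The limit of logarithms and the TP-basis of intervals\<close>

text \<open>The logarithm of a sum exceeds the larger of the two logarithms by at most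
  \<open>ln 2\<close>, which disappears after division by \<open>k\<close>.\<close>

lemma ln_add_limit:
 fixes u v :: "nat => real"
 assumes u: "!!k. 0 < u k" "(%k. ln (u k) / k) \<longlonglongrightarrow> p" and v: "!!k. 0 < v k" "(%k. ln (v k) / k) \<longlonglongrightarrow> q"
 shows "(%k. ln (u k + v k) / k) \<longlonglongrightarrow> max p q"
proof (rule tendsto_sandwich)
 have m: "max (ln (u k)) (ln (v k))<=ln (u k + v k) & ln (u k + v k)<=ln 2 + max (ln (u k)) (ln (v k))" for k
 proof -
 have "ln (u k + v k)<=ln (2 * max (u k) (v k))" using u(1)[of k] v(1)[of k] by (subst ln_le_cancel_iff) auto
 also have "\<dots> = ln 2 + ln (max (u k) (v k))" using u(1)[of k] v(1)[of k] by (intro ln_mult_pos) auto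
 also have "ln (max (u k) (v k)) = max (ln (u k)) (ln (v k))" using u(1)[of k] v(1)[of k] by (auto simp: max_def)
 finally show ?thesis using u(1)[of k] v(1)[of k] by auto
 qed
 have d: "max (ln (u k)) (ln (v k)) / real k = max (ln (u k) / k) (ln (v k) / k)" for k
 by (simp add: max_divide_distrib_right)
 show "(%k. max (ln (u k) / k) (ln (v k) / k)) \<longlonglongrightarrow> max p q" by (intro tendsto_max u v)
 have "(%k. ln 2 / real k + max (ln (u k) / k) (ln (v k) / k)) \<longlonglongrightarrow> 0 + max p q"
 by (intro tendsto_add tendsto_max u v lim_const_over_n)
 thus "(%k. ln 2 / real k + max (ln (u k) / k) (ln (v k) / k)) \<longlonglongrightarrow> max p q" by simp
 show "\<forall>\<^sub>F k in sequentially. max (ln (u k) / k) (ln (v k) / k)<=ln (u k + v k) / real k"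
 using m by (intro always_eventually allI) (auto simp: d[symmetric] intro!: divide_right_mono)
 show "\<forall>\<^sub>F k in sequentially. ln (u k + v k) / real k<=ln 2 / real k + max (ln (u k) / k) (ln (v k) / k)"
 using m by (intro always_eventually allI) (auto simp: d[symmetric] add_divide_distrib[symmetric] intro!: divide_right_mono)
qed


lemma set_neqI: "a:A ==> a~:B ==> A ~= B"
 by auto

text \<open>Take positive solutions \<open>F k\<close> with values \<open>exp (k * f0 I)\<close> on
  intervals. The sequences \<open>ln (F k X) / k\<close> converge on intervals, and
  \<open>span_induct\<close> carries convergence to all sets: the sum in the relation becomes a max,
  and the division by \<open>F(Xj)\<close> becomes a subtraction. The limit inherits the
  TP-relation.\<close>

lemma TP_function_exists:
 fixes f0 :: "nat set => real"
 obtains f where "f:TP_functions n" "!!I. I:intervals n ==> f I = f0 I"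
proof -
 have "EX F. positive_TP n F & (ALL I:intervals n. F I = exp (real k * f0 I))" for k
 by (rule positive_TP_exists[of n "%I. exp (real k * f0 I)"]) (simp, blast)
 then obtain F where F: "!!k. positive_TP n (F k)" "!!k I. I:intervals n ==> F k I = exp (real k * f0 I)"
 by metis
 have pos: "0 < F k X" if "X<={1..n}" for k X using F(1)[of k] that by (auto simp: positive_TP_def)
 have rel: "F m (insert i (insert k X)) * F m (insert j X) =
 F m (insert i (insert j X)) * F m (insert k X) + F m (insert i X) * F m (insert j (insert k X))"
 if "i < j" "j < k" "{i, j, k}<={1..n}" "X<={1..n} - {i, j, k}" for i j k X m
 using F(1)[of m] that unfolding positive_TP_def by blast
 let ?L = "%X l. (%k. ln (F k X) / real k) \<longlonglongrightarrow> l"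
 have prodL: "(%k. ln (F k X * F k Y) / real k) \<longlonglongrightarrow> l + l'" if "X<={1..n}" "Y<={1..n}" "?L X l" "?L Y l'" for X Y l l'
 using tendsto_add[OF that(3,4)] that(1,2) by (simp add: ln_mult_pos pos add_divide_distrib)
 have limint: "?L I (f0 I)" if "I:intervals n" for I
 proof (rule tendsto_eventually)
 show "\<forall>\<^sub>F k in sequentially. ln (F k I) / real k = f0 I"
 using eventually_gt_at_top[of 0] by eventually_elim (simp add: F(2)[OF that])
 qed
 have ex: "EX l. ?L X l" if "X<={1..n}" for X
 using that
 proof (induction rule: span_induct)
 case (interval X)
 thus ?case using limint by blast
 next
 case (step i j k X)
 obtain lj lij lk li ljk where l: "?L (insert j X) lj" "?L (insert i (insert j X)) lij" "?L (insert k X) lk"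
 "?L (insert i X) li" "?L (insert j (insert k X)) ljk" using step by blast
 have s: "insert j X<={1..n}" "insert i (insert j X)<={1..n}" "insert k X<={1..n}" "insert i X<={1..n}"
 "insert j (insert k X)<={1..n}" "insert i (insert k X)<={1..n}" using step by auto
 have "(%m. ln (F m (insert i (insert j X)) * F m (insert k X) + F m (insert i X) * F m (insert j (insert k X))) / m)
 \<longlonglongrightarrow> max (lij + lk) (li + ljk)"
 using s by (intro ln_add_limit prodL l mult_pos_pos pos)
 hence "(%m. ln (F m (insert i (insert k X)) * F m (insert j X)) / m) \<longlonglongrightarrow> max (lij + lk) (li + ljk)"
 using rel[OF step(1-4)] by simp
 from tendsto_diff[OF this l(1)] have "?L (insert i (insert k X)) (max (lij + lk) (li + ljk) - lj)"
 using s by (simp add: ln_mult_pos pos add_divide_distrib)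
 thus ?case by blast
 qed
 define f where "f = restrict (%X. lim (%k. ln (F k X) / real k)) (Pow {1..n})"
 have fL: "?L X (f X)" if "X<={1..n}" for X
 using ex[OF that] that by (auto simp: f_def limI)
 have "f:TP_functions n"
 unfolding TP_functions_def
 proof (intro CollectI conjI allI impI)
 show "f:extensional (Pow {1..n})" by (simp add: f_def)
 fix i j k X
 assume a: "i < j & j < k & {i, j, k}<={1..n} & X<={1..n} - {i, j, k}"
 have s: "insert j X<={1..n}" "insert i (insert j X)<={1..n}" "insert k X<={1..n}" "insert i X<={1..n}"
 "insert j (insert k X)<={1..n}" "insert i (insert k X)<={1..n}" using a by auto
 have "(%m. ln (F m (insert i (insert j X)) * F m (insert k X) + F m (insert i X) * F m (insert j (insert k X))) / m)
 \<longlonglongrightarrow> max (f (insert i (insert j X)) + f (insert k X)) (f (insert i X) + f (insert j (insert k X)))"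
 using s by (intro ln_add_limit prodL fL mult_pos_pos pos)
 moreover have "(%m. ln (F m (insert i (insert k X)) * F m (insert j X)) / m) \<longlonglongrightarrow> f (insert i (insert k X)) + f (insert j X)"
 using s by (intro prodL fL)
 ultimately show "f (X Un {i, k}) + f (X Un {j}) = max (f (X Un {i, j}) + f (X Un {k})) (f (X Un {i}) + f (X Un {j, k}))"
 using rel[of i j k X] a by (simp add: LIMSEQ_unique)
 qed
 moreover have "f I = f0 I" if "I:intervals n" for I
 using LIMSEQ_unique[OF fL limint] that intervals_subset by blast
 ultimately show ?thesis using that by blast
qed

lemma TP_functions_eqI:
 assumes "f:TP_functions n" "g:TP_functions n" "!!X. X<={1..n} ==> f X = g X"
 shows "f = g"
 using assms by (intro extensionalityI[of f "Pow {1..n}"]) (auto simp: TP_functions_def)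

lemma intervals_TP_basis: "TP_basis n (intervals n)"
proof -
 have "inj_on (%f. restrict f (intervals n)) (TP_functions n)"
 proof (rule inj_onI)
 fix f g assume f: "f:TP_functions n" and g: "g:TP_functions n"
 and e: "restrict f (intervals n) = restrict g (intervals n)"
 have "f X = g X" if "X<={1..n}" for X
 using that
 proof (induction rule: span_induct)
 case (interval X)
 thus ?case using e by (metis restrict_apply')
 next
 case (step i j k X)
 thus ?case using TP_functionsD[OF f step(1-4)] TP_functionsD[OF g step(1-4)] by simp
 qed
 thus "f = g" using f g by (intro TP_functions_eqI)
 qed
 moreover have "extensional (intervals n)<=(%f. restrict f (intervals n)) ` TP_functions n"
 proof
 fix e :: "nat set => real" assume e: "e:extensional (intervals n)"
 obtain f where f: "f:TP_functions n" "!!I. I:intervals n ==> f I = e I"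
 using TP_function_exists by metis
 have "restrict f (intervals n) = e"
 using f e by (intro extensionalityI[of _ "intervals n"]) auto
 thus "e:(%f. restrict f (intervals n)) ` TP_functions n" using f by blast
 qed
 ultimately show ?thesis
 unfolding TP_basis_def bij_betw_def using intervals_subset by (auto simp: restrict_extensional)
qed

text \<open>The new coordinate is \<open>\<phi> f - f Y\<close>, where \<open>\<phi> f\<close>
  depends on the unchanged coordinates only. This is an invertible change of coordinates.\<close>

lemma TP_basis_exchange:
 assumes B: "TP_basis n B"
 and Y: "Y:B" "Y'<={1..n}" "Y'~:B"
 and rel: "!!f. f:TP_functions n ==> f Y + f Y' = \<phi> f"
 and dep: "!!f g. (!!Z. Z:B - {Y} ==> f Z = g Z) ==> \<phi> f = (\<phi> g :: real)"
 shows "TP_basis n (B - {Y} Un {Y'})"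
proof -
 let ?B' = "B - {Y} Un {Y'}"
 have bij: "bij_betw (%f. restrict f B) (TP_functions n) (extensional B)" and sub: "B<=Pow {1..n}"
 using B by (auto simp: TP_basis_def)
 have "inj_on (%f. restrict f ?B') (TP_functions n)"
 proof (rule inj_onI)
 fix f g assume f: "f:TP_functions n" and g: "g:TP_functions n" and e: "restrict f ?B' = restrict g ?B'"
 have ag: "f Z = g Z" if "Z:?B'" for Z using e that by (metis restrict_apply')
 have "\<phi> f = \<phi> g" using ag by (intro dep) auto
 hence "f Y = g Y" using rel[OF f] rel[OF g] ag[of Y'] by simp
 hence "restrict f B = restrict g B" using ag by (auto simp: restrict_def fun_eq_iff)
 thus "f = g" using bij f g unfolding bij_betw_def inj_on_def by blast
 qed
 moreover have "extensional ?B'<=(%f. restrict f ?B') ` TP_functions n"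
 proof
 fix e :: "nat set => real" assume e: "e:extensional ?B'"
 define e0 where "e0 = restrict (e(Y := \<phi> e - e Y')) B"
 have "e0:extensional B" by (simp add: e0_def)
 then obtain f where f: "f:TP_functions n" "restrict f B = e0"
 using bij unfolding bij_betw_def by (metis (no_types, lifting) imageE)
 have fe: "f Z = e0 Z" if "Z:B" for Z using f(2) that by (metis restrict_apply')
 have "f Z = e Z" if "Z:B - {Y}" for Z using fe[of Z] that by (auto simp: e0_def)
 moreover from this have "\<phi> f = \<phi> e" by (intro dep) auto
 hence "f Y' = e Y'" using rel[OF f(1)] fe[OF Y(1)] Y by (auto simp: e0_def)
 ultimately have "restrict f ?B' = e" using e by (intro extensionalityI[of _ ?B']) auto
 thus "e:(%f. restrict f ?B') ` TP_functions n" using f by blast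
 qed
 ultimately show ?thesis
 unfolding TP_basis_def bij_betw_def using sub Y by (auto simp: restrict_extensional)
qed

lemma TP_flip_TP_basis:
 assumes "TP_flip n B B'"
 shows "TP_basis n B'"
proof -
 have U: "Z Un {a} = insert a Z" "Z Un {a, b} = insert a (insert b Z)" for Z :: "nat set" and a b by auto
 obtain i j k X where ijk: "i < j" "j < k" "{i, j, k}<={1..n}" "X<={1..n} - {i, j, k}"
 and four: "{insert i (insert j X), insert k X, insert i X, insert j (insert k X)}<=B"
 and B: "TP_basis n B"
 and alt: "insert j X:B & insert i (insert k X)~:B & B' = B - {insert j X} Un {insert i (insert k X)} |
 insert i (insert k X):B & insert j X~:B & B' = B - {insert i (insert k X)} Un {insert j X}"
 using assms unfolding TP_flip_def U by (elim conjE exE) (rule that; assumption)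
 let ?\<phi> = "%f. max (f (insert i (insert j X)) + f (insert k X)) (f (insert i X) + f (insert j (insert k X)))"
 have ne: "insert i (insert j X)~:{insert j X, insert i (insert k X)}" "insert k X~:{insert j X, insert i (insert k X)}"
 "insert i X~:{insert j X, insert i (insert k X)}" "insert j (insert k X)~:{insert j X, insert i (insert k X)}"
 proof -
 have m: "i~:X" "j~:X" "k~:X" "i ~= j" "i ~= k" "j ~= k" using ijk by auto
 have "insert i (insert j X) ~= insert j X" "insert i (insert j X) ~= insert i (insert k X)"
 "insert k X ~= insert j X" "insert k X ~= insert i (insert k X)"
 "insert i X ~= insert j X" "insert i X ~= insert i (insert k X)"
 "insert j (insert k X) ~= insert j X" "insert j (insert k X) ~= insert i (insert k X)"
 by (rule set_neqI[of i] set_neqI[of j] set_neqI[of k] set_neqI[of i, symmetric] set_neqI[of k, symmetric]; use m in simp)+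
 thus "insert i (insert j X)~:{insert j X, insert i (insert k X)}" "insert k X~:{insert j X, insert i (insert k X)}"
 "insert i X~:{insert j X, insert i (insert k X)}" "insert j (insert k X)~:{insert j X, insert i (insert k X)}"
 by simp_all
 qed
 have rel: "f (insert i (insert k X)) + f (insert j X) = ?\<phi> f" if "f:TP_functions n" for f
 using TP_functionsD[OF that ijk] .
 from alt show ?thesis
 proof
 assume a: "insert j X:B & insert i (insert k X)~:B & B' = B - {insert j X} Un {insert i (insert k X)}"
 have dep: "?\<phi> f = ?\<phi> g" if "!!Z. Z:B - {insert j X} ==> f Z = g Z" for f g
 using four ne by (simp add: that)
 have "TP_basis n (B - {insert j X} Un {insert i (insert k X)})"
 by (rule TP_basis_exchange[where \<phi> = ?\<phi>, OF B _ _ _ _ dep]) (use a ijk rel in "auto simp: add.commute")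
 thus ?thesis using a by simp
 next
 assume a: "insert i (insert k X):B & insert j X~:B & B' = B - {insert i (insert k X)} Un {insert j X}"
 have dep: "?\<phi> f = ?\<phi> g" if "!!Z. Z:B - {insert i (insert k X)} ==> f Z = g Z" for f g
 using four ne by (simp add: that)
 have "TP_basis n (B - {insert i (insert k X)} Un {insert j X})"
 by (rule TP_basis_exchange[where \<phi> = ?\<phi>, OF B _ _ _ _ dep]) (use a ijk rel in auto)
 thus ?thesis using a by simp
 qed
qed

section \<open>The combinatorial form of generalized tilings\<close>
lemma insert_cancel_iff: "q~:A ==> i~:A ==> insert q A = insert i A \<longleftrightarrow> q = i"
 by (metis insertE insertI1)

lemma insert_insert_Diff: "c:A ==> insert c (insert q (A - {c})) = insert q A"
 by auto

definition LE :: "tile => (nat set \<times> nat set) set" where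
 "LE te = {(bottom te, left te), (left te, top_vertex te)}"

definition RE :: "tile => (nat set \<times> nat set) set" where
 "RE te = {(bottom te, right te), (right te, top_vertex te)}"

definition LB :: "nat => (nat set \<times> nat set) set" where
 "LB n = {({1..i - 1}, {1..i}) | i. i:{1..n}}"

definition RB :: "nat => (nat set \<times> nat set) set" where
 "RB n = {({i + 1..n}, {i..n}) | i. i:{1..n}}"

text \<open>The number of tiles left of \<open>e\<close>: a white tile that has \<open>e\<close>
  among its right edges lies left of it. Black tiles count on the opposite side. Thus a white and a
  black tile that overlap along \<open>e\<close> contribute to different counts, just as two white
  tiles on the two sides of \<open>e\<close>; \<open>dnc\<close> counts the right side.\<close>

definition upc :: "tile set => tile set => nat set \<times> nat set => nat" where
 "upc W K e = card {te:W. e:RE te} + card {te:K. e:LE te}"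

definition dnc :: "tile set => tile set => nat set \<times> nat set => nat" where
 "dnc W K e = card {te:W. e:LE te} + card {te:K. e:RE te}"

lemma bottom_Tile [simp]: "bottom (Tile X i j) = X"
 and left_Tile [simp]: "left (Tile X i j) = insert i X"
 and right_Tile [simp]: "right (Tile X i j) = insert j X"
 and top_Tile [simp]: "top_vertex (Tile X i j) = insert i (insert j X)"
 by (simp_all add: bottom_def left_def right_def top_vertex_def)

lemma LE_Tile: "LE (Tile X i j) = {(X, insert i X), (insert i X, insert i (insert j X))}"
 and RE_Tile: "RE (Tile X i j) = {(X, insert j X), (insert j X, insert i (insert j X))}"
 by (simp_all add: LE_def RE_def)

lemma tile_edges_LE_RE: "tile_edges te = LE te Un RE te"
 by (auto simp: tile_edges_def LE_def RE_def)

lemma Tile_in_tiles: "Tile X i j:tiles n \<longleftrightarrow> i < j & 1<=i & j<=n & X<={1..n} & i~:X & j~:X"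
 by (auto simp: tiles_def)

lemma tiles_cases:
 assumes "te:tiles n"
 obtains X i j where "te = Tile X i j" "i < j" "1<=i" "j<=n" "X<={1..n}" "i~:X" "j~:X"
 using assms by (cases te) (auto simp: Tile_in_tiles)

lemma LE_I1: "(A, insert q A):LE (Tile A q m)"
 and LE_I2: "c:A ==> (A, insert q A):LE (Tile (A - {c}) c q)"
 and RE_I1: "(A, insert q A):RE (Tile A m q)"
 and RE_I2: "c:A ==> (A, insert q A):RE (Tile (A - {c}) q c)"
 by (auto simp: LE_Tile RE_Tile)

lemma LE_cases:
 assumes "(A, insert q A):LE te" "q~:A" "te:tiles n"
 obtains (low) m where "te = Tile A q m" "q < m" | (high) c where "te = Tile (A - {c}) c q" "c:A" "c < q"
proof -
 obtain X i j where t: "te = Tile X i j" "i < j" "i~:X" "j~:X" using assms(3) by (rule tiles_cases)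
 from assms(1) consider "A = X" "insert q A = insert i X" | "A = insert i X" "insert q A = insert i (insert j X)"
 unfolding t(1) LE_Tile by blast
 thus ?thesis
 proof cases
 case 1
 hence "q = i" using assms(2) t insert_cancel_iff by metis
 thus ?thesis using low[of j] t 1 by simp
 next
 case 2
 have "insert q A = insert j A" using 2 by auto
 moreover have "j~:A" using 2 t by auto
 ultimately have "q = j" using assms(2) insert_cancel_iff by metis
 moreover have "X = A - {i}" using 2 t by auto
 ultimately show ?thesis using high[of i] t 2 by simp
 qed
qed

lemma RE_cases:
 assumes "(A, insert q A):RE te" "q~:A" "te:tiles n"
 obtains (low) m where "te = Tile A m q" "m < q" | (high) c where "te = Tile (A - {c}) q c" "c:A" "q < c"
proof -
 obtain X i j where t: "te = Tile X i j" "i < j" "i~:X" "j~:X" using assms(3) by (rule tiles_cases)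
 from assms(1) consider "A = X" "insert q A = insert j X" | "A = insert j X" "insert q A = insert i (insert j X)"
 unfolding t(1) RE_Tile by blast
 thus ?thesis
 proof cases
 case 1
 hence "q = j" using assms(2) t insert_cancel_iff by metis
 thus ?thesis using low[of i] t 1 by simp
 next
 case 2
 have "i~:A" using 2 t by auto
 hence "q = i" using assms(2) 2 insert_cancel_iff by metis
 moreover have "X = A - {j}" using 2 t by auto
 ultimately show ?thesis using high[of j] t 2 by simp
 qed
qed

lemma edge_form:
 assumes "te:tiles n" "e:tile_edges te"
 obtains A q where "e = (A, insert q A)" "q~:A" "q:{1..n}" "A<={1..n}"
proof -
 obtain X i j where t: "te = Tile X i j" "i < j" "1<=i" "j<=n" "X<={1..n}" "i~:X" "j~:X"
 using assms(1) by (rule tiles_cases)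
 have "insert i (insert j X) = insert j (insert i X)" by auto
 then consider "e = (X, insert i X)" | "e = (X, insert j X)" | "e = (insert i X, insert j (insert i X))" |
 "e = (insert j X, insert i (insert j X))"
 using assms(2) unfolding t(1) tile_edges_LE_RE LE_Tile RE_Tile by auto
 thus ?thesis
 proof cases
 case 1
 thus ?thesis using that[of X i] t by auto
 next
 case 2
 thus ?thesis using that[of X j] t by auto
 next
 case 3
 thus ?thesis using that[of "insert i X" j] t by auto
 next
 case 4
 thus ?thesis using that[of "insert j X" i] t by auto
 qed
qed

lemma LE_RE_disjoint: "te:tiles n ==> LE te Int RE te = {}"
proof (erule tiles_cases)
 fix X i j assume t: "te = Tile X i j" "i < j" "i~:X" "j~:X"
 have "insert i X ~= insert j X" using t insert_cancel_iff[of i X j] by simp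
 moreover have "X ~= insert i X" "X ~= insert j X" using t by auto
 ultimately show ?thesis unfolding t(1) LE_Tile RE_Tile by auto
qed

lemma RB_not_LE:
 assumes "e:RB n" "te:tiles n"
 shows "e~:LE te"
proof
 assume L: "e:LE te"
 obtain k where k: "e = ({k + 1..n}, {k..n})" "1<=k" "k<=n" using assms(1) by (auto simp: RB_def)
 have "{k..n} = insert k {k + 1..n}" using k by auto
 hence "({k + 1..n}, insert k {k + 1..n}):LE te" using L k by simp
 thus False
 proof (rule LE_cases[OF _ _ assms(2)])
 fix m assume "te = Tile {k + 1..n} k m" "k < m"
 thus False using assms(2) by (simp add: Tile_in_tiles)
 qed auto
qed

lemma LB_not_RE:
 assumes "e:LB n" "te:tiles n"
 shows "e~:RE te"
proof
 assume L: "e:RE te"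
 obtain k where k: "e = ({1..k - 1}, {1..k})" "1<=k" "k<=n" using assms(1) by (auto simp: LB_def)
 have "{1..k} = insert k {1..k - 1}" using k by auto
 hence "({1..k - 1}, insert k {1..k - 1}):RE te" using L k by simp
 thus False
 proof (rule RE_cases[OF _ _ assms(2)])
 show "k~:{1..k - 1}" using k by auto
 fix m assume "te = Tile {1..k - 1} m k" "m < k"
 thus False using assms(2) by (auto simp: Tile_in_tiles)
 next
 fix c assume "c:{1..k - 1}" "k < c"
 thus False by auto
 qed
qed

text \<open>A finite set on which a relation links every element but the last to a unique successor and every element
  but the first to a predecessor, increasing a key, is a single chain.\<close>
lemma chain_enum:
 fixes key :: "'v => nat"
 assumes l: "l:V"
 and pred: "!!y. y:V ==> y ~= f ==> EX x:V. R x y"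
 and key: "!!x y. R x y ==> key x < key y"
 and uniq: "!!x y z. R x y ==> R x z ==> y = z"
 and last: "!!y. ~ R l y"
 obtains N g where "g (0 :: nat) = f" "g N = l" "V = g ` {..N}" "!!i. i < N ==> R (g i) (g (Suc i))"
proof -
 have path: "EX N g. g (0 :: nat) = f & g N = x & (ALL i<N. R (g i) (g (Suc i))) & (ALL i<=N. g i:V)" if "x:V" for x
 using that
 proof (induction "key x" arbitrary: x rule: less_induct)
 case less
 show ?case
 proof (cases "x = f")
 case True
 thus ?thesis using less.prems by (intro exI[of _ 0] exI[of _ "%_. f"]) auto
 next
 case False
 then obtain y where y: "y:V" "R y x" using pred less.prems by blast
 obtain N g where g: "g (0 :: nat) = f" "g N = y" "ALL i<N. R (g i) (g (Suc i))" "ALL i<=N. g i:V"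
 using less.hyps[OF key[OF y(2)] y(1)] by blast
 let ?g = "g(Suc N := x)"
 have "R (?g i) (?g (Suc i))" if "i < Suc N" for i
 using that g y(2) by (cases "i = N") auto
 moreover have "?g i:V" if "i<=Suc N" for i
 using that g less.prems by (cases "i = Suc N") auto
 ultimately show ?thesis using g by (intro exI[of _ "Suc N"] exI[of _ ?g]) auto
 qed
 qed
 obtain N g where g: "g (0 :: nat) = f" "g N = l" "ALL i<N. R (g i) (g (Suc i))" "ALL i<=N. g i:V"
 using path[OF l] by blast
 have "x:g ` {..N}" if "x:V" for x
 proof -
 obtain M g' where g': "g' (0 :: nat) = f" "g' M = x" "ALL i<M. R (g' i) (g' (Suc i))"
 using path[OF `x:V`] by blast
 have same: "i<=N ==> i<=M ==> g' i = g i" for i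
 proof (induction i)
 case (Suc i)
 hence "R (g i) (g (Suc i))" "R (g i) (g' (Suc i))" using g(3) g'(3) by (metis Suc_leD Suc_le_lessD)+
 thus ?case using uniq by blast
 qed (simp add: g g')
 show ?thesis
 proof (cases "M<=N")
 case True
 thus ?thesis using same[of M] g'(2) by auto
 next
 case False
 hence "R l (g' (Suc N))" using g'(3)[rule_format, of N] same[of N] g(2) by auto
 thus ?thesis using last by blast
 qed
 qed
 thus ?thesis using that[of g N] g by auto
qed

lemma chain_mono:
 fixes x :: "nat => 'a :: preorder"
 assumes "!!i. i < N ==> x i<=x (Suc i)" "i<=j" "j<=N"
 shows "x i<=x j"
 using assms(2,3)
proof (induction j rule: dec_induct)
 case (step j)
 thus ?case using assms(1)[of j] order_trans by fastforce
qed simp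

definition wsum :: "(nat => 'a :: comm_monoid_add) => nat set => 'a" where
 "wsum a A = (\<Sum>k\<in>A. a k)"

lemma wsum_insert: "finite A ==> q~:A ==> wsum a (insert q A) = a q + wsum a A"
 by (simp add: wsum_def)

lemma wsum_remove: "finite A ==> c:A ==> wsum a A = a c + wsum a (A - {c})"
 by (simp add: wsum_def sum.remove)

lemma wsum_swap:
 fixes a :: "nat => 'a :: ab_group_add"
 assumes "finite A" "c:A" "q~:A"
 shows "wsum a (insert q (A - {c})) = wsum a A - a c + a q"
 using wsum_insert[of "A - {c}" q a] wsum_remove[OF assms(1,2), of a] assms by simp

text \<open>T1 and T2 without geometry: with the sides of black tiles exchanged, an inner edge has
  one tile on each side, a left boundary edge only one on its right, a right boundary edge only one
  on its left. A pair of sets that is no edge has both counts 0, which is why \<open>inner\<close>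
  says at most one.\<close>

locale gt =
 fixes n :: nat and W K :: "tile set"
 assumes n2: "2<=n" and fin: "finite W" "finite K"
 and sub: "W<=tiles n" "K<=tiles n" and disj: "W Int K = {}"
 and atLB: "!!e. e:LB n ==> upc W K e = 0 & dnc W K e = 1"
 and atRB: "!!e. e:RB n ==> upc W K e = 1 & dnc W K e = 0"
 and inner: "!!e. e~:LB n ==> e~:RB n ==> upc W K e = dnc W K e & upc W K e<=1"
 and black_edges: "!!te te'. te:K ==> te':K ==> te ~= te' ==> tile_edges te Int tile_edges te' = {}"
 and T3: "axiom_T3 W K"
begin

abbreviation "edges \<equiv> edges_of (W Un K)"
abbreviation "bots \<equiv> bottom ` K"
abbreviation "tops \<equiv> top_vertex ` K"
abbreviation "B \<equiv> spectrum W K"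

text \<open>By T3 no edge leaves a top or enters a bottom, so both ends of such an edge are
  nonterminal. Every edge of a black tile has a terminal end, hence the tiles on both sides of an
  edge in \<open>V\<close> are white. These edges are the planar part of the tiling.\<close>

definition V :: "nat set => nat => bool" where
 "V A q \<longleftrightarrow> q~:A & (A, insert q A):edges & A~:bots & insert q A~:tops"

lemma W_tile: "Tile X i j:W ==> i < j & 1<=i & j<=n & X<={1..n} & i~:X & j~:X & finite X"
 and K_tile: "Tile X i j:K ==> i < j & 1<=i & j<=n & X<={1..n} & i~:X & j~:X & finite X"
 using sub Tile_in_tiles finite_subset[OF _ finite_atLeastAtMost] by (metis in_mono)+

lemma edgesI: "te:W Un K ==> e:LE te Un RE te ==> e:edges"
 unfolding edges_of_def tile_edges_LE_RE by blast

lemma tile_edge_mem: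
 assumes "Tile X i j:W Un K"
 shows "(X, insert i X):edges" "(X, insert j X):edges"
 "(insert i X, insert i (insert j X)):edges" "(insert j X, insert i (insert j X)):edges"
 using assms by (auto intro!: edgesI[of "Tile X i j"] simp: LE_Tile RE_Tile)

lemma edge_props:
 assumes "(A, A'):edges"
 obtains q where "A' = insert q A" "q~:A" "q:{1..n}" "A<={1..n}"
 using assms sub unfolding edges_of_def by (auto elim!: edge_form[where n = n])

lemma edge_subset: "(A, A'):edges ==> A<={1..n} & A'<={1..n}"
 by (erule edge_props) auto

lemma not_into_bots: "(A, A'):edges ==> A'~:bots"
 using T3 unfolding axiom_T3_def by (fastforce elim: edge_props)

lemma not_from_tops: "(A, A'):edges ==> A~:tops"
 using T3 unfolding axiom_T3_def by (fastforce elim: edge_props)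

lemma black_bottom_unique:
 assumes "te:K" "te':K" "bottom te:tile_vertices te'"
 shows "te = te'"
 using T3 assms unfolding axiom_T3_def by blast

lemma black_top_unique:
 assumes "te:K" "te':K" "top_vertex te:tile_vertices te'"
 shows "te = te'"
 using T3 assms unfolding axiom_T3_def by blast

lemma side_nonterminal:
 assumes "Tile X i j:W Un K"
 shows "insert i X~:bots" "insert i X~:tops" "insert j X~:bots" "insert j X~:tops"
 "X~:tops" "insert i (insert j X)~:bots"
 using tile_edge_mem[OF assms] not_into_bots not_from_tops by blast+

lemma B_I: "te:W Un K ==> v:tile_vertices te ==> v~:bots ==> v~:tops ==> v:B"
 unfolding spectrum_def terminal_vertices_def by blast

lemma tile_vertices_Tile: "tile_vertices (Tile X i j) = {X, insert i X, insert j X, insert i (insert j X)}"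
 by (simp add: tile_vertices_def)

lemma vertex_B:
 assumes "Tile X i j:W Un K"
 shows "insert i X:B" "insert j X:B" "X~:bots ==> X:B" "insert i (insert j X)~:tops ==> insert i (insert j X):B"
 using side_nonterminal[OF assms] by (intro B_I[OF assms]; simp add: tile_vertices_Tile)+

lemma edges_count: "e:edges ==> upc W K e + dnc W K e ~= 0"
 using fin unfolding edges_of_def upc_def dnc_def tile_edges_LE_RE by (auto simp: card_eq_0_iff)

lemma upc_1: "e:edges ==> e~:LB n ==> upc W K e = 1"
 using edges_count[of e] inner[of e] atRB[of e] by (cases "e:RB n") auto

lemma dnc_1: "e:edges ==> e~:RB n ==> dnc W K e = 1"
 using edges_count[of e] inner[of e] atLB[of e] by (cases "e:LB n") auto

lemma LB_RB_edges: "e:LB n Un RB n ==> e:edges"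
proof -
 assume "e:LB n Un RB n"
 hence "upc W K e + dnc W K e ~= 0" using atLB atRB by fastforce
 thus ?thesis
 unfolding upc_def dnc_def edges_of_def tile_edges_LE_RE
 by (auto simp: card_eq_0_iff) 
qed

lemma dnc_unique:
 assumes "e:edges" "te:W" "te':W" "e:LE te" "e:LE te'"
 shows "te = te'"
proof -
 have "dnc W K e<=1" using dnc_1[OF assms(1)] atRB[of e] by (cases "e:RB n") auto
 hence "card {te:W. e:LE te}<=1" by (simp add: dnc_def)
 moreover have "card {te, te'}<=card {te:W. e:LE te}" using assms fin by (intro card_mono) auto
 ultimately show ?thesis by (cases "te = te'") auto
qed

lemma upc_unique:
 assumes "e:edges" "te:W" "te':W" "e:RE te" "e:RE te'"
 shows "te = te'"
proof -
 have "upc W K e<=1" using upc_1[OF assms(1)] atLB[of e] by (cases "e:LB n") auto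
 hence "card {te:W. e:RE te}<=1" by (simp add: upc_def)
 moreover have "card {te, te'}<=card {te:W. e:RE te}" using assms fin by (intro card_mono) auto
 ultimately show ?thesis by (cases "te = te'") auto
qed

lemma dnc_ex: "e:edges ==> e~:RB n ==> (EX te:W. e:LE te) | (EX te:K. e:RE te)"
 using dnc_1[of e] unfolding dnc_def by (auto simp: card_eq_0_iff) (metis (no_types, lifting) One_nat_def add_eq_0_iff_both_eq_0 card.empty empty_Collect_eq nat.simps(3))

lemma upc_ex: "e:edges ==> e~:LB n ==> (EX te:W. e:RE te) | (EX te:K. e:LE te)"
 using upc_1[of e] unfolding upc_def by (auto simp: card_eq_0_iff) (metis (no_types, lifting) One_nat_def add_eq_0_iff_both_eq_0 card.empty empty_Collect_eq nat.simps(3))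

lemma not_both_dn: "e:edges ==> te:W ==> e:LE te ==> te':K ==> e~:RE te'"
proof
 assume a: "e:edges" "te:W" "e:LE te" "te':K" "e:RE te'"
 have "dnc W K e<=1" using dnc_1[OF a(1)] atRB[of e] by (cases "e:RB n") auto
 moreover have "card {te:W. e:LE te} ~= 0" "card {te:K. e:RE te} ~= 0" using a fin by (auto simp: card_eq_0_iff)
 ultimately show False by (simp add: dnc_def)
qed

lemma not_both_up: "e:edges ==> te:W ==> e:RE te ==> te':K ==> e~:LE te'"
proof
 assume a: "e:edges" "te:W" "e:RE te" "te':K" "e:LE te'"
 have "upc W K e<=1" using upc_1[OF a(1)] atLB[of e] by (cases "e:LB n") auto
 moreover have "card {te:W. e:RE te} ~= 0" "card {te:K. e:LE te} ~= 0" using a fin by (auto simp: card_eq_0_iff)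
 ultimately show False by (simp add: upc_def)
qed

lemma black_edge_terminal:
 assumes "te:K" "(A, A'):LE te Un RE te"
 shows "A = bottom te | A' = top_vertex te"
 using assms by (auto simp: LE_def RE_def)

lemma white_right:
 assumes "V A q" "(A, insert q A)~:RB n"
 obtains (up) m where "q < m" "Tile A q m:W" | (down) c where "c:A" "c < q" "Tile (A - {c}) c q:W"
proof -
 have e: "(A, insert q A):edges" "q~:A" using assms by (auto simp: V_def)
 have "~ (EX te:K. (A, insert q A):RE te)"
 using assms(1) black_edge_terminal unfolding V_def by fastforce
 then obtain te where te: "te:W" "(A, insert q A):LE te" using dnc_ex[OF e(1) assms(2)] by blast
 hence "te:tiles n" using sub by blast
 from te(2) e(2) this show ?thesis by (rule LE_cases) (use te up down in auto)
qed

lemma white_left: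
 assumes "V A q" "(A, insert q A)~:LB n"
 obtains (down) m where "m < q" "Tile A m q:W" | (up) c where "c:A" "q < c" "Tile (A - {c}) q c:W"
proof -
 have e: "(A, insert q A):edges" "q~:A" using assms by (auto simp: V_def)
 have "~ (EX te:K. (A, insert q A):LE te)"
 using assms(1) black_edge_terminal unfolding V_def by fastforce
 then obtain te where te: "te:W" "(A, insert q A):RE te" using upc_ex[OF e(1) assms(2)] by blast
 hence "te:tiles n" using sub by blast
 from te(2) e(2) this show ?thesis by (rule RE_cases) (use te up down in auto)
qed

lemma V_lower:
 assumes "Tile X i j:W" "X~:bots"
 shows "V X i" "V X j"
proof -
 have t: "Tile X i j:W Un K" using assms by blast
 show "V X i" "V X j"
 using assms(2) W_tile[OF assms(1)] side_nonterminal[OF t] tile_edge_mem(1,2)[OF t] unfolding V_def by simp_all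
qed

lemma V_upper:
 assumes "Tile X i j:W" "insert i (insert j X)~:tops"
 shows "V (insert i X) j" "V (insert j X) i"
proof -
 have t: "Tile X i j:W Un K" using assms by blast
 have c: "insert j (insert i X) = insert i (insert j X)" by auto
 have "(insert i X, insert j (insert i X)):edges" using tile_edge_mem(3)[OF t] unfolding c .
 moreover have "j~:insert i X" "i~:insert j X" using W_tile[OF assms(1)] by auto
 ultimately show "V (insert i X) j" "V (insert j X) i"
 using assms(2) side_nonterminal[OF t] tile_edge_mem(4)[OF t] unfolding V_def c by simp_all
qed

end

lemma chain_ex:
 fixes key :: "'v => nat"
 assumes "l:V" and "ALL y:V. y ~= f --> (EX x:V. R x y)" and "ALL x y. R x y --> key x < key y"
 and "ALL x y z. R x y --> R x z --> y = z" and "ALL y. ~ R l y"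
 shows "EX (N :: nat) g. g 0 = f & g N = l & V = g ` {..N} & (ALL i<N. R (g i) (g (Suc i)))"
proof (rule chain_enum[of l V f R key])
 fix N and g :: "nat => 'v"
 assume "g 0 = f" "g N = l" "V = g ` {..N}" "!!i. i < N ==> R (g i) (g (Suc i))"
 thus ?thesis by blast
qed (use assms in blast)+

context gt
begin

lemma LB_level: "h < n ==> ({1..h}, insert (Suc h) {1..h}):LB n"
 unfolding LB_def by (intro CollectI exI[of _ "Suc h"]) auto

lemma RB_level: "h < n ==> ({n - h + 1..n}, insert (n - h) {n - h + 1..n}):RB n"
 unfolding RB_def by (intro CollectI exI[of _ "n - h"]) auto

lemma LB_levelD: "(A, A'):LB n ==> A = {1..card A} & A' = {1..Suc (card A)} & card A < n"
 unfolding LB_def by auto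

lemma RB_levelD: "(A, A'):RB n ==> A = {n - card A + 1..n} & A' = {n - card A..n} & card A < n"
 unfolding RB_def by auto

section \<open>The white tiles around the two ends of a black tile\<close>

text \<open>The black tile takes the left count of its lower left edge, so the right count belongs
  to a white tile. As no edge enters \<open>C\<close>, that tile has bottom \<open>C\<close>
  too.\<close>

lemma black_lower_left:
 assumes "Tile C p q:K"
 obtains m where "Tile C p m:W" "m ~= q" "p < m"
proof -
 let ?e = "(C, insert p C)"
 have t: "Tile C p q:W Un K" "Tile C p q:tiles n" using assms sub by auto
 have e: "?e:edges" "?e:LE (Tile C p q)" "p~:C" using tile_edge_mem[OF t(1)] K_tile[OF assms] by (auto simp: LE_Tile)
 have Cb: "C:bots" using assms by (metis bottom_Tile imageI)
 have "?e~:RB n" using RB_not_LE t(2) e(2) by blast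
 then consider te where "te:W" "?e:LE te" | te where "te:K" "?e:RE te" using dnc_ex[OF e(1)] by blast
 thus ?thesis
 proof cases
 case 1
 have "te:tiles n" using 1 sub by blast
 from 1(2) e(3) this show ?thesis
 proof (rule LE_cases)
 fix m assume "te = Tile C p m" "p < m"
 thus ?thesis using that[of m] 1 assms disj by blast
 next
 fix c assume c: "te = Tile (C - {c}) c p" "c:C"
 hence "(C - {c}, C):edges" using tile_edge_mem(1)[of "C - {c}" c p] 1 by (simp add: insert_absorb)
 thus ?thesis using not_into_bots Cb by blast
 qed
 next
 case 2
 have "te = Tile C p q"
 proof (rule ccontr)
 assume "te ~= Tile C p q"
 hence "tile_edges te Int tile_edges (Tile C p q) = {}" using black_edges 2 assms by blast
 thus False using 2 e(2) unfolding tile_edges_LE_RE by blast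
 qed
 thus ?thesis using 2 e(2) LE_RE_disjoint[OF t(2)] by blast
 qed
qed

lemma black_upper_left:
 assumes "Tile C p q:K"
 obtains c where "c:C" "c < q" "Tile (insert p C - {c}) c q:W"
proof -
 let ?e = "(insert p C, insert q (insert p C))"
 have t: "Tile C p q:W Un K" "Tile C p q:tiles n" using assms sub by auto
 have cm: "insert q (insert p C) = insert p (insert q C)" by auto
 have e: "?e:edges" "?e:LE (Tile C p q)" "q~:insert p C"
 using tile_edge_mem(3)[OF t(1)] K_tile[OF assms] unfolding cm by (auto simp: LE_Tile)
 have Yt: "insert q (insert p C):tops" unfolding cm using assms by (metis top_Tile imageI)
 have "?e~:RB n" using RB_not_LE t(2) e(2) by blast
 then consider te where "te:W" "?e:LE te" | te where "te:K" "?e:RE te" using dnc_ex[OF e(1)] by blast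
 thus ?thesis
 proof cases
 case 1
 have "te:tiles n" using 1 sub by blast
 from 1(2) e(3) this show ?thesis
 proof (rule LE_cases)
 fix m assume "te = Tile (insert p C) q m"
 hence "(insert q (insert p C), insert q (insert m (insert p C))):edges"
 using tile_edge_mem(3)[of "insert p C" q m] 1 by simp
 thus ?thesis using not_from_tops Yt by blast
 next
 fix c assume c: "te = Tile (insert p C - {c}) c q" "c:insert p C" "c < q"
 have "c ~= p"
 proof
 assume "c = p"
 hence "te = Tile C p q" using c K_tile[OF assms] by auto
 thus False using 1 assms disj by blast
 qed
 thus ?thesis using that[of c] c 1 by auto
 qed
 next
 case 2
 have "te = Tile C p q"
 proof (rule ccontr)
 assume "te ~= Tile C p q"
 hence "tile_edges te Int tile_edges (Tile C p q) = {}" using black_edges 2 assms by blast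
 thus False using 2 e(2) unfolding tile_edges_LE_RE by blast
 qed
 thus ?thesis using 2 e(2) LE_RE_disjoint[OF t(2)] by blast
 qed
qed

lemma empty_not_bots: "{}~:bots"
proof
 assume "{}:bots"
 then obtain C p q where "Tile C p q:K" "C = {}" by (metis bottom_Tile imageE tile.exhaust)
 thus False using black_upper_left by blast
qed

lemma full_not_tops: "{1..n}~:tops"
proof
 assume "{1..n}:tops"
 then obtain C p q where k: "Tile C p q:K" "{1..n} = insert p (insert q C)" by (metis top_Tile imageE tile.exhaust)
 obtain m where "Tile C p m:W" "m ~= q" "p < m" using black_lower_left[OF k(1)] .
 hence "m:{1..n}" "m~:insert p (insert q C)" using W_tile[of C p m] by auto
 thus False using k(2) by blast
qed

lemma LB_not_terminal: assumes "(A, A'):LB n" shows "A~:bots" "A'~:tops"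
proof -
 have A: "A = {1..card A}" "A' = {1..Suc (card A)}" "card A < n" using LB_levelD[OF assms] by auto
 show "A~:bots"
 proof (cases "card A = 0")
 case True
 thus ?thesis using A(1) empty_not_bots by simp
 next
 case False
 hence "({1..card A - 1}, insert (card A) {1..card A - 1}):edges"
 using LB_level[of "card A - 1"] A(3) LB_RB_edges by auto
 moreover have "insert (card A) {1..card A - 1} = {1..card A}" using False by auto
 ultimately show ?thesis using not_into_bots A(1) by metis
 qed
 show "A'~:tops"
 proof (cases "Suc (card A) = n")
 case True
 thus ?thesis using A(2) full_not_tops by simp
 next
 case False
 hence "({1..Suc (card A)}, insert (Suc (Suc (card A))) {1..Suc (card A)}):edges"
 using LB_level[of "Suc (card A)"] A(3) LB_RB_edges by auto
 thus ?thesis using not_from_tops A(2) by metis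
 qed
qed

lemma RB_not_terminal: assumes "(A, A'):RB n" shows "A~:bots" "A'~:tops"
proof -
 have A: "A = {n - card A + 1..n}" "A' = {n - card A..n}" "card A < n" using RB_levelD[OF assms] by auto
 show "A~:bots"
 proof (cases "card A = 0")
 case True
 hence "A = {}" using A(1) by (metis atLeastatMost_empty Suc_eq_plus1 diff_zero lessI)
 thus ?thesis using empty_not_bots by simp
 next
 case False
 let ?h = "card A - 1"
 have "({n - ?h + 1..n}, insert (n - ?h) {n - ?h + 1..n}):edges"
 using RB_level[of ?h] A(3) LB_RB_edges by auto
 moreover have "insert (n - ?h) {n - ?h + 1..n} = {n - card A + 1..n}" using False A(3) by auto
 ultimately show ?thesis using not_into_bots A(1) by metis
 qed
 show "A'~:tops"
 proof (cases "Suc (card A) = n")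
 case True
 hence "A' = {1..n}" using A(2) by auto
 thus ?thesis using full_not_tops by simp
 next
 case False
 let ?h = "Suc (card A)"
 have "({n - ?h + 1..n}, insert (n - ?h) {n - ?h + 1..n}):edges"
 using RB_level[of ?h] A(3) False LB_RB_edges by auto
 moreover have "{n - ?h + 1..n} = A'" using A False by auto
 ultimately show ?thesis using not_from_tops by metis
 qed
qed

text \<open>No edge enters \<open>C\<close>, so a white tile with an edge at \<open>C\<close> has
  bottom \<open>C\<close>. Crossing these tiles from edge to edge leads from \<open>p\<close> to
  \<open>q\<close>, where the black tile with its exchanged sides closes the fan. The case
  \<open>N = 1\<close> would be a white copy of the black tile. These tiles, and those of
  \<open>top_chain\<close> at the other end, bound the lens of the black tile.\<close>

lemma bot_chain:
 assumes k: "Tile C p q:K"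
 obtains N g where "2<=N" "g (0 :: nat) = p" "g N = q" "!!t. t < N ==> g t < g (Suc t) & Tile C (g t) (g (Suc t)):W"
 "!!i j. Tile C i j:W ==> EX t<N. i = g t & j = g (Suc t)"
 "!!m. m~:C ==> (C, insert m C):edges ==> m:g ` {..N}"
proof -
 have Cb: "C:bots" using k by (metis bottom_Tile imageI)
 have noent: "(A, C)~:edges" for A using not_into_bots Cb by blast
 let ?V = "{m. m~:C & (C, insert m C):edges}"
 define R where "R i j \<longleftrightarrow> Tile C i j:W" for i j
 have kt: "Tile C p q:W Un K" "Tile C p q:tiles n" using k sub by auto
 have l: "q:?V" using tile_edge_mem(2)[OF kt(1)] K_tile[OF k] by auto
 have pred: "EX x:?V. R x m" if m: "m:?V" "m ~= p" for m
 proof -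
 let ?e = "(C, insert m C)"
 have e: "?e:edges" "m~:C" using m by auto
 have "?e~:LB n" using LB_not_terminal(1) Cb by blast
 then consider te where "te:W" "?e:RE te" | te where "te:K" "?e:LE te" using upc_ex[OF e(1)] by blast
 thus ?thesis
 proof cases
 case 1
 have "te:tiles n" using 1 sub by blast
 from 1(2) e(2) this show ?thesis
 proof (rule RE_cases)
 fix i assume i: "te = Tile C i m"
 hence "R i m" "i:?V" using 1 tile_edge_mem(1)[of C i m] W_tile[of C i m] by (auto simp: R_def)
 thus ?thesis by blast
 next
 fix c assume c: "te = Tile (C - {c}) m c" "c:C"
 hence "(C - {c}, C):edges" using tile_edge_mem(2)[of "C - {c}" m c] 1 by (simp add: insert_absorb)
 thus ?thesis using noent by blast
 qed
 next
 case 2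
 have "te:tiles n" using 2 sub by blast
 from 2(2) e(2) this show ?thesis
 proof (rule LE_cases)
 fix x assume x: "te = Tile C m x"
 hence "te = Tile C p q" using black_bottom_unique[OF 2(1) k] by (simp add: tile_vertices_Tile)
 thus ?thesis using x m by simp
 next
 fix c assume c: "te = Tile (C - {c}) c m" "c:C"
 hence "(C - {c}, C):edges" using tile_edge_mem(1)[of "C - {c}" c m] 2 by (simp add: insert_absorb)
 thus ?thesis using noent by blast
 qed
 qed
 qed
 have lt: "R i j ==> i < j" for i j using W_tile by (auto simp: R_def)
 hence lt': "R i j ==> id i < id j" for i j by simp
 have un: "R i j ==> R i j' ==> j = j'" for i j j'
 using dnc_unique[of "(C, insert i C)" "Tile C i j" "Tile C i j'"] tile_edge_mem(1)[of C i j] LE_I1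
 by (auto simp: R_def)
 have la: "~ R q y" for y
 using not_both_dn[of "(C, insert q C)" "Tile C q y" "Tile C p q"] tile_edge_mem(2)[OF kt(1)] k LE_I1 RE_I1
 by (auto simp: R_def)
 obtain N g where g: "g (0 :: nat) = p" "g N = q" "?V = g ` {..N}" "!!i. i < N ==> R (g i) (g (Suc i))"
 proof -
 have "EX (N :: nat) g. g 0 = p & g N = q & ?V = g ` {..N} & (ALL i<N. R (g i) (g (Suc i)))"
 proof (rule chain_ex[where key = id])
 show "ALL y:?V. y ~= p --> (EX x:?V. R x y)" using pred by blast
 show "ALL x y. R x y --> id x < id y" using lt' by blast
 show "ALL x y z. R x y --> R x z --> y = z" using un by blast
 qed (use l la in blast)+
 thus ?thesis using that by blast
 qed
 have "N ~= 0" using g(1,2) K_tile[OF k] by (metis less_irrefl)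
 moreover have "N ~= 1"
 proof
 assume "N = 1"
 hence "R p q" using g by fastforce
 thus False using k disj by (auto simp: R_def)
 qed
 ultimately have "2<=N" by simp
 moreover have "EX t<N. i = g t & j = g (Suc t)" if w: "Tile C i j:W" for i j
 proof -
 have "i:?V" using tile_edge_mem(1)[of C i j] W_tile[OF w] w by auto
 then obtain t where t: "t<=N" "i = g t" using g(3) by auto
 have "t ~= N" using t w g(2) la by (auto simp: R_def)
 hence "t < N" using t by simp
 moreover have "j = g (Suc t)" using un[of i j] w g(4)[OF `t < N`] t by (auto simp: R_def)
 ultimately show ?thesis using t by blast
 qed
 ultimately show ?thesis using that[of N g] g lt unfolding R_def by blast
qed

text \<open>The mirror image at the top \<open>Y\<close>: the edge with label \<open>m\<close> comes
  from \<open>Y - {m}\<close>. In a tile with labels \<open>i < j\<close> the upper right edge has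
  label \<open>i\<close> and the upper left edge has label \<open>j\<close>, so here increasing
  labels run from right to left.\<close>

lemma top_chain:
 assumes k: "Tile C p q:K" and Y: "Y = insert p (insert q C)"
 obtains N g where "2<=N" "g (0 :: nat) = p" "g N = q"
 "!!t. t < N ==> g t < g (Suc t) & g t:Y & g (Suc t):Y & Tile (Y - {g (Suc t)} - {g t}) (g t) (g (Suc t)):W"
 "!!i j X. Tile X i j:W ==> insert i (insert j X) = Y ==> EX t<N. i = g t & j = g (Suc t)"
 "!!m. m:Y ==> (Y - {m}, Y):edges ==> m:g ` {..N}"
proof -
 have Yt: "Y:tops" using k Y by (metis top_Tile imageI)
 have noleave: "(Y, A)~:edges" for A using not_from_tops Yt by blast
 let ?V = "{m. m:Y & (Y - {m}, Y):edges}"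
 define R where "R i j \<longleftrightarrow> i:Y & j:Y & i ~= j & Tile (Y - {j} - {i}) i j:W" for i j
 have kt: "Tile C p q:W Un K" "Tile C p q:tiles n" using k sub by auto
 have Yp: "Y - {q} = insert p C" "Y - {p} = insert q C" using K_tile[OF k] by (auto simp: Y)
 have l: "q:?V" using tile_edge_mem(3)[OF kt(1)] Yp by (auto simp: Y)
 have edge: "(Y - {i}, Y):RE (Tile (Y - {j} - {i}) i j)" "(Y - {j}, Y):LE (Tile (Y - {j} - {i}) i j)"
 if "i:Y" "j:Y" "i ~= j" for i j
 proof -
 have "Y - {j} - {i} = Y - {i} - {j}" by auto
 moreover have "(Y - {i}, insert i (Y - {i})):RE (Tile (Y - {i} - {j}) i j)" using that by (intro RE_I2) auto
 moreover have "(Y - {j}, insert j (Y - {j})):LE (Tile (Y - {j} - {i}) i j)" using that by (intro LE_I2) auto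
 ultimately show "(Y - {i}, Y):RE (Tile (Y - {j} - {i}) i j)" "(Y - {j}, Y):LE (Tile (Y - {j} - {i}) i j)"
 using that by (simp_all add: insert_absorb)
 qed
 have inV: "i:?V" "j:?V" if "R i j" for i j
 using that edge[of i j] edgesI[of "Tile (Y - {j} - {i}) i j"] by (auto simp: R_def)
 have pred: "EX x:?V. R x m" if m: "m:?V" "m ~= p" for m
 proof -
 let ?A = "Y - {m}"
 have Ym: "insert m ?A = Y" "m~:?A" using m by auto
 let ?e = "(?A, insert m ?A)"
 have e: "?e:edges" using m Ym by simp
 have "?e~:RB n" using RB_not_terminal(2)[of ?A Y] Yt Ym by auto
 then consider te where "te:W" "?e:LE te" | te where "te:K" "?e:RE te" using dnc_ex[OF e] by blast
 thus ?thesis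
 proof cases
 case 1
 have "te:tiles n" using 1 sub by blast
 from 1(2) Ym(2) this show ?thesis
 proof (rule LE_cases)
 fix x assume "te = Tile ?A m x"
 hence "(Y, insert m (insert x ?A)):edges" using tile_edge_mem(3)[of ?A m x] 1 Ym by simp
 thus ?thesis using noleave by blast
 next
 fix c assume c: "te = Tile (?A - {c}) c m" "c:?A" "c < m"
 hence "R c m" using 1 m by (auto simp: R_def)
 thus ?thesis using inV by blast
 qed
 next
 case 2
 have "te:tiles n" using 2 sub by blast
 from 2(2) Ym(2) this show ?thesis
 proof (rule RE_cases)
 fix x assume "te = Tile ?A x m"
 hence "(Y, insert x (insert m ?A)):edges" using tile_edge_mem(4)[of ?A x m] 2 Ym by simp
 thus ?thesis using noleave by blast
 next
 fix c assume c: "te = Tile (?A - {c}) m c" "c:?A"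
 have "top_vertex te = Y" using c m by (simp add: c(1)) auto
 hence "te = Tile C p q" using black_top_unique[OF 2(1) k] by (simp add: tile_vertices_Tile Y)
 thus ?thesis using c m by simp
 qed
 qed
 qed
 have lt: "R i j ==> i < j" for i j using W_tile by (auto simp: R_def)
 hence lt': "R i j ==> id i < id j" for i j by simp
 have un: "j = j'" if "R i j" "R i j'" for i j j'
 proof -
 have "Tile (Y - {j} - {i}) i j = Tile (Y - {j'} - {i}) i j'"
 using that edge[of i j] edge[of i j'] inV[OF that(1)]
 by (intro upc_unique[of "(Y - {i}, Y)"]) (auto simp: R_def)
 thus ?thesis by simp
 qed
 have la: "~ R q y" for y
 proof
 assume r: "R q y"
 have "(Y - {q}, Y):LE (Tile C p q)" unfolding Yp(1) LE_Tile using Y by simp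
 thus False
 using r not_both_up[of "(Y - {q}, Y)" "Tile (Y - {y} - {q}) q y" "Tile C p q"] edge[of q y] inV[OF r] k
 by (auto simp: R_def)
 qed
 obtain N g where g: "g (0 :: nat) = p" "g N = q" "?V = g ` {..N}" "!!i. i < N ==> R (g i) (g (Suc i))"
 proof -
 have "EX (N :: nat) g. g 0 = p & g N = q & ?V = g ` {..N} & (ALL i<N. R (g i) (g (Suc i)))"
 proof (rule chain_ex[where key = id])
 show "ALL y:?V. y ~= p --> (EX x:?V. R x y)" using pred by blast
 show "ALL x y. R x y --> id x < id y" using lt' by blast
 show "ALL x y z. R x y --> R x z --> y = z" using un by blast
 qed (use l la in blast)+
 thus ?thesis using that by blast
 qed
 have "N ~= 0" using g(1,2) K_tile[OF k] by (metis less_irrefl)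
 moreover have "N ~= 1"
 proof
 assume "N = 1"
 hence "R p q" using g by fastforce
 moreover have "Y - {q} - {p} = C" using Yp K_tile[OF k] by auto
 ultimately show False using k disj by (auto simp: R_def)
 qed
 ultimately have "2<=N" by simp
 moreover have "EX t<N. i = g t & j = g (Suc t)" if w: "Tile X i j:W" "insert i (insert j X) = Y" for i j X
 proof -
 have "X = Y - {j} - {i}" using w W_tile[OF w(1)] by auto
 hence r: "R i j" using w W_tile[OF w(1)] by (auto simp: R_def)
 hence "i:g ` {..N}" using inV(1)[OF r] g(3) by blast
 then obtain t where t: "t<=N" "i = g t" by auto
 have "t ~= N" using t r g(2) la by auto
 hence "t < N" using t by simp
 moreover have "j = g (Suc t)" using un[of i j] r g(4)[OF `t < N`] t by auto
 ultimately show ?thesis using t by blast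
 qed
 moreover have "g t < g (Suc t) & g t:Y & g (Suc t):Y & Tile (Y - {g (Suc t)} - {g t}) (g t) (g (Suc t)):W" if "t < N" for t
 using g(4)[OF that] lt by (auto simp: R_def)
 moreover have "m:Y ==> (Y - {m}, Y):edges ==> m:g ` {..N}" for m using g(3) by blast
 ultimately show ?thesis using that[of N g] g(1,2) by blast
qed

section \<open>The planar edges of one level\<close>

text \<open>Passing through a white tile from left to right, between its two lower edges in the
  first case and between its two upper edges in the second.\<close>

definition step :: "nat set \<times> nat => nat set \<times> nat => bool" where
 "step e e' \<longleftrightarrow> (fst e' = fst e & Tile (fst e) (snd e) (snd e'):W) |
 (snd e':fst e & Tile (fst e - {snd e'}) (snd e') (snd e):W & fst e' = insert (snd e) (fst e - {snd e'}))"

definition VS :: "nat => (nat set \<times> nat) set" where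
 "VS h = {(A, q). V A q & card A = h}"

lemma V_subset: "V A q ==> A<={1..n} & q:{1..n} & q~:A & finite A"
 using edge_subset[of A "insert q A"] finite_subset[OF _ finite_atLeastAtMost] unfolding V_def by blast

lemma step_LE: "step (A, q) e' ==> EX te:W. (A, insert q A):LE te"
 unfolding step_def using LE_I1 LE_I2 by fastforce

lemma step_unique:
 assumes "V A q" "step (A, q) e" "step (A, q) e'"
 shows "e = e'"
proof -
 have ed: "(A, insert q A):edges" using assms(1) by (simp add: V_def)
 obtain A1 q1 A2 q2 where e: "e = (A1, q1)" "e' = (A2, q2)" by (metis surj_pair)
 have "A1 = A & Tile A q q1:W | q1:A & Tile (A - {q1}) q1 q:W & A1 = insert q (A - {q1})"
 using assms(2) by (auto simp: step_def e)
 moreover have "A2 = A & Tile A q q2:W | q2:A & Tile (A - {q2}) q2 q:W & A2 = insert q (A - {q2})"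
 using assms(3) by (auto simp: step_def e)
 ultimately show ?thesis
 proof (elim disjE conjE)
 assume a: "A1 = A" "Tile A q q1:W" "A2 = A" "Tile A q q2:W"
 hence "Tile A q q1 = Tile A q q2" using dnc_unique[OF ed] LE_I1 by blast
 thus ?thesis using a e by simp
 next
 assume a: "Tile A q q1:W" "q2:A" "Tile (A - {q2}) q2 q:W"
 hence "Tile A q q1 = Tile (A - {q2}) q2 q" using dnc_unique[OF ed] LE_I1 LE_I2 by blast
 thus ?thesis using a by blast
 next
 assume a: "q1:A" "Tile (A - {q1}) q1 q:W" "Tile A q q2:W"
 hence "Tile A q q2 = Tile (A - {q1}) q1 q" using dnc_unique[OF ed] LE_I1 LE_I2 by blast
 thus ?thesis using a by blast
 next
 assume a: "q1:A" "Tile (A - {q1}) q1 q:W" "A1 = insert q (A - {q1})" "q2:A" "Tile (A - {q2}) q2 q:W" "A2 = insert q (A - {q2})"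
 hence "Tile (A - {q1}) q1 q = Tile (A - {q2}) q2 q" using dnc_unique[OF ed] LE_I2 by blast
 thus ?thesis using a e by simp
 qed
qed

text \<open>A step keeps one end of the edge and moves the other to the right. The last expression
  is twice the abscissa of the midpoint, which therefore moves strictly.\<close>

lemma step_mono:
 fixes a :: "nat => 'a :: linordered_idom"
 assumes a: "!!i j. 1<=i ==> i < j ==> j<=n ==> a i < a j"
 and "V A q" "step (A, q) (A', q')"
 shows "wsum a A<=wsum a A'" "wsum a (insert q A)<=wsum a (insert q' A')"
 "2 * wsum a A + a q < 2 * wsum a A' + a q'"
proof -
 have f: "finite A" "q~:A" using V_subset[OF assms(2)] by auto
 consider "A' = A" "Tile A q q':W" | "q':A" "Tile (A - {q'}) q' q:W" "A' = insert q (A - {q'})"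
 using assms(3) by (auto simp: step_def)
 hence "wsum a A<=wsum a A' & wsum a (insert q A)<=wsum a (insert q' A') & 2 * wsum a A + a q < 2 * wsum a A' + a q'"
 proof cases
 case 1
 have "a q < a q'" "q'~:A" using W_tile[OF 1(2)] a by auto
 thus ?thesis using 1 f by (simp add: wsum_insert)
 next
 case 2
 have lt: "a q' < a q" using W_tile[OF 2(2)] a by auto
 have w: "wsum a A' = wsum a A - a q' + a q" unfolding 2(3) using f 2 by (intro wsum_swap) auto
 have "insert q' A' = insert q A" unfolding 2(3) using insert_insert_Diff[OF 2(1)] .
 thus ?thesis using w lt by (simp add: algebra_simps)
 qed
 thus "wsum a A<=wsum a A'" "wsum a (insert q A)<=wsum a (insert q' A')" "2 * wsum a A + a q < 2 * wsum a A' + a q'"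
 by blast+
qed

text \<open>Each edge of the level except the one on the left boundary has a white tile on its left,
  whose other edge of the same level is the predecessor. The key is twice the midpoint abscissa for
  the weights \<open>2 ^ k\<close>, a natural number, so \<open>chain_ex\<close> applies.\<close>

lemma level_chain:
 assumes h: "h < n"
 obtains N g where "VS h = g ` {..N}" "!!i. i < N ==> step (g i) (g (Suc i))"
 "!!x y. x:VS h ==> step x y ==> EX i<N. x = g i & y = g (Suc i)"
proof -
 define f l where "f = ({1..h}, Suc h)" and "l = ({n - h + 1..n}, n - h)"
 define R where "R x y \<longleftrightarrow> x:VS h & step x y" for x y
 have lV: "l:VS h"
 using RB_level[OF h] RB_not_terminal[OF RB_level[OF h]] LB_RB_edges[of "({n - h + 1..n}, insert (n - h) {n - h + 1..n})"] h
 unfolding VS_def V_def l_def by auto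
 have pred: "EX x:VS h. R x y" if y: "y:VS h" "y ~= f" for y
 proof -
 obtain A q where Aq: "y = (A, q)" "V A q" "card A = h" using y by (auto simp: VS_def)
 have "(A, insert q A)~:LB n"
 proof
 assume "(A, insert q A):LB n"
 from LB_levelD[OF this] have A: "A = {1..h}" "insert q A = {1..Suc h}" using Aq by auto
 have "{1..Suc h} = insert (Suc h) {1..h}" by auto
 hence "insert q {1..h} = insert (Suc h) {1..h}" using A by metis
 moreover have "q~:{1..h}" using Aq(2) A(1) unfolding V_def by metis
 moreover have "Suc h~:{1..h}" by simp
 ultimately have "q = Suc h" using insert_cancel_iff by metis
 thus False using y(2) A(1) Aq(1) by (metis f_def)
 qed
 with Aq(2) show ?thesis
 proof (cases rule: white_left)
 case (down m)
 have "A~:bots" using Aq by (simp add: V_def)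
 hence "V A m" using V_lower down by blast
 hence "(A, m):VS h" "step (A, m) y" using Aq down by (auto simp: VS_def step_def)
 thus ?thesis unfolding R_def by blast
 next
 case (up c)
 let ?A = "insert q (A - {c})"
 have fA: "finite A" "q~:A" using V_subset[OF Aq(2)] by auto
 have "insert q (insert c (A - {c})) = insert q A" using up by auto
 moreover have "insert q A~:tops" using Aq by (simp add: V_def)
 ultimately have "V ?A c" using V_upper(1)[OF up(3)] by simp
 moreover have "card ?A = h" using fA up Aq(3) by (metis Diff_iff card_Suc_Diff1 card_insert_disjoint finite_Diff)
 moreover have "step (?A, c) (A, q)" using up fA by (auto simp: step_def)
 ultimately show ?thesis using Aq unfolding R_def VS_def by blast
 qed
 qed
 let ?key = "%(A, q). nat (2 * wsum (%k. 2 ^ k :: int) A + 2 ^ q)"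
 have key: "?key x < ?key y" if "R x y" for x y
 proof -
 obtain A q A' q' where xy: "x = (A, q)" "y = (A', q')" by (metis surj_pair)
 have v: "V A q" "step (A, q) (A', q')" using that xy by (auto simp: R_def VS_def)
 have "0<=wsum (%k. 2 ^ k :: int) A" by (simp add: wsum_def sum_nonneg)
 moreover have "2 * wsum (%k. 2 ^ k :: int) A + 2 ^ q < 2 * wsum (%k. 2 ^ k :: int) A' + 2 ^ q'"
 using step_mono(3)[OF _ v, of "%k. 2 ^ k :: int"] by auto
 moreover have "(0 :: int) < 2 ^ q" by simp
 ultimately have "nat (2 * wsum (%k. 2 ^ k :: int) A + 2 ^ q) < nat (2 * wsum (%k. 2 ^ k :: int) A' + 2 ^ q')"
 by linarith
 thus ?thesis using xy by simp
 qed
 have un: "y = z" if "R x y" "R x z" for x y z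
 proof -
 obtain A q where x: "x = (A, q)" by (cases x)
 hence "V A q" using that by (auto simp: R_def VS_def)
 thus ?thesis using step_unique[of A q y z] that x by (simp add: R_def)
 qed
 have la: "~ R l y" for y
 proof
 assume "R l y"
 hence "step ({n - h + 1..n}, n - h) y" by (simp add: R_def l_def)
 hence "EX te:W. ({n - h + 1..n}, insert (n - h) {n - h + 1..n}):LE te" by (rule step_LE)
 thus False using RB_not_LE[OF RB_level[OF h]] sub by blast
 qed
 obtain N g where g: "g (0 :: nat) = f" "g N = l" "VS h = g ` {..N}" "!!i. i < N ==> R (g i) (g (Suc i))"
 proof -
 have "EX (N :: nat) g. g 0 = f & g N = l & VS h = g ` {..N} & (ALL i<N. R (g i) (g (Suc i)))"
 proof (rule chain_ex[where key = ?key])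
 show "ALL y:VS h. y ~= f --> (EX x:VS h. R x y)" using pred by blast
 show "ALL x y. R x y --> ?key x < ?key y" using key by blast
 show "ALL x y z. R x y --> R x z --> y = z" using un by blast
 qed (use lV la in blast)+
 thus ?thesis using that by blast
 qed
 have "EX i<N. x = g i & y = g (Suc i)" if "x:VS h" "step x y" for x y
 proof -
 have "x:g ` {..N}" using that(1) unfolding g(3) .
 then obtain i where i: "i<=N" "x = g i" by auto
 have "R x y" using that by (simp add: R_def)
 hence "i ~= N" using la i(2) g(2) by metis
 hence "i < N" using i by simp
 hence "R x (g (Suc i))" using g(4)[of i] i(2) by metis
 thus ?thesis using un[OF `R x y`, of "g (Suc i)"] i `i < N` by blast
 qed
 thus ?thesis using that[of g N] g(3,4) by (auto simp: R_def)
qed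

end

definition increasing_on :: "nat => (nat => 'a :: linordered_idom) => bool" where
 "increasing_on n a \<longleftrightarrow> (ALL i j. 1<=i --> i < j --> j<=n --> a i < a j)"

lemma increasing_onD: "increasing_on n a ==> 1<=i ==> i < j ==> j<=n ==> a i < a j"
 by (simp add: increasing_on_def)

lemma chain_less:
 fixes g :: "nat => nat"
 assumes "ALL t<N. g t < g (Suc t)" "i < j" "j<=N"
 shows "g i < g j"
 using assms(2,3)
proof (induction j)
 case (Suc j)
 thus ?case using assms(1) by (metis Suc_le_lessD less_SucE less_or_eq_imp_le less_trans)
qed simp

context gt
begin

lemma card_less_n: "A<={1..n} ==> q:{1..n} ==> q~:A ==> card A < n"
 using psubset_card_mono[of "{1..n}" A] by (metis card_atLeastAtMost diff_Suc_1 finite_atLeastAtMost psubsetI)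

lemma level_order:
 assumes h: "h < n" and a: "increasing_on n (a :: nat => 'a :: linordered_idom)"
 obtains N g where "VS h = g ` {..N}" "!!x y. x:VS h ==> step x y ==> EX i<N. x = g i & y = g (Suc i)"
 "!!i j. i<=j ==> j<=N ==> wsum a (fst (g i))<=wsum a (fst (g j))"
 "!!i j. i<=j ==> j<=N ==> wsum a (insert (snd (g i)) (fst (g i)))<=wsum a (insert (snd (g j)) (fst (g j)))"
 "!!i. i < N ==> step (g i) (g (Suc i))"
proof -
 obtain N g where g: "VS h = g ` {..N}" "!!i. i < N ==> step (g i) (g (Suc i))"
 "!!x y. x:VS h ==> step x y ==> EX i<N. x = g i & y = g (Suc i)" using level_chain[OF h] by metis
 have st: "wsum a (fst (g i))<=wsum a (fst (g (Suc i))) &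
 wsum a (insert (snd (g i)) (fst (g i)))<=wsum a (insert (snd (g (Suc i))) (fst (g (Suc i))))" if "i < N" for i
 proof -
 have "g i:VS h" using g(1) that by auto
 hence "V (fst (g i)) (snd (g i))" by (auto simp: VS_def)
 moreover have "step (fst (g i), snd (g i)) (fst (g (Suc i)), snd (g (Suc i)))" using g(2)[OF that] by simp
 ultimately show ?thesis using step_mono(1,2)[of a, OF increasing_onD[of n a]] a by blast
 qed
 show ?thesis
 proof (rule that[OF g(1,3)])
 show "wsum a (fst (g i))<=wsum a (fst (g j))" if "i<=j" "j<=N" for i j
 using chain_mono[of N "%i. wsum a (fst (g i))" i j] st that by blast
 show "wsum a (insert (snd (g i)) (fst (g i)))<=wsum a (insert (snd (g j)) (fst (g j)))" if "i<=j" "j<=N" for i j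
 using chain_mono[of N "%i. wsum a (insert (snd (g i)) (fst (g i)))" i j] st that by blast
 qed (use g(2,3) in blast)+
qed

lemma lower_step:
 assumes "Tile X i j:W" "X~:bots"
 shows "(X, i):VS (card X)" "(X, j):VS (card X)" "step (X, i) (X, j)" "card X < n"
 using V_lower[OF assms] assms W_tile[OF assms(1)] card_less_n[of X j] by (auto simp: VS_def step_def)

lemma upper_step:
 assumes "Tile X i j:W" "insert i (insert j X)~:tops"
 shows "(insert i X, j):VS (Suc (card X))" "(insert j X, i):VS (Suc (card X))"
 "step (insert i X, j) (insert j X, i)" "Suc (card X) < n"
proof -
 have t: "i < j" "1<=i" "j<=n" "X<={1..n}" "i~:X" "j~:X" "finite X" using W_tile[OF assms(1)] by auto
 have "insert i X - {i} = X" using t by auto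
 thus "step (insert i X, j) (insert j X, i)" using assms(1) by (simp add: step_def)
 show "(insert i X, j):VS (Suc (card X))" "(insert j X, i):VS (Suc (card X))"
 using V_upper[OF assms] t by (auto simp: VS_def)
 have "card (insert i X) < n" using t by (intro card_less_n[of _ j]) auto
 thus "Suc (card X) < n" using t by simp
qed

text \<open>The lower edges of each tile are consecutive in the chain of their level, and the upper
  ends of the edges are ordered along the chain. Different consecutive pairs therefore have disjoint
  spans between left and right vertex.\<close>

lemma lower_unique:
 assumes "Tile X i j:W" "X~:bots" "Tile X' i' j':W" "X'~:bots" "card X' = card X"
 and a: "increasing_on n (a :: nat => 'a :: linordered_idom)"
 and ov: "wsum a (insert i X) < wsum a (insert j' X')" "wsum a (insert i' X') < wsum a (insert j X)"
 shows "X' = X & i' = i & j' = j"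
proof -
 note s = lower_step[OF assms(1,2)] and s' = lower_step[OF assms(3,4), unfolded assms(5)]
 obtain N g where g: "VS (card X) = g ` {..N}" "!!x y. x:VS (card X) ==> step x y ==> EX i<N. x = g i & y = g (Suc i)"
 "!!i j. i<=j ==> j<=N ==> wsum a (insert (snd (g i)) (fst (g i)))<=wsum a (insert (snd (g j)) (fst (g j)))"
 using level_order[OF s(4) a] by metis
 obtain u where u: "u < N" "(X, i) = g u" "(X, j) = g (Suc u)" using g(2)[OF s(1,3)] by blast
 obtain v where v: "v < N" "(X', i') = g v" "(X', j') = g (Suc v)" using g(2)[OF s'(1,3)] by blast
 have e: "fst (g u) = X" "snd (g u) = i" "fst (g (Suc u)) = X" "snd (g (Suc u)) = j"
 "fst (g v) = X'" "snd (g v) = i'" "fst (g (Suc v)) = X'" "snd (g (Suc v)) = j'"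
 using u v by (metis fst_conv snd_conv)+
 have "~ u < v" using g(3)[of "Suc u" v] v(1) ov e by auto
 moreover have "~ v < u" using g(3)[of "Suc v" u] u(1) ov e by auto
 ultimately have "u = v" by simp
 thus ?thesis using e by auto
qed

text \<open>The two upper edges of the tile are consecutive in their chain, along which lower ends
  are ordered; none fits strictly between the left and the right vertex.\<close>

lemma bottom_between:
 assumes "Tile X i k:W" "insert i (insert k X)~:tops" "V A q" "card A = Suc (card X)"
 and a: "increasing_on n (a :: nat => 'a :: linordered_idom)"
 and btw: "wsum a (insert i X) < wsum a A" "wsum a A < wsum a (insert k X)"
 shows False
proof -
 note s = upper_step[OF assms(1,2)]
 obtain N g where g: "VS (Suc (card X)) = g ` {..N}" "!!x y. x:VS (Suc (card X)) ==> step x y ==> EX i<N. x = g i & y = g (Suc i)"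
 "!!i j. i<=j ==> j<=N ==> wsum a (fst (g i))<=wsum a (fst (g j))"
 using level_order[OF s(4) a] by metis
 obtain u where u: "u < N" "(insert i X, k) = g u" "(insert k X, i) = g (Suc u)" using g(2)[OF s(1,3)] by blast
 have "(A, q):VS (Suc (card X))" using assms by (simp add: VS_def)
 then obtain v where v: "v<=N" "(A, q) = g v" using g(1) by auto
 have e: "fst (g u) = insert i X" "fst (g (Suc u)) = insert k X" "fst (g v) = A" using u v by (metis fst_conv)+
 have "~ v<=u" using g(3)[of v u] u(1) btw e by auto
 moreover have "~ Suc u<=v" using g(3)[of "Suc u" v] v(1) btw e by auto
 ultimately show False by simp
qed

text \<open>The edge with label \<open>m\<close> at \<open>v\<close> lies between the two tiles. Its
  neighbours in the chain have lower ends strictly left and strictly right of \<open>v\<close>, so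
  no other edge of the chain has lower end \<open>v\<close>.\<close>

lemma single_out:
 assumes "Tile X m k:W" "Tile X' i m:W" "v = insert k X" "v = insert i X'" "insert m v~:tops" "V v m'"
 shows "m' = m"
proof -
 have cm: "insert m (insert k X) = insert m v" "insert i (insert m X') = insert m v" using assms(3,4) by auto
 note s = upper_step[OF assms(1), unfolded cm, OF assms(5)] and s' = upper_step[OF assms(2), unfolded cm, OF assms(5)]
 have fX: "finite X" "finite X'" "k~:X" "m~:X" "i~:X'" "m~:X'" "m < k" "i < m" using W_tile[OF assms(1)] W_tile[OF assms(2)] by auto
 have cX: "Suc (card X) = card v" "Suc (card X') = card v"
 using card_insert_disjoint[of X k] card_insert_disjoint[of X' i] fX assms(3,4) by metis+
 let ?a = "%k. 2 ^ k :: int"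
 have a: "increasing_on n ?a" by (simp add: increasing_on_def)
 obtain N g where g: "VS (card v) = g ` {..N}" "!!x y. x:VS (card v) ==> step x y ==> EX i<N. x = g i & y = g (Suc i)"
 "!!i j. i<=j ==> j<=N ==> wsum ?a (fst (g i))<=wsum ?a (fst (g j))" "!!i. i < N ==> step (g i) (g (Suc i))"
 using level_order[OF s(4)[unfolded cX] a] by metis
 obtain u where u: "u < N" "(insert m X, k) = g u" "(v, m) = g (Suc u)"
 using g(2)[OF s(1,3)[unfolded cX]] assms(3) by metis
 have "(v, m'):VS (card v)" using assms by (simp add: VS_def)
 hence "(v, m'):g ` {..N}" unfolding g(1) .
 then obtain w where w: "w<=N" "(v, m') = g w" by auto
 have lt: "wsum ?a (insert m X) < wsum ?a v" "wsum ?a v < wsum ?a (insert m X')"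
 proof -
 have "wsum ?a v = ?a k + wsum ?a X" "wsum ?a v = ?a i + wsum ?a X'"
 using wsum_insert[of X k ?a] wsum_insert[of X' i ?a] fX assms(3,4) by metis+
 moreover have "?a m < ?a k" "?a i < ?a m" using fX by simp_all
 moreover have "wsum ?a (insert m X) = ?a m + wsum ?a X" "wsum ?a (insert m X') = ?a m + wsum ?a X'"
 using wsum_insert[of X m ?a] wsum_insert[of X' m ?a] fX by simp_all
 ultimately show "wsum ?a (insert m X) < wsum ?a v" "wsum ?a v < wsum ?a (insert m X')"
 by linarith+
 qed
 have e: "fst (g u) = insert m X" "fst (g w) = v" using u w by (metis fst_conv)+
 have "~ w<=u" using g(3)[of w u] u(1) lt e by auto
 show ?thesis
 proof (cases "w = Suc u")
 case True
 thus ?thesis using u(3) w(2) by (metis prod.inject)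
 next
 case False
 hence lt': "Suc u < w" "Suc u < N" using `~ w<=u` w(1) by linarith+
 have "V v m" using s(2) assms(3) by (simp add: VS_def)
 moreover have "step (v, m) (g (Suc (Suc u)))" using g(4)[OF lt'(2)] u(3) by simp
 moreover have "step (v, m) (insert m X', i)" using s'(3) assms(4) by simp
 ultimately have "g (Suc (Suc u)) = (insert m X', i)" by (rule step_unique)
 thus ?thesis using g(3)[of "Suc (Suc u)" w] lt'(1) w(1) e(2) lt(2) by simp
 qed
qed

text \<open>\<open>interior_lower A d\<close>: the vertex \<open>A\<close> lies strictly inside the lower boundary of the lens of a black tile with
  top \<open>A \<union> {d}\<close>.\<close>
definition interior_lower :: "nat set => nat => bool" where
 "interior_lower A d \<longleftrightarrow> d~:A & (EX C p q. Tile C p q:K & p < d & d < q & insert d A = insert p (insert q C))"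

lemma interior_lowerI:
 "Tile C p q:K ==> p < d ==> d < q ==> d~:A ==> insert d A = insert p (insert q C) ==> interior_lower A d"
 unfolding interior_lower_def by blast

lemma bot_labels:
 assumes "Tile C p q:K" "Tile C i j:W"
 shows "p<=i" "j<=q"
proof -
 obtain N g where g: "g (0 :: nat) = p" "g N = q" "!!t. t < N ==> g t < g (Suc t) & Tile C (g t) (g (Suc t)):W"
 "!!i j. Tile C i j:W ==> EX t<N. i = g t & j = g (Suc t)" using bot_chain[OF assms(1)] by metis
 obtain t where t: "t < N" "i = g t" "j = g (Suc t)" using g(4)[OF assms(2)] by blast
 have le: "ALL t<N. g t < g (Suc t)" using g(3) by blast
 have "g 0<=g t" by (cases "t = 0") (use chain_less[OF le, of 0 t] t in auto)
 moreover have "g (Suc t)<=g N" by (cases "Suc t = N") (use chain_less[OF le, of "Suc t" N] t in auto)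
 ultimately show "p<=i" "j<=q" using t g(1,2) by simp_all
qed

lemma top_labels:
 assumes "Tile C p q:K" "Tile X i j:W" "insert i (insert j X) = insert p (insert q C)"
 shows "p<=i" "j<=q"
proof -
 obtain N g where g: "g (0 :: nat) = p" "g N = q" "!!t. t < N ==> g t < g (Suc t)"
 "!!i j X. Tile X i j:W ==> insert i (insert j X) = insert p (insert q C) ==> EX t<N. i = g t & j = g (Suc t)"
 using top_chain[OF assms(1) refl] by metis
 obtain t where t: "t < N" "i = g t" "j = g (Suc t)" using g(4)[OF assms(2,3)] by blast
 have le: "ALL t<N. g t < g (Suc t)" using g(3) by blast
 have "g 0<=g t" by (cases "t = 0") (use chain_less[OF le, of 0 t] t in auto)
 moreover have "g (Suc t)<=g N" by (cases "Suc t = N") (use chain_less[OF le, of "Suc t" N] t in auto)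
 ultimately show "p<=i" "j<=q" using t g(1,2) by simp_all
qed

lemma bot_ends:
 assumes "Tile C p q:K"
 obtains m m' where "Tile C p m:W" "m < q" "Tile C m' q:W" "p < m'"
proof -
 obtain N g where g: "2<=N" "g (0 :: nat) = p" "g N = q" "!!t. t < N ==> g t < g (Suc t) & Tile C (g t) (g (Suc t)):W"
 using bot_chain[OF assms(1)] by metis
 have le: "ALL t<N. g t < g (Suc t)" using g(4) by blast
 obtain M where M: "N = Suc M" "1<=M" using g(1) by (cases N) auto
 have "Tile C p (g 1):W" using g(4)[of 0] g(2) M by simp
 moreover have "g 1 < q" using chain_less[OF le, of 1 N] g(3) M by simp
 moreover have "Tile C (g M) q:W" using g(4)[of M] g(3) M by simp
 moreover have "p < g M" using chain_less[OF le, of 0 M] g(2) M by simp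
 ultimately show ?thesis using that by blast
qed

text \<open>If the top is terminal, it is the top of a lens. Either the left vertex of the tile is
  inside the lower boundary of that lens, or it is the left vertex of the black tile
  \<open>Tile C p q\<close>. In the second case the first white tile over \<open>C\<close> has the
  same left vertex and a smaller right label.\<close>

lemma right_stack:
 assumes "Tile X c d:W"
 shows "EX d'. V (insert c X) d' | interior_lower (insert c X) d'"
 using assms
proof (induction d arbitrary: X c rule: less_induct)
 case (less d)
 let ?A = "insert c X"
 have t: "c < d" "c~:X" "d~:X" using W_tile[OF less.prems] by auto
 show ?case
 proof (cases "insert c (insert d X):tops")
 case False
 thus ?thesis using V_upper(1)[OF less.prems] by blast
 next
 case True
 then obtain C p q where k: "Tile C p q:K" "insert c (insert d X) = insert p (insert q C)"
 by (metis top_Tile imageE tile.exhaust)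
 have pq: "p<=c" "d<=q" using top_labels[OF k(1) less.prems k(2)] by auto
 have dA: "insert d ?A = insert p (insert q C)" using k(2) by auto
 show ?thesis
 proof (cases "d = q")
 case False
 hence "interior_lower ?A d" using pq t by (intro interior_lowerI[OF k(1) _ _ _ dA]) auto
 thus ?thesis by blast
 next
 case True
 have "insert q ?A = insert q (insert p C)" using dA True by (metis insert_commute)
 moreover have "q~:?A" "q~:insert p C" using True t K_tile[OF k(1)] by auto
 ultimately have "?A = insert p C" by (metis Diff_insert_absorb)
 moreover obtain m where "Tile C p m:W" "m < q" using bot_ends[OF k(1)] by metis
 ultimately show ?thesis using less.IH[of m C p] True by metis
 qed
 qed
qed

lemma left_stack:
 assumes "Tile X c d:W"
 shows "EX d'. V (insert d X) d' | interior_lower (insert d X) d'"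
 using assms
proof (induction "n - c" arbitrary: X c d rule: less_induct)
 case less
 let ?A = "insert d X"
 have t: "c < d" "c~:X" "d~:X" "d<=n" using W_tile[OF less.prems] by auto
 show ?case
 proof (cases "insert c (insert d X):tops")
 case False
 thus ?thesis using V_upper(2)[OF less.prems] by blast
 next
 case True
 then obtain C p q where k: "Tile C p q:K" "insert c (insert d X) = insert p (insert q C)"
 by (metis top_Tile imageE tile.exhaust)
 have pq: "p<=c" "d<=q" using top_labels[OF k(1) less.prems k(2)] by auto
 show ?thesis
 proof (cases "c = p")
 case False
 hence "interior_lower ?A c" using pq t by (intro interior_lowerI[OF k(1) _ _ _ k(2)]) auto
 thus ?thesis by blast
 next
 case True
 have "p~:?A" "p~:insert q C" using True t K_tile[OF k(1)] by auto
 hence "?A = insert q C" using k(2) True by (metis Diff_insert_absorb)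
 moreover obtain m where m: "Tile C m q:W" "p < m" using bot_ends[OF k(1)] by metis
 moreover have "n - m < n - c" using m True W_tile[OF m(1)] by auto
 ultimately show ?thesis using less.hyps[of m C q] by metis
 qed
 qed
qed

text \<open>Move to the right across the edges that enter \<open>A\<close>. Their labels decrease,
  and the walk ends at the right boundary or at a tile with left vertex \<open>A\<close>, to which
  \<open>right_stack\<close> applies.\<close>

lemma top_has_out:
 assumes "V (A - {q}) q" "q:A" "A ~= {1..n}"
 shows "EX d'. V A d' | interior_lower A d'"
 using assms
proof (induction q rule: less_induct)
 case (less q)
 have Aq: "insert q (A - {q}) = A" using less.prems by auto
 show ?case
 proof (cases "(A - {q}, insert q (A - {q})):RB n")
 case True
 hence r: "A = {n - card (A - {q})..n}" "card (A - {q}) < n" using RB_levelD Aq by metis+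
 define c where "c = card (A - {q})"
 have c: "A = {n - c..n}" "c < n" using r by (simp_all add: c_def)
 have "Suc c ~= n" using c less.prems(3) by auto
 hence Sc: "Suc c < n" using c by simp
 have A: "{n - Suc c + 1..n} = A" using c Sc by (simp add: Suc_diff_Suc)
 have "V A (n - Suc c)"
 using RB_level[OF Sc, unfolded A] RB_not_terminal[OF RB_level[OF Sc, unfolded A]] LB_RB_edges[of "(A, insert (n - Suc c) A)"] c Sc
 unfolding V_def by auto
 thus ?thesis by blast
 next
 case False
 with less.prems(1) show ?thesis
 proof (cases rule: white_right)
 case (up m)
 thus ?thesis using right_stack[OF up(2)] Aq by simp
 next
 case (down c)
 have "insert c (insert q (A - {q} - {c})) = A" using down less.prems by auto
 moreover have "A~:tops" using less.prems(1) Aq by (simp add: V_def)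
 ultimately have "V (insert q (A - {q} - {c})) c" using V_upper(2)[OF down(3)] by simp
 moreover have "insert q (A - {q} - {c}) = A - {c}" using down less.prems by auto
 ultimately show ?thesis using less.IH[of c] down less.prems by auto
 qed
 qed
qed

lemma B_out:
 assumes "A:B" "A ~= {1..n}"
 shows "EX d. V A d | interior_lower A d"
proof -
 have nt: "A~:bots" "A~:tops" using assms by (auto simp: spectrum_def terminal_vertices_def)
 obtain te where te: "te:W Un K" "A:tile_vertices te" using assms by (auto simp: spectrum_def)
 obtain X i j where t: "te = Tile X i j" by (cases te)
 have kb: "Tile X i j:K ==> X:bots & insert i (insert j X):tops" by (metis bottom_Tile top_Tile imageI)
 consider "A = X" | "A = insert i X" | "A = insert j X" | "A = insert i (insert j X)"
 using te(2) t by (auto simp: tile_vertices_Tile)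
 thus ?thesis
 proof cases
 case 1
 hence "Tile X i j:W" using te t kb nt by blast
 thus ?thesis using V_lower(1) nt 1 by blast
 next
 case 2
 show ?thesis
 proof (cases "te:W")
 case True
 thus ?thesis using right_stack t 2 by blast
 next
 case False
 then obtain m where "Tile X i m:W" using bot_ends[of X i j] te t by blast
 thus ?thesis using right_stack 2 by blast
 qed
 next
 case 3
 show ?thesis
 proof (cases "te:W")
 case True
 thus ?thesis using left_stack t 3 by blast
 next
 case False
 then obtain m where "Tile X m j:W" using bot_ends[of X i j] te t by blast
 thus ?thesis using left_stack 3 by blast
 qed
 next
 case 4
 hence w: "Tile X i j:W" using te t kb nt by blast
 have "A - {i} = insert j X" "i:A" using 4 W_tile[OF w] by auto
 thus ?thesis using top_has_out[of A i] V_upper(2)[OF w] 4 nt assms by simp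
 qed
qed

end

lemma pow2_increasing: "increasing_on n (%k. 2 ^ k :: int)"
 by (simp add: increasing_on_def)

section \<open>Finding a configuration that can be lowered\<close>

context gt
begin

text \<open>The configuration at which \<open>X \<union> {i, k}\<close> can be lowered to \<open>X \<union> {j}\<close>.\<close>
definition EW :: "nat set => nat => nat => nat => bool" where
 "EW X i j k \<longleftrightarrow> i < j & j < k & i~:X & j~:X & k~:X &
 Tile (insert i X) j k:W & Tile (insert k X) i j:W & Tile X i k:W"

text \<open>The two tiles have the common top \<open>insert x v\<close>; \<open>v\<close> is the
  right vertex of the one and the left vertex of the other. From the edge with label
  \<open>i\<close> walk left across the planar edges entering \<open>v\<close>, up to a tile
  \<open>Tile (v - {q1} - {k}) q1 k\<close>. If \<open>q1 = i\<close>, this is the third tile of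
  \<open>EW\<close>. Otherwise the tile right of the edge with label \<open>q1\<close> puts
  \<open>v - {q1}\<close> into the same position one level lower. The bound \<open>g\<close> keeps
  terminal bottoms away from the lower levels.\<close>

lemma descent:
 assumes nolow: "!!C p q. Tile C p q:K ==> g<=Suc (card C)"
 shows "card v<=g ==> i < x ==> x < k ==> i:v ==> k:v ==> x~:v ==> Tile (v - {k}) x k:W ==>
 Tile (v - {i}) i x:W ==> v - {k}~:bots ==> v - {i}~:bots ==>
 EX X i' j' k'. EW X i' j' k' & (card X + 2 < card v | X = v - {k} - {i} & i' = i & j' = x & k' = k)"
proof (induction "card v" arbitrary: v i x k rule: less_induct)
 case less
 note t1 = less.prems(7) and t2 = less.prems(8)
 have ik: "i < x" "x < k" "i:v" "k:v" "x~:v" using less.prems by auto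
 have w1: "v - {k}<={1..n}" "k<=n" "1<=x" using W_tile[OF t1] by auto
 have vsub: "v<={1..n}" using w1 ik by auto
 have fv: "finite v" using vsub finite_subset by blast
 have vins: "insert q (v - {q}) = v" if "q:v" for q using that by auto
 have vtop: "v~:tops" using side_nonterminal(4)[of "v - {k}" x k] t1 vins[OF ik(4)] by simp
 have cardv: "card (v - {q}) = card v - 1" if "q:v" for q using that fv by simp
 let ?a = "%k. 2 ^ k :: int"
 have wv: "wsum ?a v = ?a q + wsum ?a (v - {q})" if "q:v" for q using wsum_remove[OF fv that] .
 have upleft: "EX c:v. q < c & Tile (v - {q} - {c}) q c:W & V (v - {c}) c"
 if q: "q:v" "V (v - {q}) q" "q ~= k" for q
 proof -
 have "(v - {q}, insert q (v - {q}))~:LB n"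
 proof
 assume "(v - {q}, insert q (v - {q})):LB n"
 hence "v = {1..Suc (card (v - {q}))}" using LB_levelD vins[OF q(1)] by metis
 then obtain m where m: "v = {1..m}" by blast
 hence "k<=m" using ik(4) by simp
 thus False using m ik w1(3) by auto
 qed
 with q(2) show ?thesis
 proof (cases rule: white_left)
 \<comment> \<open>This tile and \<open>Tile (v - {k}) x k\<close> both have right vertex
   \<open>v\<close>, so their spans overlap and \<open>lower_unique\<close> would give
   \<open>q = k\<close>.\<close>
 case (down m)
 have qb: "v - {q}~:bots" using q(2) by (simp add: V_def)
 have mq: "m~:v - {q}" "m < q" using W_tile[OF down(2)] by auto
 have xk: "x~:v - {k}" using ik by auto
 have "wsum ?a (insert x (v - {k})) < wsum ?a (insert q (v - {q}))"
 using wsum_insert[of "v - {k}" x ?a] fv xk wv[OF ik(4)] ik(2) vins[OF q(1)] by simp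
 moreover have "wsum ?a (insert m (v - {q})) < wsum ?a (insert k (v - {k}))"
 using wsum_insert[of "v - {q}" m ?a] fv mq wv[OF q(1)] vins[OF ik(4)] by simp
 ultimately have "v - {q} = v - {k}"
 using lower_unique[OF t1 less.prems(9) down(2) qb _ pow2_increasing] cardv[OF q(1)] cardv[OF ik(4)] by simp
 thus ?thesis using q(1,3) by blast
 next
 case (up c)
 let ?X = "v - {q} - {c}"
 have e: "insert q ?X = v - {c}" "insert q (insert c ?X) = v" using q(1) up by auto
 have "V (v - {c}) c" using V_upper(1)[OF up(3)] vtop unfolding e by blast
 thus ?thesis using up by blast
 qed
 qed
 have climb: "EX q1:v. q<=q1 & V (v - {q1}) q1 & Tile (v - {q1} - {k}) q1 k:W"
 if "q:v" "V (v - {q}) q" "q ~= k" for q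
 using that
 proof (induction "n - q" arbitrary: q rule: less_induct)
 case (less q)
 obtain c where c: "c:v" "q < c" "Tile (v - {q} - {c}) q c:W" "V (v - {c}) c"
 using upleft[OF less.prems] by blast
 show ?case
 proof (cases "c = k")
 case True
 thus ?thesis using c less.prems by blast
 next
 case False
 have "c<=n" using c(1) vsub by auto
 hence "n - c < n - q" using c(2) by linarith
 then obtain q1 where "q1:v" "c<=q1" "V (v - {q1}) q1" "Tile (v - {q1} - {k}) q1 k:W"
 using less.hyps[OF _ c(1,4) False] by blast
 thus ?thesis using c(2) by (intro bexI[of _ q1]) auto
 qed
 qed
 have Vi: "V (v - {i}) i" using V_lower(1)[OF t2 less.prems(10)] .
 obtain q1 where q1: "q1:v" "i<=q1" "V (v - {q1}) q1" "Tile (v - {q1} - {k}) q1 k:W"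
 using climb[OF ik(3) Vi] ik by auto
 have q1k: "q1 < k" using W_tile[OF q1(4)] by auto
 show ?case
 proof (cases "q1 = i")
 case True
 let ?X = "v - {k} - {i}"
 have e: "insert i ?X = v - {k}" "insert k ?X = v - {i}" "v - {i} - {k} = ?X" using ik by auto
 have "EW ?X i x k" unfolding EW_def using e q1(4) True t1 t2 ik by simp
 thus ?thesis by blast
 next
 case False
 hence iq: "i < q1" using q1 by simp
 have "(v - {q1}, insert q1 (v - {q1}))~:RB n"
 proof
 assume "(v - {q1}, insert q1 (v - {q1})):RB n"
 hence r: "v - {q1} = {n - card (v - {q1}) + 1..n}" "v = {n - card (v - {q1})..n}"
 using RB_levelD vins[OF q1(1)] by metis+
 define m where "m = n - card (v - {q1})"
 have m: "v - {q1} = {m + 1..n}" "v = {m..n}" using r by (simp_all add: m_def)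
 have "q1:{m..n}" "i:{m..n}" by (metis m(2) q1(1), metis m(2) ik(3))
 moreover have "q1~:{m + 1..n}" by (metis m(1) Diff_iff singletonI)
 ultimately show False using iq by simp
 qed
 with q1(3) show ?thesis
 proof (cases rule: white_right)
 case (up m)
 have qb: "v - {q1}~:bots" using q1(3) by (simp add: V_def)
 have mq: "m~:v - {q1}" "q1 < m" using W_tile[OF up(2)] by auto
 have xi: "x~:v - {i}" using ik by auto
 have "wsum ?a (insert i (v - {i})) < wsum ?a (insert m (v - {q1}))"
 using wsum_insert[of "v - {q1}" m ?a] fv mq wv[OF q1(1)] vins[OF ik(3)] by simp
 moreover have "wsum ?a (insert q1 (v - {q1})) < wsum ?a (insert x (v - {i}))"
 using wsum_insert[of "v - {i}" x ?a] fv xi wv[OF ik(3)] ik(1) vins[OF q1(1)] by simp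
 ultimately have "v - {q1} = v - {i}"
 using lower_unique[OF t2 less.prems(10) up(2) qb _ pow2_increasing] cardv[OF q1(1)] cardv[OF ik(3)] by simp
 thus ?thesis using q1(1) False by blast
 next
 case (down c)
 let ?u = "v - {q1}"
 have cu: "card ?u < card v" "card ?u = card v - 1" using card_Diff1_less[OF fv q1(1)] cardv[OF q1(1)] by simp_all
 \<comment> \<open>These sets are two levels below \<open>v\<close>, while black bottoms are at most
   one level below it.\<close>
 have small: "?u - {d}~:bots" if "d:?u" for d
 proof
 assume "?u - {d}:bots"
 then obtain te where te: "te:K" "bottom te = ?u - {d}" by auto
 obtain C p q where C: "te = Tile C p q" by (cases te)
 have "g<=Suc (card (?u - {d}))" using nolow[of C p q] te unfolding C bottom_Tile by blast
 moreover have "Suc (card (?u - {d})) = card ?u" by (rule card_Suc_Diff1) (use that fv in auto)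
 ultimately show False using cu less.prems(1) by linarith
 qed
 have "EX X i' j' k'. EW X i' j' k' & (card X + 2 < card ?u | X = ?u - {k} - {c} & i' = c & j' = q1 & k' = k)"
 proof (rule less.hyps[OF cu(1)])
 show "Tile (?u - {k}) q1 k:W" using q1(4) .
 show "Tile (?u - {c}) c q1:W" using down(3) .
 show "?u - {k}~:bots" "?u - {c}~:bots" using small ik(4) q1k down(1) by auto
 qed (use cu less.prems(1) q1k down ik q1 in auto)
 then obtain X i' j' k' where E: "EW X i' j' k'"
 and X: "card X + 2 < card ?u | X = ?u - {k} - {c} & i' = c & j' = q1 & k' = k" by blast
 have "card X + 2 < card v"
 proof (cases "card X + 2 < card ?u")
 case False
 hence "card X = card (?u - {k} - {c})" using X by blast
 moreover have "k:?u" "c:?u - {k}" using ik(4) q1k down by auto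
 moreover have "Suc (card (?u - {k} - {c})) = card (?u - {k})" "Suc (card (?u - {k})) = card ?u"
 by (rule card_Suc_Diff1; use calculation fv in blast)+
 ultimately show ?thesis using cu(1) by linarith
 qed (use cu in linarith)
 thus ?thesis using E by blast
 qed
 qed
qed

section \<open>Tilings without black tiles\<close>

text \<open>By \<open>descent\<close>, a vertex cannot be the right vertex of one tile and the left
  vertex of another under a common top (\<open>noDD\<close>). So left of the upper left edge there
  is the boundary or a tile with bottom \<open>insert i X\<close>, one level higher; in both cases
  \<open>insert i X\<close> is an interval that ends in \<open>k - 1\<close>. Symmetrically
  \<open>insert k X\<close> is an interval that starts with \<open>i + 1\<close>.\<close>

lemma interval_tiles:
 assumes K0: "K = {}" and noEW: "!!X i j k. ~ EW X i j k"
 shows "Tile X i k:W ==> X = {i + 1..k - 1}"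
proof (induction "n - card X" arbitrary: X i k rule: less_induct)
 case less
 have t: "i < k" "1<=i" "k<=n" "X<={1..n}" "i~:X" "k~:X" "finite X" using W_tile[OF less.prems] by auto
 have nt: "Z~:bots" "Z~:tops" for Z using K0 by auto
 have noDD: False if "Tile Z q c:W" "Tile Z' c' q:W" "insert c Z = insert c' Z'" for Z q c Z' c'
 proof -
 let ?u = "insert c Z"
 have s: "c~:Z" "q~:Z" "c'~:Z'" "q < c" "c' < q" using W_tile[OF that(1)] W_tile[OF that(2)] by auto
 have e: "?u - {c} = Z" using s by simp
 have "?u - {c'} = Z'" unfolding that(3) using s by simp
 note e = e this
 have "EX X i' j' k'. EW X i' j' k' & (card X + 2 < card ?u | X = ?u - {c} - {c'} & i' = c' & j' = q & k' = c)"
 proof (rule descent[of "card ?u" ?u c' q c])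
 show "c':?u" using that(3) by auto
 show "Tile (?u - {c}) q c:W" "Tile (?u - {c'}) c' q:W" using that e by simp_all
 qed (use K0 s nt in auto)
 thus False using noEW by blast
 qed
 have Vk: "V (insert i X) k" "V (insert k X) i" using V_upper[OF less.prems] nt by auto
 have cX: "card X < n" using t by (intro card_less_n[of X k]) auto
 have bigger: "n - card (insert q X) < n - card X" if "q~:X" for q using that t cX by simp
 have L: "EX \<alpha>. insert i X = {\<alpha>..k - 1}"
 proof (cases "(insert i X, insert k (insert i X)):LB n")
 case True
 from LB_levelD[OF this] obtain m where m: "insert i X = {1..m}" "insert k (insert i X) = {1..Suc m}" by blast
 have "k:{1..Suc m}" "k~:{1..m}" using m t by auto
 hence "m = k - 1" by auto
 thus ?thesis using m by blast
 next
 case False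
 with Vk(1) show ?thesis
 proof (cases rule: white_left)
 case (down m)
 hence "insert i X = {m + 1..k - 1}" using less.hyps[OF bigger[OF t(5)]] by blast
 thus ?thesis by blast
 next
 case (up c)
 have "insert c (insert i X - {c}) = insert i X" using up by auto
 hence False using noDD[OF up(3) less.prems] by simp
 thus ?thesis by blast
 qed
 qed
 have R: "EX \<beta>. insert k X = {i + 1..\<beta>}"
 proof (cases "(insert k X, insert i (insert k X)):RB n")
 case True
 from RB_levelD[OF this] obtain m where m: "insert k X = {m + 1..n}" "insert i (insert k X) = {m..n}" by blast
 have "i:{m..n}" "i~:{m + 1..n}" using m t by auto
 hence "m = i" by auto
 thus ?thesis using m by blast
 next
 case False
 with Vk(2) show ?thesis
 proof (cases rule: white_right)
 case (up m)
 hence "insert k X = {i + 1..m - 1}" using less.hyps[OF bigger[OF t(6)]] by blast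
 thus ?thesis by blast
 next
 case (down c)
 have "insert c (insert k X - {c}) = insert k X" using down by auto
 hence False using noDD[OF less.prems down(3)] by simp
 thus ?thesis by blast
 qed
 qed
 obtain \<alpha> \<beta> where ab: "insert i X = {\<alpha>..k - 1}" "insert k X = {i + 1..\<beta>}" using L R by blast
 show ?case
 proof (intro equalityI subsetI)
 fix y assume "y:X"
 hence "y:{\<alpha>..k - 1}" "y:{i + 1..\<beta>}" using ab by blast+
 thus "y:{i + 1..k - 1}" by simp
 next
 fix y assume y: "y:{i + 1..k - 1}"
 have "i:{\<alpha>..k - 1}" using ab(1) by blast
 hence "y:{\<alpha>..k - 1}" using y by simp
 hence "y:insert i X" using ab(1) by blast
 thus "y:X" using y by simp
 qed
qed

text \<open>The tiles with right label \<open>q\<close> are met one after another from the left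
  boundary edge with label \<open>q\<close>. Since every tile lies over an interval, each next tile
  is determined.\<close>

lemma all_interval_tiles:
 assumes K0: "K = {}" and int: "!!X i k. Tile X i k:W ==> X = {i + 1..k - 1}"
 shows "1<=p ==> p < q ==> q<=n ==> Tile {p + 1..q - 1} p q:W"
proof (induction p rule: dec_induct)
 case base
 let ?A = "{1..q - 1}"
 have A: "({1..q - 1}, insert q {1..q - 1}):LB n"
 using LB_level[of "q - 1"] base by simp
 hence "EX te:W. (?A, insert q ?A):LE te"
 using dnc_ex[OF LB_RB_edges] K0 RB_not_LE atLB[OF A] atRB by fastforce
 then obtain te where te: "te:W" "(?A, insert q ?A):LE te" by blast
 have q: "q~:?A" "te:tiles n" using base te sub by auto
 from te(2) q show ?case
 proof (rule LE_cases)
 fix m assume "te = Tile ?A q m"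
 hence "?A = {q + 1..m - 1}" using int te by blast
 moreover have "1:?A" using base by auto
 ultimately have "1:{q + 1..m - 1}" by blast
 thus ?case using base by simp
 next
 fix c assume c: "te = Tile (?A - {c}) c q" "c:?A"
 hence e: "?A - {c} = {c + 1..q - 1}" using int te by blast
 have "c = 1"
 proof (rule ccontr)
 assume "c ~= 1"
 hence "1:?A - {c}" using c by auto
 hence "1:{c + 1..q - 1}" using e by blast
 thus False using c by simp
 qed
 thus ?case using c(1) te(1) e by simp
 qed
next
 case (step p)
 let ?A = "{p + 1..q - 1}"
 have T: "Tile ?A p q:W" using step by simp
 have e: "(?A, insert q ?A):edges" using tile_edge_mem(2)[of ?A p q] T by simp
 have "(?A, insert q ?A)~:RB n"
 proof
 assume "(?A, insert q ?A):RB n"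
 then obtain m where m: "?A = {m + 1..n}" "insert q ?A = {m..n}" using RB_levelD by blast
 have "q:{m..n}" "p + 1:{m + 1..n}" using m step by auto
 hence "q:{m + 1..n}" using step by auto
 hence "q:?A" using m by blast
 hence "p + 1<=q" "q<=q - 1" by simp_all
 thus False by arith
 qed
 then obtain te where te: "te:W" "(?A, insert q ?A):LE te" using dnc_ex[OF e] K0 by blast
 have "~ q<=q - 1" using step by arith
 hence q: "q~:?A" "te:tiles n" using te sub by auto
 have pA: "p + 1:?A" using step by auto
 from te(2) q show ?case
 proof (rule LE_cases)
 fix m assume "te = Tile ?A q m"
 hence "?A = {q + 1..m - 1}" using int te by blast
 hence "p + 1:{q + 1..m - 1}" using pA by blast
 thus ?case using step by simp
 next
 fix c assume c: "te = Tile (?A - {c}) c q" "c:?A"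
 hence e: "?A - {c} = {c + 1..q - 1}" using int te by blast
 have "c = p + 1"
 proof (rule ccontr)
 assume "c ~= p + 1"
 hence "p + 1:?A - {c}" using pA by auto
 hence "p + 1:{c + 1..q - 1}" using e by blast
 thus False using c by simp
 qed
 thus ?case using c(1) te(1) e by simp
 qed
qed

lemma spectrum_intervals:
 assumes K0: "K = {}" and noEW: "!!X i j k. ~ EW X i j k"
 shows "B = intervals n"
proof -
 note int = interval_tiles[OF assms]
 have nt: "Z~:bots" "Z~:tops" for Z using K0 by auto
 have I: "{p..q}:intervals n" if "1<=p" "q<=n" for p q
 using that unfolding intervals_def by (cases "p<=q") auto
 show ?thesis
 proof (intro equalityI subsetI)
 fix A assume "A:B"
 then obtain te where te: "te:W" "A:tile_vertices te" using K0 by (auto simp: spectrum_def)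
 obtain X i k where t: "te = Tile X i k" by (cases te)
 have X: "X = {i + 1..k - 1}" using int te t by blast
 have ik: "i < k" "1<=i" "k<=n" using W_tile[of X i k] te t by auto
 have "insert i X = {i..k - 1}" "insert k X = {i + 1..k}" "insert i (insert k X) = {i..k}" using ik by (auto simp: X)
 hence "A = {i + 1..k - 1} | A = {i..k - 1} | A = {i + 1..k} | A = {i..k}"
 using te(2) t X by (auto simp: tile_vertices_Tile)
 thus "A:intervals n" using ik by (elim disjE) (simp_all add: I)
 next
 fix A assume "A:intervals n"
 then consider "A = {}" | p q where "A = {p..q}" "1<=p" "p<=q" "q<=n" by (auto simp: intervals_def)
 thus "A:B"
 proof cases
 case 1
 have "Tile {1 + 1..2 - 1} 1 2:W" using all_interval_tiles[OF K0 int, of 1 2] n2 by simp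
 thus ?thesis using vertex_B(3)[of "{1 + 1..2 - 1}" 1 2] nt 1 by simp
 next
 case 2
 show ?thesis
 proof (cases "p = q")
 case False
 hence T: "Tile {p + 1..q - 1} p q:W" using 2 all_interval_tiles[OF K0 int, of p q] by simp
 have "insert p (insert q {p + 1..q - 1}) = {p..q}" using 2 by auto
 thus ?thesis using vertex_B(4)[of "{p + 1..q - 1}" p q] T nt 2 by simp
 next
 case True
 show ?thesis
 proof (cases "p < n")
 case True
 hence "Tile {p + 1..p + 1 - 1} p (p + 1):W" using 2 all_interval_tiles[OF K0 int, of p "p + 1"] by simp
 thus ?thesis using vertex_B(1)[of "{p + 1..p + 1 - 1}" p "p + 1"] 2 `p = q` by simp
 next
 case False
 hence "p = n" using 2 by simp
 hence "Tile {n - 1 + 1..n - 1} (n - 1) n:W" using n2 all_interval_tiles[OF K0 int, of "n - 1" n] by simp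
 thus ?thesis using vertex_B(2)[of "{n - 1 + 1..n - 1}" "n - 1" n] 2 `p = q` `p = n` n2 by simp
 qed
 qed
 qed
 qed
qed

end

section \<open>Overlap of tiles sharing an edge\<close>
definition cross2 :: "real \<times> real => real \<times> real => real" where
 "cross2 u v = fst u * snd v - snd u * fst v"

definition para :: "real \<times> real => real \<times> real => real \<times> real => (real \<times> real) set" where
 "para Q u w = {z. EX s t. 0<=s & s<=1 & 0<=t & t<=1 & z = Q + s *\<^sub>R u + t *\<^sub>R w}"

lemma paraI: "0<=s ==> s<=1 ==> 0<=t ==> t<=1 ==> Q + s *\<^sub>R u + t *\<^sub>R w:para Q u w"
 unfolding para_def by blast

lemma convex_para: "convex (para Q u w)"
proof (rule convexI)
 fix x y and a b :: real
 assume xy: "x:para Q u w" "y:para Q u w" and ab: "0<=a" "0<=b" "a + b = 1"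
 obtain s t where x: "0<=s" "s<=1" "0<=t" "t<=1" "x = Q + s *\<^sub>R u + t *\<^sub>R w" using xy(1) unfolding para_def by blast
 obtain s' t' where y: "0<=s'" "s'<=1" "0<=t'" "t'<=1" "y = Q + s' *\<^sub>R u + t' *\<^sub>R w" using xy(2) unfolding para_def by blast
 have "a *\<^sub>R x + b *\<^sub>R y = (a + b) *\<^sub>R Q + (a * s + b * s') *\<^sub>R u + (a * t + b * t') *\<^sub>R w"
 unfolding x(5) y(5) by (simp add: scaleR_add_right scaleR_add_left)
 moreover have "0<=a * s + b * s'" "0<=a * t + b * t'" using x y ab by simp_all
 moreover have "a * s + b * s'<=a * 1 + b * 1" "a * t + b * t'<=a * 1 + b * 1" using x y ab by (intro add_mono mult_left_mono; simp)+
 ultimately show "a *\<^sub>R x + b *\<^sub>R y:para Q u w" using ab(3) by (simp add: paraI)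
qed

lemma convex_hull_para: "convex hull {Q, Q + u, Q + w, Q + u + w} = para Q u w"
proof (rule hull_unique)
 show "{Q, Q + u, Q + w, Q + u + w}<=para Q u w"
 using paraI[of 0 0 Q u w] paraI[of 1 0 Q u w] paraI[of 0 1 Q u w] paraI[of 1 1 Q u w] by simp
 show "convex (para Q u w)" by (rule convex_para)
 fix T assume T: "{Q, Q + u, Q + w, Q + u + w}<=T" "convex T"
 show "para Q u w<=T"
 proof
 fix z assume "z:para Q u w"
 then obtain s t where st: "0<=s" "s<=1" "0<=t" "t<=1" "z = Q + s *\<^sub>R u + t *\<^sub>R w" unfolding para_def by blast
 have "(1 - s) *\<^sub>R Q + s *\<^sub>R (Q + u):T" "(1 - s) *\<^sub>R (Q + w) + s *\<^sub>R (Q + u + w):T"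
 using T st by (auto intro!: convexD)
 hence "(1 - t) *\<^sub>R ((1 - s) *\<^sub>R Q + s *\<^sub>R (Q + u)) + t *\<^sub>R ((1 - s) *\<^sub>R (Q + w) + s *\<^sub>R (Q + u + w)):T"
 using T st by (intro convexD) auto
 moreover have "(1 - t) *\<^sub>R ((1 - s) *\<^sub>R Q + s *\<^sub>R (Q + u)) + t *\<^sub>R ((1 - s) *\<^sub>R (Q + w) + s *\<^sub>R (Q + u + w)) = z"
 unfolding st(5) by (simp add: algebra_simps)
 ultimately show "z:T" by simp
 qed
qed

text \<open>Cramer's rule in the basis \<open>u\<close>, \<open>w\<close>.\<close>

lemma para_coords:
 assumes "cross2 u w ~= 0"
 shows "z = Q + (cross2 (z - Q) w / cross2 u w) *\<^sub>R u + (cross2 u (z - Q) / cross2 u w) *\<^sub>R w"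
proof -
 obtain z1 z2 q1 q2 u1 u2 w1 w2 where e: "z = (z1, z2)" "Q = (q1, q2)" "u = (u1, u2)" "w = (w1, w2)" by (metis surj_pair)
 let ?D = "u1 * w2 - u2 * w1"
 have D: "?D ~= 0" using assms by (simp add: e cross2_def)
 have "z1 * ?D = q1 * ?D + ((z1 - q1) * w2 - (z2 - q2) * w1) * u1 + (u1 * (z2 - q2) - u2 * (z1 - q1)) * w1"
 "z2 * ?D = q2 * ?D + ((z1 - q1) * w2 - (z2 - q2) * w1) * u2 + (u1 * (z2 - q2) - u2 * (z1 - q1)) * w2"
 by algebra+
 hence "z1 = q1 + ((z1 - q1) * w2 - (z2 - q2) * w1) / ?D * u1 + (u1 * (z2 - q2) - u2 * (z1 - q1)) / ?D * w1"
 "z2 = q2 + ((z1 - q1) * w2 - (z2 - q2) * w1) / ?D * u2 + (u1 * (z2 - q2) - u2 * (z1 - q1)) / ?D * w2"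
 using D by (simp_all add: nonzero_eq_divide_eq add_divide_distrib[symmetric] field_simps)
 thus ?thesis by (simp add: e cross2_def)
qed

lemma cross2_linear: "cross2 u (s *\<^sub>R v + t *\<^sub>R w) = s * cross2 u v + t * cross2 u w"
 "cross2 (s *\<^sub>R v + t *\<^sub>R w) u = s * cross2 v u + t * cross2 w u" "cross2 u u = 0"
 by (simp_all add: cross2_def algebra_simps)

lemma interior_para:
 assumes D: "cross2 u w ~= 0" and st: "0 < s" "s < 1" "0 < t" "t < 1"
 shows "Q + s *\<^sub>R u + t *\<^sub>R w:interior (para Q u w)"
proof -
 let ?f = "%z. cross2 (z - Q) w / cross2 u w" and ?g = "%z. cross2 u (z - Q) / cross2 u w"
 let ?S = "{z. 0 < ?f z} Int {z. ?f z < 1} Int {z. 0 < ?g z} Int {z. ?g z < 1}"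
 have "open ?S" unfolding cross2_def by (intro open_Int open_Collect_less continuous_intros) (use D in "auto simp: cross2_def")
 moreover have "?S<=para Q u w"
 proof
 fix z assume "z:?S"
 hence "Q + ?f z *\<^sub>R u + ?g z *\<^sub>R w:para Q u w" by (intro paraI) auto
 thus "z:para Q u w" using para_coords[OF D, of z Q] by simp
 qed
 moreover have "Q + s *\<^sub>R u + t *\<^sub>R w:?S"
 using st D by (simp add: cross2_linear)
 ultimately show ?thesis by (meson interiorI)
qed

lemma overlap_same_side:
 assumes "0 < cross2 u w * cross2 u w'"
 shows "interior (para Q u w) Int interior (para Q u w') ~= {}"
proof -
 let ?D = "cross2 u w" and ?D' = "cross2 u w'"
 have D: "?D ~= 0" "?D' ~= 0" using assms by auto
 define \<alpha> \<beta> where "\<alpha> = cross2 w w' / ?D'" and "\<beta> = ?D / ?D'"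
 have b: "0 < \<beta>" using assms unfolding \<beta>_def by (simp add: zero_less_divide_iff zero_less_mult_iff)
 have w: "w = \<alpha> *\<^sub>R u + \<beta> *\<^sub>R w'"
 using para_coords[OF D(2), of w 0] unfolding \<alpha>_def \<beta>_def by simp
 \<comment> \<open>Small enough that the point \<open>Q + u / 2 + e w\<close> has both coordinates
   strictly between 0 and 1 also with respect to \<open>u\<close> and \<open>w'\<close>.\<close>
 define e where "e = 1 / (2 * (1 + \<bar>\<alpha>\<bar> + \<beta>))"
 have e: "0 < e" "e * (1 + \<bar>\<alpha>\<bar> + \<beta>) = 1 / 2" using b by (auto simp: e_def field_simps)
 have "0<=e * \<bar>\<alpha>\<bar>" "0 < e * \<beta>" using e b by simp_all
 moreover have "e + e * \<bar>\<alpha>\<bar> + e * \<beta> = 1 / 2" using e(2) by (simp add: distrib_left)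
 ultimately have e2: "e * \<bar>\<alpha>\<bar> < 1 / 2" "e * \<beta> < 1" "e < 1" using e(1) by linarith+
 have e3: "\<bar>e * \<alpha>\<bar> < 1 / 2" using e2(1) e(1) by (simp add: abs_mult)
 have "Q + (1 / 2) *\<^sub>R u + e *\<^sub>R w:interior (para Q u w)" by (rule interior_para[OF D(1)]) (use e e2 in auto)
 moreover have "Q + (1 / 2) *\<^sub>R u + e *\<^sub>R w = Q + (1 / 2 + e * \<alpha>) *\<^sub>R u + (e * \<beta>) *\<^sub>R w'"
 by (subst w) (simp add: scaleR_add_right scaleR_add_left)
 moreover have "Q + (1 / 2 + e * \<alpha>) *\<^sub>R u + (e * \<beta>) *\<^sub>R w':interior (para Q u w')"
 by (rule interior_para[OF D(2)]) (use e3 e2 b e(1) in "auto simp: abs_less_iff")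
 ultimately show ?thesis by auto
qed

text \<open>The line of the common side separates the parallelograms, so a common interior point
  would be on it. Moved slightly against \<open>w\<close> it would still be in the first
  parallelogram, but on the wrong side.\<close>

lemma no_overlap_opposite:
 assumes "cross2 u w < 0" "0 < cross2 u w'"
 shows "interior (para Q u w) Int interior (para Q u w') = {}"
proof (rule ccontr)
 assume "interior (para Q u w) Int interior (para Q u w') ~= {}"
 then obtain z where z: "z:interior (para Q u w)" "z:interior (para Q u w')" by blast
 have side: "cross2 u (y - Q)<=0" if "y:para Q u w" for y
 proof -
 obtain s t where "0<=t" "y = Q + s *\<^sub>R u + t *\<^sub>R w" using `y:para Q u w` unfolding para_def by blast
 moreover have "t * cross2 u w<=0" using `0<=t` assms(1) by (simp add: mult_nonneg_nonpos)
 ultimately show ?thesis by (simp add: cross2_linear add.assoc)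
 qed
 have "0<=cross2 u (z - Q)"
 proof -
 have "z:para Q u w'" using z(2) interior_subset by blast
 then obtain s t where "0<=t" "z = Q + s *\<^sub>R u + t *\<^sub>R w'" unfolding para_def by blast
 thus ?thesis using assms(2) by (simp add: cross2_linear add.assoc)
 qed
 obtain e where e: "0 < e" "ball z e<=para Q u w" using z(1) by (meson mem_interior)
 have w0: "w ~= 0" using assms(1) by (auto simp: cross2_def)
 let ?d = "e / (2 * norm w)"
 have d: "0 < ?d" using e w0 by simp
 have "dist z (z - ?d *\<^sub>R w) < e" using e w0 by (simp add: dist_norm)
 hence "z - ?d *\<^sub>R w:para Q u w" using e by auto
 from side[OF this] have "cross2 u (z - Q - ?d *\<^sub>R w)<=0" by (simp add: algebra_simps)
 moreover have "cross2 u (z - Q - ?d *\<^sub>R w) = cross2 u (z - Q) - ?d * cross2 u w" by (simp add: cross2_def algebra_simps)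
 moreover have "?d * cross2 u w < 0" using d assms(1) by (rule mult_pos_neg)
 ultimately show False using `0<=cross2 u (z - Q)` by linarith
qed

lemma set_point_insert: "finite A ==> q~:A ==> set_point a (insert q A) = set_point a A + gen_vec a q"
 by (simp add: set_point_def add.commute)

lemma tile_finite: "Tile X i j:tiles n ==> finite X"
 using finite_subset[OF _ finite_atLeastAtMost] by (metis Tile_in_tiles)

lemma tile_region_para:
 assumes "Tile X i j:tiles n"
 shows "tile_region a (Tile X i j) = para (set_point a X) (gen_vec a i) (gen_vec a j)"
proof -
 have t: "finite X" "i~:X" "j~:X" "i ~= j" using assms tile_finite by (auto simp: Tile_in_tiles)
 have "set_point a ` tile_vertices (Tile X i j) = {set_point a X, set_point a X + gen_vec a i, set_point a X + gen_vec a j,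
 set_point a X + gen_vec a i + gen_vec a j}"
 using t by (auto simp: tile_vertices_def set_point_insert algebra_simps)
 thus ?thesis unfolding tile_region_def by (simp add: convex_hull_para)
qed

lemma para_swap: "para Q u w = para Q w u"
proof -
 have "z:para Q w u" if "z:para Q u w" for z Q u and w :: "real \<times> real"
 proof -
 obtain s t where st: "0<=s" "s<=1" "0<=t" "t<=1" "z = Q + s *\<^sub>R u + t *\<^sub>R w" using `z:para Q u w` unfolding para_def by blast
 hence "Q + t *\<^sub>R w + s *\<^sub>R u:para Q w u" by (intro paraI)
 thus ?thesis unfolding st(5) by (simp add: ac_simps)
 qed
 from this[of _ Q u w] this[of _ Q w u] show ?thesis by blast
qed

lemma para_reflect: "para Q u w = para (Q + w) u (- w)"
proof -
 have "z:para (Q + w) u (- w)" if "z:para Q u w" for z Q u and w :: "real \<times> real"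
 proof -
 obtain s t where st: "0<=s" "s<=1" "0<=t" "t<=1" "z = Q + s *\<^sub>R u + t *\<^sub>R w" using `z:para Q u w` unfolding para_def by blast
 hence "Q + w + s *\<^sub>R u + (1 - t) *\<^sub>R (- w):para (Q + w) u (- w)" by (intro paraI) auto
 moreover have "Q + w + s *\<^sub>R u + (1 - t) *\<^sub>R (- w) = z" unfolding st(5) by (simp add: algebra_simps)
 ultimately show ?thesis by simp
 qed
 from this[of _ Q u w] this[of _ "Q + w" u "- w"] show ?thesis by auto
qed

context
 fixes n :: nat and a :: "nat => real"
 assumes gen: "generic_generators n a"
begin

lemma gen_mono: "1<=i ==> i < j ==> j<=n ==> a i < a j"
 using gen unfolding generic_generators_def strict_mono_on_def by auto

lemma cross2_gen: "cross2 (gen_vec a i) (gen_vec a j) = a i - a j"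
 by (simp add: cross2_def gen_vec_def)

text \<open>Both kinds of tiles are rewritten as parallelograms with the edge itself as first side;
  a tile with its top on the edge needs the reflection \<open>para_reflect\<close>. The sign of
  \<open>cross2\<close> says that the second side points to the right.\<close>

lemma region_LE:
 assumes "(A, insert q A):LE te" "q~:A" "te:tiles n"
 obtains w where "cross2 (gen_vec a q) w < 0" "tile_region a te = para (set_point a A) (gen_vec a q) w"
 using assms(1-3)
proof (rule LE_cases)
 fix m assume m: "te = Tile A q m" "q < m"
 hence "1<=q" "m<=n" using assms(3) by (auto simp: Tile_in_tiles)
 hence "cross2 (gen_vec a q) (gen_vec a m) < 0" using gen_mono[of q m] m by (simp add: cross2_gen)
 moreover have "tile_region a te = para (set_point a A) (gen_vec a q) (gen_vec a m)" using m assms(3) tile_region_para by blast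
 ultimately show ?thesis by (rule that)
next
 fix c assume c: "te = Tile (A - {c}) c q" "c:A" "c < q"
 have t: "1<=c" "q<=n" "finite (A - {c})"
 using assms(2,3) tile_finite[of "A - {c}" c q n] unfolding c(1) Tile_in_tiles by simp_all
 have P: "set_point a A = set_point a (A - {c}) + gen_vec a c" using set_point_insert[OF t(3), of c a] c by (simp add: insert_absorb)
 have "tile_region a te = para (set_point a (A - {c})) (gen_vec a q) (gen_vec a c)"
 using c assms(3) tile_region_para para_swap by metis
 hence "tile_region a te = para (set_point a A) (gen_vec a q) (- gen_vec a c)" using para_reflect P by metis
 moreover have "cross2 (gen_vec a q) (- gen_vec a c) < 0" using gen_mono[of c q] t c by (simp add: cross2_def gen_vec_def)
 ultimately show ?thesis using that by blast
qed

lemma region_RE: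
 assumes "(A, insert q A):RE te" "q~:A" "te:tiles n"
 obtains w where "0 < cross2 (gen_vec a q) w" "tile_region a te = para (set_point a A) (gen_vec a q) w"
 using assms(1-3)
proof (rule RE_cases)
 fix m assume m: "te = Tile A m q" "m < q"
 hence "1<=m" "q<=n" using assms(3) by (auto simp: Tile_in_tiles)
 hence "0 < cross2 (gen_vec a q) (gen_vec a m)" using gen_mono[of m q] m by (simp add: cross2_gen)
 moreover have "tile_region a te = para (set_point a A) (gen_vec a q) (gen_vec a m)" using m assms(3) tile_region_para para_swap by metis
 ultimately show ?thesis by (rule that)
next
 fix c assume c: "te = Tile (A - {c}) q c" "c:A" "q < c"
 have t: "1<=q" "c<=n" "finite (A - {c})"
 using assms(2,3) tile_finite[of "A - {c}" q c n] unfolding c(1) Tile_in_tiles by simp_all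
 have P: "set_point a A = set_point a (A - {c}) + gen_vec a c" using set_point_insert[OF t(3), of c a] c by (simp add: insert_absorb)
 have "tile_region a te = para (set_point a (A - {c})) (gen_vec a q) (gen_vec a c)"
 using c assms(3) tile_region_para by metis
 hence "tile_region a te = para (set_point a A) (gen_vec a q) (- gen_vec a c)" using para_reflect P by metis
 moreover have "0 < cross2 (gen_vec a q) (- gen_vec a c)" using gen_mono[of q c] t c by (simp add: cross2_def gen_vec_def)
 ultimately show ?thesis using that by blast
qed

lemma overlap_iff_same_side:
 assumes "te:tiles n" "te':tiles n" "e:tile_edges te" "e:tile_edges te'"
 shows "overlap a te te' \<longleftrightarrow> (e:LE te \<longleftrightarrow> e:LE te')"
proof -
 obtain A q where e: "e = (A, insert q A)" "q~:A" using edge_form[OF assms(1,3)] by metis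
 have LR: "e:RE te' \<longleftrightarrow> e~:LE te'" if "te':tiles n" "e:tile_edges te'" for te'
 using that LE_RE_disjoint[OF that(1)] unfolding tile_edges_LE_RE by blast
 let ?u = "gen_vec a q" and ?Q = "set_point a A"
 have reg: "EX w. cross2 ?u w ~= 0 & tile_region a te' = para ?Q ?u w & (e:LE te' \<longleftrightarrow> cross2 ?u w < 0)"
 if "te':tiles n" "e:tile_edges te'" for te'
 proof (cases "e:LE te'")
 case True
 thus ?thesis using region_LE[of A q te'] that e by (metis less_irrefl)
 next
 case False
 hence "e:RE te'" using LR that by blast
 thus ?thesis using region_RE[of A q te'] that e False by (metis less_irrefl not_less_iff_gr_or_eq)
 qed
 obtain w where w: "cross2 ?u w ~= 0" "tile_region a te = para ?Q ?u w" "e:LE te \<longleftrightarrow> cross2 ?u w < 0" using reg[OF assms(1,3)] by blast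
 obtain w' where w': "cross2 ?u w' ~= 0" "tile_region a te' = para ?Q ?u w'" "e:LE te' \<longleftrightarrow> cross2 ?u w' < 0" using reg[OF assms(2,4)] by blast
 show ?thesis
 proof (cases "e:LE te \<longleftrightarrow> e:LE te'")
 case True
 hence "0 < cross2 ?u w * cross2 ?u w'" using w w' by (auto simp: zero_less_mult_iff)
 thus ?thesis using True overlap_same_side w(2) w'(2) unfolding overlap_def by simp
 next
 case False
 then consider "cross2 ?u w < 0" "0 < cross2 ?u w'" | "cross2 ?u w' < 0" "0 < cross2 ?u w" using w w' by linarith
 hence "interior (para ?Q ?u w) Int interior (para ?Q ?u w') = {}"
 by cases (use no_overlap_opposite Int_commute in metis)+
 thus ?thesis using False w(2) w'(2) unfolding overlap_def by simp
 qed
qed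

lemma set_point_inj:
 assumes "X<={1..n}" "Y<={1..n}" "set_point a X = set_point a Y"
 shows "X = Y"
proof -
 have s: "set_point a Z = (\<Sum>i\<in>{1..n}. of_int (if i:Z then 1 else 0) *\<^sub>R gen_vec a i)" if "Z<={1..n}" for Z
 proof -
 have "(\<Sum>i\<in>{1..n}. of_int (if i:Z then 1 else 0) *\<^sub>R gen_vec a i) = (\<Sum>i\<in>{1..n}. if i:Z then gen_vec a i else 0)"
 by (intro sum.cong) auto
 also have "\<dots> = (\<Sum>i\<in>{1..n} Int Z. gen_vec a i)" by (simp add: sum.inter_restrict)
 also have "{1..n} Int Z = Z" using that by auto
 finally show ?thesis by (simp add: set_point_def)
 qed
 have "ALL c d :: nat => int. (\<Sum>i\<in>{1..n}. of_int (c i) *\<^sub>R gen_vec a i) = (\<Sum>i\<in>{1..n}. of_int (d i) *\<^sub>R gen_vec a i) -->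
 (ALL i:{1..n}. c i = d i)" using gen unfolding generic_generators_def by blast
 from this[rule_format, of "%i. if i:X then 1 else 0" "%i. if i:Y then 1 else 0"]
 have "ALL i:{1..n}. (if i:X then 1 else 0 :: int) = (if i:Y then 1 else 0)"
 using assms(3) unfolding s[OF assms(1)] s[OF assms(2)] by simp
 hence "ALL i:{1..n}. i:X \<longleftrightarrow> i:Y" by (metis zero_neq_one)
 thus ?thesis using assms(1,2) by blast
qed

lemma snd_set_point: "snd (set_point a X) = card X"
 by (simp add: set_point_def snd_sum gen_vec_def)

text \<open>The second coordinate is the level. The bottom and the top are the only points of lowest
  and highest level, so the region determines both, and with them the labels.\<close>

lemma region_inj:
 assumes "te:tiles n" "te':tiles n" "tile_region a te = tile_region a te'"
 shows "te = te'"
proof -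
 obtain X i j where t: "te = Tile X i j" "i < j" "1<=i" "j<=n" "X<={1..n}" "i~:X" "j~:X" using assms(1) by (rule tiles_cases)
 obtain X' i' j' where t': "te' = Tile X' i' j'" "i' < j'" "1<=i'" "j'<=n" "X'<={1..n}" "i'~:X'" "j'~:X'" using assms(2) by (rule tiles_cases)
 have fX: "finite X" "finite X'" using t t' finite_subset by blast+
 let ?P = "para (set_point a X) (gen_vec a i) (gen_vec a j)" and ?P' = "para (set_point a X') (gen_vec a i') (gen_vec a j')"
 have eq: "?P = ?P'" using assms tile_region_para t(1) t'(1) by metis
 have rng: "real (card Z)<=snd z & snd z<=card Z + 2 & (snd z = card Z --> z = set_point a Z) &
 (snd z = card Z + 2 --> z = set_point a Z + gen_vec a k + gen_vec a l)"
 if "z:para (set_point a Z) (gen_vec a k) (gen_vec a l)" for z Z k l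
 proof -
 obtain s t where st: "0<=s" "s<=1" "0<=t" "t<=1" "z = set_point a Z + s *\<^sub>R gen_vec a k + t *\<^sub>R gen_vec a l"
 using `z:para (set_point a Z) (gen_vec a k) (gen_vec a l)` unfolding para_def by blast
 have sn: "snd z = card Z + s + t" by (simp add: st(5) snd_set_point gen_vec_def)
 have "snd z = card Z --> s = 0 & t = 0" "snd z = card Z + 2 --> s = 1 & t = 1" using st sn by auto
 hence "snd z = card Z --> z = set_point a Z" "snd z = card Z + 2 --> z = set_point a Z + gen_vec a k + gen_vec a l"
 unfolding st(5) by (metis add.right_neutral scale_zero_left scaleR_one)+
 moreover have "real (card Z)<=snd z" "snd z<=card Z + 2" using sn st(1-4) by linarith+
 ultimately show ?thesis by blast
 qed
 have m: "set_point a Z:para (set_point a Z) u w" "set_point a Z + u + w:para (set_point a Z) u w" for Z u w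
 using paraI[of 0 0 "set_point a Z" u w] paraI[of 1 1 "set_point a Z" u w] by simp_all
 have "set_point a X:?P'" "set_point a X':?P" using m(1) eq by metis+
 hence "card X = card X'" "set_point a X = set_point a X'" using rng[of _ X' i' j'] rng[of _ X i j] snd_set_point
 by (metis le_antisym of_nat_le_iff)+
 hence X: "X = X'" using set_point_inj t t' by blast
 have "set_point a X + gen_vec a i + gen_vec a j:?P'" using m(2) eq by metis
 moreover have "snd (set_point a X + gen_vec a i + gen_vec a j) = card X' + 2" using X by (simp add: snd_set_point gen_vec_def)
 ultimately have "set_point a X + gen_vec a i + gen_vec a j = set_point a X' + gen_vec a i' + gen_vec a j'" using rng[of _ X' i' j'] by blast
 hence "set_point a (insert j (insert i X)) = set_point a (insert j' (insert i' X'))"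
 using fX t t' by (simp add: set_point_insert)
 hence "insert j (insert i X) = insert j' (insert i' X')" using t t' by (intro set_point_inj) auto
 hence "insert j (insert i X) - X = insert j' (insert i' X) - X" using X by simp
 hence "{i, j} = {i', j'}" using t t' X by (simp add: insert_Diff_if insert_commute)
 hence "i = i' & j = j'" using t(2) t'(2) by (auto simp: doubleton_eq_iff)
 thus ?thesis using t t' X by simp
qed

lemma region_in_zonogon:
 assumes "te:tiles n"
 shows "tile_region a te<=zonogon n a"
proof -
 have cv: "convex (zonogon n a)"
 proof (rule convexI)
 fix x y and u v :: real
 assume xy: "x:zonogon n a" "y:zonogon n a" and uv: "0<=u" "0<=v" "u + v = 1"
 obtain l where l: "x = (\<Sum>i\<in>{1..n}. l i *\<^sub>R gen_vec a i)" "ALL i:{1..n}. 0<=l i & l i<=1" using xy(1) unfolding zonogon_def by blast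
 obtain l' where l': "y = (\<Sum>i\<in>{1..n}. l' i *\<^sub>R gen_vec a i)" "ALL i:{1..n}. 0<=l' i & l' i<=1" using xy(2) unfolding zonogon_def by blast
 have "u *\<^sub>R x + v *\<^sub>R y = (\<Sum>i\<in>{1..n}. (u * l i + v * l' i) *\<^sub>R gen_vec a i)"
 unfolding l l' by (simp add: scaleR_sum_right sum.distrib scaleR_add_left)
 moreover have "0<=u * l i + v * l' i & u * l i + v * l' i<=1" if "i:{1..n}" for i
 proof -
 have "u * l i<=u * 1" "v * l' i<=v * 1" using l l' uv that by (intro mult_left_mono; simp)+
 thus ?thesis using l l' uv that by simp
 qed
 ultimately show "u *\<^sub>R x + v *\<^sub>R y:zonogon n a"
 unfolding zonogon_def by (intro CollectI exI[of _ "%i. u * l i + v * l' i"]) simp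
 qed
 have "set_point a X:zonogon n a" if "X<={1..n}" for X
 proof -
 have "(\<Sum>i\<in>{1..n}. (if i:X then 1 else 0) *\<^sub>R gen_vec a i) = (\<Sum>i\<in>{1..n}. if i:X then gen_vec a i else 0)"
 by (intro sum.cong) auto
 also have "\<dots> = (\<Sum>i\<in>{1..n} Int X. gen_vec a i)" by (simp add: sum.inter_restrict)
 also have "{1..n} Int X = X" using that by auto
 finally have "set_point a X = (\<Sum>i\<in>{1..n}. (if i:X then 1 else 0) *\<^sub>R gen_vec a i)" by (simp add: set_point_def)
 thus ?thesis unfolding zonogon_def by (intro CollectI exI[of _ "%i. if i:X then 1 else 0"]) simp
 qed
 moreover have "Y<={1..n}" if "Y:tile_vertices te" for Y
 using assms that by (cases te) (auto simp: Tile_in_tiles tile_vertices_def)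
 ultimately show ?thesis unfolding tile_region_def using cv by (intro hull_minimal) auto
qed

end

section \<open>Squares of the cube complex\<close>
lemma cube_square_iff:
 assumes "p ~= q" "p~:Z" "q~:Z"
 shows "x:cube_square (Tile Z p q) \<longleftrightarrow>
 (ALL l. l ~= p --> l ~= q --> x l = indicat_real Z l) & 0<=x p & x p<=1 & 0<=x q & x q<=1"
proof -
 have d: "Z ~= insert p Z" "Z ~= insert q Z" "Z ~= insert p (insert q Z)" "insert p Z ~= insert q Z"
 "insert p Z ~= insert p (insert q Z)" "insert q Z ~= insert p (insert q Z)"
 using assms by (metis insertE insertI1 insertI2)+
 have v: "tile_vertices (Tile Z p q) = {Z, insert p Z, insert q Z, insert p (insert q Z)}"
 by (simp add: tile_vertices_def)
 have sm: "(\<Sum>Y\<in>tile_vertices (Tile Z p q). f Y) = f Z + f (insert p Z) + f (insert q Z) + f (insert p (insert q Z))" for f :: "nat set => real"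
 using d unfolding v by simp
 show ?thesis
 proof
 assume "x:cube_square (Tile Z p q)"
 then obtain w where w: "x = (%k. \<Sum>Y\<in>tile_vertices (Tile Z p q). w Y * indicat_real Y k)"
 "ALL Y:tile_vertices (Tile Z p q). 0<=w Y" "(\<Sum>Y\<in>tile_vertices (Tile Z p q). w Y) = 1"
 unfolding cube_square_def by blast
 have w0: "0<=w Z" "0<=w (insert p Z)" "0<=w (insert q Z)" "0<=w (insert p (insert q Z))" using w(2) unfolding v by auto
 have w1: "w Z + w (insert p Z) + w (insert q Z) + w (insert p (insert q Z)) = 1" using w(3) unfolding sm .
 have "x l = indicat_real Z l" if "l ~= p" "l ~= q" for l
 unfolding w(1) sm using that w1 by (cases "l:Z") (simp_all add: indicator_def)
 moreover have "x p = w (insert p Z) + w (insert p (insert q Z))" "x q = w (insert q Z) + w (insert p (insert q Z))"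
 unfolding w(1) sm using assms by (simp_all add: indicator_def)
 ultimately show "(ALL l. l ~= p --> l ~= q --> x l = indicat_real Z l) & 0<=x p & x p<=1 & 0<=x q & x q<=1"
 using w0 w1 by auto
 next
 assume x: "(ALL l. l ~= p --> l ~= q --> x l = indicat_real Z l) & 0<=x p & x p<=1 & 0<=x q & x q<=1"
 define w where "w Y = (if p:Y then x p else 1 - x p) * (if q:Y then x q else 1 - x q)" for Y
 have wv: "w Z = (1 - x p) * (1 - x q)" "w (insert p Z) = x p * (1 - x q)" "w (insert q Z) = (1 - x p) * x q" "w (insert p (insert q Z)) = x p * x q"
 using assms unfolding w_def by auto
 have "0<=w Y" for Y using x unfolding w_def by auto
 moreover have s1: "(\<Sum>Y\<in>tile_vertices (Tile Z p q). w Y) = 1" unfolding sm wv by (simp add: algebra_simps)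
 moreover have "x = (%k. \<Sum>Y\<in>tile_vertices (Tile Z p q). w Y * indicat_real Y k)"
 proof
 fix l
 consider "l = p" | "l = q" | "l ~= p" "l ~= q" by blast
 thus "x l = (\<Sum>Y\<in>tile_vertices (Tile Z p q). w Y * indicat_real Y l)"
 proof cases
 case 1
 thus ?thesis unfolding sm wv using assms by (simp add: indicator_def algebra_simps)
 next
 case 2
 thus ?thesis unfolding sm wv using assms by (simp add: indicator_def algebra_simps)
 next
 case 3
 hence "(\<Sum>Y\<in>tile_vertices (Tile Z p q). w Y * indicat_real Y l) = (\<Sum>Y\<in>tile_vertices (Tile Z p q). w Y * indicat_real Z l)"
 unfolding sm by (simp add: indicator_def)
 also have "\<dots> = indicat_real Z l" by (simp add: sum_distrib_right[symmetric] s1)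
 finally show ?thesis using x 3 by simp
 qed
 qed
 ultimately show "x:cube_square (Tile Z p q)" unfolding cube_square_def by blast
 qed
qed

lemma compact_cube_square: "compact (cube_square te)" if "te:tiles n"
proof -
 obtain Z p q where t: "te = Tile Z p q" "p < q" "p~:Z" "q~:Z" using `te:tiles n` by (rule tiles_cases)
 let ?f = "%(s :: real, t :: real) l. if l = p then s else if l = q then t else indicat_real Z l"
 have "cube_square te = ?f ` ({0..1} \<times> {0..1})"
 proof (rule set_eqI)
 fix x
 have "x:?f ` ({0..1} \<times> {0..1})" if "x:cube_square te"
 proof (rule image_eqI[of _ _ "(x p, x q)"])
 have x: "(ALL l. l ~= p --> l ~= q --> x l = indicat_real Z l) & 0<=x p & x p<=1 & 0<=x q & x q<=1"
 using `x:cube_square te` cube_square_iff[of p q Z x] t by auto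
 thus "x = ?f (x p, x q)" by (simp add: fun_eq_iff)
 show "(x p, x q):{0..1} \<times> {0..1}" using x by simp
 qed
 moreover have "x:cube_square te" if "x:?f ` ({0..1} \<times> {0..1})"
 using that t(2-4) unfolding t(1) by (subst cube_square_iff) auto
 ultimately show "x:cube_square te \<longleftrightarrow> x:?f ` ({0..1} \<times> {0..1})" by blast
 qed
 moreover have "continuous_on ({0..1} \<times> {0..1}) ?f"
 proof (rule continuous_on_coordinatewise_then_product)
 fix l
 show "continuous_on ({0..1} \<times> {0..1}) (%z. ?f z l)"
 by (cases "l = p"; cases "l = q") (auto simp: case_prod_unfold intro!: continuous_intros)
 qed
 ultimately show ?thesis by (simp add: compact_continuous_image compact_Times)
qed

lemma vertex_in_square: "te:tiles n ==> v:tile_vertices te ==> indicat_real v:cube_square te"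
proof (erule tiles_cases)
 fix X i j assume t: "te = Tile X i j" "i < j" "i~:X" "j~:X" and v: "v:tile_vertices te"
 from v consider "v = X" | "v = insert i X" | "v = insert j X" | "v = insert i (insert j X)" unfolding t(1) by (auto simp: tile_vertices_def)
 thus ?thesis using t(2-4) unfolding t(1) by cases (subst cube_square_iff; auto simp: indicator_def)+
qed

definition edge_seg :: "nat set => nat => (nat => real) set" where
 "edge_seg A q = {x. (ALL l. l ~= q --> x l = indicat_real A l) & 0<=x q & x q<=1}"

lemma edge_in_square:
 assumes "te:tiles n" "(A, insert q A):tile_edges te" "q~:A" "x:edge_seg A q"
 shows "x:cube_square te"
proof -
 from assms(2) consider "(A, insert q A):LE te" | "(A, insert q A):RE te" unfolding tile_edges_LE_RE by blast
 thus ?thesis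
 proof cases
 case 1
 thus ?thesis using assms(3,1)
 proof (rule LE_cases)
 fix m assume "te = Tile A q m" "q < m"
 thus ?thesis using assms unfolding edge_seg_def by (subst `te = _`, subst cube_square_iff) (auto simp: Tile_in_tiles indicator_def)
 next
 fix c assume "te = Tile (A - {c}) c q" "c:A" "c < q"
 thus ?thesis using assms unfolding edge_seg_def by (subst `te = _`, subst cube_square_iff) (auto simp: Tile_in_tiles indicator_def)
 qed
 next
 case 2
 thus ?thesis using assms(3,1)
 proof (rule RE_cases)
 fix m assume "te = Tile A m q" "m < q"
 thus ?thesis using assms unfolding edge_seg_def by (subst `te = _`, subst cube_square_iff) (auto simp: Tile_in_tiles indicator_def)
 next
 fix c assume "te = Tile (A - {c}) q c" "c:A" "q < c"
 thus ?thesis using assms unfolding edge_seg_def by (subst `te = _`, subst cube_square_iff) (auto simp: Tile_in_tiles indicator_def)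
 qed
 qed
qed

text \<open>The coordinates strictly between 0 and 1 show the smallest face of the cube that
  contains \<open>x\<close>, and \<open>{l. x l = 1}\<close> is its lowest vertex. This is how
  \<open>square_inter\<close> recognizes that two squares meet in common faces only.\<close>

lemma square_face:
 assumes t: "te = Tile Z p q" "te:tiles n" and x: "x:cube_square te"
 shows "0 < x l & x l < 1 ==> l = p | l = q"
 "ALL l. ~ (0 < x l & x l < 1) ==> {l. x l = 1}:tile_vertices te & x = indicat_real {l. x l = 1}"
 "0 < x m & x m < 1 ==> ALL l. l ~= m --> ~ (0 < x l & x l < 1) ==>
 ({l. x l = 1}, insert m {l. x l = 1}):tile_edges te & x:edge_seg {l. x l = 1} m"
 "0 < x p & x p < 1 ==> 0 < x q & x q < 1 ==> Z = {l. x l = 1}"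
proof -
 have pq: "p < q" "p~:Z" "q~:Z" using t by (auto simp: Tile_in_tiles)
 have X: "ALL l. l ~= p --> l ~= q --> x l = indicat_real Z l" "0<=x p" "x p<=1" "0<=x q" "x q<=1"
 using x pq cube_square_iff[of p q Z x] unfolding t(1) by auto
 have "0<=x l & x l<=1" for l using X by (cases "l = p"; cases "l = q") (auto simp: indicator_def)
 hence b: "~ (0 < x l & x l < 1) \<longleftrightarrow> x l = 0 | x l = 1" for l by (metis less_eq_real_def not_less)
 have Z: "l:Z \<longleftrightarrow> x l = 1" if "l ~= p" "l ~= q" for l using X(1) that by (auto simp: indicator_def)
 show "l = p | l = q" if "0 < x l & x l < 1"
 using X(1) that by (auto simp: indicator_def split: if_splits)
 show "Z = {l. x l = 1}" if "0 < x p & x p < 1" "0 < x q & x q < 1"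
 using Z pq that by (metis (mono_tags, lifting) Collect_cong less_irrefl mem_Collect_eq set_eqI)
 have E: "{l. x l = 1} = Z Un (if x p = 1 then {p} else {}) Un (if x q = 1 then {q} else {})"
 proof (rule set_eqI)
 fix l
 show "l:{l. x l = 1} \<longleftrightarrow> l:Z Un (if x p = 1 then {p} else {}) Un (if x q = 1 then {q} else {})"
 using Z[of l] pq by (cases "l = p"; cases "l = q") auto
 qed
 show "{l. x l = 1}:tile_vertices te & x = indicat_real {l. x l = 1}" if "ALL l. ~ (0 < x l & x l < 1)"
 proof
 show "{l. x l = 1}:tile_vertices te" unfolding E t(1) by (auto simp: tile_vertices_def)
 have "ALL l. x l = 0 | x l = 1" using that b by blast
 hence "x l = indicat_real {l. x l = 1} l" for l by (cases "x l = 1") (auto simp: indicator_def)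
 thus "x = indicat_real {l. x l = 1}" by (rule ext)
 qed
 show "({l. x l = 1}, insert m {l. x l = 1}):tile_edges te & x:edge_seg {l. x l = 1} m"
 if m: "0 < x m & x m < 1" "ALL l. l ~= m --> ~ (0 < x l & x l < 1)"
 proof
 have mpq: "m = p | m = q" using X(1) m(1) by (auto simp: indicator_def split: if_splits)
 have "ALL l. l ~= m --> x l = 0 | x l = 1" using m(2) b by blast
 thus "x:edge_seg {l. x l = 1} m" using m(1) unfolding edge_seg_def by (auto simp: indicator_def)
 show "({l. x l = 1}, insert m {l. x l = 1}):tile_edges te"
 using mpq
 proof
 assume "m = p"
 thus ?thesis using m(1) unfolding E t(1) by (auto simp: tile_edges_LE_RE LE_Tile RE_Tile)
 next
 assume "m = q"
 thus ?thesis using m(1) unfolding E t(1) by (auto simp: tile_edges_LE_RE LE_Tile RE_Tile insert_commute)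
 qed
 qed
qed

lemma square_inter:
 assumes "te:tiles n" "\<sigma>:tiles n" "te ~= \<sigma>" "x:cube_square te" "x:cube_square \<sigma>"
 shows "(EX v:tile_vertices te Int tile_vertices \<sigma>. x = indicat_real v) |
 (EX A q. q~:A & (A, insert q A):tile_edges te Int tile_edges \<sigma> & x:edge_seg A q)"
proof -
 obtain Z p q where t: "te = Tile Z p q" "p < q" using assms(1) by (rule tiles_cases)
 obtain Z' p' q' where t': "\<sigma> = Tile Z' p' q'" "p' < q'" using assms(2) by (rule tiles_cases)
 note f = square_face[OF t(1) assms(1,4)] and f' = square_face[OF t'(1) assms(2,5)]
 consider "ALL l. ~ (0 < x l & x l < 1)" | m where "0 < x m & x m < 1" "ALL l. l ~= m --> ~ (0 < x l & x l < 1)"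
 | m m' where "m < m'" "0 < x m & x m < 1" "0 < x m' & x m' < 1"
 by (metis linorder_neqE_nat)
 thus ?thesis
 proof cases
 case 1
 note f(2)[OF 1] f'(2)[OF 1]
 thus ?thesis by (intro disjI1 bexI[of _ "{l. x l = 1}"] IntI) simp_all
 next
 case 2
 have "m~:{l. x l = 1}" using 2 by simp
 moreover note f(3)[OF 2] f'(3)[OF 2]
 ultimately show ?thesis by (intro disjI2 exI[of _ "{l. x l = 1}"] exI[of _ m] conjI IntI) simp_all
 next
 case 3
 have "m = p" "m' = q" using f(1)[OF 3(2)] f(1)[OF 3(3)] 3(1) t(2) by auto
 moreover have "m = p'" "m' = q'" using f'(1)[OF 3(2)] f'(1)[OF 3(3)] 3(1) t'(2) by auto
 ultimately have "Z = Z'" using f(4) f'(4) 3 by metis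
 thus ?thesis using assms(3) t t' `m = p` `m' = q` `m = p'` `m' = q'` by simp
 qed
qed

section \<open>Replacing a disc on a cube by the complementary disc\<close>
text \<open>Projecting from a point \<open>P\<close> outside the cube maps the part of its surface facing \<open>P\<close> homeomorphically
  onto the part facing away, and fixes the silhouette.\<close>
lemma cone_projection:
 fixes P :: "nat => real" and m N :: "(nat => real) => real" and C Q D1 D2 :: "(nat => real) set"
 assumes hm: "!!z c. 0 < c ==> m (%l. z l / c) = m z / c" and hN: "!!z c. 0 < c ==> N (%l. z l / c) = N z / c"
 and hC: "!!z c. 0 < c ==> z:C ==> (%l. z l / c):C"
 and cN: "continuous_on UNIV N"
 and Q: "!!x. x:Q \<longleftrightarrow> (%l. x l - P l):C & N (%l. x l - P l)<=1 & 1<=m (%l. x l - P l)"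
 and pos: "!!x. x:Q ==> 0 < N (%l. x l - P l)"
 and D1: "D1 = {x:Q. m (%l. x l - P l) = 1}" and D2: "D2 = {x:Q. N (%l. x l - P l) = 1}"
 shows "EX g. continuous_on D1 g & bij_betw g D1 D2 & (ALL x:D1 Int D2. g x = x)"
proof -
 \<comment> \<open>Radial projection from \<open>P\<close>: \<open>m\<close> equals 1 on the faces
   that face \<open>P\<close> and \<open>N\<close> equals 1 on those that face away. Both scale
   linearly along rays, so dividing \<open>z = x - P\<close> by \<open>N z\<close> maps the first
   part to the second, and dividing by \<open>m z\<close> maps it back.\<close>
 define g where "g x = (%l. P l + (x l - P l) / N (%l. x l - P l))" for x
 define h where "h x = (%l. P l + (x l - P l) / m (%l. x l - P l))" for x
 have g: "g x:D2 & h (g x) = x" if "x:D1" for x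
 proof -
 define z where "z = (%l. x l - P l)"
 have z: "z:C" "N z<=1" "m z = 1" "0 < N z" using that Q pos unfolding D1 z_def by auto
 have gz: "(%l. g x l - P l) = (%l. z l / N z)" unfolding g_def z_def by simp
 have N1: "N (%l. g x l - P l) = 1" unfolding gz hN[OF z(4)] using z by simp
 have "1<=m (%l. g x l - P l)" "(%l. g x l - P l):C" unfolding gz hm[OF z(4)] using z hC by simp_all
 hence "g x:D2" unfolding D2 using Q[of "g x"] N1 by simp
 moreover have "h (g x) = x" unfolding h_def gz hm[OF z(4)] using z by (simp add: fun_eq_iff z_def g_def)
 ultimately show ?thesis by simp
 qed
 have h: "h x:D1 & g (h x) = x" if "x:D2" for x
 proof -
 define z where "z = (%l. x l - P l)"
 have z: "z:C" "N z = 1" "1<=m z" using that Q unfolding D2 z_def by auto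
 hence m0: "0 < m z" by simp
 have gz: "(%l. h x l - P l) = (%l. z l / m z)" unfolding h_def z_def by simp
 have m1: "m (%l. h x l - P l) = 1" unfolding gz hm[OF m0] using m0 by simp
 have "N (%l. h x l - P l)<=1" "(%l. h x l - P l):C" unfolding gz hN[OF m0] using z m0 hC by simp_all
 hence "h x:D1" unfolding D1 using Q[of "h x"] m1 by simp
 moreover have "g (h x) = x" unfolding g_def gz hN[OF m0] using z m0 by (simp add: fun_eq_iff z_def h_def)
 ultimately show ?thesis by simp
 qed
 have "bij_betw g D1 D2" by (rule bij_betw_byWitness[of _ h]) (use g h in auto)
 moreover have "continuous_on D1 g"
 proof (rule continuous_on_coordinatewise_then_product)
 fix l
 have sub: "continuous_on D1 (%x l. x l - P l)"
 by (rule continuous_on_coordinatewise_then_product) (intro continuous_intros continuous_on_product_coordinates continuous_on_subset[OF _ subset_UNIV])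
 have "continuous_on D1 (%x. N (%l. x l - P l))" using continuous_on_compose2[OF cN sub] by simp
 moreover have "continuous_on D1 (%x :: nat => real. x l)" by (rule continuous_on_subset[OF continuous_on_product_coordinates subset_UNIV])
 moreover have "ALL x:D1. N (%l. x l - P l) ~= 0" using pos unfolding D1 by fastforce
 ultimately show "continuous_on D1 (%x. g x l)" unfolding g_def by (intro continuous_intros) auto
 qed
 moreover have "ALL x:D1 Int D2. g x = x" unfolding g_def D2 by auto
 ultimately show ?thesis by blast
qed

text \<open>Extended by the identity on \<open>S\<close>, the map \<open>g\<close> stays continuous
  and injective, because \<open>S\<close> meets the two discs only where \<open>g\<close> is the
  identity.\<close>

lemma glue_homeomorphic:
 fixes S D1 D2 :: "(nat => real) set"
 assumes "compact S" "compact D1" and sep: "S Int (D1 Un D2)<=D1 Int D2"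
 and g: "continuous_on D1 g" "bij_betw g D1 D2" "ALL x:D1 Int D2. g x = x"
 shows "S Un D1 homeomorphic S Un D2"
proof -
 define h where "h x = (if x:D1 then g x else x)" for x
 have hS: "h x = x" if "x:S" for x using that sep g(3) unfolding h_def by auto
 have hD: "h x = g x" if "x:D1" for x using that unfolding h_def by simp
 have "continuous_on (S Un D1) h"
 proof (rule continuous_on_closed_Un)
 show "closed S" "closed D1" using assms(1,2) compact_imp_closed by blast+
 show "continuous_on S h" by (rule continuous_on_eq[OF continuous_on_id]) (simp add: hS)
 show "continuous_on D1 h" by (rule continuous_on_eq[OF g(1)]) (simp add: hD)
 qed
 moreover have "h ` (S Un D1) = S Un D2" using hS hD g(2) unfolding image_Un bij_betw_def by (metis image_cong image_ident)
 moreover have "inj_on h (S Un D1)"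
 proof (rule inj_onI)
 fix x y assume xy: "x:S Un D1" "y:S Un D1" "h x = h y"
 have gD: "x:D1 ==> g x:D2" for x using g(2) unfolding bij_betw_def by blast
 consider "x:D1" "y:D1" | "x:D1" "y:S" "y~:D1" | "y:D1" "x:S" "x~:D1" | "x:S" "y:S" using xy by blast
 thus "x = y"
 proof cases
 case 1
 thus ?thesis using xy(3) hD g(2) unfolding bij_betw_def inj_on_def by metis
 next
 case 2
 hence "y:D2" using xy(3) hD hS gD by metis
 thus ?thesis using 2 sep by blast
 next
 case 3
 hence "x:D2" using xy(3) hD hS gD by metis
 thus ?thesis using 3 sep by blast
 next
 case 4
 thus ?thesis using xy(3) hS by metis
 qed
 qed
 ultimately show ?thesis using homeomorphic_compact[of "S Un D1" h "S Un D2"] assms by auto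
qed

definition cube3 :: "nat set => nat => nat => nat => (nat => real) set" where
 "cube3 X i j k = {x. (ALL l. l ~= i --> l ~= j --> l ~= k --> x l = indicat_real X l) &
 0<=x i & x i<=1 & 0<=x j & x j<=1 & 0<=x k & x k<=1}"

lemma cube3_faces:
 assumes "i < j" "j < k" "i~:X" "j~:X" "k~:X"
 shows "cube_square (Tile (insert i X) j k) = {x:cube3 X i j k. x i = 1}"
 "cube_square (Tile (insert k X) i j) = {x:cube3 X i j k. x k = 1}"
 "cube_square (Tile (insert j X) i k) = {x:cube3 X i j k. x j = 1}"
 "cube_square (Tile X i j) = {x:cube3 X i j k. x k = 0}"
 "cube_square (Tile X j k) = {x:cube3 X i j k. x i = 0}"
 "cube_square (Tile X i k) = {x:cube3 X i j k. x j = 0}"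
 using assms by (auto simp: cube_square_iff cube3_def indicator_def)

lemma coord_cont: "continuous_on UNIV (%z :: nat => real. z l)"
 by (rule continuous_on_product_coordinates)

lemma min_divide: "0 < c ==> min (a / c) (b / c) = min a b / (c :: real)"
 and max_divide: "0 < c ==> max (a / c) (b / c) = max a b / (c :: real)"
 by (auto simp: min_def max_def divide_le_cancel)

lemma min3_1: "1<=a ==> 1<=b ==> 1<=d ==> min (min a b) d = 1 \<longleftrightarrow> a = 1 | b = 1 | d = (1 :: real)"
 and min2_1: "1<=a ==> 1<=b ==> min a b = 1 \<longleftrightarrow> a = 1 | b = (1 :: real)"
 and max3_1: "a<=1 ==> b<=1 ==> d<=1 ==> max (max a b) d = 1 \<longleftrightarrow> a = 1 | b = 1 | d = (1 :: real)"
 by (auto simp: min_def max_def)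

lemma half_abs: "2 * \<bar>y - 1 / 2\<bar><=1 \<longleftrightarrow> 0<=y & y<=(1 :: real)"
 and half_abs_eq: "2 * \<bar>y - 1 / 2\<bar> = 1 \<longleftrightarrow> y = 0 | y = (1 :: real)"
 by (auto simp: abs_if)

text \<open>\<open>b\<close> and \<open>t\<close> tell which disc contains the faces
  \<open>x j = 0\<close> and \<open>x j = 1\<close>. The centre of projection has coordinate 2 or -1
  where one face of an opposite pair is to be visible, and 1/2 where neither is. If both
  \<open>j\<close>-faces belong to \<open>R\<close>, it is \<open>A\<close> that consists of the
  faces visible from a point, so that the map goes from \<open>A\<close> to
  \<open>R\<close>.\<close>

lemma cube3_exchange:
 fixes b t :: bool and X :: "nat set"
 assumes o: "i < j" "j < k"
 defines "R \<equiv> {x:cube3 X i j k. x i = 1 | x k = 1 | b & x j = 0 | t & x j = 1}"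
 and "A \<equiv> {x:cube3 X i j k. x i = 0 | x k = 0 | ~ b & x j = 0 | ~ t & x j = 1}"
 shows "(EX g. continuous_on R g & bij_betw g R A & (ALL x:R Int A. g x = x)) |
 (EX g. continuous_on A g & bij_betw g A R & (ALL x:A Int R. g x = x))"
proof -
 let ?C = "{z. ALL l. l ~= i --> l ~= j --> l ~= k --> z l = 0} :: (nat => real) set"
 let ?P = "%pi pj pk l. if l = i then pi else if l = j then pj else if l = k then pk else indicat_real X l"
 let ?R = "%x :: nat => real. x i = 1 | x k = 1 | b & x j = 0 | t & x j = 1"
 let ?A = "%x :: nat => real. x i = 0 | x k = 0 | ~ b & x j = 0 | ~ t & x j = 1"
 have ne: "i ~= j" "j ~= k" "i ~= k" using o by auto
 note cc = continuous_on_max continuous_on_min continuous_on_rabs coord_cont continuous_intros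
 consider "b" "~ t" | "~ b" "t" | "~ b" "~ t" | "b" "t" by blast
 thus ?thesis
 proof cases
 case 1
 have Ri: "?R x \<longleftrightarrow> x i = 1 | x k = 1 | x j = 0" and Ai: "?A x \<longleftrightarrow> x i = 0 | x k = 0 | x j = 1" for x using 1 by auto
 show ?thesis
 apply (rule disjI1, rule cone_projection[where P = "?P 2 (- 1) 2" and C = ?C and Q = "cube3 X i j k" and N = "%z. max (max (- z i / 2) (- z k / 2)) (z j / 2)" and m = "%z. min (min (- z i) (- z k)) (z j)"])
 subgoal by (simp add: min_divide[symmetric])
 subgoal by (simp add: max_divide[symmetric])
 subgoal by simp
 subgoal by (intro cc; simp)
 subgoal using ne by (auto simp: cube3_def half_abs)
 subgoal using ne by (auto simp: cube3_def less_max_iff_disj)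
 subgoal unfolding R_def A_def Ri Ai by (intro Collect_cong conj_cong refl) (use ne in "auto simp: cube3_def min3_1 min2_1")
 subgoal unfolding R_def A_def Ri Ai by (intro Collect_cong conj_cong refl) (use ne in "auto simp: cube3_def max3_1 half_abs half_abs_eq")
 done
 next
 case 2
 have Ri: "?R x \<longleftrightarrow> x i = 1 | x k = 1 | x j = 1" and Ai: "?A x \<longleftrightarrow> x i = 0 | x k = 0 | x j = 0" for x using 2 by auto
 show ?thesis
 apply (rule disjI1, rule cone_projection[where P = "?P 2 2 2" and C = ?C and Q = "cube3 X i j k" and N = "%z. max (max (- z i / 2) (- z k / 2)) (- z j / 2)" and m = "%z. min (min (- z i) (- z k)) (- z j)"])
 subgoal by (simp add: min_divide[symmetric])
 subgoal by (simp add: max_divide[symmetric])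
 subgoal by simp
 subgoal by (intro cc; simp)
 subgoal using ne by (auto simp: cube3_def half_abs)
 subgoal using ne by (auto simp: cube3_def less_max_iff_disj)
 subgoal unfolding R_def A_def Ri Ai by (intro Collect_cong conj_cong refl) (use ne in "auto simp: cube3_def min3_1 min2_1")
 subgoal unfolding R_def A_def Ri Ai by (intro Collect_cong conj_cong refl) (use ne in "auto simp: cube3_def max3_1 half_abs half_abs_eq")
 done
 next
 case 3
 have Ri: "?R x \<longleftrightarrow> x i = 1 | x k = 1" and Ai: "?A x \<longleftrightarrow> x i = 0 | x k = 0 | x j = 0 | x j = 1" for x using 3 by auto
 show ?thesis
 apply (rule disjI1, rule cone_projection[where P = "?P 2 (1 / 2) 2" and C = ?C and Q = "cube3 X i j k" and N = "%z. max (max (- z i / 2) (- z k / 2)) (2 * \<bar>z j\<bar>)" and m = "%z. min (- z i) (- z k)"])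
 subgoal by (simp add: min_divide[symmetric])
 subgoal by (simp add: max_divide[symmetric])
 subgoal by simp
 subgoal by (intro cc; simp)
 subgoal using ne by (auto simp: cube3_def half_abs)
 subgoal using ne by (auto simp: cube3_def less_max_iff_disj)
 subgoal unfolding R_def A_def Ri Ai by (intro Collect_cong conj_cong refl) (use ne in "auto simp: cube3_def min3_1 min2_1")
 subgoal unfolding R_def A_def Ri Ai by (intro Collect_cong conj_cong refl) (use ne in "auto simp: cube3_def max3_1 half_abs half_abs_eq")
 done
 next
 case 4
 have Ri: "?R x \<longleftrightarrow> x i = 1 | x k = 1 | x j = 0 | x j = 1" and Ai: "?A x \<longleftrightarrow> x i = 0 | x k = 0" for x using 4 by auto
 show ?thesis
 apply (rule disjI2, rule cone_projection[where P = "?P (- 1) (1 / 2) (- 1)" and C = ?C and Q = "cube3 X i j k" and N = "%z. max (max (z i / 2) (z k / 2)) (2 * \<bar>z j\<bar>)" and m = "%z. min (z i) (z k)"])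
 subgoal by (simp add: min_divide[symmetric])
 subgoal by (simp add: max_divide[symmetric])
 subgoal by simp
 subgoal by (intro cc; simp)
 subgoal using ne by (auto simp: cube3_def half_abs)
 subgoal using ne by (auto simp: cube3_def less_max_iff_disj)
 subgoal unfolding R_def A_def Ri Ai by (intro Collect_cong conj_cong refl) (use ne in "auto simp: cube3_def min3_1 min2_1")
 subgoal unfolding R_def A_def Ri Ai by (intro Collect_cong conj_cong refl) (use ne in "auto simp: cube3_def max3_1 half_abs half_abs_eq")
 done
 qed
qed

section \<open>The complex of the standard tiling is a disc\<close>
definition std_tiles :: "nat => tile set" where
 "std_tiles n = {Tile {p + 1..q - 1} p q | p q. 1<=p & p < q & q<=n}"

definition clip :: "real => real => real" where
 "clip L u = max 0 (min L u)"

text \<open>The fractional indicator of the real interval from \<open>s\<close> to \<open>s + L\<close>: coordinate \<open>i\<close> is the length of its part in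
  the unit interval ending at \<open>i\<close>.\<close>
definition frac_interval :: "nat => real => real => nat => real" where
 "frac_interval n s L i = (if 1<=i & i<=n then clip L (real i - s) - clip L (real i - 1 - s) else 0)"

text \<open>An interval that starts in the unit cell of \<open>p\<close> and ends in that of
  \<open>q\<close> fills the cells between them. Its fractions in the two end cells are the two
  coordinates of a point in the square of the tile.\<close>

lemma frac_interval_tile:
 assumes "1<=p" "p < q" "q<=n" "real p - 1<=s" "s<=real p" "real q - 1<=t" "t<=real q"
 shows "frac_interval n s (t - s) = (%i. if i = p then real p - s else if i = q then t - real q + 1 else indicat_real {p + 1..q - 1} i)"
proof
 fix i
 have pq: "real p + 1<=real q" using assms(2) by linarith
 consider "i < p" | "i = p" | "p < i" "i < q" | "i = q" | "q < i" by linarith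
 thus "frac_interval n s (t - s) i = (if i = p then real p - s else if i = q then t - real q + 1 else indicat_real {p + 1..q - 1} i)"
 proof cases
 case 1
 hence "real i + 1<=real p" by linarith
 thus ?thesis using 1 assms pq by (auto simp: frac_interval_def clip_def max_def min_def)
 next
 case 2
 thus ?thesis using assms pq by (auto simp: frac_interval_def clip_def max_def min_def)
 next
 case 3
 hence "real p + 1<=real i" "real i + 1<=real q" by linarith+
 thus ?thesis using 3 assms pq by (auto simp: frac_interval_def clip_def max_def min_def)
 next
 case 4
 thus ?thesis using assms pq by (auto simp: frac_interval_def clip_def max_def min_def)
 next
 case 5
 hence "real q + 1<=real i" by linarith
 thus ?thesis using 5 assms pq by (auto simp: frac_interval_def clip_def max_def min_def)
 qed
qed

lemma cell_exists:
 assumes "0<=s" "s<=real n" "1<=n"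
 obtains p where "1<=p" "p<=n" "real p - 1<=s" "s<=real p"
proof (cases "s = 0")
 case True
 thus ?thesis using that[of 1] assms by simp
next
 case False
 let ?p = "nat \<lceil>s\<rceil>"
 have "0 < \<lceil>s\<rceil>" "\<lceil>s\<rceil><=int n" using assms False by (simp_all add: ceiling_le_iff)
 thus ?thesis using that[of ?p] assms False by (simp add: of_nat_nat)
qed

lemma std_complex:
 assumes n: "2<=n"
 shows "(\<Union>te\<in>std_tiles n. cube_square te) = {frac_interval n s L | s L. 0<=s & 0<=L & s + L<=real n}"
proof (intro set_eqI iffI)
 fix x assume "x:(\<Union>te\<in>std_tiles n. cube_square te)"
 then obtain p q where pq: "1<=p" "p < q" "q<=n" "x:cube_square (Tile {p + 1..q - 1} p q)" unfolding std_tiles_def by auto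
 have x: "ALL l. l ~= p --> l ~= q --> x l = indicat_real {p + 1..q - 1} l" "0<=x p" "x p<=1" "0<=x q" "x q<=1"
 using pq cube_square_iff[of p q "{p + 1..q - 1}" x] by auto
 let ?s = "real p - x p" and ?t = "real q - 1 + x q"
 have "frac_interval n ?s (?t - ?s) = (%i. if i = p then real p - ?s else if i = q then ?t - real q + 1 else indicat_real {p + 1..q - 1} i)"
 by (rule frac_interval_tile) (use pq x in auto)
 also have "\<dots> = x" using x by auto
 finally have "x = frac_interval n ?s (?t - ?s)" by simp
 moreover have "0<=?s" "0<=?t - ?s" "?s + (?t - ?s)<=real n" using pq x by auto
 ultimately show "x:{frac_interval n s L | s L. 0<=s & 0<=L & s + L<=real n}" by blast
next
 fix x assume "x:{frac_interval n s L | s L. 0<=s & 0<=L & s + L<=real n}"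
 then obtain s L where sL: "x = frac_interval n s L" "0<=s" "0<=L" "s + L<=real n" by blast
 obtain p where p: "1<=p" "p<=n" "real p - 1<=s" "s<=real p" using cell_exists[of s n] sL n by auto
 obtain q where q: "1<=q" "q<=n" "real q - 1<=s + L" "s + L<=real q" using cell_exists[of "s + L" n] sL n by auto
 have inU: "y:(\<Union>te\<in>std_tiles n. cube_square te)"
 if "1<=p" "p < q" "q<=n" "0<=u" "u<=1" "0<=v" "v<=1" "y = (%i. if i = p then u else if i = q then v else indicat_real {p + 1..q - 1} i)" for p q u v y
 proof -
 have "y:cube_square (Tile {p + 1..q - 1} p q)" using that by (subst cube_square_iff) auto
 thus ?thesis using that(1-3) unfolding std_tiles_def by blast
 qed
 show "x:(\<Union>te\<in>std_tiles n. cube_square te)"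
 proof (cases "p < q")
 case True
 have "x = (%i. if i = p then real p - s else if i = q then s + L - real q + 1 else indicat_real {p + 1..q - 1} i)"
 using frac_interval_tile[OF p(1) True q(2) p(3,4) q(3,4)] sL(1) by simp
 thus ?thesis using p q True by (intro inU[of p q "real p - s" "s + L - real q + 1"]) auto
 next
 \<comment> \<open>The interval lies in the cell of \<open>p\<close> alone, so the point is on the
   edge from the empty set to \<open>{p}\<close>. For \<open>p = n\<close> this is an edge of the
   tile with labels \<open>n - 1\<close> and \<open>n\<close>.\<close>
 case False
 hence qp: "real q<=real p" by simp
 hence L1: "s + L<=real p" "L<=1" using p q by linarith+
 have x: "x i = (if i = p then L else 0)" for i
 proof -
 consider "i < p" | "i = p" | "p < i" by linarith
 thus ?thesis
 proof cases
 case 1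
 hence "real i + 1<=real p" by linarith
 thus ?thesis using 1 p L1 sL unfolding sL(1) by (auto simp: frac_interval_def clip_def max_def min_def)
 next
 case 2
 thus ?thesis using p L1 sL(2-4) unfolding sL(1) by (auto simp: frac_interval_def clip_def max_def min_def)
 next
 case 3
 hence "real p + 1<=real i" by linarith
 thus ?thesis using 3 p L1 sL(2-4) unfolding sL(1) by (auto simp: frac_interval_def clip_def max_def min_def)
 qed
 qed
 show ?thesis
 proof (cases "p < n")
 case True
 show ?thesis by (rule inU[of p "Suc p" L 0]) (use True p sL(3) L1 x in "auto simp: fun_eq_iff indicator_def")
 next
 case False
 hence "p = n" using p by simp
 show ?thesis by (rule inU[of "n - 1" n 0 L]) (use n p sL(3) L1 x `p = n` in "auto simp: fun_eq_iff indicator_def")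
 qed
 qed
qed

lemma sum_parts:
 fixes P :: "nat => real"
 shows "(\<Sum>i\<in>{1..n}. real i * (P i - P (i - 1))) = real n * P n - (\<Sum>m<n. P m)"
 and "(\<Sum>i\<in>{1..n}. P i - P (i - 1)) = P n - P 0"
 by (induction n) (simp_all add: algebra_simps)

definition psum :: "(nat => real) => nat => real" where
 "psum x m = (\<Sum>i\<in>{1..m}. x i)"

definition moments :: "nat => (nat => real) => real \<times> real" where
 "moments n x = (\<Sum>i\<in>{1..n}. x i, \<Sum>i\<in>{1..n}. real i * x i)"

lemma psum_diff: "1<=i ==> psum x i - psum x (i - 1) = x i"
 by (cases i) (simp_all add: psum_def)

lemma moments_psum: "moments n x = (psum x n, real n * psum x n - (\<Sum>m<n. psum x m))"
proof -
 have "(\<Sum>i\<in>{1..n}. real i * x i) = (\<Sum>i\<in>{1..n}. real i * (psum x i - psum x (i - 1)))"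
 by (intro sum.cong refl) (metis atLeastAtMost_iff psum_diff)
 thus ?thesis unfolding moments_def sum_parts(1) by (simp add: psum_def)
qed

lemma psum_frac_interval:
 assumes "0<=s" "0<=L" "m<=n"
 shows "psum (frac_interval n s L) m = clip L (real m - s)"
proof -
 have "psum (frac_interval n s L) m = (\<Sum>i\<in>{1..m}. clip L (real i - s) - clip L (real (i - 1) - s))"
 unfolding psum_def by (intro sum.cong refl) (use assms in "auto simp: frac_interval_def of_nat_diff")
 also have "\<dots> = clip L (real m - s) - clip L (real 0 - s)" by (rule sum_parts(2))
 finally show ?thesis using assms by (simp add: clip_def)
qed

lemma clip_top: "0<=L ==> L<=u ==> clip L u = L"
 by (simp add: clip_def)

text \<open>Mass and first moment map the complex onto the image of the whole cube \<open>Q\<close>,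
  which is convex. Injectivity: for fixed mass \<open>L\<close>, shifting the interval makes every
  partial sum weakly smaller, and equal moments force all of them to be equal. Surjectivity: a
  density with values in \<open>[0, 1]\<close> has a moment between those of the leftmost and the
  rightmost interval of the same mass, and the intermediate value theorem finds a position with this
  moment.\<close>

lemma std_complex_disc:
 assumes n: "2<=n"
 shows "axiom_T4 (std_tiles n)"
proof -
 define U where "U = (\<Union>te\<in>std_tiles n. cube_square te)"
 define Q where "Q = {x :: nat => real. ALL i. 0<=x i & x i<=1}"
 note Ueq = std_complex[OF n, folded U_def]
 have tl: "std_tiles n<=tiles n" unfolding std_tiles_def by (auto simp: Tile_in_tiles)
 have fin: "finite (std_tiles n)"
 proof (rule finite_subset)
 show "std_tiles n<=(%z. Tile {fst z + 1..snd z - 1} (fst z) (snd z)) ` ({1..n} \<times> {1..n})"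
 proof
 fix te assume "te:std_tiles n"
 then obtain p q where "te = Tile {p + 1..q - 1} p q" "1<=p" "p < q" "q<=n" unfolding std_tiles_def by blast
 thus "te:(%z. Tile {fst z + 1..snd z - 1} (fst z) (snd z)) ` ({1..n} \<times> {1..n})" by (intro image_eqI[of _ _ "(p, q)"]) auto
 qed
 qed simp
 have cU: "compact U" unfolding U_def using fin tl by (intro compact_UN) (auto intro: compact_cube_square)
 have UQ: "U<=Q"
 proof
 fix x assume "x:U"
 then obtain s L where "x = frac_interval n s L" "0<=L" unfolding Ueq by blast
 thus "x:Q" unfolding Q_def by (auto simp: frac_interval_def clip_def max_def min_def)
 qed
 have cont: "continuous_on S (moments n)" for S
 unfolding moments_def by (intro continuous_intros continuous_on_subset[OF coord_cont subset_UNIV])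
 have mom: "moments n (frac_interval n s L) = (L, real n * L - (\<Sum>m<n. clip L (real m - s)))" if "0<=s" "0<=L" "s + L<=real n" for s L
 unfolding moments_psum using that by (simp add: psum_frac_interval clip_top)
 have inj: "inj_on (moments n) U"
 proof (rule inj_onI)
 have main: "frac_interval n s L = frac_interval n s' L" if a: "0<=s" "s<=s'" "0<=L" "s + L<=real n" "s' + L<=real n"
 "(\<Sum>m<n. clip L (real m - s)) = (\<Sum>m<n. clip L (real m - s'))" for s s' L
 proof -
 have le: "clip L (real m - s')<=clip L (real m - s)" for m using a by (auto simp: clip_def max_def min_def)
 have eq: "clip L (real m - s) = clip L (real m - s')" if "m < n" for m
 proof (rule ccontr)
 assume "clip L (real m - s) ~= clip L (real m - s')"
 hence "(\<Sum>m<n. clip L (real m - s')) < (\<Sum>m<n. clip L (real m - s))"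
 using le[of m] `m < n` by (intro sum_strict_mono_ex1) (auto intro: le bexI[of _ m])
 thus False using a by simp
 qed
 have "clip L (real n - s) = clip L (real n - s')" using a by (simp add: clip_top)
 with eq have eq': "clip L (real m - s) = clip L (real m - s')" if "m<=n" for m using that by (cases "m = n") auto
 show ?thesis
 proof
 fix i
 show "frac_interval n s L i = frac_interval n s' L i"
 using eq'[of i] eq'[of "i - 1"] by (auto simp: frac_interval_def of_nat_diff)
 qed
 qed
 fix x y assume xy: "x:U" "y:U" "moments n x = moments n y"
 obtain s L where x: "x = frac_interval n s L" "0<=s" "0<=L" "s + L<=real n" using xy(1) unfolding Ueq by blast
 obtain s' L' where y: "y = frac_interval n s' L'" "0<=s'" "0<=L'" "s' + L'<=real n" using xy(2) unfolding Ueq by blast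
 have "L = L'" "(\<Sum>m<n. clip L (real m - s)) = (\<Sum>m<n. clip L (real m - s'))"
 using xy(3) mom[OF x(2-4)] mom[OF y(2-4)] unfolding x(1) y(1) by auto
 note e = this
 show "x = y"
 proof (cases "s<=s'")
 case True
 have "frac_interval n s L = frac_interval n s' L" by (rule main) (use True x(2-4) y(2-4) e in auto)
 thus ?thesis unfolding x(1) y(1) e(1) .
 next
 case False
 have "frac_interval n s' L = frac_interval n s L" by (rule main) (use False x(2-4) y(2-4) e in auto)
 thus ?thesis unfolding x(1) y(1) e(1) by simp
 qed
 qed
 have img: "moments n ` U = moments n ` Q"
 proof (intro equalityI subsetI)
 fix z assume "z:moments n ` Q"
 then obtain y where y: "z = moments n y" "y:Q" by blast
 define L where "L = psum y n"
 have y01: "0<=y i" "y i<=1" for i using y(2) unfolding Q_def by auto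
 have mono: "psum y m<=psum y n & psum y n<=psum y m + (real n - real m)" if "m<=n" for m
 proof -
 have "{1..n} = {1..m} Un {m + 1..n}" using that by auto
 hence "psum y n = psum y m + (\<Sum>i\<in>{m + 1..n}. y i)" unfolding psum_def by (simp add: sum.union_disjoint)
 moreover have "0<=(\<Sum>i\<in>{m + 1..n}. y i)" using y01 by (simp add: sum_nonneg)
 moreover have "(\<Sum>i\<in>{m + 1..n}. y i)<=(\<Sum>i\<in>{m + 1..n}. 1)" using y01 by (intro sum_mono) auto
 ultimately show ?thesis using that by (simp add: of_nat_diff)
 qed
 have p0: "0<=psum y m" "psum y m<=real m" for m
 unfolding psum_def using y01 sum_mono[of "{1..m}" y "%_. 1"] by (auto simp: sum_nonneg)
 have L: "0<=L" "L<=real n" unfolding L_def using p0 by auto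
 let ?F = "%s. \<Sum>m<n. clip L (real m - s)"
 have "?F (real n - L)<=(\<Sum>m<n. psum y m)"
 proof (rule sum_mono)
 fix m assume "m:{..<n}"
 thus "clip L (real m - (real n - L))<=psum y m" using mono[of m] p0[of m] unfolding L_def clip_def by auto
 qed
 moreover have "(\<Sum>m<n. psum y m)<=?F 0"
 proof (rule sum_mono)
 fix m assume "m:{..<n}"
 thus "psum y m<=clip L (real m - 0)" using mono[of m] p0[of m] unfolding L_def clip_def by auto
 qed
 moreover have "continuous_on {0..real n - L} ?F" unfolding clip_def by (intro continuous_intros)
 ultimately obtain s where s: "0<=s" "s<=real n - L" "?F s = (\<Sum>m<n. psum y m)"
 using IVT2'[of ?F "real n - L" "\<Sum>m<n. psum y m" 0] L by auto
 have "moments n (frac_interval n s L) = z" using mom[of s L] s L unfolding y(1) moments_psum[of n y] L_def[symmetric] by simp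
 moreover have "frac_interval n s L:U" unfolding Ueq by (intro CollectI exI[of _ s] exI[of _ L]) (use s L in auto)
 ultimately show "z:moments n ` U" by blast
 qed (use UQ in blast)
 have "convex (moments n ` Q)"
 proof (rule convexI)
 fix z z' and u v :: real
 assume z: "z:moments n ` Q" "z':moments n ` Q" and uv: "0<=u" "0<=v" "u + v = 1"
 obtain x y where xy: "z = moments n x" "z' = moments n y" "x:Q" "y:Q" using z by blast
 let ?w = "%i. u * x i + v * y i"
 have "moments n ?w = u *\<^sub>R z + v *\<^sub>R z'"
 unfolding xy moments_def by (simp add: sum_distrib_left sum.distrib algebra_simps)
 moreover have "?w:Q"
 proof -
 have "u * x i<=u * 1" "v * y i<=v * 1" for i using xy uv unfolding Q_def by (intro mult_left_mono; auto)+
 moreover have "u * x i + v * y i<=1" for i using calculation[of i] uv(3) by linarith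
 ultimately show ?thesis using xy uv unfolding Q_def by simp
 qed
 ultimately show "u *\<^sub>R z + v *\<^sub>R z':moments n ` Q" by force
 qed
 moreover have "compact (moments n ` U)" using cU cont compact_continuous_image by blast
 moreover have "interior (moments n ` Q) ~= {}"
 proof -
 let ?S = "{z :: real \<times> real. 0 < 2 * fst z - snd z} Int {z. 2 * fst z - snd z < 1} Int {z. 0 < snd z - fst z} Int {z. snd z - fst z < 1}"
 have "open ?S" by (intro open_Int open_Collect_less continuous_intros)
 moreover have "?S<=moments n ` Q"
 proof
 fix z assume z: "z:?S"
 let ?y = "%i :: nat. if i = 1 then 2 * fst z - snd z else if i = 2 then snd z - fst z else 0"
 have I: "{1..n} = insert 1 (insert 2 {3..n})" using n by auto
 have "moments n ?y = z" unfolding moments_def I by (simp add: prod_eq_iff)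
 moreover have "?y:Q" using z unfolding Q_def by auto
 ultimately show "z:moments n ` Q" by force
 qed
 moreover have "(1, 3 / 2):?S" by simp
 ultimately show ?thesis using interior_maximal[of ?S "moments n ` Q"] by blast
 qed
 ultimately have "moments n ` U homeomorphic cball (0 :: real \<times> real) 1"
 unfolding img by (intro homeomorphic_convex_compact_cball) auto
 moreover have "U homeomorphic moments n ` U" using homeomorphic_compact[OF cU cont refl inj] .
 ultimately show ?thesis unfolding axiom_T4_def U_def using homeomorphic_trans by blast
qed

section \<open>The flip of a tiling\<close>

lemma card_update:
 assumes "finite W" "Wr<=W" "finite Wa" "Wa Int W = {}"
 shows "int (card {te:W - Wr Un Wa. P te}) = int (card {te:W. P te}) - int (card {te:Wr. P te}) + int (card {te:Wa. P te})"
proof -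
 have fr: "finite Wr" using assms finite_subset by blast
 have "{te:W - Wr Un Wa. P te} = {te:W - Wr. P te} Un {te:Wa. P te}" by blast
 hence "card {te:W - Wr Un Wa. P te} = card {te:W - Wr. P te} + card {te:Wa. P te}"
 using assms by (simp only:) (rule card_Un_disjoint; force)
 moreover have "{te:W. P te} = {te:W - Wr. P te} Un {te:Wr. P te}" using assms(2) by blast
 hence "card {te:W. P te} = card {te:W - Wr. P te} + card {te:Wr. P te}"
 using assms fr by (simp only:) (rule card_Un_disjoint; force)
 ultimately show ?thesis by simp
qed

lemma card_filter_insert:
 "finite S ==> t~:S ==> card {te:insert t S. P te} = (if P t then 1 else 0) + card {te:S. P te}"
proof (cases "P t")
 case True
 assume a: "finite S" "t~:S"
 have "{te:insert t S. P te} = insert t {te:S. P te}" using True by blast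
 thus ?thesis using a True by simp
next
 case False
 hence "{te:insert t S. P te} = {te:S. P te}" by blast
 thus ?thesis using False by simp
qed

lemma if_pair: "a ~= b ==> (if e:{a, b} then 1 else 0 :: int) = (if e = a then 1 else 0) + (if e = b then 1 else 0)"
 by auto

lemma card_filter_single: "card {te:{a}. P te} = (if P a then 1 else 0)"
proof -
 have "{te:{a}. P te} = (if P a then {a} else {})" by auto
 thus ?thesis by simp
qed

lemma card_filter_pair: "a ~= b ==> card {te:{a, b}. P te} = (if P a then 1 else 0) + (if P b then 1 else 0)"
 using card_filter_insert[of "{b}" a P] card_filter_single[of b P] by (simp only: finite.intros singleton_iff if_cancel) simp

lemma card_filter_triple: "a ~= b ==> a ~= c ==> b ~= c ==>
 card {te:{a, b, c}. P te} = (if P a then 1 else 0) + (if P b then 1 else 0) + (if P c then 1 else 0)"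
 using card_filter_insert[of "{b, c}" a P] card_filter_pair[of b c P] by (simp only: finite.intros insert_iff empty_iff) simp

text \<open>Two tile complexes that differ by replacing a disc on the surface of a 3-cube by the complementary disc.\<close>
definition exchange :: "nat set => nat => nat => nat => tile set => tile set => bool" where
 "exchange X i j k T T' \<longleftrightarrow> (EX S b t. let
 R = {Tile (insert i X) j k, Tile (insert k X) i j} Un (if b then {Tile X i k} else {}) Un (if t then {Tile (insert j X) i k} else {});
 A = {Tile X i j, Tile X j k} Un (if b then {} else {Tile X i k}) Un (if t then {} else {Tile (insert j X) i k})
 in T = S Un R & T' = S Un A & S Int (R Un A) = {} &
 (ALL te:S. ALL e:tile_edges te. e:edges_of (R Un A) --> e:edges_of R & e:edges_of A) &
 (ALL te:S. ALL v:tile_vertices te. v:\<Union> (tile_vertices ` (R Un A)) --> v:\<Union> (tile_vertices ` R) & v:\<Union> (tile_vertices ` A)))"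

context gt
begin

text \<open>There are two cases at either end of the cube. If \<open>Tile X i k\<close> is white
  (\<open>b1\<close>), it is removed; otherwise \<open>X\<close> is no vertex and this tile is added
  as a black one. If \<open>Tile (insert j X) i k\<close> is black (\<open>t2'\<close>), it is
  removed; otherwise \<open>insert j X\<close> is no vertex and the tile is added as a white one.
  The second half of \<open>hb\<close> or the absence of vertices guarantees that no other tile is
  left hanging at a vertex that disappears or becomes terminal.\<close>

lemma flip:
 assumes ord: "i < j" "j < k" "i~:X" "j~:X" "k~:X"
 and t1: "Tile (insert i X) j k:W" and t2: "Tile (insert k X) i j:W"
 and nb: "insert i X~:bots" "insert k X~:bots"
 and hb: "Tile X i k:W & (ALL A A'. (A, A'):edges --> insert i (insert k X):{A, A'} -->
 (A, A'):{(insert i X, insert i (insert k X)), (insert k X, insert i (insert k X)), (insert i (insert k X), insert i (insert j (insert k X)))})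
 | (ALL te:W Un K. X~:tile_vertices te) & (ALL A'. (insert i (insert k X), A'):edges --> A' = insert i (insert j (insert k X))) &
 (ALL te:K. insert i (insert k X)~:tile_vertices te)"
 and hj: "(ALL te:W Un K. insert j X~:tile_vertices te) | Tile (insert j X) i k:K"
 shows "EX W' K'. gt n W' K' & spectrum W' K' = B - {insert i (insert k X)} Un {insert j X} & exchange X i j k (W Un K) (W' Un K')"
proof -
 define Xi Xj Xk Xij Xik Xjk Xijk where "Xi = insert i X" and "Xj = insert j X" and "Xk = insert k X"
 and "Xij = insert i (insert j X)" and "Xik = insert i (insert k X)" and "Xjk = insert j (insert k X)"
 and "Xijk = insert i (insert j (insert k X))"
 note defs = Xi_def Xj_def Xk_def Xij_def Xik_def Xjk_def Xijk_def
 have ins: "insert j Xi = Xij" "insert k Xi = Xik" "insert j Xik = Xijk" "insert k Xij = Xijk"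
 "insert i Xk = Xik" "insert j Xk = Xjk" "insert i Xjk = Xijk" "insert i Xj = Xij" "insert k Xj = Xjk"
 "insert j Xk = Xjk"
 by (auto simp: defs)
 have mem: "i~:X" "j~:X" "k~:X" "i:Xi" "j~:Xi" "k~:Xi" "i~:Xj" "j:Xj" "k~:Xj" "i~:Xk" "j~:Xk" "k:Xk"
 "i:Xij" "j:Xij" "k~:Xij" "i:Xik" "j~:Xik" "k:Xik" "i~:Xjk" "j:Xjk" "k:Xjk" "i:Xijk" "j:Xijk" "k:Xijk"
 using ord by (auto simp: defs)
 have ne: "X ~= Xi" "X ~= Xj" "X ~= Xk" "Xi ~= Xj" "Xi ~= Xk" "Xj ~= Xk" "Xij ~= Xik" "Xij ~= Xjk" "Xik ~= Xjk" "Xik ~= X" "Xik ~= Xi"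
 "Xik ~= Xj" "Xik ~= Xk" "Xik ~= Xijk" "Xi ~= Xij" "Xi ~= Xik" "Xj ~= Xij" "Xj ~= Xjk" "Xk ~= Xik" "Xk ~= Xjk" "Xijk ~= X" "Xijk ~= Xi" "Xijk ~= Xj" "Xijk ~= Xk" "Xijk ~= Xij" "Xijk ~= Xjk"
 "X ~= Xij" "X ~= Xjk" "Xi ~= Xjk" "Xk ~= Xij"
 using mem by metis+
 define a1 a2 r0 r1 r2 a3 where "a1 = Tile X i j" and "a2 = Tile X j k" and "r0 = Tile X i k" and "r1 = Tile Xi j k"
 and "r2 = Tile Xk i j" and "a3 = Tile Xj i k"
 note tdefs = a1_def a2_def r0_def r1_def r2_def a3_def
 have LEs: "LE a1 = {(X, Xi), (Xi, Xij)}" "LE a2 = {(X, Xj), (Xj, Xjk)}" "LE r0 = {(X, Xi), (Xi, Xik)}"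
 "LE r1 = {(Xi, Xij), (Xij, Xijk)}" "LE r2 = {(Xk, Xik), (Xik, Xijk)}" "LE a3 = {(Xj, Xij), (Xij, Xijk)}"
 and REs: "RE a1 = {(X, Xj), (Xj, Xij)}" "RE a2 = {(X, Xk), (Xk, Xjk)}" "RE r0 = {(X, Xk), (Xk, Xik)}"
 "RE r1 = {(Xi, Xik), (Xik, Xijk)}" "RE r2 = {(Xk, Xjk), (Xjk, Xijk)}" "RE a3 = {(Xj, Xjk), (Xjk, Xijk)}"
 unfolding tdefs LE_Tile RE_Tile by (simp_all add: defs insert_commute)
 have verts: "tile_vertices a1 = {X, Xi, Xj, Xij}" "tile_vertices a2 = {X, Xj, Xk, Xjk}" "tile_vertices r0 = {X, Xi, Xk, Xik}"
 "tile_vertices r1 = {Xi, Xij, Xik, Xijk}" "tile_vertices r2 = {Xk, Xik, Xjk, Xijk}" "tile_vertices a3 = {Xj, Xij, Xjk, Xijk}"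
 unfolding tdefs tile_vertices_Tile by (simp_all add: defs insert_commute)
 have tne: "a1 ~= a2" "a1 ~= a3" "a2 ~= a3" "r0 ~= r1" "r0 ~= r2" "r1 ~= r2" using ord by (auto simp: tdefs)
 have r12: "r1:W" "r2:W" using t1 t2 by (simp_all add: tdefs defs)
 have rng: "1<=i" "k<=n" "X<={1..n}" using W_tile[OF t1] W_tile[OF t2] by auto
 have tin: "a1:tiles n" "a2:tiles n" "a3:tiles n" "r0:tiles n"
 using rng ord unfolding tdefs Tile_in_tiles by (auto simp: defs)
 have nbots: "Xi~:bots" "Xk~:bots" "Xij~:bots" "Xik~:bots" "Xjk~:bots" "Xijk~:bots"
 and ntops: "Xi~:tops" "Xk~:tops" "Xij~:tops" "Xik~:tops" "Xjk~:tops"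
 using nb side_nonterminal[of Xi j k] side_nonterminal[of Xk i j] r12 unfolding tdefs ins by (auto simp: Xi_def Xk_def ins(3,4,7))
 define b1 where "b1 \<longleftrightarrow> r0:W"
 define t2' where "t2' \<longleftrightarrow> a3:K"
 have b1E: "(A, A'):{(Xi, Xik), (Xk, Xik), (Xik, Xijk)}" if "b1" "(A, A'):edges" "Xik:{A, A'}" for A A'
 proof -
 have "X:tile_vertices r0" using verts by simp
 hence "~ (ALL te:W Un K. X~:tile_vertices te)" using that(1) unfolding b1_def by blast
 thus ?thesis using hb that(2,3) unfolding defs by blast
 qed
 have b2X: "X~:tile_vertices te" if "~ b1" "te:W Un K" for te
 using hb that unfolding b1_def r0_def by blast
 have b2v: "A' = Xijk" if "~ b1" "(Xik, A'):edges" for A'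
 using hb that unfolding b1_def r0_def defs by blast
 have b2k: "Xik~:tile_vertices te" if "~ b1" "te:K" for te
 using hb that unfolding b1_def r0_def defs by blast
 have t0j: "Xj~:tile_vertices te" if "~ t2'" "te:W Un K" for te
 using hj that unfolding t2'_def a3_def defs by blast
 have ev: "A:\<Union> (tile_vertices ` (W Un K)) & A':\<Union> (tile_vertices ` (W Un K))" if "(A, A'):edges" for A A'
 using that unfolding edges_of_def tile_edges_def tile_vertices_def by auto
 have XjE: "(A, Xj)~:edges" for A
 proof (cases t2')
 case True
 hence "Xj:bots" unfolding t2'_def a3_def by (metis bottom_Tile imageI)
 thus ?thesis using not_into_bots by blast
 next
 case False
 thus ?thesis using ev t0j by blast
 qed
 have XjE': "~ t2' ==> (Xj, A)~:edges" for A using ev t0j by blast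
 have XE: "~ b1 ==> (X, A)~:edges & (A, X)~:edges" for A using ev b2X by blast
 have XX: "X~:tops"
 proof (cases b1)
 case True
 thus ?thesis using side_nonterminal(5)[of X i k] unfolding b1_def r0_def by blast
 next
 case False
 show ?thesis
 proof
 assume "X:tops"
 then obtain te where "te:K" "top_vertex te = X" by auto
 thus False using b2X[OF False, of te] unfolding tile_vertices_def by auto
 qed
 qed
 have a1n: "a1~:W Un K" "a2~:W Un K"
 using XjE edgesI[of a1 "(X, Xj)"] edgesI[of a2 "(X, Xj)"] unfolding REs LEs by auto
 have a3n: "~ t2' ==> a3~:W Un K" using t0j[of a3] verts(6) by auto
 have r0n: "~ b1 ==> r0~:W Un K" using b2X[of r0] verts(3) by auto
 define Wr Wa Kr Ka where "Wr = {r1, r2} Un (if b1 then {r0} else {})" and "Wa = {a1, a2} Un (if t2' then {} else {a3})"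
 and "Kr = (if t2' then {a3} else {})" and "Ka = (if b1 then {} else {r0})"
 define W' K' where "W' = W - Wr Un Wa" and "K' = K - Kr Un Ka"
 have sets: "Wr<=W" "Wa Int W = {}" "Kr<=K" "Ka Int K = {}" "finite Wa" "finite Ka"
 using r12 a1n a3n r0n unfolding Wr_def Wa_def Kr_def Ka_def b1_def t2'_def by (auto split: if_splits)
 let ?c = "%e a. (if e = a then 1 else 0 :: int)"
 \<comment> \<open>The change of both counts at \<open>e\<close>: an edge that appears (in
   \<open>P\<close>) gains a tile on each side, an edge that disappears (in \<open>M\<close>) loses
   one on each side. That \<open>upc\<close> and \<open>dnc\<close> change equally is what preserves
   the axioms of \<open>gt\<close>.\<close>
 define D where "D e = (if t2' then ?c e (X, Xj) - ?c e (Xij, Xijk) - ?c e (Xjk, Xijk) else ?c e (X, Xj) + ?c e (Xj, Xij) + ?c e (Xj, Xjk))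
 - ?c e (Xik, Xijk) + (if b1 then - ?c e (Xi, Xik) - ?c e (Xk, Xik) else ?c e (X, Xi) + ?c e (X, Xk))" for e
 have cnt: "int (card {te:Wr. P te}) = (if P r1 then 1 else 0) + (if P r2 then 1 else 0) + (if b1 then (if P r0 then 1 else 0) else 0)"
 "int (card {te:Wa. P te}) = (if P a1 then 1 else 0) + (if P a2 then 1 else 0) + (if t2' then 0 else (if P a3 then 1 else 0))"
 "int (card {te:Kr. P te}) = (if t2' then (if P a3 then 1 else 0) else 0)"
 "int (card {te:Ka. P te}) = (if b1 then 0 else (if P r0 then 1 else 0))" for P
 proof -
 note t3 = card_filter_triple[OF tne(6) tne(4)[symmetric] tne(5)[symmetric], of P] card_filter_pair[OF tne(6), of P]
 card_filter_triple[OF tne(1-3), of P] card_filter_pair[OF tne(1), of P] card_filter_single[of a3 P] card_filter_single[of r0 P]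
 show "int (card {te:Wr. P te}) = (if P r1 then 1 else 0) + (if P r2 then 1 else 0) + (if b1 then (if P r0 then 1 else 0) else 0)"
 proof (cases b1)
 case True
 hence "Wr = {r1, r2, r0}" unfolding Wr_def by auto
 thus ?thesis by (simp only: t3 True) simp
 next
 case False
 hence "Wr = {r1, r2}" unfolding Wr_def by auto
 thus ?thesis by (simp only: t3 False) simp
 qed
 show "int (card {te:Wa. P te}) = (if P a1 then 1 else 0) + (if P a2 then 1 else 0) + (if t2' then 0 else (if P a3 then 1 else 0))"
 proof (cases t2')
 case True
 hence "Wa = {a1, a2}" unfolding Wa_def by auto
 thus ?thesis by (simp only: t3 True) simp
 next
 case False
 hence "Wa = {a1, a2, a3}" unfolding Wa_def by auto
 thus ?thesis by (simp only: t3 False) simp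
 qed
 show "int (card {te:Kr. P te}) = (if t2' then (if P a3 then 1 else 0) else 0)"
 proof (cases t2')
 case True
 hence "Kr = {a3}" unfolding Kr_def by auto
 thus ?thesis by (simp only: t3 True) simp
 next
 case False
 hence "Kr = {}" unfolding Kr_def by auto
 thus ?thesis using False by simp
 qed
 show "int (card {te:Ka. P te}) = (if b1 then 0 else (if P r0 then 1 else 0))"
 proof (cases b1)
 case True
 hence "Ka = {}" unfolding Ka_def by auto
 thus ?thesis using True by simp
 next
 case False
 hence "Ka = {r0}" unfolding Ka_def by auto
 thus ?thesis by (simp only: t3 False) simp
 qed
 qed
 have up': "int (upc W' K' e) = int (upc W K e) + D e" for e
 proof -
 have "int (upc W' K' e) = int (upc W K e) - int (card {te:Wr. e:RE te}) + int (card {te:Wa. e:RE te})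
 - int (card {te:Kr. e:LE te}) + int (card {te:Ka. e:LE te})"
 using card_update[OF fin(1) sets(1,5,2), of "%te. e:RE te"] card_update[OF fin(2) sets(3,6,4), of "%te. e:LE te"]
 unfolding upc_def W'_def K'_def by simp
 also have "\<dots> = int (upc W K e) + D e"
 unfolding cnt LEs REs D_def using ne by (cases t2'; cases b1) (simp_all add: if_pair)
 finally show ?thesis .
 qed
 have dn': "int (dnc W' K' e) = int (dnc W K e) + D e" for e
 proof -
 have "int (dnc W' K' e) = int (dnc W K e) - int (card {te:Wr. e:LE te}) + int (card {te:Wa. e:LE te})
 - int (card {te:Kr. e:RE te}) + int (card {te:Ka. e:RE te})"
 using card_update[OF fin(1) sets(1,5,2), of "%te. e:LE te"] card_update[OF fin(2) sets(3,6,4), of "%te. e:RE te"]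
 unfolding dnc_def W'_def K'_def by simp
 also have "\<dots> = int (dnc W K e) + D e"
 unfolding cnt LEs REs D_def using ne by (cases t2'; cases b1) (simp_all add: if_pair)
 finally show ?thesis .
 qed
 define P where "P = (if t2' then {(X, Xj)} else {(X, Xj), (Xj, Xij), (Xj, Xjk)}) Un (if b1 then {} else {(X, Xi), (X, Xk)})"
 define M where "M = {(Xik, Xijk)} Un (if t2' then {(Xij, Xijk), (Xjk, Xijk)} else {}) Un (if b1 then {(Xi, Xik), (Xk, Xik)} else {})"
 have Pn: "e~:edges" if "e:P" for e using that XjE XjE' XE unfolding P_def by (auto split: if_splits)
 have Mb: "EX te:W. e:RE te | (EX te:K. e:LE te)" "(EX te:W. e:LE te) | (EX te:K. e:RE te)" if "e:M" for e
 proof -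
 have b: "e:RE r1 | e:RE r2 | (b1 & e:RE r0) | (t2' & e:LE a3)"
 "e:LE r1 | e:LE r2 | (b1 & e:LE r0) | (t2' & e:RE a3)"
 using that unfolding M_def LEs REs by (auto split: if_splits)
 show "EX te:W. e:RE te | (EX te:K. e:LE te)" using b(1) r12 unfolding b1_def t2'_def by blast
 show "(EX te:W. e:LE te) | (EX te:K. e:RE te)" using b(2) r12 unfolding b1_def t2'_def by blast
 qed
 have Mnb: "e~:LB n & e~:RB n & upc W K e = 1 & dnc W K e = 1" if "e:M" for e
 proof -
 have "0 < upc W K e" using Mb(1)[OF that] fin unfolding upc_def by (auto simp: card_gt_0_iff)
 moreover have "0 < dnc W K e" using Mb(2)[OF that] fin unfolding dnc_def by (auto simp: card_gt_0_iff)
 ultimately have nB: "e~:LB n" "e~:RB n" using atLB[of e] atRB[of e] by auto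
 with `0 < upc W K e` show ?thesis using inner[OF nB] by auto
 qed
 have Pnb: "e~:LB n & e~:RB n & upc W K e = 0 & dnc W K e = 0" if "e:P" for e
 proof -
 have nB: "e~:LB n" "e~:RB n" using Pn[OF that] LB_RB_edges[of e] by auto
 have "upc W K e + dnc W K e = 0"
 proof (rule ccontr)
 assume "upc W K e + dnc W K e ~= 0"
 then obtain te where "te:W Un K" "e:LE te Un RE te" using fin unfolding upc_def dnc_def by (auto simp: card_eq_0_iff)
 thus False using edgesI Pn[OF that] by blast
 qed
 thus ?thesis using nB by simp
 qed
 have PM: "P Int M = {}"
 proof -
 have "e:edges" if "e:M" for e using Mb(2)[OF that] edgesI by blast
 thus ?thesis using Pn by blast
 qed
 have DP: "D e = 1" if "e:P" for e
 proof -
 have "e = (X, Xj) | (~ t2' & (e = (Xj, Xij) | e = (Xj, Xjk))) | (~ b1 & (e = (X, Xi) | e = (X, Xk)))"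
 using that unfolding P_def by (auto split: if_splits)
 thus ?thesis unfolding D_def by (elim disjE conjE) (simp_all add: ne ne[symmetric])
 qed
 have D0: "D e = 0" if "e~:P" "e~:M" for e
 using that unfolding D_def P_def M_def by (cases t2'; cases b1; simp)
 have DM: "D e = - 1" if "e:M" for e
 proof -
 have "e = (Xik, Xijk) | (t2' & (e = (Xij, Xijk) | e = (Xjk, Xijk))) | (b1 & (e = (Xi, Xik) | e = (Xk, Xik)))"
 using that unfolding M_def by (auto split: if_splits)
 thus ?thesis unfolding D_def by (elim disjE conjE) (simp_all add: ne ne[symmetric])
 qed
 have edges': "e~:M & (e:edges | e:P)" if "e:edges_of (W' Un K')" for e
 proof -
 have fin': "finite W'" "finite K'" using fin sets unfolding W'_def K'_def by auto
 have "EX te:W' Un K'. e:tile_edges te" using that unfolding edges_of_def by auto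
 then obtain te where "te:W' Un K'" "e:LE te Un RE te" unfolding tile_edges_LE_RE by auto
 hence pos: "upc W' K' e + dnc W' K' e ~= 0" using fin' unfolding upc_def dnc_def by (auto simp: card_eq_0_iff)
 have nM: "e~:M"
 proof
 assume m: "e:M"
 have "int (upc W' K' e) = 0" "int (dnc W' K' e) = 0" using up'[of e] dn'[of e] DM[OF m] Mnb[OF m] by simp_all
 thus False using pos by simp
 qed
 show ?thesis
 proof (cases "e:P")
 case False
 hence "upc W' K' e = upc W K e" "dnc W' K' e = dnc W K e" using up'[of e] dn'[of e] D0[OF False nM] by simp_all
 hence "upc W K e + dnc W K e ~= 0" using pos by simp
 then obtain te where "te:W Un K" "e:LE te Un RE te" using fin unfolding upc_def dnc_def by (auto simp: card_eq_0_iff)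
 thus ?thesis using edgesI nM by blast
 qed (use nM in blast)
 qed
 have fin': "finite W'" "finite K'" using fin sets unfolding W'_def K'_def by auto
 have tne': "r0 ~= a1" "r0 ~= a2" "r0 ~= a3" using ord ne unfolding tdefs by auto
 have WaE: "te = a1 | te = a2 | (~ t2' & te = a3)" if "te:Wa" for te using that unfolding Wa_def by (auto split: if_splits)
 have KaE: "~ b1 & te = r0" if "te:Ka" for te using that unfolding Ka_def by (auto split: if_splits)
 have Kold: "te:K & (t2' --> te ~= a3)" if "te:K - Kr" for te using that unfolding Kr_def by auto
 have Xjbot: "bottom te ~= Xj" if "te:K - Kr" for te
 proof
 assume b: "bottom te = Xj"
 have "Xj:tile_vertices te" using b unfolding tile_vertices_def by auto
 hence t: "t2'" using t0j Kold[OF that] by blast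
 have "bottom te:tile_vertices a3" using b verts by simp
 hence "te = a3" using black_bottom_unique Kold[OF that] t unfolding t2'_def by blast
 thus False using Kold[OF that] t by blast
 qed
 have Pheads: "A':{Xj, Xij, Xjk, Xi, Xk}" and Ptails: "A = X | A = Xj & ~ t2'" if "(A, A'):P" for A A'
 using that unfolding P_def by (auto split: if_splits)
 have gt': "gt n W' K'"
 proof (rule gt.intro)
 show "2<=n" by (rule n2)
 show "finite W'" "finite K'" by (rule fin')+
 show "W'<=tiles n" "K'<=tiles n"
 using sub tin WaE KaE unfolding W'_def K'_def by blast+
 have "te~:K'" if "te:W'" for te
 proof -
 have "te:W - Wr | te:Wa" using that unfolding W'_def by blast
 hence 1: "te~:K" using a1n a3n WaE[of te] disj by blast
 have 2: "te~:Ka"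
 proof
 assume "te:Ka"
 hence "~ b1" "te = r0" using KaE by blast+
 hence "te:Wa" using r0n `te:W - Wr | te:Wa` by blast
 thus False using WaE[of te] tne' `te = r0` by blast
 qed
 show ?thesis using 1 2 unfolding K'_def by blast
 qed
 thus "W' Int K' = {}" by blast
 fix e
 have nPM: "e~:P" "e~:M" if "e:LB n Un RB n" using that Mnb[of e] Pnb[of e] by blast+
 have same: "upc W' K' e = upc W K e" "dnc W' K' e = dnc W K e" if "e~:P" "e~:M"
 using up'[of e] dn'[of e] D0[OF that] by simp_all
 show "upc W' K' e = 0 & dnc W' K' e = 1" if "e:LB n" using same nPM atLB[OF that] that by simp
 show "upc W' K' e = 1 & dnc W' K' e = 0" if "e:RB n" using same nPM atRB[OF that] that by simp
 show "upc W' K' e = dnc W' K' e & upc W' K' e<=1" if "e~:LB n" "e~:RB n"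
 proof (cases "e:P")
 case True
 have "int (upc W' K' e) = 1" "int (dnc W' K' e) = 1" using up'[of e] dn'[of e] DP[OF True] Pnb[OF True] by simp_all
 thus ?thesis by simp
 next
 case nP: False
 show ?thesis
 proof (cases "e:M")
 case True
 have "int (upc W' K' e) = 0" "int (dnc W' K' e) = 0" using up'[of e] dn'[of e] DM[OF True] Mnb[OF True] by simp_all
 thus ?thesis by simp
 next
 case False
 thus ?thesis using same nP inner[OF that] by simp
 qed
 qed
 next
 have r0e: "tile_edges te Int tile_edges r0 = {}" if "te:K" "~ b1" for te
 proof -
 have False if e: "e:tile_edges te" "e:tile_edges r0" for e
 proof -
 have ed: "e:edges" using edgesI[of te e] e(1) `te:K` unfolding tile_edges_LE_RE by blast
 obtain A A' where A: "e = (A, A')" by (cases e)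
 have "e:{(X, Xi), (Xi, Xik), (X, Xk), (Xk, Xik)}" using e(2) unfolding tile_edges_LE_RE LEs REs by blast
 hence "e = (Xi, Xik) | e = (Xk, Xik)" using XE[OF `~ b1`] ed by blast
 hence "A' = Xik" "A = Xi | A = Xk" using A by auto
 moreover have "A = bottom te | A' = top_vertex te"
 using black_edge_terminal[OF `te:K`, of A A'] e(1) A unfolding tile_edges_LE_RE by blast
 moreover have "bottom te:bots" "top_vertex te:tops" using `te:K` by blast+
 ultimately show False using nbots ntops by metis
 qed
 thus ?thesis by blast
 qed
 fix te te' assume te: "te:K'" "te':K'" "te ~= te'"
 then consider "te:K" "te':K" | "te:K" "te':Ka" | "te:Ka" "te':K" | "te:Ka" "te':Ka" unfolding K'_def by blast
 thus "tile_edges te Int tile_edges te' = {}"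
 proof cases
 case 1
 thus ?thesis using black_edges te(3) by blast
 next
 case 2
 thus ?thesis using r0e[of te] KaE[of te'] by simp
 next
 case 3
 thus ?thesis using r0e[of te'] KaE[of te] by blast
 next
 case 4
 thus ?thesis using KaE[of te'] KaE[of te] te(3) by simp
 qed
 next
 have old: "bottom te~:tile_vertices te' & top_vertex te~:tile_vertices te'" if t: "te:K - Kr" "te':K' - {te}" for te te'
 proof (cases "te':K")
 case True
 thus ?thesis using black_bottom_unique[of te te'] black_top_unique[of te te'] t by blast
 next
 case False
 hence r: "~ b1" "te' = r0" using t KaE[of te'] unfolding K'_def by blast+
 have "bottom te:tile_vertices te" "top_vertex te:tile_vertices te" unfolding tile_vertices_def by blast+
 hence a: "bottom te ~= X" "bottom te ~= Xik" "top_vertex te ~= X" "top_vertex te ~= Xik"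
 using b2X[OF r(1), of te] b2k[OF r(1), of te] t by (metis DiffD1 UnI2)+
 have "bottom te:bots" "top_vertex te:tops" using t by blast+
 hence "bottom te ~= Xi" "bottom te ~= Xk" "top_vertex te ~= Xi" "top_vertex te ~= Xk" using nbots ntops by metis+
 with a show ?thesis unfolding r(2) verts by simp
 qed
 have new: "bottom r0~:tile_vertices te' & top_vertex r0~:tile_vertices te'" if "~ b1" "te':K' - {r0}" for te'
 proof -
 have "te':K" using that KaE[of te'] unfolding K'_def by blast
 moreover have "bottom r0 = X" "top_vertex r0 = Xik" unfolding r0_def Xik_def by simp_all
 ultimately show ?thesis using b2X[OF that(1), of te'] b2k[OF that(1), of te'] by simp
 qed
 have oldE: "Y' ~= bottom te" "Y ~= top_vertex te" if t: "te:K - Kr" and e: "(Y, Y'):edges_of (W' Un K')" for te Y Y'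
 proof -
 have b: "bottom te:bots" "top_vertex te:tops" using t by blast+
 have tv: "top_vertex te:tile_vertices te" unfolding tile_vertices_def by blast
 from edges'[OF e] have "(Y, Y'):edges | (Y, Y'):P" by blast
 thus "Y' ~= bottom te"
 proof
 assume "(Y, Y'):P"
 thus ?thesis using Pheads[of Y Y'] nbots b Xjbot[OF t] by (metis empty_iff insert_iff)
 qed (use not_into_bots b in metis)
 from `(Y, Y'):edges | (Y, Y'):P` show "Y ~= top_vertex te"
 proof
 assume "(Y, Y'):P"
 hence "Y = X | Y = Xj & ~ t2'" by (rule Ptails)
 thus ?thesis using XX b tv t0j[of te] t by (metis DiffD1 UnI2)
 qed (use not_from_tops b in metis)
 qed
 have newE: "Y' ~= bottom r0" "Y ~= top_vertex r0" if b: "~ b1" and e: "(Y, Y'):edges_of (W' Un K')" for Y Y'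
 proof -
 have r: "bottom r0 = X" "top_vertex r0 = Xik" unfolding r0_def Xik_def by simp_all
 note ee = edges'[OF e]
 have "X~:{Xj, Xij, Xjk, Xi, Xk}" using mem by (metis emptyE insertE)
 thus "Y' ~= bottom r0" using ee XE[OF b] Pheads[of Y Y'] unfolding r by blast
 have "(Xik, Xijk):M" unfolding M_def by blast
 thus "Y ~= top_vertex r0" using ee b2v[OF b, of Y'] Ptails[of Y Y'] ne unfolding r by blast
 qed
 show "axiom_T3 W' K'"
 unfolding axiom_T3_def
 proof (intro ballI conjI; clarify)
 fix te te' assume t: "te:K'" "te':K'" "te'~:{}" "te' ~= te"
 show "bottom te:tile_vertices te' ==> False" using old[of te te'] new[of te'] t KaE[of te] unfolding K'_def by blast
 next
 fix te te' assume t: "te:K'" "te':K'" "te'~:{}" "te' ~= te"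
 show "top_vertex te:tile_vertices te' ==> False" using old[of te te'] new[of te'] t KaE[of te] unfolding K'_def by blast
 next
 fix te Y Y' assume t: "te:K'" "(Y, Y'):edges_of (W' Un K')" "bottom te:{Y, Y'}"
 show "Y = bottom te" using oldE(1)[of te Y Y'] newE(1)[of Y Y'] t KaE[of te] unfolding K'_def by blast
 next
 fix te Y Y' assume t: "te:K'" "(Y, Y'):edges_of (W' Un K')" "top_vertex te:{Y, Y'}"
 show "Y' = top_vertex te" using oldE(2)[of te Y Y'] newE(2)[of Y Y'] t KaE[of te] unfolding K'_def by blast
 qed
 qed
 define S where "S = (W Un K) - (Wr Un Kr)"
 have TS: "W Un K = S Un (Wr Un Kr)" using sets unfolding S_def by blast
 have WK: "Wr Int K = {}" "Kr Int W = {}" using sets disj by blast+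
 have TS': "W' Un K' = S Un (Wa Un Ka)" using WK unfolding S_def W'_def K'_def by blast
 have addn: "(Wa Un Ka) Int (W Un K) = {}" using WaE KaE a1n a3n r0n by blast
 have Sedge: "(A, A')~:M & (A, A'):edges" if "te:S" "(A, A'):tile_edges te" for te A A'
 proof -
 have "(A, A'):edges_of (W' Un K')" using that unfolding TS' edges_of_def by blast
 moreover have "(A, A'):edges" using that unfolding TS edges_of_def by blast
 ultimately show ?thesis using edges' by blast
 qed
 have vE: "EX A A'. (A, A'):tile_edges te & v:{A, A'}" if "v:tile_vertices te" for v te
 using that unfolding tile_vertices_def tile_edges_def by blast
 have Sik: "Xik~:tile_vertices te" if "te:S" "b1" for te
 proof
 assume "Xik:tile_vertices te"
 then obtain A A' where A: "(A, A'):tile_edges te" "Xik:{A, A'}" using vE by blast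
 note e = Sedge[OF that(1) A(1)]
 have "(A, A'):{(Xi, Xik), (Xk, Xik), (Xik, Xijk)}" by (rule b1E[OF that(2) conjunct2[OF e] A(2)])
 moreover have "{(Xi, Xik), (Xk, Xik), (Xik, Xijk)}<=M" using that(2) unfolding M_def by simp
 ultimately show False using e by (metis subsetD)
 qed
 \<comment> \<open>If the black tile at \<open>Xijk\<close> goes, this vertex must lose all its
   edges. In the chain of labels at the top, \<open>i, j\<close> come from \<open>r2\<close> and
   \<open>j, k\<close> from \<open>r1\<close>, so the chain is exactly \<open>i, j, k\<close>, and
   all three edges are in \<open>M\<close>.\<close>
 have Sijk: "Xijk~:tile_vertices te" if S: "te:S" and t: "t2'" for te
 proof
 have a3K: "Tile Xj i k:K" using t unfolding t2'_def a3_def .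
 have Yeq: "Xijk = insert i (insert k Xj)" unfolding defs by (simp add: insert_commute)
 have im: "m:{i, j, k}" if mm: "m:Xijk" "(Xijk - {m}, Xijk):edges" for m
 proof (rule top_chain[OF a3K Yeq])
 fix N and g :: "nat => nat"
 assume g: "2<=N" "g 0 = i" "g N = k"
 "!!t. t < N ==> g t < g (Suc t) & g t:Xijk & g (Suc t):Xijk & Tile (Xijk - {g (Suc t)} - {g t}) (g t) (g (Suc t)):W"
 and g5: "!!i j X. Tile X i j:W ==> insert i (insert j X) = Xijk ==> EX t<N. i = g t & j = g (Suc t)"
 and g6: "!!m. m:Xijk ==> (Xijk - {m}, Xijk):edges ==> m:g ` {..N}"
 have le: "ALL t<N. g t < g (Suc t)" using g(4) by blast
 have I: "insert i (insert j Xk) = Xijk" "insert j (insert k Xi) = Xijk" unfolding defs by (simp_all add: insert_commute)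
 obtain t where t: "t < N" "i = g t" "j = g (Suc t)" using g5[OF _ I(1)] r12(2) unfolding r2_def by blast
 obtain u where u: "u < N" "j = g u" "k = g (Suc u)" using g5[OF _ I(2)] r12(1) unfolding r1_def by blast
 have t0: "t = 0"
 proof (rule ccontr)
 assume "t ~= 0"
 hence "g 0 < g t" using chain_less[OF le, of 0 t] t(1) by simp
 thus False unfolding g(2) t(2)[symmetric] by simp
 qed
 have "u = Suc t"
 proof (rule linorder_cases[of u "Suc t"])
 assume "u < Suc t"
 hence "g u < g (Suc t)" using chain_less[OF le, of u "Suc t"] t(1) by simp
 thus ?thesis unfolding t(3)[symmetric] u(2)[symmetric] by simp
 next
 assume "Suc t < u"
 hence "g (Suc t) < g u" using chain_less[OF le, of "Suc t" u] u(1) by simp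
 thus ?thesis unfolding t(3)[symmetric] u(2)[symmetric] by simp
 qed
 moreover have "Suc u = N"
 proof (rule ccontr)
 assume "Suc u ~= N"
 hence "g (Suc u) < g N" using chain_less[OF le, of "Suc u" N] u(1) by simp
 thus False unfolding g(3) u(3)[symmetric] by simp
 qed
 ultimately have N: "N = 2" using t0 by simp
 have "g 1 = j" using t(3) t0 by simp
 note N = N this
 obtain t' where t': "m = g t'" "t'<=N" using g6[OF mm] by auto
 hence "t' = 0 | t' = 1 | t' = 2" using N(1) by linarith
 hence "m = g 0 | m = g 1 | m = g N" using t'(1) N(1) by auto
 thus "m:{i, j, k}" unfolding g(2,3) N(2) by simp
 qed
 assume "Xijk:tile_vertices te"
 then obtain A A' where A: "(A, A'):tile_edges te" "Xijk:{A, A'}" using vE by blast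
 hence e: "(A, A')~:M" "(A, A'):edges" using Sedge[OF S A(1)] by simp_all
 have "Xijk:tops" using a3K Yeq by (metis top_Tile imageI)
 hence "A' = Xijk" using not_from_tops[OF e(2)] A(2) by blast
 obtain m where m: "A' = insert m A" "m~:A" using edge_props[OF e(2)] by metis
 hence Am: "A = Xijk - {m}" "m:Xijk" using `A' = Xijk` by (metis Diff_insert_absorb, metis insertI1)
 hence "m:{i, j, k}" using im[of m] e(2) unfolding `A' = Xijk` by simp
 moreover have "Xijk - {i} = Xjk" "Xijk - {j} = Xik" "Xijk - {k} = Xij" using ord unfolding defs by auto
 ultimately have "(A, A'):{(Xjk, Xijk), (Xik, Xijk), (Xij, Xijk)}" unfolding Am(1) `A' = Xijk` by (elim insertE) simp_all
 moreover have "{(Xjk, Xijk), (Xik, Xijk), (Xij, Xijk)}<=M" using t unfolding M_def by simp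
 ultimately show False using e(1) by (metis subsetD)
 qed
 have SX: "X~:tile_vertices te" if "te:S" "~ b1" for te using b2X that unfolding S_def by blast
 have Sj: "Xj~:tile_vertices te" if "te:S" "~ t2'" for te using t0j that unfolding S_def by blast
 have RA: "Wr Un Kr = {r1, r2} Un (if b1 then {r0} else {}) Un (if t2' then {a3} else {})"
 "Wa Un Ka = {a1, a2} Un (if b1 then {} else {r0}) Un (if t2' then {} else {a3})"
 unfolding Wr_def Wa_def Kr_def Ka_def by auto
 have vR: "\<Union> (tile_vertices ` (Wr Un Kr)) = {Xi, Xij, Xik, Xijk, Xk, Xjk} Un (if b1 then {X} else {}) Un (if t2' then {Xj} else {})"
 unfolding RA by (rule set_eqI, cases b1; cases t2'; simp add: verts; argo)
 have vA: "\<Union> (tile_vertices ` (Wa Un Ka)) = {X, Xi, Xj, Xij, Xk, Xjk} Un (if b1 then {} else {Xik}) Un (if t2' then {} else {Xijk})"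
 unfolding RA by (rule set_eqI, cases b1; cases t2'; simp add: verts; argo)
 have spec: "spectrum W' K' = B - {Xik} Un {Xj}"
 proof -
 have bots': "bottom ` K' = bots - (if t2' then {Xj} else {}) Un (if b1 then {} else {X})"
 proof -
 have "bottom ` (K - Kr) = bots - (if t2' then {Xj} else {})"
 proof -
 have "bottom ` K - {Xj} = bottom ` (K - {a3})" if t2'
 using Xjbot that unfolding Kr_def by (auto simp: a3_def)
 thus ?thesis unfolding Kr_def by simp
 qed
 thus ?thesis unfolding K'_def Ka_def image_Un by (simp add: r0_def)
 qed
 have tops': "top_vertex ` K' = tops - (if t2' then {Xijk} else {}) Un (if b1 then {} else {Xik})"
 proof -
 have "top_vertex ` (K - Kr) = tops - (if t2' then {Xijk} else {})"
 proof -
 have "top_vertex ` K - {Xijk} = top_vertex ` (K - {a3})" if t2'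
 proof -
 have a3: "top_vertex a3 = Xijk" unfolding a3_def defs by (simp add: insert_commute)
 have "te = a3" if "te:K" "top_vertex te = Xijk" for te
 using black_top_unique[of te a3] that `t2'` verts(6) unfolding t2'_def by simp
 thus ?thesis using a3 by blast
 qed
 thus ?thesis unfolding Kr_def by simp
 qed
 moreover have "top_vertex r0 = Xik" unfolding r0_def Xik_def by simp
 ultimately show ?thesis unfolding K'_def Ka_def image_Un by simp
 qed
 have vs: "\<Union> (tile_vertices ` (W Un K)) = \<Union> (tile_vertices ` S) Un \<Union> (tile_vertices ` (Wr Un Kr))"
 "\<Union> (tile_vertices ` (W' Un K')) = \<Union> (tile_vertices ` S) Un \<Union> (tile_vertices ` (Wa Un Ka))"
 unfolding TS TS' by blast+
 define vS where "vS = \<Union> (tile_vertices ` S)"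
 have f: "b1 ==> Xik~:vS" "t2' ==> Xijk~:vS" "~ b1 ==> X~:vS" "~ t2' ==> Xj~:vS"
 using Sik Sijk SX Sj unfolding vS_def by blast+
 have Xjt: "Xj~:tops"
 proof
 assume "Xj:tops"
 then obtain te where te: "te:K" "top_vertex te = Xj" by auto
 hence v: "Xj:tile_vertices te" unfolding tile_vertices_def by blast
 hence t: t2' using t0j te(1) by blast
 hence "te = a3" using black_top_unique[OF te(1), of a3] te(2) verts(6) unfolding t2'_def by simp
 hence "Xj = Xijk" using te(2) unfolding a3_def defs by (simp add: insert_commute)
 thus False using ne by metis
 qed
 have Xjb: "t2' \<longleftrightarrow> Xj:bots"
 proof
 assume "Xj:bots"
 then obtain te where te: "te:K" "bottom te = Xj" by auto
 hence v: "Xj:tile_vertices te" unfolding tile_vertices_def by blast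
 thus t2' using t0j te(1) by blast
 qed (metis a3_def bottom_Tile imageI t2'_def)
 have Xb: "~ b1 ==> X~:bots"
 proof
 assume b: "~ b1" "X:bots"
 then obtain te where te: "te:K" "bottom te = X" by auto
 thus False using b2X[OF b(1), of te] unfolding tile_vertices_def by blast
 qed
 have Xijkt: "t2' ==> Xijk:tops"
 proof -
 assume t2'
 moreover have "top_vertex a3 = Xijk" unfolding a3_def defs by (simp add: insert_commute)
 ultimately show ?thesis unfolding t2'_def by (metis imageI)
 qed
 have "v:spectrum W' K' \<longleftrightarrow> v:B - {Xik} Un {Xj}" for v
 proof -
 consider "v = X" | "v = Xi" | "v = Xj" | "v = Xk" | "v = Xij" | "v = Xik" | "v = Xjk" | "v = Xijk"
 | "v ~= X" "v ~= Xi" "v ~= Xj" "v ~= Xk" "v ~= Xij" "v ~= Xik" "v ~= Xjk" "v ~= Xijk" by argo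
 moreover have L: "v:spectrum W' K' \<longleftrightarrow> (v:vS | v:{X, Xi, Xj, Xij, Xk, Xjk} | ~ b1 & v = Xik | ~ t2' & v = Xijk) &
 ~ (v:bots & ~ (t2' & v = Xj) | ~ b1 & v = X) & ~ (v:tops & ~ (t2' & v = Xijk) | ~ b1 & v = Xik)"
 unfolding spectrum_def terminal_vertices_def vs bots' tops' vA vS_def[symmetric] by (cases b1; cases t2'; simp; argo)
 moreover have R: "v:B - {Xik} Un {Xj} \<longleftrightarrow> v = Xj | v ~= Xik & (v:vS | v:{Xi, Xij, Xik, Xijk, Xk, Xjk} | b1 & v = X | t2' & v = Xj) & v~:bots & v~:tops"
 unfolding spectrum_def terminal_vertices_def vs vR vS_def[symmetric] by (cases b1; cases t2'; simp; argo)
 ultimately show ?thesis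
 proof cases
 case 1
 show ?thesis unfolding L R by (cases b1; cases t2') (simp_all add: 1 f Xjt Xjb[symmetric] Xijkt XX Xb nbots ntops ne ne[symmetric])
 next
 case 2
 show ?thesis unfolding L R by (cases b1; cases t2') (simp_all add: 2 f Xjt Xjb[symmetric] Xijkt XX Xb nbots ntops ne ne[symmetric])
 next
 case 3
 show ?thesis unfolding L R by (cases b1; cases t2') (simp_all add: 3 f Xjt Xjb[symmetric] Xijkt XX Xb nbots ntops ne ne[symmetric])
 next
 case 4
 show ?thesis unfolding L R by (cases b1; cases t2') (simp_all add: 4 f Xjt Xjb[symmetric] Xijkt XX Xb nbots ntops ne ne[symmetric])
 next
 case 5
 show ?thesis unfolding L R by (cases b1; cases t2') (simp_all add: 5 f Xjt Xjb[symmetric] Xijkt XX Xb nbots ntops ne ne[symmetric])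
 next
 case 6
 show ?thesis unfolding L R by (cases b1; cases t2') (simp_all add: 6 f Xjt Xjb[symmetric] Xijkt XX Xb nbots ntops ne ne[symmetric])
 next
 case 7
 show ?thesis unfolding L R by (cases b1; cases t2') (simp_all add: 7 f Xjt Xjb[symmetric] Xijkt XX Xb nbots ntops ne ne[symmetric])
 next
 case 8
 show ?thesis unfolding L R by (cases b1; cases t2') (simp_all add: 8 f Xjt Xjb[symmetric] Xijkt XX Xb nbots ntops ne ne[symmetric])
 next
 case 9
 thus ?thesis unfolding L R by (cases b1; cases t2') simp_all
 qed
 qed
 thus ?thesis by blast
 qed
 have "exchange X i j k (W Un K) (W' Un K')"
 proof -
 have e: "e:edges_of (Wr Un Kr) & e:edges_of (Wa Un Ka)" if "te:S" "e:tile_edges te" "e:edges_of ((Wr Un Kr) Un (Wa Un Ka))" for te e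
 proof -
 obtain A A' where A: "e = (A, A')" by (cases e)
 have "e~:M" "e:edges" using Sedge[OF that(1)] that(2) unfolding A by blast+
 moreover have "e~:P" using Pn `e:edges` by blast
 ultimately show ?thesis using that(3) unfolding RA edges_of_def tile_edges_LE_RE M_def P_def
 by (cases b1; cases t2'; simp add: LEs REs; argo)
 qed
 have v: "v:\<Union> (tile_vertices ` (Wr Un Kr)) & v:\<Union> (tile_vertices ` (Wa Un Ka))"
 if "te:S" "v:tile_vertices te" "v:\<Union> (tile_vertices ` ((Wr Un Kr) Un (Wa Un Ka)))" for te v
 proof -
 have "v:\<Union> (tile_vertices ` (Wr Un Kr)) Un \<Union> (tile_vertices ` (Wa Un Ka))" using that(3) by blast
 moreover have "b1 ==> v ~= Xik" "t2' ==> v ~= Xijk" "~ b1 ==> v ~= X" "~ t2' ==> v ~= Xj"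
 using Sik[OF that(1)] Sijk[OF that(1)] SX[OF that(1)] Sj[OF that(1)] that(2) by blast+
 ultimately show ?thesis unfolding vR vA by (cases b1; cases t2'; simp; argo)
 qed
 have d: "S Int ((Wr Un Kr) Un (Wa Un Ka)) = {}" using addn unfolding S_def by blast
 have R: "{Tile (insert i X) j k, Tile (insert k X) i j} Un (if b1 then {Tile X i k} else {}) Un (if t2' then {Tile (insert j X) i k} else {}) = Wr Un Kr"
 "{Tile X i j, Tile X j k} Un (if b1 then {} else {Tile X i k}) Un (if t2' then {} else {Tile (insert j X) i k}) = Wa Un Ka"
 unfolding RA tdefs Xi_def Xj_def Xk_def by simp_all
 show ?thesis unfolding exchange_def Let_def
 proof (rule exI[of _ S], rule exI[of _ b1], rule exI[of _ t2'], unfold R, intro conjI TS TS' d ballI impI)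
 qed (fact e[THEN conjunct1] e[THEN conjunct2] v[THEN conjunct1] v[THEN conjunct2] | rule e[THEN conjunct1] e[THEN conjunct2] v[THEN conjunct1] v[THEN conjunct2]; assumption)+
 qed
 with gt' spec show ?thesis unfolding defs by blast
qed

end

text \<open>By \<open>square_inter\<close> a remaining square meets the cube only in common vertices
  and edges, and \<open>exchange\<close> says that these belong to both discs. So the discs can be
  interchanged by \<open>glue_homeomorphic\<close>.\<close>

lemma exchange_homeomorphic:
 assumes o: "i < j" "j < k" "i~:X" "j~:X" "k~:X" and ex: "exchange X i j k T T'"
 and T: "T<=tiles n" "T'<=tiles n" "finite T" "finite T'"
 shows "(\<Union>te\<in>T. cube_square te) homeomorphic (\<Union>te\<in>T'. cube_square te)"
proof -
 obtain S b t where S: "let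
 R = {Tile (insert i X) j k, Tile (insert k X) i j} Un (if b then {Tile X i k} else {}) Un (if t then {Tile (insert j X) i k} else {});
 A = {Tile X i j, Tile X j k} Un (if b then {} else {Tile X i k}) Un (if t then {} else {Tile (insert j X) i k})
 in T = S Un R & T' = S Un A & S Int (R Un A) = {} &
 (ALL te:S. ALL e:tile_edges te. e:edges_of (R Un A) --> e:edges_of R & e:edges_of A) &
 (ALL te:S. ALL v:tile_vertices te. v:\<Union> (tile_vertices ` (R Un A)) --> v:\<Union> (tile_vertices ` R) & v:\<Union> (tile_vertices ` A))"
 using ex unfolding exchange_def by (elim exE)
 define R where "R = {Tile (insert i X) j k, Tile (insert k X) i j} Un (if b then {Tile X i k} else {}) Un (if t then {Tile (insert j X) i k} else {})"
 define A where "A = {Tile X i j, Tile X j k} Un (if b then {} else {Tile X i k}) Un (if t then {} else {Tile (insert j X) i k})"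
 have TS: "T = S Un R" "T' = S Un A" and dj: "S Int (R Un A) = {}"
 and ed: "ALL te:S. ALL e:tile_edges te. e:edges_of (R Un A) --> e:edges_of R & e:edges_of A"
 and ve: "ALL te:S. ALL v:tile_vertices te. v:\<Union> (tile_vertices ` (R Un A)) --> v:\<Union> (tile_vertices ` R) & v:\<Union> (tile_vertices ` A)"
 using S unfolding Let_def R_def[symmetric] A_def[symmetric] by blast+
 define US D1 D2 where "US = (\<Union>te\<in>S. cube_square te)" and "D1 = (\<Union>te\<in>R. cube_square te)" and "D2 = (\<Union>te\<in>A. cube_square te)"
 have tl: "S<=tiles n" "R<=tiles n" "A<=tiles n" "finite S" "finite R" "finite A" using T unfolding TS by auto
 have cp: "compact (\<Union>te\<in>Z. cube_square te)" if "Z<=tiles n" "finite Z" for Z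
 using that by (intro compact_UN) (auto intro: compact_cube_square)
 have c: "compact US" "compact D1" "compact D2" unfolding US_def D1_def D2_def using cp tl by blast+
 have D1: "D1 = {x:cube3 X i j k. x i = 1 | x k = 1 | b & x j = 0 | t & x j = 1}"
 unfolding D1_def R_def by (rule set_eqI, cases b; cases t; simp add: cube3_faces[OF o]; argo)
 have D2: "D2 = {x:cube3 X i j k. x i = 0 | x k = 0 | ~ b & x j = 0 | ~ t & x j = 1}"
 unfolding D2_def A_def by (rule set_eqI, cases b; cases t; simp add: cube3_faces[OF o]; argo)
 have sep: "US Int (D1 Un D2)<=D1 Int D2"
 proof
 fix x assume "x:US Int (D1 Un D2)"
 then obtain te \<sigma> where s: "te:S" "x:cube_square te" "\<sigma>:R Un A" "x:cube_square \<sigma>" unfolding US_def D1_def D2_def by blast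
 have ne: "te ~= \<sigma>" using dj s by blast
 have tte: "te:tiles n" "\<sigma>:tiles n" using tl s by blast+
 from square_inter[OF tte ne s(2,4)] show "x:D1 Int D2"
 proof
 assume "EX v:tile_vertices te Int tile_vertices \<sigma>. x = indicat_real v"
 then obtain v where v: "v:tile_vertices te" "v:tile_vertices \<sigma>" "x = indicat_real v" by blast
 have "v:\<Union> (tile_vertices ` (R Un A))" using v(2) s(3) by blast
 hence "v:\<Union> (tile_vertices ` R)" "v:\<Union> (tile_vertices ` A)" using ve s(1) v(1) by blast+
 then obtain \<rho> \<rho>' where r: "\<rho>:R" "v:tile_vertices \<rho>" "\<rho>':A" "v:tile_vertices \<rho>'" by blast
 have rt: "\<rho>:tiles n" "\<rho>':tiles n" using r(1,3) tl by (meson subsetD)+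
 have "x:cube_square \<rho>" "x:cube_square \<rho>'" unfolding v(3) by (rule vertex_in_square[OF rt(1) r(2)], rule vertex_in_square[OF rt(2) r(4)])
 thus ?thesis using r(1,3) unfolding D1_def D2_def by (intro IntI UN_I)
 next
 assume "EX A q. q~:A & (A, insert q A):tile_edges te Int tile_edges \<sigma> & x:edge_seg A q"
 then obtain Z q where e: "q~:Z" "(Z, insert q Z):tile_edges te" "(Z, insert q Z):tile_edges \<sigma>" "x:edge_seg Z q" by blast
 have "(Z, insert q Z):edges_of (R Un A)" using e(3) s(3) unfolding edges_of_def by blast
 hence "(Z, insert q Z):edges_of R" "(Z, insert q Z):edges_of A" using ed s(1) e(2) by blast+
 then obtain \<rho> \<rho>' where r: "\<rho>:R" "(Z, insert q Z):tile_edges \<rho>" "\<rho>':A" "(Z, insert q Z):tile_edges \<rho>'" unfolding edges_of_def by blast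
 have rt: "\<rho>:tiles n" "\<rho>':tiles n" using r(1,3) tl by (meson subsetD)+
 have "x:cube_square \<rho>" "x:cube_square \<rho>'" by (rule edge_in_square[OF rt(1) r(2) e(1,4)], rule edge_in_square[OF rt(2) r(4) e(1,4)])
 thus ?thesis using r(1,3) unfolding D1_def D2_def by (intro IntI UN_I)
 qed
 qed
 have U: "(\<Union>te\<in>T. cube_square te) = US Un D1" "(\<Union>te\<in>T'. cube_square te) = US Un D2"
 unfolding TS US_def D1_def D2_def by blast+
 from cube3_exchange[OF o(1,2), of X b t] show ?thesis unfolding D1[symmetric] D2[symmetric] U
 proof
 assume "EX g. continuous_on D1 g & bij_betw g D1 D2 & (ALL x:D1 Int D2. g x = x)"
 thus "US Un D1 homeomorphic US Un D2" using glue_homeomorphic[OF c(1,2) sep] by blast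
 next
 assume "EX g. continuous_on D2 g & bij_betw g D2 D1 & (ALL x:D2 Int D1. g x = x)"
 moreover have "US Int (D2 Un D1)<=D2 Int D1" using sep by blast
 ultimately have "US Un D2 homeomorphic US Un D1" using glue_homeomorphic[OF c(1,3)] by blast
 thus "US Un D1 homeomorphic US Un D2" using homeomorphic_sym by blast
 qed
qed

section \<open>Duality\<close>
definition dual_set :: "nat => nat set => nat set" where
 "dual_set n A = {1..n} - A"

definition dual_tile :: "nat => tile => tile" where
 "dual_tile n te = Tile (dual_set n (top_vertex te)) (tile_fst te) (tile_snd te)"

lemma dual_dual: "A<={1..n} ==> dual_set n (dual_set n A) = A"
 and dual_subset: "dual_set n A<={1..n}"
 unfolding dual_set_def by auto

lemma dual_inj: "A<={1..n} ==> A'<={1..n} ==> dual_set n A = dual_set n A' \<longleftrightarrow> A = A'"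
 using dual_dual by metis

lemma dual_insert_remove: "q:{1..n} ==> q~:A ==> insert q (dual_set n (insert q A)) = dual_set n A"
 unfolding dual_set_def by auto

lemma dual_tile_Tile: "dual_tile n (Tile X i j) = Tile (dual_set n (insert i (insert j X))) i j"
 unfolding dual_tile_def by simp

text \<open>Complementation is the half turn of the zonogon: bottom and top change places, as do
  left and right, while the labels of a tile are kept.\<close>

lemma dual_tile_props:
 assumes "te:tiles n"
 shows "dual_tile n te:tiles n" "dual_tile n (dual_tile n te) = te"
 "bottom (dual_tile n te) = dual_set n (top_vertex te)" "top_vertex (dual_tile n te) = dual_set n (bottom te)"
 "left (dual_tile n te) = dual_set n (right te)" "right (dual_tile n te) = dual_set n (left te)"
 "LE (dual_tile n te) = (%(A, A'). (dual_set n A', dual_set n A)) ` RE te"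
 "RE (dual_tile n te) = (%(A, A'). (dual_set n A', dual_set n A)) ` LE te"
 "tile_vertices (dual_tile n te) = dual_set n ` tile_vertices te"
proof -
 obtain X i j where t: "te = Tile X i j" "i < j" "1<=i" "j<=n" "X<={1..n}" "i~:X" "j~:X" using assms by (rule tiles_cases)
 show 1: "dual_tile n te:tiles n" using t unfolding t(1) dual_tile_Tile Tile_in_tiles dual_set_def by auto
 show b: "bottom (dual_tile n te) = dual_set n (top_vertex te)" unfolding dual_tile_def by simp
 show l: "left (dual_tile n te) = dual_set n (right te)" using t unfolding t(1) dual_tile_Tile dual_set_def by auto
 show r: "right (dual_tile n te) = dual_set n (left te)" using t unfolding t(1) dual_tile_Tile dual_set_def by auto
 show tp: "top_vertex (dual_tile n te) = dual_set n (bottom te)" using t unfolding t(1) dual_tile_Tile dual_set_def by auto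
 show "LE (dual_tile n te) = (%(A, A'). (dual_set n A', dual_set n A)) ` RE te"
 "RE (dual_tile n te) = (%(A, A'). (dual_set n A', dual_set n A)) ` LE te"
 unfolding LE_def RE_def b l r tp by auto
 show "tile_vertices (dual_tile n te) = dual_set n ` tile_vertices te" unfolding tile_vertices_def b l r tp by auto
 have "X Un {i, j}<={1..n}" using t by auto
 thus "dual_tile n (dual_tile n te) = te"
 using tp t dual_dual[of X n] unfolding t(1) dual_tile_Tile by simp
qed

lemma edge_ends_subset: "te:tiles n ==> (A, A'):tile_edges te ==> A<={1..n} & A'<={1..n}"
 by (erule edge_form) auto

lemma dual_edge_mem:
 assumes "te:tiles n" "A<={1..n}" "A'<={1..n}"
 shows "(dual_set n A', dual_set n A):LE (dual_tile n te) \<longleftrightarrow> (A, A'):RE te"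
 "(dual_set n A', dual_set n A):RE (dual_tile n te) \<longleftrightarrow> (A, A'):LE te"
proof -
 have im: "(dual_set n A', dual_set n A):(%(A, A'). (dual_set n A', dual_set n A)) ` E \<longleftrightarrow> (A, A'):E" if E: "E<=tile_edges te" for E
 proof
 assume "(dual_set n A', dual_set n A):(%(A, A'). (dual_set n A', dual_set n A)) ` E"
 then obtain z where z: "z:E" "(dual_set n A', dual_set n A) = (%(A, A'). (dual_set n A', dual_set n A)) z" by blast
 obtain C C' where zC: "z = (C, C')" by (cases z)
 have C: "(C, C'):E" "dual_set n A' = dual_set n C'" "dual_set n A = dual_set n C" using z unfolding zC by simp_all
 have cs: "C<={1..n}" "C'<={1..n}" using edge_ends_subset[OF assms(1) subsetD[OF E C(1)]] by simp_all
 have "A' = C'" "A = C" using C(2,3) dual_inj[OF assms(3) cs(2)] dual_inj[OF assms(2) cs(1)] by simp_all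
 thus "(A, A'):E" using C(1) by simp
 next
 assume "(A, A'):E"
 thus "(dual_set n A', dual_set n A):(%(A, A'). (dual_set n A', dual_set n A)) ` E" by (rule rev_image_eqI) simp
 qed
 show "(dual_set n A', dual_set n A):LE (dual_tile n te) \<longleftrightarrow> (A, A'):RE te"
 unfolding dual_tile_props(7)[OF assms(1)] by (rule im) (simp add: tile_edges_LE_RE)
 show "(dual_set n A', dual_set n A):RE (dual_tile n te) \<longleftrightarrow> (A, A'):LE te"
 unfolding dual_tile_props(8)[OF assms(1)] by (rule im) (simp add: tile_edges_LE_RE)
qed

lemma dual_boundary:
 assumes "A<={1..n}" "A'<={1..n}"
 shows "(dual_set n A', dual_set n A):LB n \<longleftrightarrow> (A, A'):RB n" "(dual_set n A', dual_set n A):RB n \<longleftrightarrow> (A, A'):LB n"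
proof -
 have d1: "dual_set n {i..n} = {1..i - 1}" "dual_set n {i + 1..n} = {1..i}" if "i:{1..n}" for i using that unfolding dual_set_def by auto
 have d2: "dual_set n {1..i - 1} = {i..n}" "dual_set n {1..i} = {i + 1..n}" if "i:{1..n}" for i using that unfolding dual_set_def by auto
 have a: "(dual_set n A', dual_set n A):LB n" if "(A, A'):RB n" for A A' using that d1 unfolding LB_def RB_def by auto
 have b: "(dual_set n A', dual_set n A):RB n" if "(A, A'):LB n" for A A' using that d2 unfolding LB_def RB_def by auto
 show "(dual_set n A', dual_set n A):LB n \<longleftrightarrow> (A, A'):RB n" using a[of A A'] b[of "dual_set n A'" "dual_set n A"] assms dual_dual by metis
 show "(dual_set n A', dual_set n A):RB n \<longleftrightarrow> (A, A'):LB n" using b[of A A'] a[of "dual_set n A'" "dual_set n A"] assms dual_dual by metis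
qed

context gt
begin

lemma dual_tile_inj: "inj_on (dual_tile n) (W Un K)"
 by (rule inj_on_inverseI[of _ "dual_tile n"]) (use sub dual_tile_props(2) in blast)

lemma dual_card:
 assumes "S<=W Un K" and eq: "!!te. te:S ==> P (dual_tile n te) \<longleftrightarrow> Q te"
 shows "card {te:dual_tile n ` S. P te} = card {te:S. Q te}"
proof -
 have "{te:dual_tile n ` S. P te} = dual_tile n ` {te:S. Q te}" using eq by blast
 moreover have "inj_on (dual_tile n) {te:S. Q te}" by (rule inj_on_subset[OF dual_tile_inj]) (use assms(1) in blast)
 ultimately show ?thesis by (simp add: card_image)
qed

lemma dual_counts:
 assumes "A<={1..n}" "A'<={1..n}"
 shows "upc (dual_tile n ` W) (dual_tile n ` K) (dual_set n A', dual_set n A) = dnc W K (A, A')"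
 "dnc (dual_tile n ` W) (dual_tile n ` K) (dual_set n A', dual_set n A) = upc W K (A, A')"
proof -
 have e: "(dual_set n A', dual_set n A):LE (dual_tile n te) \<longleftrightarrow> (A, A'):RE te"
 "(dual_set n A', dual_set n A):RE (dual_tile n te) \<longleftrightarrow> (A, A'):LE te" if "te:W Un K" for te
 using dual_edge_mem[OF _ assms] that sub by blast+
 show "upc (dual_tile n ` W) (dual_tile n ` K) (dual_set n A', dual_set n A) = dnc W K (A, A')"
 "dnc (dual_tile n ` W) (dual_tile n ` K) (dual_set n A', dual_set n A) = upc W K (A, A')"
 unfolding upc_def dnc_def using e by (intro arg_cong2[where f = "(+)"] dual_card; blast)+
qed

lemma dual_vertices: "\<Union> (tile_vertices ` (dual_tile n ` S)) = dual_set n ` \<Union> (tile_vertices ` S)" if "S<=W Un K"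
proof -
 have "tile_vertices (dual_tile n te) = dual_set n ` tile_vertices te" if "te:S" for te using dual_tile_props(9) sub `S<=W Un K` that by blast
 thus ?thesis by auto
qed

lemma vertices_subset: "te:W Un K ==> v:tile_vertices te ==> v<={1..n}"
proof -
 assume a: "te:W Un K" "v:tile_vertices te"
 have "te:tiles n" using a sub by blast
 then obtain X i j where t: "te = Tile X i j" "i < j" "1<=i" "j<=n" "X<={1..n}" by (rule tiles_cases)
 have "i:{1..n}" "j:{1..n}" using t by auto
 thus ?thesis using a(2) t(5) unfolding t(1) tile_vertices_Tile by (elim insertE) simp_all
qed

lemma dual_edges: "(A, A'):edges_of (dual_tile n ` W Un dual_tile n ` K) ==>
 A<={1..n} & A'<={1..n} & (dual_set n A', dual_set n A):edges"
proof -
 assume "(A, A'):edges_of (dual_tile n ` W Un dual_tile n ` K)"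
 then obtain te where te: "te:W Un K" "(A, A'):tile_edges (dual_tile n te)" unfolding edges_of_def by auto
 hence t: "te:tiles n" using sub by blast
 note p = dual_tile_props[OF t] and q = dual_tile_props[OF dual_tile_props(1)[OF t]]
 have AA: "A<={1..n}" "A'<={1..n}" using edge_ends_subset[OF p(1) te(2)] by auto
 have "(dual_set n A', dual_set n A):tile_edges (dual_tile n (dual_tile n te))"
 using te(2) unfolding tile_edges_LE_RE q(7,8) by (auto intro: rev_image_eqI)
 thus ?thesis using AA te(1) unfolding p(2) edges_of_def by blast
qed

lemma dual_gt: "gt n (dual_tile n ` W) (dual_tile n ` K)"
proof (rule gt.intro)
 show "2<=n" by (rule n2)
 show "finite (dual_tile n ` W)" "finite (dual_tile n ` K)" using fin by auto
 show "dual_tile n ` W<=tiles n" "dual_tile n ` K<=tiles n" using sub dual_tile_props(1) by blast+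
 show "dual_tile n ` W Int dual_tile n ` K = {}" using disj inj_on_image_Int[OF dual_tile_inj, of W K] by auto
 fix e :: "nat set \<times> nat set"
 let ?W = "dual_tile n ` W" and ?K = "dual_tile n ` K"
 obtain A A' where e: "e = (A, A')" by (cases e)
 have lb: "A<={1..n} & A'<={1..n}" if "e:LB n Un RB n" using that e unfolding LB_def RB_def by auto
 have cnt: "upc ?W ?K e = dnc W K (dual_set n A', dual_set n A)" "dnc ?W ?K e = upc W K (dual_set n A', dual_set n A)"
 "e:LB n \<longleftrightarrow> (dual_set n A', dual_set n A):RB n" "e:RB n \<longleftrightarrow> (dual_set n A', dual_set n A):LB n"
 if "A<={1..n}" "A'<={1..n}"
 using dual_counts[OF dual_subset dual_subset, of A A'] dual_boundary[OF dual_subset dual_subset, of n A A'] that unfolding e by (simp_all add: dual_dual)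
 show "upc ?W ?K e = 0 & dnc ?W ?K e = 1" if "e:LB n" using cnt lb atRB that by auto
 show "upc ?W ?K e = 1 & dnc ?W ?K e = 0" if "e:RB n" using cnt lb atLB that by auto
 show "upc ?W ?K e = dnc ?W ?K e & upc ?W ?K e<=1" if ne: "e~:LB n" "e~:RB n"
 proof (cases "A<={1..n} & A'<={1..n}")
 case True
 thus ?thesis using cnt ne inner[of "(dual_set n A', dual_set n A)"] by auto
 next
 case False
 have "e~:LE te & e~:RE te" if "te:?W Un ?K" for te
 using edge_ends_subset[of te n A A'] that sub dual_tile_props(1) False unfolding e tile_edges_LE_RE by blast
 hence "{te:?W. e:RE te} = {}" "{te:?K. e:LE te} = {}" "{te:?W. e:LE te} = {}" "{te:?K. e:RE te} = {}" by blast+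
 hence "card {te:?W. e:RE te} = 0" "card {te:?K. e:LE te} = 0" "card {te:?W. e:LE te} = 0" "card {te:?K. e:RE te} = 0" by (simp_all only: card.empty)
 thus ?thesis unfolding upc_def dnc_def by linarith
 qed
next
 fix te' \<sigma>' assume a: "te':dual_tile n ` K" "\<sigma>':dual_tile n ` K" "te' ~= \<sigma>'"
 then obtain te \<sigma> where t: "te' = dual_tile n te" "\<sigma>' = dual_tile n \<sigma>" "te:K" "\<sigma>:K" "te ~= \<sigma>" by blast
 have tl: "te:tiles n" "\<sigma>:tiles n" using t sub by blast+
 show "tile_edges te' Int tile_edges \<sigma>' = {}"
 proof (rule ccontr)
 assume "tile_edges te' Int tile_edges \<sigma>' ~= {}"
 then obtain A A' where A: "(A, A'):tile_edges te'" "(A, A'):tile_edges \<sigma>'" by auto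
 have sb: "A<={1..n}" "A'<={1..n}" using edge_ends_subset[OF _ A(1)] dual_tile_props(1)[OF tl(1)] t(1) by auto
 have "(dual_set n A', dual_set n A):tile_edges \<rho>" if "\<rho>:tiles n" "(A, A'):tile_edges (dual_tile n \<rho>)" for \<rho>
 using that dual_edge_mem[OF that(1) dual_subset dual_subset, of A A'] unfolding tile_edges_LE_RE dual_dual[OF sb(1)] dual_dual[OF sb(2)] by blast
 thus False using black_edges[OF t(3-5)] A tl t by blast
 qed
next
 have b: "bottom (dual_tile n te) = dual_set n (top_vertex te)" "top_vertex (dual_tile n te) = dual_set n (bottom te)"
 "tile_vertices (dual_tile n te) = dual_set n ` tile_vertices te" if "te:K" for te
 proof -
 have "te:tiles n" using that sub by blast
 thus "bottom (dual_tile n te) = dual_set n (top_vertex te)" "top_vertex (dual_tile n te) = dual_set n (bottom te)"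
 "tile_vertices (dual_tile n te) = dual_set n ` tile_vertices te" by (rule dual_tile_props)+
 qed
 have sb: "bottom te<={1..n}" "top_vertex te<={1..n}" if "te:K" for te using vertices_subset[of te] that unfolding tile_vertices_def by blast+
 have nv: "dual_set n (bottom te)~:tile_vertices (dual_tile n te') & dual_set n (top_vertex te)~:tile_vertices (dual_tile n te')"
 if "te:K" "te':K" "te' ~= te" for te te'
 proof -
 have "bottom te~:tile_vertices te'" "top_vertex te~:tile_vertices te'" using black_bottom_unique black_top_unique that by metis+
 moreover have "ALL v:tile_vertices te'. v<={1..n}" using vertices_subset that by blast
 ultimately show ?thesis unfolding b(3)[OF that(2)] using dual_inj sb[OF that(1)] by (metis imageE)
 qed
 show "axiom_T3 (dual_tile n ` W) (dual_tile n ` K)"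
 unfolding axiom_T3_def
 proof (intro ballI conjI; clarify)
 fix te te' assume t: "te:K" "te':K" "dual_tile n te' ~= dual_tile n te"
 hence "te' ~= te" by blast
 thus "bottom (dual_tile n te):tile_vertices (dual_tile n te') ==> False" "top_vertex (dual_tile n te):tile_vertices (dual_tile n te') ==> False"
 using nv[OF t(1,2)] b[OF t(1)] by simp_all
 next
 fix te Y Y' assume t: "te:K" "(Y, Y'):edges_of (dual_tile n ` W Un dual_tile n ` K)" "bottom (dual_tile n te):{Y, Y'}"
 have "dual_set n Y'~:tops" using not_from_tops dual_edges[OF t(2)] by blast
 hence "Y' ~= dual_set n (top_vertex te)" using t(1) dual_dual[OF sb(2)[OF t(1)]] by (metis imageI)
 thus "Y = bottom (dual_tile n te)" using t(3) b(1)[OF t(1)] by auto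
 next
 fix te Y Y' assume t: "te:K" "(Y, Y'):edges_of (dual_tile n ` W Un dual_tile n ` K)" "top_vertex (dual_tile n te):{Y, Y'}"
 have "dual_set n Y~:bots" using not_into_bots dual_edges[OF t(2)] by blast
 hence "Y ~= dual_set n (bottom te)" using t(1) dual_dual[OF sb(1)[OF t(1)]] by (metis imageI)
 thus "Y' = top_vertex (dual_tile n te)" using t(3) b(2)[OF t(1)] by auto
 qed
qed

lemma dual_spectrum: "spectrum (dual_tile n ` W) (dual_tile n ` K) = dual_set n ` B"
proof -
 have b: "bottom ` dual_tile n ` K = dual_set n ` tops" "top_vertex ` dual_tile n ` K = dual_set n ` bots"
 unfolding image_image by (rule image_cong[OF refl], use dual_tile_props(3,4) sub(2) in blast)+
 have inj: "inj_on (dual_set n) (Pow {1..n})" using dual_inj unfolding inj_on_def by blast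
 have p: "\<Union> (tile_vertices ` (W Un K))<=Pow {1..n}" using vertices_subset by blast
 have v: "bots Un tops<=Pow {1..n}" using vertices_subset unfolding tile_vertices_def by blast
 have u: "(\<Union>te\<in>dual_tile n ` W Un dual_tile n ` K. tile_vertices te) = dual_set n ` \<Union> (tile_vertices ` (W Un K))"
 using dual_vertices[of "W Un K"] unfolding image_Un by blast
 have "dual_set n ` B = dual_set n ` \<Union> (tile_vertices ` (W Un K)) - dual_set n ` (bots Un tops)"
 unfolding spectrum_def terminal_vertices_def by (rule inj_on_image_set_diff[OF inj]) (use p v in blast)+
 thus ?thesis unfolding spectrum_def terminal_vertices_def u b by (simp add: image_Un Un_commute)
qed

text \<open>On the cube, complementation is the reflection of all coordinates in
  \<open>{1..n}\<close>.\<close>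

lemma dual_complex_homeomorphic: "(\<Union>te\<in>W Un K. cube_square te) homeomorphic (\<Union>te\<in>dual_tile n ` W Un dual_tile n ` K. cube_square te)"
proof -
 define r where "r x = (%l. if l:{1..n} then 1 - x l else x l)" for x :: "nat => real"
 have rr: "r (r x) = x" for x unfolding r_def by auto
 have sq: "r x:cube_square (dual_tile n te)" if xs: "x:cube_square te" "te:tiles n" for x te
 proof -
 obtain X i j where t: "te = Tile X i j" "i < j" "1<=i" "j<=n" "X<={1..n}" "i~:X" "j~:X" using xs(2) by (rule tiles_cases)
 have x: "ALL l. l ~= i --> l ~= j --> x l = indicat_real X l" "0<=x i" "x i<=1" "0<=x j" "x j<=1"
 using xs(1) t cube_square_iff[of i j X x] by auto
 have d: "i ~= j" "i~:dual_set n (insert i (insert j X))" "j~:dual_set n (insert i (insert j X))" using t unfolding dual_set_def by auto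
 show ?thesis unfolding t(1) dual_tile_Tile cube_square_iff[OF d]
 using x t(2-5) unfolding r_def dual_set_def by (auto simp: indicator_def)
 qed
 have c: "continuous_on S r" for S
 proof (rule continuous_on_coordinatewise_then_product)
 fix l
 have c: "continuous_on S (%x :: nat => real. x l)" by (rule continuous_on_subset[OF coord_cont subset_UNIV])
 show "continuous_on S (%x. r x l)" unfolding r_def
 by (cases "l:{1..n}") (simp_all only: if_True if_False continuous_on_diff continuous_on_const c)
 qed
 have i: "r ` (\<Union>te\<in>W Un K. cube_square te) = (\<Union>te\<in>dual_tile n ` W Un dual_tile n ` K. cube_square te)"
 proof (intro equalityI subsetI)
 fix y assume "y:(\<Union>te\<in>dual_tile n ` W Un dual_tile n ` K. cube_square te)"
 then obtain te where te: "te:W Un K" "y:cube_square (dual_tile n te)" by blast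
 hence t: "te:tiles n" using sub by blast
 have "r y:cube_square te" using sq[OF te(2) dual_tile_props(1)[OF t]] dual_tile_props(2)[OF t] by simp
 thus "y:r ` (\<Union>te\<in>W Un K. cube_square te)" using te(1) rr by (intro image_eqI[of _ _ "r y"]) auto
 qed (use sq sub in blast)
 have j: "inj_on r S" for S by (rule inj_on_inverseI[of _ r]) (rule rr)
 have k: "compact (\<Union>te\<in>W Un K. cube_square te)" using fin sub by (intro compact_UN) (auto intro: compact_cube_square)
 show ?thesis by (rule homeomorphic_compact[OF k c i j])
qed

end

section \<open>Combinatorial and geometric tilings\<close>
lemma boundary_LB_RB: "boundary_edges n = LB n Un RB n"
 unfolding boundary_edges_def LB_def RB_def by blast

lemma card_Un_filter: "finite W ==> finite K ==> W Int K = {} ==> card {te:W Un K. P te} = card {te:W. P te} + card {te:K. P te}"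
proof -
 assume a: "finite W" "finite K" "W Int K = {}"
 have "{te:W Un K. P te} = {te:W. P te} Un {te:K. P te}" by blast
 thus ?thesis using a by (simp only:) (rule card_Un_disjoint; force)
qed

lemma card_LE_RE:
 assumes "finite S" "S<=tiles n"
 shows "card {te:S. e:tile_edges te} = card {te:S. e:LE te} + card {te:S. e:RE te}"
proof -
 have "{te:S. e:tile_edges te} = {te:S. e:LE te} Un {te:S. e:RE te}" unfolding tile_edges_LE_RE by blast
 moreover have "{te:S. e:LE te} Int {te:S. e:RE te} = {}" using assms(2) LE_RE_disjoint by blast
 ultimately show ?thesis using assms(1) by (simp only:) (rule card_Un_disjoint; force)
qed

lemma count_total:
 assumes "finite W" "finite K" "W Int K = {}" "W Un K<=tiles n"
 shows "card {te:W Un K. e:tile_edges te} = upc W K e + dnc W K e"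
 using assms card_LE_RE[of W n e] card_LE_RE[of K n e] unfolding card_Un_filter[OF assms(1-3)] upc_def dnc_def by simp

text \<open>By \<open>overlap_iff_same_side\<close>, T2 puts two white tiles at an edge on opposite
  sides and a white and a black one on the same side; inner edges follow by counting. The delicate
  point is that the single tile at a boundary edge is white. A black one would have a boundary edge
  entering its bottom or leaving its top, against T3, unless that end is the empty or the full set;
  \<open>nobot\<close> and \<open>notop\<close> treat these.\<close>

lemma g_tiling_gt:
 assumes n: "2<=n" and gen: "generic_generators n a" and g: "g_tiling n a W K"
 shows "gt n W K"
proof -
 have f: "finite W" "finite K" "W<=tiles n" "K<=tiles n" "W Int K = {}" "W ~= {}" "axiom_T3 W K" "axiom_T2 a W K" "axiom_T1 n a (W Un K)"
 using g unfolding g_tiling_def by auto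
 have tot: "card {te:W Un K. e:tile_edges te} = upc W K e + dnc W K e" for e using count_total f by (metis Un_least)
 have bd: "upc W K e + dnc W K e = 1" if "e:LB n Un RB n" for e
 using f(9) that tot[of e] unfolding axiom_T1_def boundary_LB_RB by auto
 have inn: "upc W K e + dnc W K e = 2" if "e:edges_of (W Un K)" "e~:LB n" "e~:RB n" for e
 using f(9) that tot[of e] unfolding axiom_T1_def boundary_LB_RB by auto
 have side: "overlap a te te' \<longleftrightarrow> (e:LE te \<longleftrightarrow> e:LE te')"
 if "te:W Un K" "te':W Un K" "e:tile_edges te" "e:tile_edges te'" for e te te'
 using overlap_iff_same_side[OF gen, of te te' e] that f(3,4) by blast
 have WW: "te = te'" if "te:W" "te':W" "e:tile_edges te" "e:tile_edges te'" "e:LE te \<longleftrightarrow> e:LE te'" for e te te'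
 proof (rule ccontr)
 assume "te ~= te'"
 hence "~ overlap a te te'" using f(8) that unfolding axiom_T2_def share_edge_def by blast
 thus False using side[of te te' e] that by blast
 qed
 have WK: "e:LE te \<longleftrightarrow> e:LE te'" if "te:W" "te':K" "e:tile_edges te" "e:tile_edges te'" for e te te'
 proof -
 have "overlap a te te'" using f(8) that unfolding axiom_T2_def share_edge_def by blast
 thus ?thesis using side[of te te' e] that by blast
 qed
 have KK: "tile_edges te Int tile_edges te' = {}" if "te:K" "te':K" "te ~= te'" for te te'
 using f(8) that unfolding axiom_T2_def share_edge_def by blast
 have RL: "e:RE te \<longleftrightarrow> e:tile_edges te & e~:LE te" if "te:W Un K" for e te
 using LE_RE_disjoint[of te n] that f(3,4) unfolding tile_edges_LE_RE by blast
 have LT: "e:LE te ==> e:tile_edges te" for e te unfolding tile_edges_LE_RE by blast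
 have le1: "card {te:S. P te}<=1" if "finite S" "!!te te'. te:S ==> te':S ==> P te ==> P te' ==> te = te'" for S and P :: "tile => bool"
 using that by (simp add: card_le_Suc0_iff_eq)
 have c1: "card {te:W. e:LE te}<=1" "card {te:W. e:RE te}<=1" for e
 using WW RL LT f(1) by (intro le1; blast)+
 have ck: "card {te:K. e:LE te} + card {te:K. e:RE te}<=1" for e
 proof -
 have "card {te:K. e:tile_edges te}<=1" by (rule le1[OF f(2)]) (use KK in blast)
 thus ?thesis using card_LE_RE[OF f(2,4), of e] by simp
 qed
 have ne0: "EX te:S. P te" if "card {te:S. P te} ~= 0" for S and P :: "tile => bool"
 using that by (metis (no_types, lifting) Collect_empty_eq card.empty)
 have wk1: "card {te:W. e:LE te} = 0 | card {te:K. e:RE te} = 0" for e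
 using ne0[of W "%te. e:LE te"] ne0[of K "%te. e:RE te"] WK RL LT by blast
 have wk2: "card {te:W. e:RE te} = 0 | card {te:K. e:LE te} = 0" for e
 using ne0[of W "%te. e:RE te"] ne0[of K "%te. e:LE te"] WK RL LT by blast
 have two: "upc W K e = 1 & dnc W K e = 1" if "upc W K e + dnc W K e = 2" for e
 using that c1[of e] ck[of e] wk1[of e] wk2[of e] unfolding upc_def dnc_def by linarith
 have other: "EX te':W. e:tile_edges te' & (e:LE te' \<longleftrightarrow> e:LE te)" if "te:K" "e:tile_edges te" "e~:LB n" "e~:RB n" for e te
 proof -
 have ed: "e:edges_of (W Un K)" using that unfolding edges_of_def by blast
 hence "upc W K e = 1 & dnc W K e = 1" using two inn that by blast
 moreover have "card {te:K. e:LE te} ~= 0 | card {te:K. e:RE te} ~= 0"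
 using that(1,2) f(2) unfolding tile_edges_LE_RE by (auto simp: card_eq_0_iff)
 ultimately have "card {te:W. e:LE te} ~= 0 | card {te:W. e:RE te} ~= 0" using ck[of e] unfolding upc_def dnc_def by linarith
 hence "EX te':W. e:tile_edges te'" using ne0[of W "%te. e:LE te"] ne0[of W "%te. e:RE te"] unfolding tile_edges_LE_RE by blast
 then obtain te' where "te':W" "e:tile_edges te'" by blast
 thus ?thesis using WK[of te' te e] that by blast
 qed
 have noinB: "A' ~= bottom te" "A ~= top_vertex te" if "te:K" "(A, A'):edges_of (W Un K)" for A A' te
 proof -
 have "A ~= A'" using that(2) f(3,4) unfolding edges_of_def by (auto elim!: edge_form[where n = n])
 thus "A' ~= bottom te" "A ~= top_vertex te" using f(7) that unfolding axiom_T3_def by fastforce+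
 qed
 have bde: "e:edges_of (W Un K)" if "e:LB n Un RB n" for e
 proof -
 have "card {te:W Un K. e:tile_edges te} ~= 0" using bd[OF that] tot by simp
 from ne0[OF this] show ?thesis unfolding edges_of_def by blast
 qed
 \<comment> \<open>Here \<open>W ~= {}\<close> enters: for \<open>n = 2\<close> there is only one
   tile.\<close>
 have n2: "K = {}" if "n = 2"
 proof -
 have "te = Tile {} 1 2" if "te:tiles n" for te
 proof -
 obtain X i j where t: "te = Tile X i j" "i < j" "1<=i" "j<=n" "X<={1..n}" "i~:X" "j~:X" using `te:tiles n` by (rule tiles_cases)
 hence "i = 1" "j = 2" using `n = 2` by auto
 moreover have "{1..n} = {1, 2}" using `n = 2` by auto
 ultimately have "X<={1, 2}" "1~:X" "2~:X" using t(5-7) by simp_all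
 hence "X = {}" by (simp add: subset_insert)
 thus ?thesis using t(1) `i = 1` `j = 2` by simp
 qed
 thus ?thesis using f by blast
 qed
 have tK: "i < j & 1<=i & j<=n & X<={1..n} & i~:X & j~:X" if "Tile X i j:K" for X i j using subsetD[OF f(4) that] unfolding Tile_in_tiles .
 have sameT: "te' ~= te" if "te':W" "te:K" for te te' using that f(5) by blast
 \<comment> \<open>One upper edge of the black tile is an inner edge, so a white tile lies on the
   same side of it. The extreme label leaves only the black tile itself.\<close>
 have nobot: "~ (Tile {} p m:K & (p = 1 | m = n))" for p m
 proof
 assume k: "Tile {} p m:K & (p = 1 | m = n)"
 hence t: "Tile {} p m:K" "p < m" "1<=p" "m<=n" using tK by auto
 have n3: "n ~= 2" using n2 t by auto
 from k have "p = 1 | m = n" by blast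
 thus False
 proof
 assume p: "p = 1"
 let ?e = "({m}, insert 1 {m})"
 have e: "?e:RE (Tile {} p m)" unfolding RE_Tile p by simp
 have "?e~:LB n" using LB_not_RE[of ?e n "Tile {} p m"] e t f by blast
 moreover have "?e~:RB n"
 proof
 assume "?e:RB n"
 then obtain i where i: "{m} = {i + 1..n}" "insert 1 {m} = {i..n}" "1<=i" "i<=n" unfolding RB_def by auto
 have "1:{i..n}" using i(2) by blast
 hence "i = 1" using i(3) by simp
 hence "2:{m}" "n:{m}" using i(1) n by auto
 thus False using n3 by simp
 qed
 ultimately obtain te' where te': "te':W" "?e:RE te'" using other[OF t(1), of ?e] e RL[of _ ?e] t(1) by blast
 have "te':tiles n" using te' f by blast
 moreover have "1~:{m}" using t p by simp
 ultimately show False using te'(2)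
 proof (rule_tac RE_cases[of "{m}" 1 te' n])
 fix c assume "te' = Tile ({m} - {c}) 1 c" "c:{m}"
 hence "te' = Tile {} p m" using p by simp
 thus False using sameT te'(1) t(1) by blast
 next
 fix m' assume "te' = Tile {m} m' 1" "m' < 1"
 thus False using `te':tiles n` by (simp add: Tile_in_tiles)
 qed
 next
 assume p: "m = n"
 let ?e = "({p}, insert n {p})"
 have e: "?e:LE (Tile {} p m)" unfolding LE_Tile p by auto
 have "?e~:RB n" using RB_not_LE[of ?e n "Tile {} p m"] e t f by blast
 moreover have "?e~:LB n"
 proof
 assume "?e:LB n"
 then obtain i where i: "{p} = {1..i - 1}" "insert n {p} = {1..i}" "1<=i" "i<=n" unfolding LB_def by auto
 have "n:{1..i}" using i(2) by blast
 hence "i = n" using i(4) by simp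
 hence "1:{p}" "n - 1:{p}" using i(1) n by auto
 thus False using n3 by simp
 qed
 ultimately obtain te' where te': "te':W" "?e:LE te'" using other[OF t(1), of ?e] e LT by blast
 have tt: "te':tiles n" using te' f by blast
 have np: "n~:{p}" using t p by simp
 from te'(2) np tt show False
 proof (rule LE_cases)
 fix c assume "te' = Tile ({p} - {c}) c n" "c:{p}"
 hence "te' = Tile {} p m" using p by simp
 thus False using sameT te'(1) t(1) by blast
 next
 fix m' assume "te' = Tile {p} n m'" "n < m'"
 thus False using tt by (simp add: Tile_in_tiles)
 qed
 qed
 qed
 \<comment> \<open>The same with a lower edge: since the top is the full set, the labels of the
   white partner are forced.\<close>
 have notop: "~ (Tile X p m:K & insert p (insert m X) = {1..n} & (p = 1 | m = n))" for X p m
 proof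
 assume k: "Tile X p m:K & insert p (insert m X) = {1..n} & (p = 1 | m = n)"
 hence t: "Tile X p m:K" "p < m" "1<=p" "m<=n" "p~:X" "m~:X" "X<={1..n}" and full: "insert p (insert m X) = {1..n}" using tK by auto
 have n3: "n ~= 2" using n2 t by auto
 have mem: "l:X \<longleftrightarrow> 1<=l & l<=n & l ~= p & l ~= m" for l using full t by (metis atLeastAtMost_iff insert_iff)
 from k have "p = 1 | m = n" by blast
 thus False
 proof
 assume p: "m = n"
 let ?e = "(X, insert n X)"
 have e: "?e:RE (Tile X p m)" unfolding RE_Tile p by simp
 have "?e~:LB n" using LB_not_RE[of ?e n "Tile X p m"] e t f by blast
 moreover have "?e~:RB n"
 proof
 assume "?e:RB n"
 then obtain i where i: "X = {i + 1..n}" "insert n X = {i..n}" "1<=i" "i<=n" unfolding RB_def by auto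
 have "n~:{i + 1..n}" using t(6) p i(1) by simp
 hence "X = {}" using i by auto
 thus False using mem[of 1] mem[of 2] t p n n3 by auto
 qed
 ultimately obtain te' where te': "te':W" "?e:RE te'" using other[OF t(1), of ?e] e RL[of _ ?e] t(1) by blast
 have tt: "te':tiles n" using te' f by blast
 have np: "n~:X" using t p by simp
 from te'(2) np tt show False
 proof (rule RE_cases)
 fix m' assume m': "te' = Tile X m' n" "m' < n"
 hence "m'~:X" "1<=m'" using tt by (auto simp: Tile_in_tiles)
 hence "m' = p" using mem[of m'] m' p by auto
 thus False using sameT te'(1) t(1) m' p by blast
 next
 fix c assume "te' = Tile (X - {c}) n c" "n < c"
 thus False using tt by (simp add: Tile_in_tiles)
 qed
 next
 assume p: "p = 1"
 let ?e = "(X, insert 1 X)"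
 have e: "?e:LE (Tile X p m)" unfolding LE_Tile p by simp
 have "?e~:RB n" using RB_not_LE[of ?e n "Tile X p m"] e t f by blast
 moreover have "?e~:LB n"
 proof
 assume "?e:LB n"
 then obtain i where i: "X = {1..i - 1}" "insert 1 X = {1..i}" "1<=i" "i<=n" unfolding LB_def by auto
 have "1~:{1..i - 1}" using t(5) p i(1) by simp
 hence "X = {}" using i by auto
 thus False using mem[of n] mem[of 2] t p n n3 by auto
 qed
 ultimately obtain te' where te': "te':W" "?e:LE te'" using other[OF t(1), of ?e] e LT by blast
 have tt: "te':tiles n" using te' f by blast
 have np: "1~:X" using t p by simp
 from te'(2) np tt show False
 proof (rule LE_cases)
 fix m' assume m': "te' = Tile X 1 m'" "1 < m'"
 hence "m'~:X" "m'<=n" using tt by (auto simp: Tile_in_tiles)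
 hence "m' = m" using mem[of m'] m' p by auto
 thus False using sameT te'(1) t(1) m' p by blast
 next
 fix c assume "te' = Tile (X - {c}) c 1" "c < 1"
 thus False using tt by (simp add: Tile_in_tiles)
 qed
 qed
 qed
 have noLB: "e~:LE te" if e: "e:LB n" and te: "te:K" for e te
 proof
 assume L: "e:LE te"
 obtain i where i: "e = ({1..i - 1}, {1..i})" "1<=i" "i<=n" using e unfolding LB_def by auto
 have ins: "{1..i} = insert i {1..i - 1}" using i by auto
 have tt: "te:tiles n" using te f by blast
 have "({1..i - 1}, insert i {1..i - 1}):LE te" using L i ins by simp
 moreover have "i~:{1..i - 1}" using i by auto
 ultimately show False using tt
 proof (rule LE_cases)
 fix m assume m: "te = Tile {1..i - 1} i m" "i < m"
 show False
 proof (cases "i = 1")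
 case True
 thus ?thesis using nobot[of 1 m] m te by simp
 next
 case False
 hence "({1..i - 1 - 1}, {1..i - 1}):LB n" using i unfolding LB_def by (intro CollectI exI[of _ "i - 1"]) auto
 thus ?thesis using noinB(1)[OF te] bde m by fastforce
 qed
 next
 fix c assume c: "te = Tile ({1..i - 1} - {c}) c i" "c:{1..i - 1}"
 have tp: "insert c (insert i ({1..i - 1} - {c})) = {1..i}" using c(2) i by auto
 show False
 proof (cases "i = n")
 case True
 thus ?thesis using notop[of "{1..i - 1} - {c}" c i] tp c te by simp
 next
 case False
 hence "({1..i}, {1..i + 1}):LB n" using i unfolding LB_def by (intro CollectI exI[of _ "i + 1"]) auto
 thus ?thesis using noinB(2)[OF te] bde[of "({1..i}, {1..i + 1})"] tp c(1) by (metis Un_iff top_Tile)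
 qed
 qed
 qed
 have noRB: "e~:RE te" if e: "e:RB n" and te: "te:K" for e te
 proof
 assume L: "e:RE te"
 obtain i where i: "e = ({i + 1..n}, {i..n})" "1<=i" "i<=n" using e unfolding RB_def by auto
 have ins: "{i..n} = insert i {i + 1..n}" using i by auto
 have tt: "te:tiles n" using te f by blast
 have "({i + 1..n}, insert i {i + 1..n}):RE te" using L i ins by simp
 moreover have "i~:{i + 1..n}" by auto
 ultimately show False using tt
 proof (rule RE_cases)
 fix m assume m: "te = Tile {i + 1..n} m i" "m < i"
 show False
 proof (cases "i = n")
 case True
 thus ?thesis using nobot[of m n] m te by simp
 next
 case False
 hence "({i + 1 + 1..n}, {i + 1..n}):RB n" using i unfolding RB_def by (intro CollectI exI[of _ "i + 1"]) auto
 thus ?thesis using noinB(1)[OF te] bde[of "({i + 1 + 1..n}, {i + 1..n})"] m by (metis Un_iff bottom_Tile)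
 qed
 next
 fix c assume c: "te = Tile ({i + 1..n} - {c}) i c" "c:{i + 1..n}"
 have tp: "insert i (insert c ({i + 1..n} - {c})) = {i..n}" using c(2) i by auto
 show False
 proof (cases "i = 1")
 case True
 thus ?thesis using notop[of "{i + 1..n} - {c}" i c] tp c te by simp
 next
 case False
 hence "({i..n}, {i - 1..n}):RB n" using i unfolding RB_def by (intro CollectI exI[of _ "i - 1"]) auto
 thus ?thesis using noinB(2)[OF te] bde[of "({i..n}, {i - 1..n})"] tp c(1) by (metis Un_iff top_Tile)
 qed
 qed
 qed
 have e0: "card {te:S. P te} = 0" if "!!te. te:S ==> ~ P te" for S and P :: "tile => bool" using that by (metis (no_types, lifting) Collect_empty_eq card.empty)
 show ?thesis
 proof (rule gt.intro)
 show "2<=n" "finite W" "finite K" "W<=tiles n" "K<=tiles n" "W Int K = {}" "axiom_T3 W K" using n f by auto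
 show "tile_edges te Int tile_edges te' = {}" if "te:K" "te':K" "te ~= te'" for te te' by (rule KK[OF that])
 fix e
 show "upc W K e = 0 & dnc W K e = 1" if e: "e:LB n"
 proof -
 have "upc W K e = 0" unfolding upc_def using e0[of W "%te. e:RE te"] e0[of K "%te. e:LE te"] noLB[OF e] LB_not_RE[OF e] f by auto
 thus ?thesis using bd[of e] e by simp
 qed
 show "upc W K e = 1 & dnc W K e = 0" if e: "e:RB n"
 proof -
 have "dnc W K e = 0" unfolding dnc_def using e0[of W "%te. e:LE te"] e0[of K "%te. e:RE te"] noRB[OF e] RB_not_LE[OF e] f by auto
 thus ?thesis using bd[of e] e by simp
 qed
 show "upc W K e = dnc W K e & upc W K e<=1" if ne: "e~:LB n" "e~:RB n"
 proof (cases "e:edges_of (W Un K)")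
 case True
 thus ?thesis using two[OF inn[OF True ne]] by simp
 next
 case False
 hence "e~:LE te & e~:RE te" if "te:W Un K" for te using that unfolding edges_of_def tile_edges_LE_RE by blast
 hence "upc W K e = 0" "dnc W K e = 0" unfolding upc_def dnc_def using e0[of W "%te. e:LE te"] e0[of K "%te. e:RE te"] e0[of W "%te. e:RE te"] e0[of K "%te. e:LE te"] by auto
 thus ?thesis by simp
 qed
 qed
qed

lemma gt_g_tiling:
 assumes gen: "generic_generators n a" and g: "gt n W K" and T4: "axiom_T4 (W Un K)"
 shows "g_tiling n a W K"
proof -
 interpret gt n W K by (rule g)
 have "({}, {1}):LB n" using n2 unfolding LB_def by (intro CollectI exI[of _ 1]) auto
 hence "dnc W K ({}, {1}) = 1" using atLB by blast
 have tl: "W Un K<=tiles n" using sub by blast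
 \<comment> \<open>A left boundary edge is never a right edge of a tile, so the one tile counted
   there is white.\<close>
 have W0: "W ~= {}"
 proof
 assume "W = {}"
 hence "card {te:K. ({}, {1}):RE te} = 1" using `dnc W K ({}, {1}) = 1` unfolding dnc_def by simp
 then obtain te where "te:K" "({}, {1}):RE te" by (metis (no_types, lifting) Collect_empty_eq card.empty zero_neq_one)
 thus False using LB_not_RE `({}, {1}):LB n` sub by blast
 qed
 have T1: "axiom_T1 n a (W Un K)"
 unfolding axiom_T1_def boundary_LB_RB
 proof (intro conjI ballI impI)
 fix te assume "te:W Un K"
 thus "tile_region a te<=zonogon n a" using region_in_zonogon[OF gen] tl by blast
 next
 fix e assume "e:LB n Un RB n"
 thus "card {te:W Un K. e:tile_edges te} = 1" using count_total[OF fin disj tl, of e] atLB[of e] atRB[of e] by auto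
 next
 fix e assume "e:edges - (LB n Un RB n)"
 thus "card {te:W Un K. e:tile_edges te} = 2" using count_total[OF fin disj tl, of e] upc_1[of e] dnc_1[of e] by auto
 next
 fix te te' assume "te:W Un K" "te':W Un K" "te ~= te'"
 thus "tile_region a te ~= tile_region a te'" using region_inj[OF gen] tl by blast
 qed
 have RL: "e:RE te \<longleftrightarrow> e~:LE te" if "te:W Un K" "e:tile_edges te" for e te
 using LE_RE_disjoint[of te n] that tl unfolding tile_edges_LE_RE by blast
 have side: "overlap a te te' \<longleftrightarrow> (e:LE te \<longleftrightarrow> e:LE te')"
 if "te:W Un K" "te':W Un K" "e:tile_edges te" "e:tile_edges te'" for e te te'
 using overlap_iff_same_side[OF gen, of te te' e] that tl by blast
 have ed: "e:edges" if "te:W Un K" "e:tile_edges te" for e te using that unfolding edges_of_def by blast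
 have T2: "axiom_T2 a W K"
 unfolding axiom_T2_def
 proof (intro conjI ballI impI)
 fix te te' assume t: "te:W" "te':W" "te ~= te' & share_edge te te'"
 then obtain e where e: "e:tile_edges te" "e:tile_edges te'" unfolding share_edge_def by blast
 have u: "te:W Un K" "te':W Un K" using t by blast+
 show "~ overlap a te te'" using side[OF u e] dnc_unique[OF ed[OF u(1) e(1)] t(1,2)] upc_unique[OF ed[OF u(1) e(1)] t(1,2)] RL[OF u(1) e(1)] RL[OF u(2) e(2)] t(3) by blast
 next
 fix te te' assume t: "te:W" "te':K" "share_edge te te'"
 then obtain e where e: "e:tile_edges te" "e:tile_edges te'" unfolding share_edge_def by blast
 have u: "te:W Un K" "te':W Un K" using t by blast+
 show "overlap a te te'" using side[OF u e] not_both_dn[OF ed[OF u(1) e(1)] t(1) _ t(2)] not_both_up[OF ed[OF u(1) e(1)] t(1) _ t(2)] RL[OF u(1) e(1)] RL[OF u(2) e(2)] by blast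
 next
 fix te te' assume t: "te:K" "te':K" "te ~= te'"
 thus "~ share_edge te te'" using black_edges unfolding share_edge_def by blast
 qed
 show ?thesis unfolding g_tiling_def using fin tl disj W0 T1 T2 T3 T4 by blast
qed

section \<open>The standard tiling\<close>
lemma std_LE:
 assumes "r~:A"
 shows "te:std_tiles n & (A, insert r A):LE te \<longleftrightarrow>
 (EX m. A = {r + 1..m - 1} & 1<=r & r < m & m<=n & te = Tile A r m) |
 (EX c. A = {c..r - 1} & 1<=c & c < r & r<=n & te = Tile (A - {c}) c r)"
proof
 assume a: "te:std_tiles n & (A, insert r A):LE te"
 then obtain p q where t: "te = Tile {p + 1..q - 1} p q" "1<=p" "p < q" "q<=n" unfolding std_tiles_def by blast
 hence tt: "te:tiles n" by (auto simp: Tile_in_tiles)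
 from a have "(A, insert r A):LE te" by blast
 thus "(EX m. A = {r + 1..m - 1} & 1<=r & r < m & m<=n & te = Tile A r m) |
 (EX c. A = {c..r - 1} & 1<=c & c < r & r<=n & te = Tile (A - {c}) c r)" using assms tt
 proof (rule LE_cases)
 fix m assume "te = Tile A r m"
 thus ?thesis using t by (intro disjI1 exI[of _ q]) auto
 next
 fix c assume c: "te = Tile (A - {c}) c r" "c:A" "c < r"
 hence e: "A - {c} = {c + 1..r - 1}" "c = p" "r = q" using t by auto
 have "A = insert c (A - {c})" using c(2) by blast
 also have "\<dots> = {c..r - 1}" unfolding e(1) using c(3) by auto
 finally show ?thesis using t c e by (intro disjI2 exI[of _ c]) simp
 qed
next
 assume "(EX m. A = {r + 1..m - 1} & 1<=r & r < m & m<=n & te = Tile A r m) |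
 (EX c. A = {c..r - 1} & 1<=c & c < r & r<=n & te = Tile (A - {c}) c r)"
 thus "te:std_tiles n & (A, insert r A):LE te"
 proof (elim disjE exE conjE)
 fix m assume "A = {r + 1..m - 1}" "1<=r" "r < m" "m<=n" "te = Tile A r m"
 thus ?thesis unfolding std_tiles_def by (auto simp: LE_I1)
 next
 fix c assume c: "A = {c..r - 1}" "1<=c" "c < r" "r<=n" "te = Tile (A - {c}) c r"
 have "A - {c} = {c + 1..r - 1}" "c:A" using c by auto
 hence "te = Tile {c + 1..r - 1} c r" using c(5) by simp
 hence "te:std_tiles n" unfolding std_tiles_def using c(2-4) by (intro CollectI exI[of _ c] exI[of _ r]) simp
 moreover have "(A, insert r A):LE te" unfolding c(5) by (rule LE_I2[OF `c:A`])
 ultimately show ?thesis by blast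
 qed
qed

lemma std_RE:
 assumes "r~:A"
 shows "te:std_tiles n & (A, insert r A):RE te \<longleftrightarrow>
 (EX m. A = {m + 1..r - 1} & 1<=m & m < r & r<=n & te = Tile A m r) |
 (EX c. A = {r + 1..c} & 1<=r & r < c & c<=n & te = Tile (A - {c}) r c)"
proof
 assume a: "te:std_tiles n & (A, insert r A):RE te"
 then obtain p q where t: "te = Tile {p + 1..q - 1} p q" "1<=p" "p < q" "q<=n" unfolding std_tiles_def by blast
 hence tt: "te:tiles n" by (auto simp: Tile_in_tiles)
 from a have "(A, insert r A):RE te" by blast
 thus "(EX m. A = {m + 1..r - 1} & 1<=m & m < r & r<=n & te = Tile A m r) |
 (EX c. A = {r + 1..c} & 1<=r & r < c & c<=n & te = Tile (A - {c}) r c)" using assms tt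
 proof (rule RE_cases)
 fix m assume "te = Tile A m r"
 thus ?thesis using t by (intro disjI1 exI[of _ p]) auto
 next
 fix c assume c: "te = Tile (A - {c}) r c" "c:A" "r < c"
 hence e: "A - {c} = {r + 1..c - 1}" "c = q" "r = p" using t by auto
 have "A = insert c (A - {c})" using c(2) by blast
 also have "\<dots> = {r + 1..c}" unfolding e(1) using c(3) by auto
 finally show ?thesis using t c e by (intro disjI2 exI[of _ c]) simp
 qed
next
 assume "(EX m. A = {m + 1..r - 1} & 1<=m & m < r & r<=n & te = Tile A m r) |
 (EX c. A = {r + 1..c} & 1<=r & r < c & c<=n & te = Tile (A - {c}) r c)"
 thus "te:std_tiles n & (A, insert r A):RE te"
 proof (elim disjE exE conjE)
 fix m assume m: "A = {m + 1..r - 1}" "1<=m" "m < r" "r<=n" "te = Tile A m r"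
 have "te:std_tiles n" unfolding std_tiles_def m(5) using m(1-4) by (intro CollectI exI[of _ m] exI[of _ r]) simp
 moreover have "(A, insert r A):RE te" unfolding m(5) by (rule RE_I1)
 ultimately show ?thesis by blast
 next
 fix c assume c: "A = {r + 1..c}" "1<=r" "r < c" "c<=n" "te = Tile (A - {c}) r c"
 have "A - {c} = {r + 1..c - 1}" "c:A" using c by auto
 hence "te = Tile {r + 1..c - 1} r c" using c(5) by simp
 hence "te:std_tiles n" unfolding std_tiles_def using c(2-4) by (intro CollectI exI[of _ r] exI[of _ c]) simp
 moreover have "(A, insert r A):RE te" unfolding c(5) by (rule RE_I2[OF `c:A`])
 ultimately show ?thesis by blast
 qed
qed

text \<open>An edge with label \<open>r\<close> starts at the empty set, at an interval beginning
  right after \<open>r\<close> or at one ending right before \<open>r\<close>. For each shape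
  \<open>emp\<close>, \<open>typ1\<close> and \<open>typ2\<close> give the at most one tile on
  either side.\<close>

lemma std_gt:
 assumes n: "2<=n"
 shows "gt n (std_tiles n) {}"
proof -
 have tl: "std_tiles n<=tiles n" unfolding std_tiles_def by (auto simp: Tile_in_tiles)
 have fin: "finite (std_tiles n)"
 proof (rule finite_subset)
 show "std_tiles n<=(%z. Tile {fst z + 1..snd z - 1} (fst z) (snd z)) ` ({1..n} \<times> {1..n})"
 proof
 fix te assume "te:std_tiles n"
 then obtain p q where "te = Tile {p + 1..q - 1} p q" "1<=p" "p < q" "q<=n" unfolding std_tiles_def by blast
 thus "te:(%z. Tile {fst z + 1..snd z - 1} (fst z) (snd z)) ` ({1..n} \<times> {1..n})" by (intro image_eqI[of _ _ "(p, q)"]) auto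
 qed
 qed simp
 have iv: "x = x' & y = y'" if "{x..y} = {x'..y'}" "x<=y" for x y x' y' :: nat using that Icc_eq_Icc[of x y x' y'] by auto
 let ?L = "%A r. {te:std_tiles n. (A, insert r A):LE te}" and ?R = "%A r. {te:std_tiles n. (A, insert r A):RE te}"
 have emp: "?L {} r = (if 1<=r & r < n then {Tile {} r (r + 1)} else {})" "?R {} r = (if 1 < r & r<=n then {Tile {} (r - 1) r} else {})" for r
 proof -
 have "te:?L {} r \<longleftrightarrow> 1<=r & r < n & te = Tile {} r (r + 1)" for te
 proof -
 have "{} = {r + 1..m - 1} \<longleftrightarrow> m<=r + 1" for m by auto
 moreover have "{} = {c..r - 1} \<longleftrightarrow> r - 1 < c" for c by auto
 ultimately have "te:?L {} r \<longleftrightarrow> (EX m. m<=r + 1 & 1<=r & r < m & m<=n & te = Tile {} r m) | (EX c. r - 1 < c & 1<=c & c < r & r<=n & te = Tile ({} - {c}) c r)"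
 using std_LE[of r "{}" te n] by simp
 also have "\<dots> \<longleftrightarrow> 1<=r & r < n & te = Tile {} r (r + 1)"
 proof
 assume "(EX m. m<=r + 1 & 1<=r & r < m & m<=n & te = Tile {} r m) | (EX c. r - 1 < c & 1<=c & c < r & r<=n & te = Tile ({} - {c}) c r)"
 thus "1<=r & r < n & te = Tile {} r (r + 1)"
 proof (elim disjE exE conjE)
 fix m assume "m<=r + 1" "1<=r" "r < m" "m<=n" "te = Tile {} r m"
 moreover have "m = r + 1" using calculation by linarith
 ultimately show ?thesis by simp
 next
 fix c assume "r - 1 < c" "c < r"
 thus ?thesis by linarith
 qed
 qed (intro disjI1 exI[of _ "r + 1"], auto)
 finally show ?thesis .
 qed
 thus "?L {} r = (if 1<=r & r < n then {Tile {} r (r + 1)} else {})" by (intro set_eqI) simp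
 have "te:?R {} r \<longleftrightarrow> 1 < r & r<=n & te = Tile {} (r - 1) r" for te
 proof -
 have "{} = {m + 1..r - 1} \<longleftrightarrow> r<=m + 1" for m by auto
 moreover have "{} = {r + 1..c} \<longleftrightarrow> c<=r" for c by auto
 ultimately have "te:?R {} r \<longleftrightarrow> (EX m. r<=m + 1 & 1<=m & m < r & r<=n & te = Tile {} m r)"
 using std_RE[of r "{}" te n] by auto
 also have "\<dots> \<longleftrightarrow> 1 < r & r<=n & te = Tile {} (r - 1) r"
 proof
 assume "EX m. r<=m + 1 & 1<=m & m < r & r<=n & te = Tile {} m r"
 then obtain m where "r<=m + 1" "1<=m" "m < r" "r<=n" "te = Tile {} m r" by blast
 moreover have "m = r - 1" using calculation by linarith
 ultimately show "1 < r & r<=n & te = Tile {} (r - 1) r" by simp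
 qed (intro exI[of _ "r - 1"], auto)
 finally show ?thesis .
 qed
 thus "?R {} r = (if 1 < r & r<=n then {Tile {} (r - 1) r} else {})" by (intro set_eqI) simp
 qed
 have typ1: "?L {r + 1..y} r = (if 1<=r & y < n then {Tile {r + 1..y} r (y + 1)} else {})" "?R {r + 1..y} r = (if 1<=r & y<=n then {Tile ({r + 1..y} - {y}) r y} else {})"
 if y: "r < y" for r y
 proof -
 have "te:?L {r + 1..y} r \<longleftrightarrow> 1<=r & y < n & te = Tile {r + 1..y} r (y + 1)" for te
 proof -
 have 1: "{r + 1..y} = {r + 1..m - 1} \<longleftrightarrow> y = m - 1" for m using iv[of "r + 1" y "r + 1" "m - 1"] y by auto
 have 2: "~ ({r + 1..y} = {c..r - 1} & c < r)" for c using iv[of "r + 1" y c "r - 1"] y by auto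
 have r: "r~:{r + 1..y}" by simp
 show ?thesis using std_LE[OF r, of te n] 2 unfolding 1 using y by auto
 qed
 thus "?L {r + 1..y} r = (if 1<=r & y < n then {Tile {r + 1..y} r (y + 1)} else {})" by (intro set_eqI) simp
 have "te:?R {r + 1..y} r \<longleftrightarrow> 1<=r & y<=n & te = Tile ({r + 1..y} - {y}) r y" for te
 proof -
 have 1: "{r + 1..y} = {r + 1..c} \<longleftrightarrow> y = c" for c using iv[of "r + 1" y "r + 1" c] y by auto
 have 2: "~ ({r + 1..y} = {m + 1..r - 1} & m < r)" for m using iv[of "r + 1" y "m + 1" "r - 1"] y by auto
 have r: "r~:{r + 1..y}" by simp
 show ?thesis using std_RE[OF r, of te n] 2 unfolding 1 using y by auto
 qed
 thus "?R {r + 1..y} r = (if 1<=r & y<=n then {Tile ({r + 1..y} - {y}) r y} else {})" by (intro set_eqI) simp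
 qed
 have typ2: "?L {x..r - 1} r = (if 1<=x & r<=n then {Tile ({x..r - 1} - {x}) x r} else {})" "?R {x..r - 1} r = (if 1 < x & r<=n then {Tile {x..r - 1} (x - 1) r} else {})"
 if x: "x < r" for r x
 proof -
 have xr: "x<=r - 1" "r~:{x..r - 1}" using x by auto
 have "te:?L {x..r - 1} r \<longleftrightarrow> 1<=x & r<=n & te = Tile ({x..r - 1} - {x}) x r" for te
 proof -
 have 1: "{x..r - 1} = {c..r - 1} \<longleftrightarrow> x = c" for c using iv[of x "r - 1" c "r - 1"] xr by auto
 have 2: "{x..r - 1} ~= {r + 1..m - 1}" for m using iv[of x "r - 1" "r + 1" "m - 1"] xr x by auto
 show ?thesis using std_LE[OF xr(2), of te n] 2 unfolding 1 using x by auto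
 qed
 thus "?L {x..r - 1} r = (if 1<=x & r<=n then {Tile ({x..r - 1} - {x}) x r} else {})" by (intro set_eqI) simp
 have "te:?R {x..r - 1} r \<longleftrightarrow> 1 < x & r<=n & te = Tile {x..r - 1} (x - 1) r" for te
 proof -
 have 1: "{x..r - 1} = {m + 1..r - 1} \<longleftrightarrow> x = m + 1" for m using iv[of x "r - 1" "m + 1" "r - 1"] xr by auto
 have 2: "{x..r - 1} ~= {r + 1..c}" for c using iv[of x "r - 1" "r + 1" c] xr x by auto
 show ?thesis using std_RE[OF xr(2), of te n] 2 unfolding 1 using x by auto
 qed
 thus "?R {x..r - 1} r = (if 1 < x & r<=n then {Tile {x..r - 1} (x - 1) r} else {})" by (intro set_eqI) simp
 qed
 have cnt: "upc (std_tiles n) {} e = card {te:std_tiles n. e:RE te}" "dnc (std_tiles n) {} e = card {te:std_tiles n. e:LE te}" for e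
 unfolding upc_def dnc_def by simp_all
 show ?thesis
 proof (rule gt.intro)
 show "2<=n" "finite (std_tiles n)" "finite {}" "std_tiles n<=tiles n" "{}<=tiles n" "std_tiles n Int {} = {}" using n fin tl by auto
 show "axiom_T3 (std_tiles n) {}" unfolding axiom_T3_def by simp
 fix e
 show "upc (std_tiles n) {} e = 0 & dnc (std_tiles n) {} e = 1" if lb: "e:LB n"
 proof -
 obtain i where i: "e = ({1..i - 1}, {1..i})" "1<=i" "i<=n" using lb unfolding LB_def by auto
 have e: "e = ({1..i - 1}, insert i {1..i - 1})" using i by auto
 show ?thesis
 proof (cases "i = 1")
 case True
 have e1: "e = ({}, insert 1 {})" using e True by simp
 show ?thesis unfolding cnt e1 emp using n by simp
 next
 case False
 hence "1 < i" using i by simp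
 thus ?thesis unfolding cnt e typ2[OF `1 < i`] using i by simp
 qed
 qed
 show "upc (std_tiles n) {} e = 1 & dnc (std_tiles n) {} e = 0" if rb: "e:RB n"
 proof -
 obtain i where i: "e = ({i + 1..n}, {i..n})" "1<=i" "i<=n" using rb unfolding RB_def by auto
 have e: "e = ({i + 1..n}, insert i {i + 1..n})" using i by auto
 show ?thesis
 proof (cases "i = n")
 case True
 have e1: "e = ({}, insert n {})" using e True by simp
 show ?thesis unfolding cnt e1 emp using n by simp
 next
 case False
 hence "i < n" using i by simp
 thus ?thesis unfolding cnt e typ1[OF `i < n`] using i by simp
 qed
 qed
 show "upc (std_tiles n) {} e = dnc (std_tiles n) {} e & upc (std_tiles n) {} e<=1" if ne: "e~:LB n" "e~:RB n"
 proof (cases "EX te:std_tiles n. e:tile_edges te")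
 case False
 hence "{te:std_tiles n. e:LE te} = {}" "{te:std_tiles n. e:RE te} = {}" unfolding tile_edges_LE_RE by blast+
 hence "card {te:std_tiles n. e:LE te} = 0" "card {te:std_tiles n. e:RE te} = 0" by (simp_all only: card.empty)
 thus ?thesis unfolding cnt by linarith
 next
 case True
 then obtain te where te: "te:std_tiles n" "e:tile_edges te" by blast
 obtain A r where e: "e = (A, insert r A)" "r~:A" using edge_form[of te n e] te tl by blast
 consider "A = {}" | y where "A = {r + 1..y}" "r < y" | x where "A = {x..r - 1}" "x < r"
 proof -
 have "(A, insert r A):LE te | (A, insert r A):RE te" using te(2) unfolding e(1) tile_edges_LE_RE by blast
 hence "(EX m. A = {r + 1..m}) | (EX x. A = {x..r - 1})" using std_LE[OF e(2), of te n] std_RE[OF e(2), of te n] te(1) by blast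
 thus ?thesis
 proof (elim disjE exE)
 fix m assume m: "A = {r + 1..m}"
 show ?thesis by (cases "r < m") (use m that in auto)
 next
 fix x assume x: "A = {x..r - 1}"
 show ?thesis
 proof (cases "x < r")
 case True
 thus ?thesis using x that(3) by blast
 next
 case False
 show ?thesis
 proof (cases "r = 0 & x = 0")
 case True
 hence "r:A" using x by simp
 thus ?thesis using e(2) by blast
 next
 case False
 hence "A = {}" using x `~ x < r` by auto
 thus ?thesis by (rule that(1))
 qed
 qed
 qed
 qed
 thus ?thesis
 proof cases
 case 1
 have e1: "e = ({}, insert r {})" using e 1 by simp
 have "r ~= 1" using ne(1) n unfolding e1 LB_def by (auto dest!: spec[of _ 1])
 moreover have "r ~= n" using ne(2) n unfolding e1 RB_def by (auto dest!: spec[of _ n])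
 ultimately show ?thesis unfolding cnt e1 emp by auto
 next
 case 2
 have e1: "e = ({r + 1..y}, insert r {r + 1..y})" using e 2 by simp
 have "~ (1<=r & y = n)"
 proof
 assume a: "1<=r & y = n"
 hence "e = ({r + 1..n}, {r..n})" using e1 2(2) by auto
 thus False using ne(2) a 2(2) unfolding RB_def by auto
 qed
 thus ?thesis unfolding cnt e1 typ1[OF 2(2)] by auto
 next
 case 3
 have e1: "e = ({x..r - 1}, insert r {x..r - 1})" using e 3 by simp
 have "~ (x = 1 & r<=n)"
 proof
 assume a: "x = 1 & r<=n"
 hence "e = ({1..r - 1}, {1..r})" using e1 3(2) by auto
 thus False using ne(1) a 3(2) unfolding LB_def by auto
 qed
 thus ?thesis unfolding cnt e1 typ2[OF 3(2)] by auto
 qed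
 qed
 qed simp
qed

lemma std_spectrum:
 assumes n: "2<=n"
 shows "spectrum (std_tiles n) {} = intervals n"
proof (intro equalityI subsetI)
 fix v assume "v:spectrum (std_tiles n) {}"
 then obtain te where "te:std_tiles n" "v:tile_vertices te" unfolding spectrum_def by auto
 then obtain p q where t: "1<=p" "p < q" "q<=n" "v:tile_vertices (Tile {p + 1..q - 1} p q)" unfolding std_tiles_def by blast
 have e: "insert p {p + 1..q - 1} = {p..q - 1}" "insert q {p + 1..q - 1} = {p + 1..q}" "insert p {p + 1..q} = {p..q}" using t by auto
 have "tile_vertices (Tile {p + 1..q - 1} p q) = {{p + 1..q - 1}, {p..q - 1}, {p + 1..q}, {p..q}}" unfolding tile_vertices_def by (simp only: bottom_Tile left_Tile right_Tile top_Tile e)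
 then consider "v = {p + 1..q - 1}" | "v = {p..q - 1}" | "v = {p + 1..q}" | "v = {p..q}" using t(4) by auto
 hence "EX x y. v = {x..y} & 1<=x & y<=n"
 proof cases
 case 1
 thus ?thesis using t by (intro exI[of _ "p + 1"] exI[of _ "q - 1"]) auto
 next
 case 2
 thus ?thesis using t by (intro exI[of _ p] exI[of _ "q - 1"]) auto
 next
 case 3
 thus ?thesis using t by (intro exI[of _ "p + 1"] exI[of _ q]) auto
 next
 case 4
 thus ?thesis using t by (intro exI[of _ p] exI[of _ q]) auto
 qed
 then obtain x y where "v = {x..y}" "1<=x" "y<=n" by blast
 thus "v:intervals n" unfolding intervals_def by (cases "x<=y") auto
next
 fix v assume "v:intervals n"
 then consider "v = {}" | p q where "v = {p..q}" "1<=p" "p<=q" "q<=n" unfolding intervals_def by auto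
 hence "EX te:std_tiles n. v:tile_vertices te"
 proof cases
 case 1
 have t: "Tile {1 + 1..2 - 1} 1 2:std_tiles n" using n unfolding std_tiles_def by (intro CollectI exI[of _ 1] exI[of _ 2]) simp
 have "v:tile_vertices (Tile {1 + 1..2 - 1} 1 2)" using 1 by (simp add: tile_vertices_def)
 thus ?thesis using t by (rule bexI)
 next
 case 2
 show ?thesis
 proof (cases "p = q")
 case False
 hence "v = insert p (insert q {p + 1..q - 1})" using 2 by auto
 hence v: "v:tile_vertices (Tile {p + 1..q - 1} p q)" unfolding tile_vertices_def by (simp only: top_Tile) simp
 have "Tile {p + 1..q - 1} p q:std_tiles n" using 2 False unfolding std_tiles_def by (intro CollectI exI[of _ p] exI[of _ q]) simp
 with v show ?thesis by (rule bexI)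
 next
 case True
 hence vp: "v = {p}" using 2 by simp
 show ?thesis
 proof (cases "p < n")
 case True
 have t: "Tile {p + 1..p + 1 - 1} p (p + 1):std_tiles n" using 2 True unfolding std_tiles_def by (intro CollectI exI[of _ p] exI[of _ "p + 1"]) simp
 have "v:tile_vertices (Tile {p + 1..p + 1 - 1} p (p + 1))" unfolding vp tile_vertices_def by simp
 thus ?thesis using t by (rule bexI)
 next
 case False
 hence "p = n" using 2 by simp
 have t: "Tile {(n - 1) + 1..n - 1} (n - 1) n:std_tiles n" using n unfolding std_tiles_def by (intro CollectI exI[of _ "n - 1"] exI[of _ n]) simp
 have "v:tile_vertices (Tile {(n - 1) + 1..n - 1} (n - 1) n)" unfolding vp `p = n` tile_vertices_def using n by simp
 thus ?thesis using t by (rule bexI)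
 qed
 qed
 qed
 thus "v:spectrum (std_tiles n) {}" unfolding spectrum_def terminal_vertices_def by auto
qed

section \<open>Weak separation\<close>
definition encloses :: "nat set => nat set => bool" where
 "encloses A B \<longleftrightarrow> (EX p q r. p:A & p~:B & q:B & q~:A & r:B & r~:A & q < p & p < r)"

definition alternates :: "nat set => nat set => bool" where
 "alternates A B \<longleftrightarrow> (EX p q p' q'. p:A & p~:B & q:B & q~:A & p':A & p'~:B & q':B & q'~:A &
 p < q & q < p' & p' < q')"

text \<open>Weak separation in the sense of Leclerc and Zelevinsky: of two sets of different size
  the smaller may surround the larger but not conversely, and the differences of two sets of equal
  size do not cross in cyclic order.\<close>

definition ws :: "nat set => nat set => bool" where
 "ws A B \<longleftrightarrow> (card A < card B --> ~ encloses A B) & (card B < card A --> ~ encloses B A) &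
 (card A = card B --> ~ alternates A B & ~ alternates B A)"

lemma ws_sym: "ws A B \<longleftrightarrow> ws B A"
 unfolding ws_def by auto

lemma ws_lessD:
 assumes "ws A B" "card A < card B" "p:A" "p~:B" "q:B" "q~:A" "r:B" "r~:A" "q < p" "p < r"
 shows False
proof -
 have "encloses A B" unfolding encloses_def using assms(3-10) by (intro exI[of _ p] exI[of _ q] exI[of _ r]) simp
 thus False using assms(1,2) by (simp add: ws_def)
qed

lemma ws_eqD:
 assumes "ws A B" "card A = card B" "p:A" "p~:B" "q:B" "q~:A" "p':A" "p'~:B" "q':B" "q'~:A" "p < q" "q < p'" "p' < q'"
 shows False
proof -
 have "alternates A B" unfolding alternates_def using assms(3-13)
 by (intro exI[of _ p] exI[of _ q] exI[of _ p'] exI[of _ q']) simp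
 thus False using assms(1,2) by (simp add: ws_def)
qed

text \<open>For large \<open>Z\<close> (\<open>big\<close>) an enclosed element of
  \<open>Xik\<close> already lies in \<open>Xi\<close> or \<open>Xk\<close>. For small
  \<open>Z\<close> two enclosing elements of \<open>Xik\<close> lie together in \<open>Xij\<close>
  or in \<open>Xjk\<close>, unless they are \<open>i\<close> and \<open>k\<close>; then
  \<open>j\<close>, or an element of \<open>X - Z\<close>, replaces one of them. The latter exists
  if \<open>j\<close> is in \<open>Z\<close>, since otherwise \<open>Xj\<close> would be a proper
  subset of \<open>Z\<close>, which is too small for that.\<close>

lemma ws_flip:
 assumes f: "finite X" "finite Z" and ijk: "i < j" "j < k" "i~:X" "j~:X" "k~:X"
 and w: "ws Z (insert i X)" "ws Z (insert j X)" "ws Z (insert k X)" "ws Z (insert i (insert j X))" "ws Z (insert j (insert k X))"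
 and ne: "Z ~= insert j X"
 shows "ws Z (insert i (insert k X))"
proof -
 let ?V = "insert i (insert k X)"
 define m where "m = card X"
 have c: "card (insert i X) = m + 1" "card (insert j X) = m + 1" "card (insert k X) = m + 1"
 "card (insert i (insert j X)) = m + 2" "card (insert j (insert k X)) = m + 2" "card ?V = m + 2"
 using f ijk by (auto simp: m_def)
 have big: False if Z: "m + 1 < card Z" and p: "p:?V" "p~:Z" and q: "q:Z" "q~:?V" "r:Z" "r~:?V" "q < p" "p < r" for p q r
 proof (cases "p = k")
 case True
 thus False using ws_lessD[of "insert k X" Z p q r] w(3) c(3) Z p q ws_sym by auto
 next
 case False
 thus False using ws_lessD[of "insert i X" Z p q r] w(1) c(1) Z p q ws_sym by auto
 qed
 have small: False if Z: "card Z < m + 2" and p: "p:Z" "p~:?V" and q: "q:?V" "q~:Z" "r:?V" "r~:Z" "q < p" "p < r" for p q r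
 proof -
 have LIJ: False if "p':Z" "p'~:insert i (insert j X)" "q':insert i (insert j X)" "q'~:Z" "r':insert i (insert j X)" "r'~:Z" "q' < p'" "p' < r'" for p' q' r'
 using ws_lessD[OF w(4), of p' q' r'] that Z c(4) by simp
 have LJK: False if "p':Z" "p'~:insert j (insert k X)" "q':insert j (insert k X)" "q'~:Z" "r':insert j (insert k X)" "r'~:Z" "q' < p'" "p' < r'" for p' q' r'
 using ws_lessD[OF w(5), of p' q' r'] that Z c(5) by simp
 have exX: "EX x:X. x~:Z" if "j:Z" "i~:Z | k~:Z | p ~= j"
 proof (rule ccontr)
 assume "~ (EX x:X. x~:Z)"
 hence s: "insert j X<=Z" using that by auto
 hence "insert j X \<subset> Z" using ne by auto
 hence "card (insert j X) < card Z" using f by (simp add: psubset_card_mono)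
 thus False using Z c(2) by simp
 qed
 show False
 proof (cases "p = j")
 case False
 have pn: "p~:X" "p ~= i" "p ~= k" using p by auto
 consider "q:insert i X" "r:insert i X" | "q:insert k X" "r:insert k X" | "q = i" "r = k" | "q = k" "r = i"
 using q by auto
 thus False
 proof cases
 case 1
 thus False using LIJ[of p q r] p pn q False by auto
 next
 case 2
 thus False using LJK[of p q r] p pn q False by auto
 next
 case 3
 show False
 proof (cases "j:Z")
 case False
 show False
 proof (cases "p < j")
 case True
 thus False using LIJ[of p i j] p pn q 3 False `p ~= j` by auto
 next
 case F: False
 thus False using LJK[of p j k] p pn q 3 False `p ~= j` by auto
 qed
 next
 case True
 obtain x where x: "x:X" "x~:Z" using exX True False by blast
 have "x ~= p" using x p by auto
 show False
 proof (cases "p < x")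
 case True
 thus False using LIJ[of p i x] p pn q 3 x `p ~= j` by auto
 next
 case F: False
 thus False using LJK[of p x k] p pn q 3 x `p ~= j` `x ~= p` by auto
 qed
 qed
 next
 case 4
 thus False using q ijk by auto
 qed
 next
 case pj: True
 have jZ: "j:Z" using p pj by simp
 have main: False if "a:{i, k}" "u:insert a X" "u~:Z" "v:insert a X" "v~:Z" "u < j" "j < v" for a u v
 proof (cases "card Z < m + 1")
 case True
 hence "card Z < card (insert a X)" "ws Z (insert a X)" using c w that(1) by auto
 thus False using ws_lessD[of Z "insert a X" j u v] that jZ ijk by auto
 next
 case F: False
 hence cz: "card Z = m + 1" using Z by simp
 have wa: "ws Z (insert a X)" "card Z = card (insert a X)" "j~:insert a X" using w c cz that ijk by auto
 have uv: "{u, v}<=insert a X - Z" "u ~= v" using that by auto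
 \<comment> \<open>Sets of equal size have equally large differences, so besides \<open>j\<close>
   there is a second element \<open>y\<close> of \<open>Z - insert a X\<close>. Outside of
   \<open>u\<close> and \<open>v\<close> it produces an alternation, between them it is enclosed by
   them.\<close>
 have "card (insert a X - Z) = card (Z - insert a X)"
 using f wa(2) by (simp add: card_Diff_subset_Int Int_commute)
 moreover have "2<=card (insert a X - Z)" using card_mono[of "insert a X - Z" "{u, v}"] uv f by simp
 ultimately have "2<=card (Z - insert a X)" by simp
 have "Z - insert a X ~= {j}"
 proof
 assume h: "Z - insert a X = {j}"
 show False using `2<=card (Z - insert a X)` unfolding h by simp
 qed
 moreover have "j:Z - insert a X" using jZ wa(3) by blast
 ultimately obtain y where y: "y:Z" "y~:insert a X" "y ~= j" by blast
 have yuv: "y ~= u" "y ~= v" using y that by auto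
 consider "y < u" | "v < y" | "u < y" "y < v" using yuv by linarith
 thus False
 proof cases
 case 1
 show False by (rule ws_eqD[OF wa(1,2), of y u j v]) (use 1 y that jZ wa in auto)
 next
 case 2
 show False by (rule ws_eqD[OF wa(1)[unfolded ws_sym[of Z]] wa(2)[symmetric], of u j v y]) (use 2 y that jZ wa in auto)
 next
 case 3
 show False
 proof (cases "a = i")
 case True
 show False by (rule LIJ[of y u v]) (use 3 y that True in auto)
 next
 case False
 show False by (rule LJK[of y u v]) (use 3 y that False in auto)
 qed
 qed
 qed
 consider "q:insert i X" "r:insert i X" | "q:insert k X" "r:insert k X" | "q = i" "r = k" | "q = k" "r = i"
 using q by auto
 thus False
 proof cases
 case 1
 thus False using main[of i q r] q pj by auto
 next
 case 2
 thus False using main[of k q r] q pj by auto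
 next
 case 3
 then obtain x where x: "x:X" "x~:Z" using exX jZ q by blast
 have "x ~= j" using x ijk by auto
 show False
 proof (cases "x < j")
 case True
 thus False using main[of k x k] x q 3 ijk by auto
 next
 case False
 thus False using main[of i i x] x q 3 ijk `x ~= j` by auto
 qed
 next
 case 4
 thus False using q ijk by auto
 qed
 qed
 qed
 show ?thesis
 unfolding ws_def c(6)
 proof (intro conjI impI notI)
 assume "card Z < m + 2" "encloses Z ?V"
 thus False using small unfolding encloses_def by (elim exE conjE)
 next
 assume cZ: "m + 2 < card Z" and e: "encloses ?V Z"
 have "m + 1 < card Z" using cZ by simp
 with e show False using big unfolding encloses_def by (elim exE conjE)
 next
 assume cZ: "card Z = m + 2" and e: "alternates Z ?V"
 have c1: "m + 1 < card Z" using cZ by simp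
 from e show False unfolding alternates_def by (elim exE conjE) (rule big[OF c1])
 next
 assume cZ: "card Z = m + 2" and e: "alternates ?V Z"
 have c1: "m + 1 < card Z" using cZ by simp
 from e obtain q p' q' where "p':?V" "p'~:Z" "q:Z" "q~:?V" "q':Z" "q'~:?V" "q < p'" "p' < q'"
 unfolding alternates_def by (elim exE conjE)
 thus False by (rule big[OF c1])
 qed
qed

section \<open>Flips that are forced by weak separation\<close>
lemma card_exchange:
 assumes "finite A" "c:A" "s~:A"
 shows "card (insert s (A - {c})) = card A"
proof -
 have "card (insert s (A - {c})) = Suc (card (A - {c}))" by (rule card_insert_disjoint) (use assms in auto)
 also have "\<dots> = card A" by (rule card_Suc_Diff1[OF assms(1,2)])
 finally show ?thesis .
qed

lemma three_labels:
 fixes p q r a b c :: nat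
 assumes "p = a | p = b | p = c" "q = a | q = b | q = c" "r = a | r = b | r = c" "p < q" "q < r" "a < b" "b < c"
 shows "p = a" "r = c"
 using assms by (elim disjE; simp)+

context gt
begin

definition WS :: bool where
 "WS \<longleftrightarrow> (ALL A:B. ALL A':B. ws A A')"

lemma WS_less:
 assumes WS "A:B" "A':B" "card A < card A'" "p:A" "p~:A'" "q:A'" "q~:A" "r:A'" "r~:A" "q < p" "p < r"
 shows False
 using ws_lessD[OF _ assms(4-12)] assms(1-3) unfolding WS_def by blast

lemma WS_eq:
 assumes WS "A:B" "A':B" "card A = card A'" "p:A" "p~:A'" "q:A'" "q~:A" "p':A" "p'~:A'" "q':A'" "q'~:A"
 "p < q" "q < p'" "p' < q'"
 shows False
 using ws_eqD[OF _ assms(4-15)] assms(1-3) unfolding WS_def by blast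

lemma B_not_terminal: "A:B ==> A~:bots & A~:tops"
 unfolding spectrum_def terminal_vertices_def by blast

lemma B_subset: "A:B ==> A<={1..n}"
proof -
 assume "A:B"
 then obtain te where a: "te:W Un K" "A:tile_vertices te" unfolding spectrum_def by blast
 have "te:tiles n" using a sub by blast
 then obtain X i j where t: "te = Tile X i j" "i < j" "1<=i" "j<=n" "X<={1..n}" by (rule tiles_cases)
 have "i:{1..n}" "j:{1..n}" using t by auto
 thus ?thesis using a(2) t(5) unfolding t(1) tile_vertices_Tile by (elim insertE) simp_all
qed

lemma B_finite: "A:B ==> finite A"
 using B_subset finite_subset by blast

lemma V_B:
 assumes "V A q"
 shows "A:B" "insert q A:B"
proof -
 have e: "(A, insert q A):edges" "A~:bots" "insert q A~:tops" using assms unfolding V_def by auto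
 then obtain te where te: "te:W Un K" "(A, insert q A):tile_edges te" unfolding edges_of_def by blast
 have "A:tile_vertices te" "insert q A:tile_vertices te" using te(2) unfolding tile_edges_def tile_vertices_def by auto
 thus "A:B" "insert q A:B" using B_I[OF te(1)] e not_into_bots[OF e(1)] not_from_tops[OF e(1)] by blast+
qed

lemma bot_mid:
 assumes "Tile C p q:K"
 obtains m where "p < m" "m < q" "m~:C" "insert m C:B"
proof -
 obtain m where m: "Tile C p m:W" "m < q" using bot_ends[OF assms] by metis
 thus ?thesis using that[of m] W_tile[OF m(1)] vertex_B(2)[of C p m] by blast
qed

lemma top_mid:
 assumes "Tile C p q:K"
 obtains c where "p < c" "c < q" "c:C" "insert q (insert p (C - {c})):B"
proof -
 obtain c where c: "c:C" "c < q" "Tile (insert p C - {c}) c q:W" using black_upper_left[OF assms] by metis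
 have k: "p~:C" "p < q" using K_tile[OF assms] by auto
 have cp: "c ~= p" using c k by blast
 have "insert c (insert q (insert p C - {c})) = insert p (insert q C)" using c cp by auto
 hence "p<=c" by (rule top_labels(1)[OF assms c(3)])
 hence "p < c" using cp by simp
 moreover have "insert q (insert p C - {c}):B" using vertex_B(2)[of "insert p C - {c}" c q] c(3) by blast
 moreover have "insert p C - {c} = insert p (C - {c})" using cp by auto
 ultimately show ?thesis using that[of c] c by simp
qed

text \<open>The set \<open>insert q A\<close> and the top \<open>Y\<close> of the tile would not be
  weakly separated, as \<open>s < q < m\<close>. If \<open>Y\<close> is terminal, a left or right
  vertex of its black tile takes its place; this fails only if the tile has the labels of the black
  tile, and then \<open>A\<close> would be its bottom.\<close>

lemma gap:
 assumes WS "Tile A s m:W" "A:B" "insert q A:B" "q~:A" "s < q" "q < m"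
 shows False
proof -
 have t: "s < m" "s~:A" "m~:A" "finite A" using W_tile[OF assms(2)] by auto
 have Ab: "A~:bots" using B_not_terminal assms(3) by blast
 define Y where "Y = insert s (insert m A)"
 have Y: "s:Y" "m:Y" "q~:Y" "card Y = card A + 2" using t assms(5-7) unfolding Y_def by auto
 have cq: "card (insert q A) = card A + 1" using t assms(5) by simp
 show False
 proof (cases "Y:tops")
 case False
 hence "Y:B" using vertex_B(4)[of A s m] assms(2) unfolding Y_def by blast
 thus False using WS_less[OF assms(1,4), of Y q s m] Y cq t assms(6,7) by simp
 next
 case True
 then obtain \<kappa> where k: "\<kappa>:K" "top_vertex \<kappa> = Y" by auto
 then obtain C p p' where \<kappa>: "\<kappa> = Tile C p p'" by (cases \<kappa>) auto
 have K: "Tile C p p':K" and CY: "insert p (insert p' C) = Y" using k \<kappa> by auto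
 have kt: "p < p'" "p~:C" "p'~:C" "finite C" using K_tile[OF K] by auto
 have lab: "p<=s" "m<=p'" using top_labels[OF K assms(2)] CY unfolding Y_def by auto
 have cC: "card Y = card C + 2" unfolding CY[symmetric] using kt by simp
 have eB: "insert p C:B" "insert p' C:B" using vertex_B(1,2)[of C p p'] K by blast+
 have mem1: "x:insert p' C \<longleftrightarrow> x:Y & x ~= p" and mem2: "x:insert p C \<longleftrightarrow> x:Y & x ~= p'" for x unfolding CY[symmetric] using kt by auto
 have memA: "x:A \<longleftrightarrow> x:Y & x ~= s & x ~= m" for x unfolding Y_def using t by auto
 have pY: "p:Y" "p':Y" unfolding CY[symmetric] by auto
 consider "p < s" | "m < p'" | "p = s" "p' = m" using lab by linarith
 thus False
 proof cases
 case 1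
 have "p:A" using memA pY 1 t by auto
 thus False using WS_eq[OF assms(1,4) eB(2), of p s q m] mem1 memA Y cC cq kt t 1 assms(5-7) by auto
 next
 case 2
 have "p':A" using memA pY 2 t by auto
 thus False using WS_eq[OF assms(1) eB(1) assms(4), of s q m p'] mem2 memA Y cC cq kt t 2 assms(5-7) by auto
 next
 case 3
 have "A = C"
 proof (rule set_eqI)
 fix x show "x:A \<longleftrightarrow> x:C" using memA[of x] mem1[of x] 3 kt by (cases "x = p'") auto
 qed
 thus False using Ab K by (metis bottom_Tile imageI)
 qed
 qed
qed

text \<open>A vertex \<open>insert m C\<close> inside the upper boundary of the lens belongs to the
  spectrum and is smaller than \<open>insert q A\<close>. It contains \<open>d\<close>, which lies
  between \<open>p\<close> and \<open>p'\<close>, two elements that only \<open>insert q A\<close>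
  has.\<close>

lemma no_interior_lower:
 assumes WS "insert q A:B" "q~:A"
 shows "~ interior_lower A d"
proof
 assume "interior_lower A d"
 then obtain C p p' where K: "Tile C p p':K" "p < d" "d < p'" "d~:A" and Y: "insert d A = insert p (insert p' C)"
 unfolding interior_lower_def by blast
 have kt: "p < p'" "p~:C" "p'~:C" "finite C" using K_tile[OF K(1)] by auto
 obtain m where m: "p < m" "m < p'" "m~:C" "insert m C:B" using bot_mid[OF K(1)] by metis
 have mem: "x:A \<longleftrightarrow> x ~= d & (x = p | x = p' | x:C)" for x using Y K(4) by (metis insert_iff)
 have fA: "finite A" using Y kt by (metis finite_insert)
 have "card (insert d A) = card C + 2" unfolding Y using kt by simp
 hence cA: "card A = card C + 1" using fA K(4) by simp
 have qd: "q ~= d"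
 proof
 assume "q = d"
 hence "insert q A:tops" using Y K(1) by (metis imageI top_Tile)
 thus False using B_not_terminal assms(2) by blast
 qed
 have dC: "d:C" using Y K(2,3) by (metis insertI1 insertE less_irrefl)
 have c: "card (insert m C) < card (insert q A)" using m kt fA assms(3) cA by simp
 show False using WS_less[OF assms(1) m(4) assms(2) c, of d p p'] mem dC qd K(2-4) m kt by auto
qed

text \<open>Look at the outgoing planar edge whose label \<open>s\<close> is the largest below
  \<open>q\<close>, or the smallest one if none is below. On the side of \<open>q\<close>, a tile
  with bottom \<open>A\<close> is excluded by \<open>gap\<close> or by the choice of
  \<open>s\<close>. A tile with top \<open>insert s A\<close> has a side vertex
  \<open>insert s (A - {c})\<close>, in which \<open>s\<close> lies between \<open>c\<close> and
  \<open>q\<close> of \<open>insert q A\<close>.\<close>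

lemma pair_V:
 assumes ws: WS and A: "A:B" "insert q A:B" "q~:A"
 shows "V A q"
proof (rule ccontr)
 assume nV: "~ V A q"
 have sub: "A<={1..n}" "q:{1..n}" using B_subset[OF A(1)] B_subset[OF A(2)] by auto
 have fA: "finite A" using sub finite_subset by blast
 have "A ~= {1..n}" using sub A(3) by blast
 then obtain d where "V A d" using B_out[OF A(1)] no_interior_lower[OF ws A(2,3)] by blast
 define D where "D = {d. V A d}"
 have "D<={1..n}" using V_subset unfolding D_def by blast
 hence D: "finite D" "d:D" using `V A d` finite_subset unfolding D_def by blast+
 have Ab: "A~:bots" using B_not_terminal A(1) by blast
 have cq: "card (insert q A) = card A + 1" using fA A(3) by simp
 show False
 proof (cases "EX d:D. d < q")
 case True
 define s where "s = Max {d:D. d < q}"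
 have fs: "finite {d:D. d < q}" "{d:D. d < q} ~= {}" using D True by auto
 have "s:{d:D. d < q}" unfolding s_def by (rule Max_in[OF fs])
 hence s: "V A s" "s < q" unfolding D_def by auto
 have smax: "d<=s" if "V A d" "d < q" for d unfolding s_def by (rule Max_ge[OF fs(1)]) (use that in "auto simp: D_def")
 have "(A, insert s A)~:RB n"
 proof
 assume r: "(A, insert s A):RB n"
 note rb = RB_levelD[OF r]
 have "s:{n - card A..n}" using rb by blast
 hence "n - card A < q" using s(2) by simp
 hence "q:{n - card A + 1..n}" using sub(2) by simp
 thus False using rb A(3) by metis
 qed
 from s(1) this show False
 proof (rule white_right)
 fix m assume m: "s < m" "Tile A s m:W"
 have "V A m" using V_lower(2)[OF m(2) Ab] .
 hence "m ~= q" "~ m < q" using nV smax[of m] m(1) by auto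
 thus False using gap[OF ws m(2) A] s(2) by simp
 next
 fix c assume c: "c:A" "c < s" "Tile (A - {c}) c s:W"
 have sA: "s~:A" using s(1) unfolding V_def by blast
 have R: "insert s (A - {c}):B" using vertex_B(2)[of "A - {c}" c s] c(3) by blast
 have "card (insert s (A - {c})) = card A" by (rule card_exchange[OF fA c(1) sA])
 thus False using WS_less[OF ws R A(2), of s c q] cq c sA s(2) A(3) by auto
 qed
 next
 case False
 define s where "s = Min D"
 have s: "V A s" using Min_in[OF D(1)] D(2) unfolding s_def D_def by auto
 have smin: "s<=d" if "V A d" for d unfolding s_def by (rule Min_le[OF D(1)]) (use that in "auto simp: D_def")
 have qs: "q < s" using False s nV unfolding D_def by (metis linorder_neqE_nat mem_Collect_eq)
 have "(A, insert s A)~:LB n"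
 proof
 assume r: "(A, insert s A):LB n"
 note rb = LB_levelD[OF r]
 have "s:{1..Suc (card A)}" using rb by blast
 hence "q:{1..card A}" using sub(2) qs by simp
 thus False using rb A(3) by metis
 qed
 from s this show False
 proof (rule white_left)
 fix m assume m: "m < s" "Tile A m s:W"
 have "V A m" using V_lower(1)[OF m(2) Ab] .
 thus False using smin m(1) by fastforce
 next
 fix c assume c: "c:A" "s < c" "Tile (A - {c}) s c:W"
 have sA: "s~:A" using s unfolding V_def by blast
 have R: "insert s (A - {c}):B" using vertex_B(1)[of "A - {c}" s c] c(3) by blast
 have "card (insert s (A - {c})) = card A" by (rule card_exchange[OF fA c(1) sA])
 thus False using WS_less[OF ws R A(2), of s q c] cq c sA qs A(3) by auto
 qed
 qed
qed

lemma level_order_ex: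
 assumes "h < n" "increasing_on n (a :: nat => 'a :: linordered_idom)"
 shows "EX N g. VS h = g ` {..N} & (ALL x y. x:VS h --> step x y --> (EX i<N. x = g i & y = g (Suc i))) &
 (ALL i j. i<=j --> j<=N --> wsum a (fst (g i))<=wsum a (fst (g j))) &
 (ALL i j. i<=j --> j<=N --> wsum a (insert (snd (g i)) (fst (g i)))<=wsum a (insert (snd (g j)) (fst (g j)))) &
 (ALL i<N. step (g i) (g (Suc i)))"
proof (rule level_order[OF assms])
 fix N g
 assume g: "VS h = g ` {..N}" and g2: "!!x y. x:VS h ==> step x y ==> EX i<N. x = g i & y = g (Suc i)"
 and g3: "!!i j. i<=j ==> j<=N ==> wsum a (fst (g i))<=wsum a (fst (g j))"
 and g4: "!!i j. i<=j ==> j<=N ==> wsum a (insert (snd (g i)) (fst (g i)))<=wsum a (insert (snd (g j)) (fst (g j)))"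
 and g5: "!!i. i < N ==> step (g i) (g (Suc i))"
 show ?thesis
 by (rule exI[of _ N], rule exI[of _ g], intro conjI allI impI) (simp_all only: g g2[unfolded g] g3 g4 g5)
qed

text \<open>Edges of one level with a common top are consecutive, so from all but the last of them the chain moves on by
  a tile below that top.\<close>
lemma same_top_step:
 assumes "V A q" "V A' q'" "insert q A = insert q' A'" "q' < q"
 obtains c where "c:A" "c < q" "Tile (A - {c}) c q:W"
proof -
 have s: "A<={1..n}" "finite A" "q~:A" "A'<={1..n}" "finite A'" "q'~:A'" "q:{1..n}" using V_subset[OF assms(1)] V_subset[OF assms(2)] by auto
 have cA: "card A' = card A" using arg_cong[OF assms(3), of card] s by simp
 have h: "card A < n" by (rule card_less_n[OF s(1,7,3)])
 let ?a = "%k. 2 ^ k :: int"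
 obtain N g where g: "VS (card A) = g ` {..N}"
 "ALL i j. i<=j --> j<=N --> wsum ?a (fst (g i))<=wsum ?a (fst (g j))"
 "ALL i j. i<=j --> j<=N --> wsum ?a (insert (snd (g i)) (fst (g i)))<=wsum ?a (insert (snd (g j)) (fst (g j)))"
 "ALL i<N. step (g i) (g (Suc i))"
 using level_order_ex[OF h pow2_increasing] by (elim exE conjE)
 have "(A, q):VS (card A)" "(A', q'):VS (card A)" unfolding VS_def using assms cA by auto
 then obtain u v where u: "u<=N" "g u = (A, q)" and v: "v<=N" "g v = (A', q')" unfolding g(1) by (metis atMost_iff imageE)
 have less: "wsum ?a A < wsum ?a A'"
 proof -
 have "wsum ?a (insert q A) = 2 ^ q + wsum ?a A" "wsum ?a (insert q' A') = 2 ^ q' + wsum ?a A'"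
 using wsum_insert s by blast+
 moreover have "(2 :: int) ^ q' < 2 ^ q" using assms(4) by simp
 moreover have "wsum ?a (insert q A) = wsum ?a (insert q' A')" by (simp only: assms(3))
 ultimately show ?thesis by linarith
 qed
 have uv: "u < v"
 proof (rule ccontr)
 assume "~ u < v"
 thus False using g(2)[rule_format, of v u] u v less by simp
 qed
 obtain A1 q1 where g1: "g (Suc u) = (A1, q1)" by (cases "g (Suc u)")
 have st: "step (A, q) (A1, q1)" using g(4)[rule_format, of u] u v uv g1 by simp
 have "wsum ?a (insert q1 A1)<=wsum ?a (insert q' A')" using g(3)[rule_format, of "Suc u" v] uv v g1 by simp
 hence le: "wsum ?a (insert q1 A1)<=wsum ?a (insert q A)" using assms(3) by simp
 from st show ?thesis unfolding step_def fst_conv snd_conv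
 proof (elim disjE conjE)
 assume a: "A1 = A" "Tile A q q1:W"
 have "q < q1" "q1~:A" using W_tile[OF a(2)] by auto
 hence "(2 :: int) ^ q < 2 ^ q1" by simp
 thus ?thesis using le wsum_insert[OF s(2), of q1 ?a] wsum_insert[OF s(2,3), of ?a] `q1~:A` a(1) by simp
 next
 assume "q1:A" "Tile (A - {q1}) q1 q:W"
 thus ?thesis using that[of q1] W_tile[of "A - {q1}" q1 q] by blast
 qed
qed

text \<open>In the chain of their level, the planar edges into \<open>Xik\<close> lie between the
  lower edges of the first two tiles. There the third tile contributes two consecutive edges with
  lower ends \<open>Xi\<close> and \<open>Xk\<close>. So the abscissa of \<open>A\<close> is one of
  theirs, and powers of two give the label.\<close>

lemma single_in:
 assumes t: "Tile (insert i X) j k:W" "Tile (insert k X) i j:W" "Tile X i k:W"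
 and nb: "insert i X~:bots" "insert k X~:bots" "insert i (insert k X)~:tops"
 and V: "V A m" "insert m A = insert i (insert k X)"
 shows "m = i | m = k"
proof -
 have o: "i < j" "j < k" "i~:X" "k~:X" "finite X" "j~:X" using W_tile[OF t(1)] W_tile[OF t(2)] W_tile[OF t(3)] by auto
 let ?a = "%k. 2 ^ k :: int"
 note s1 = lower_step[OF t(1) nb(1)] and s2 = lower_step[OF t(2) nb(2)] and s3 = upper_step[OF t(3) nb(3)]
 have c: "card (insert i X) = Suc (card X)" "card (insert k X) = Suc (card X)" using o by simp_all
 have sA: "finite A" "m~:A" using V_subset[OF V(1)] by auto
 have "card A = Suc (card X)" using arg_cong[OF V(2), of card] sA o by simp
 hence AV: "(A, m):VS (Suc (card X))" using V(1) unfolding VS_def by simp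
 obtain N g where g: "VS (Suc (card X)) = g ` {..N}"
 "ALL x y. x:VS (Suc (card X)) --> step x y --> (EX i<N. x = g i & y = g (Suc i))"
 and g3: "ALL i j. i<=j --> j<=N --> wsum ?a (fst (g i))<=wsum ?a (fst (g j))"
 and g4: "ALL i j. i<=j --> j<=N --> wsum ?a (insert (snd (g i)) (fst (g i)))<=wsum ?a (insert (snd (g j)) (fst (g j)))"
 using level_order_ex[OF s3(4) pow2_increasing] by (elim exE conjE)
 note g = g g3[rule_format] g4[rule_format]
 obtain u where u: "u < N" "(insert i X, j) = g u" "(insert i X, k) = g (Suc u)" using g(2) s1 unfolding c by blast
 obtain v where v: "v < N" "(insert k X, i) = g v" "(insert k X, j) = g (Suc v)" using g(2) s2 unfolding c by blast
 obtain x where x: "x < N" "(insert i X, k) = g x" "(insert k X, i) = g (Suc x)" using g(2) s3 by blast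
 obtain w where w: "w<=N" "g w = (A, m)" using AV unfolding g(1) by (metis atMost_iff imageE)
 let ?Y = "insert i (insert k X)"
 have ws: "wsum ?a (insert i X) = 2 ^ i + wsum ?a X" "wsum ?a (insert k X) = 2 ^ k + wsum ?a X" "wsum ?a ?Y = 2 ^ i + 2 ^ k + wsum ?a X"
 "wsum ?a (insert j (insert i X)) = 2 ^ j + 2 ^ i + wsum ?a X" "wsum ?a (insert j (insert k X)) = 2 ^ j + 2 ^ k + wsum ?a X"
 using o by (simp_all add: wsum_insert)
 have YA: "wsum ?a ?Y = 2 ^ m + wsum ?a A" using wsum_insert[OF sA, of ?a] unfolding V(2) .
 have p: "(2 :: int) ^ i < 2 ^ j" "(2 :: int) ^ j < 2 ^ k" using o by simp_all
 have "~ w<=u"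
 proof
 assume "w<=u"
 hence "wsum ?a (insert m A)<=wsum ?a (insert j (insert i X))" using g(4)[of w u] w u(1) u(2)[symmetric] by simp
 thus False using ws p unfolding V(2) by simp
 qed
 moreover have "~ Suc v<=w"
 proof
 assume "Suc v<=w"
 hence "wsum ?a (insert j (insert k X))<=wsum ?a (insert m A)" using g(4)[of "Suc v" w] w v(3)[symmetric] by simp
 thus False using ws p unfolding V(2) by simp
 qed
 ultimately have uv: "Suc u<=w" "w<=v" by simp_all
 show ?thesis
 proof (cases "w<=x")
 case True
 have "wsum ?a (insert i X)<=wsum ?a A" using g(3)[of "Suc u" w] uv w u(3)[symmetric] by simp
 moreover have "wsum ?a A<=wsum ?a (insert i X)" using g(3)[of w x] True w x(1) x(2)[symmetric] by simp
 ultimately have "(2 :: int) ^ m = 2 ^ k" using YA ws by linarith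
 thus ?thesis by simp
 next
 case False
 have "wsum ?a (insert k X)<=wsum ?a A" using g(3)[of "Suc x" w] False w x(3)[symmetric] by simp
 moreover have "wsum ?a A<=wsum ?a (insert k X)" using g(3)[of w v] uv w v(1) v(2)[symmetric] by simp
 ultimately have "(2 :: int) ^ m = 2 ^ i" using YA ws by linarith
 thus ?thesis by simp
 qed
qed

text \<open>The edges of the cube come from \<open>pair_V\<close>. Whatever could violate a
  hypothesis of \<open>flip\<close> would put a set into the spectrum that is not weakly separated
  from one of the five given sets, or from another set found on the way.\<close>

lemma lowering:
 assumes ws: WS and o: "i < j" "j < k" "i~:X" "j~:X" "k~:X"
 and B: "insert i X:B" "insert k X:B" "insert i (insert j X):B" "insert i (insert k X):B" "insert j (insert k X):B"
 and nB: "insert j X~:B"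
 shows "EX W' K'. gt n W' K' & spectrum W' K' = B - {insert i (insert k X)} Un {insert j X} & exchange X i j k (W Un K) (W' Un K')"
proof -
 define Xi Xk Xij Xik Xjk where "Xi = insert i X" and "Xk = insert k X" and "Xij = insert i (insert j X)"
 and "Xik = insert i (insert k X)" and "Xjk = insert j (insert k X)"
 note d = Xi_def Xk_def Xij_def Xik_def Xjk_def
 note B' = B[folded d]
 have fX: "finite X" using B_finite[OF B(1)] by simp
 have cd: "card Xi = card X + 1" "card Xk = card X + 1" "card Xij = card X + 2" "card Xik = card X + 2" "card Xjk = card X + 2"
 using fX o unfolding d by auto
 have mem: "x:Xi \<longleftrightarrow> x = i | x:X" "x:Xk \<longleftrightarrow> x = k | x:X" "x:Xij \<longleftrightarrow> x = i | x = j | x:X"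
 "x:Xik \<longleftrightarrow> x = i | x = k | x:X" "x:Xjk \<longleftrightarrow> x = j | x = k | x:X" for x unfolding d by auto
 have ne: "i ~= j" "j ~= k" "i ~= k" "j ~= i" "k ~= j" "k ~= i" using o by auto
 have ins: "insert j Xi = Xij" "insert k Xi = Xik" "insert i Xk = Xik" "insert j Xk = Xjk" unfolding d by auto
 have nonin: "j~:Xi" "k~:Xi" "i~:Xk" "j~:Xk" using mem ne o by auto
 have Vs: "V Xi j" "V Xi k" "V Xk i" "V Xk j"
 using pair_V[OF ws B'(1), of j] pair_V[OF ws B'(1), of k] pair_V[OF ws B'(2), of i] pair_V[OF ws B'(2), of j] B' nonin unfolding ins by auto
 have t1: "Tile Xi j k:W"
 proof -
 have "(Xi, insert j Xi)~:RB n"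
 proof
 assume r: "(Xi, insert j Xi):RB n"
 note rb = RB_levelD[OF r]
 have "i:Xi" using mem(1)[of i] by simp
 hence i1: "n - card Xi + 1<=i" using rb by (metis atLeastAtMost_iff)
 have "j<=n" using rb by (metis atLeastAtMost_iff insertI1)
 hence "j:{n - card Xi + 1..n}" using i1 o by simp
 thus False using rb nonin(1) by metis
 qed
 from Vs(1) this show ?thesis
 proof (rule white_right)
 fix m assume m: "j < m" "Tile Xi j m:W"
 have Vm: "V Xi m" using V_lower(2)[OF m(2)] B_not_terminal B'(1) by blast
 have mX: "m~:X" "m ~= i" using Vm mem(1) unfolding V_def by auto
 have mB: "insert m Xi:B" using V_B[OF Vm] by blast
 have cm: "card (insert m Xi) = card X + 2" using Vm cd(1) fX unfolding V_def Xi_def by simp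
 show ?thesis
 proof (rule linorder_cases[of m k])
 assume "m < k"
 thus ?thesis using WS_eq[OF ws mB B'(5), of i j m k] cm cd mem m(1) mX ne o by auto
 next
 assume "k < m"
 thus ?thesis using gap[OF ws m(2) B'(1), of k] B'(4) ins nonin o by auto
 qed (use m in simp)
 next
 fix c assume c: "c:Xi" "c < j" "Tile (Xi - {c}) c j:W"
 have R: "insert j (Xi - {c}):B" using vertex_B(2)[of "Xi - {c}" c j] c(3) by blast
 have ci: "c ~= i"
 proof
 assume "c = i"
 hence "insert j (Xi - {c}) = insert j X" using o unfolding d by auto
 thus False using R nB by simp
 qed
 hence cX: "c:X" using c mem by auto
 have cr: "card (insert j (Xi - {c})) = card X + 1" using card_exchange[OF B_finite[OF B'(1)] c(1)] cd(1) nonin by simp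
 show ?thesis
 proof (cases "c < i")
 case True
 thus ?thesis using WS_less[OF ws R B'(5), of i c k] cr cd mem cX ci ne o by auto
 next
 case False
 hence "i < c" using ci by simp
 thus ?thesis using WS_eq[OF ws R B'(2), of i c j k] cr cd mem cX ci c(2) ne o by auto
 qed
 qed
 qed
 have t2: "Tile Xk i j:W"
 proof -
 have "(Xk, insert j Xk)~:LB n"
 proof
 assume r: "(Xk, insert j Xk):LB n"
 note rb = LB_levelD[OF r]
 have "k:Xk" using mem(2)[of k] by simp
 hence k1: "k<=card Xk" using rb by (metis atLeastAtMost_iff)
 have "1<=j" using rb by (metis atLeastAtMost_iff insertI1)
 hence "j:{1..card Xk}" using k1 o by simp
 thus False using rb nonin(4) by metis
 qed
 from Vs(4) this show ?thesis
 proof (rule white_left)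
 fix m assume m: "m < j" "Tile Xk m j:W"
 have Vm: "V Xk m" using V_lower(1)[OF m(2)] B_not_terminal B'(2) by blast
 have mX: "m~:X" "m ~= k" using Vm mem(2) unfolding V_def by auto
 have mB: "insert m Xk:B" using V_B[OF Vm] by blast
 have cm: "card (insert m Xk) = card X + 2" using Vm cd(2) fX unfolding V_def Xk_def by simp
 show ?thesis
 proof (rule linorder_cases[of m i])
 assume "i < m"
 thus ?thesis using WS_eq[OF ws B'(3) mB, of i m j k] cm cd mem m(1) mX ne o by auto
 next
 assume "m < i"
 thus ?thesis using gap[OF ws m(2) B'(2), of i] B'(4) ins nonin o by auto
 qed (use m in simp)
 next
 fix c assume c: "c:Xk" "j < c" "Tile (Xk - {c}) j c:W"
 have R: "insert j (Xk - {c}):B" using vertex_B(1)[of "Xk - {c}" j c] c(3) by blast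
 have ci: "c ~= k"
 proof
 assume "c = k"
 hence "insert j (Xk - {c}) = insert j X" using o unfolding d by auto
 thus False using R nB by simp
 qed
 hence cX: "c:X" using c mem by auto
 have cr: "card (insert j (Xk - {c})) = card X + 1" using card_exchange[OF B_finite[OF B'(2)] c(1)] cd(2) nonin by simp
 show ?thesis
 proof (cases "k < c")
 case True
 thus ?thesis using WS_less[OF ws R B'(3), of k i c] cr cd mem cX ci ne o by auto
 next
 case False
 hence "c < k" using ci by simp
 thus ?thesis using WS_eq[OF ws B'(1) R, of i j c k] cr cd mem cX ci c(2) ne o by auto
 qed
 qed
 qed
 \<comment> \<open>An edge from the bottom \<open>Xik - {m}\<close> to the spectrum can only have
   label \<open>m\<close> or \<open>j\<close>, but a lens has at least three labels at its
   bottom.\<close>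
 have nolens: False if K: "Tile C p p':K" and C: "C = Xik - {m}" "m:Xik" for C p p' m
 proof -
 have Cb: "C~:B" using B_not_terminal K by (metis bottom_Tile imageI)
 have "m ~= i" "m ~= k"
 proof -
 show "m ~= i"
 proof
 assume "m = i"
 hence "C = Xk" using C(1) ne o unfolding d by auto
 thus False using Cb B'(2) by simp
 qed
 show "m ~= k"
 proof
 assume "m = k"
 hence "C = Xi" using C(1) ne o unfolding d by auto
 thus False using Cb B'(1) by simp
 qed
 qed
 hence mX: "m:X" "m ~= i" "m ~= k" "m ~= j" using C(2) mem o by auto
 have fC: "finite C" "card C = card X + 1" using C fX cd(4) unfolding Xik_def by auto
 have memC: "x:C \<longleftrightarrow> x = i | x = k | x:X & x ~= m" for x unfolding C(1) using mem mX by auto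
 have bad: False if l: "insert l C:B" "l~:C" "l ~= m" "l ~= j" for l
 proof -
 have lX: "l~:X" "l ~= i" "l ~= k" using l memC by auto
 have cl: "card (insert l C) = card X + 2" using fC l(2) by simp
 have A: "~ (l < m & m < k)" by (rule notI, rule WS_less[OF ws B'(1) l(1), of m l k]) (use o(1,2) in "simp_all add: cl cd mem memC mX lX ne o(3-5) l(3) l(3)[symmetric] mX(2-4)[symmetric]")
 have A2: "~ (k < m & m < l)" by (rule notI, rule WS_less[OF ws B'(1) l(1), of m k l]) (use o(1,2) in "simp_all add: cl cd mem memC mX lX ne o(3-5) l(3) l(3)[symmetric] mX(2-4)[symmetric]")
 have A': "~ (l < m & m < i)" by (rule notI, rule WS_less[OF ws B'(2) l(1), of m l i]) (use o(1,2) in "simp_all add: cl cd mem memC mX lX ne o(3-5) l(3) l(3)[symmetric] mX(2-4)[symmetric]")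
 have A'2: "~ (i < m & m < l)" by (rule notI, rule WS_less[OF ws B'(2) l(1), of m i l]) (use o(1,2) in "simp_all add: cl cd mem memC mX lX ne o(3-5) l(3) l(3)[symmetric] mX(2-4)[symmetric]")
 have E1: "~ (m < l & l < j)" if "m < i" by (rule notI, rule WS_eq[OF ws B'(3) l(1), of m l j k]) (use o(1,2) that in "simp_all add: cl cd mem memC mX lX l(4) ne o(3-5) l(3) l(3)[symmetric] mX(2-4)[symmetric]")
 have E2: "~ (j < l)" if "m < i" by (rule notI, rule WS_eq[OF ws B'(5) l(1), of m i j l]) (use o(1,2) that in "simp_all add: cl cd mem memC mX lX l(4) ne o(3-5) l(3) l(3)[symmetric] mX(2-4)[symmetric]")
 have E3: "~ (l < j)" if "k < m" by (rule notI, rule WS_eq[OF ws l(1) B'(3), of l j k m]) (use o(1,2) that in "simp_all add: cl cd mem memC mX lX l(4) ne o(3-5) l(3) l(3)[symmetric] mX(2-4)[symmetric]")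
 have E4: "~ (j < l & l < m)" if "k < m" by (rule notI, rule WS_eq[OF ws l(1) B'(5), of i j l m]) (use o(1,2) that in "simp_all add: cl cd mem memC mX lX l(4) ne o(3-5) l(3) l(3)[symmetric] mX(2-4)[symmetric]")
 show False
 proof (rule linorder_cases[of m i])
 assume mi: "m < i"
 hence "m < k" using o(1,2) by linarith
 hence "m < l" using A l(3) by linarith
 thus False using E1[OF mi] E2[OF mi] l(4) by linarith
 next
 assume im: "i < m"
 show False
 proof (cases "k < m")
 case True
 hence "l < m" using A2 l(3) by linarith
 thus False using E3[OF True] E4[OF True] l(4) by linarith
 next
 case False
 hence "m < k" using mX(3) by simp
 thus False using A A'2 im l(3) by linarith
 qed
 qed (use mX(2) in simp)
 qed
 obtain c where c: "p < c" "c < p'" "c~:C" "insert c C:B" using bot_mid[OF K] by metis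
 have e: "insert p C:B" "insert p' C:B" "p~:C" "p'~:C" using vertex_B(1,2)[of C p p'] K K_tile[OF K] by blast+
 have "p:{m, j}" "c:{m, j}" "p':{m, j}" using bad[OF e(1,3)] bad[OF c(4,3)] bad[OF e(2,4)] by auto
 thus False using c(1,2) by auto
 qed
 \<comment> \<open>For another label \<open>m\<close> the set \<open>A'\<close> is not in the
   spectrum, hence the top of a lens. Three of the labels at this top are then \<open>i\<close>,
   \<open>k\<close> and \<open>m\<close>, and each possible order of these is contradictory.\<close>
 have outs: "A' = insert i (insert j (insert k X))" if e: "(Xik, A'):edges" for A'
 proof -
 obtain m where m: "A' = insert m Xik" "m~:Xik" using edge_props[OF e] by metis
 have mX: "m~:X" "m ~= i" "m ~= k" using m mem by auto
 have fv: "finite Xik" using fX unfolding d by simp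
 have cm: "card A' = card X + 3" unfolding m(1) using m(2) fv cd by simp
 have memY: "x:A' \<longleftrightarrow> x = m | x = i | x = k | x:X" for x unfolding m(1) using mem by auto
 show ?thesis
 proof (cases "m = j")
 case True
 thus ?thesis unfolding m(1) d by auto
 next
 case mj: False
 have nAB: "A'~:B"
 proof
 assume AB: "A':B"
 show False
 proof (cases "m < j")
 case True
 hence False apply - by (rule WS_less[OF ws B'(3) AB, of j m k]) (use o(1,2) in "simp_all add: cm cd mem memY mX mj ne o(3-5)")
 thus False .
 next
 case False
 hence "j < m" using mj by simp
 hence False apply - by (rule WS_less[OF ws B'(5) AB, of j i m]) (use o(1,2) in "simp_all add: cm cd mem memY mX mj ne o(3-5)")
 thus False .
 qed
 qed
 obtain te where te: "te:W Un K" "(Xik, A'):tile_edges te" using e unfolding edges_of_def by blast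
 have "A':tile_vertices te" using te(2) unfolding tile_edges_def tile_vertices_def by auto
 hence "A':tops" using B_I[OF te(1)] nAB not_into_bots[OF e] by blast
 then obtain \<kappa> where k: "\<kappa>:K" "top_vertex \<kappa> = A'" by auto
 then obtain C p p' where \<kappa>: "\<kappa> = Tile C p p'" by (cases \<kappa>) auto
 have K: "Tile C p p':K" and CY: "insert p (insert p' C) = A'" using k \<kappa> by auto
 have kt: "p < p'" "p~:C" "p'~:C" "finite C" using K_tile[OF K] by auto
 have bad: False if l: "A' - {l}:B" "l:X" for l
 proof -
 have lm: "l ~= m" "l ~= i" "l ~= k" "l ~= j" using l mX o by auto
 have cl: "card (A' - {l}) = card X + 2" using cm memY l fv m(1) by simp
 have ml: "x:A' - {l} \<longleftrightarrow> x = m | x = i | x = k | x:X & x ~= l" for x using memY lm by auto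
 have A: "~ (m < l & l < k)" by (rule notI, rule WS_less[OF ws B'(1) l(1), of l m k]) (use o(1,2) in "simp_all add: cl cd mem memY ml mX lm l(2) ne o(3-5)")
 have A2: "~ (k < l & l < m)" by (rule notI, rule WS_less[OF ws B'(1) l(1), of l k m]) (use o(1,2) in "simp_all add: cl cd mem memY ml mX lm l(2) ne o(3-5)")
 have A': "~ (m < l & l < i)" by (rule notI, rule WS_less[OF ws B'(2) l(1), of l m i]) (use o(1,2) in "simp_all add: cl cd mem memY ml mX lm l(2) ne o(3-5)")
 have A'2: "~ (i < l & l < m)" by (rule notI, rule WS_less[OF ws B'(2) l(1), of l i m]) (use o(1,2) in "simp_all add: cl cd mem memY ml mX lm l(2) ne o(3-5)")
 have E1: "~ (m < j & k < l)" by (rule notI, rule WS_eq[OF ws l(1) B'(3), of m j k l]) (use o(1,2) in "simp_all add: cl cd mem memY ml mX lm l(2) mj ne o(3-5)")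
 have E2: "~ (l < m & m < j)" by (rule notI, rule WS_eq[OF ws B'(3) l(1), of l m j k]) (use o(1,2) in "simp_all add: cl cd mem memY ml mX lm l(2) mj ne o(3-5)")
 have E3: "~ (l < i & j < m)" by (rule notI, rule WS_eq[OF ws B'(5) l(1), of l i j m]) (use o(1,2) in "simp_all add: cl cd mem memY ml mX lm l(2) mj ne o(3-5)")
 have E4: "~ (j < m & m < l)" by (rule notI, rule WS_eq[OF ws l(1) B'(5), of i j m l]) (use o(1,2) in "simp_all add: cl cd mem memY ml mX lm l(2) mj ne o(3-5)")
 show False
 proof (cases "m < j")
 case True
 hence "m < l" using E2 lm(1) by linarith
 thus False using A E1 True lm(3) by linarith
 next
 case False
 hence jm: "j < m" using mj by simp
 hence "l < m" using E4 lm(1) by linarith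
 thus False using A'2 E3 jm lm(2) by linarith
 qed
 qed
 have Cpp: "A' - {p'} = insert p C" "A' - {p} = insert p' C" unfolding CY[symmetric] using kt by auto
 have e: "A' - {p}:B" "A' - {p'}:B" unfolding Cpp using vertex_B(1,2)[of C p p'] K by blast+
 obtain c where c: "p < c" "c < p'" "c:C" "insert p' (insert p (C - {c})):B" using top_mid[OF K] by metis
 have "A' - {c} = insert p' (insert p (C - {c}))" unfolding CY[symmetric] using c(1-3) by auto
 hence c4: "A' - {c}:B" using c(4) by simp
 have inY: "p:A'" "p':A'" "c:A'" unfolding CY[symmetric] using c by auto
 have L: "p = m | p = i | p = k" "c = m | c = i | c = k" "p' = m | p' = i | p' = k" using bad[OF e(1)] bad[OF c4] bad[OF e(2)] inY memY by auto
 have ik: "i < k" using o(1,2) by simp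
 have CB: "C~:B" using B_not_terminal K by (metis bottom_Tile imageI)
 have Ceq: "C = A' - {p} - {p'}" unfolding CY[symmetric] using kt by auto
 show ?thesis
 proof (rule linorder_cases[of m i])
 assume mi: "m < i"
 have pp: "p = m" "p' = k" using three_labels[OF L c(1,2) mi ik] by auto
 have "x:C \<longleftrightarrow> x:Xi" for x unfolding Ceq pp using mX o(3-5) ne by (cases "x = m"; cases "x = k"; simp add: memY mem)
 hence "C = Xi" by blast
 thus ?thesis using CB B'(1) by simp
 next
 assume mi: "i < m"
 show ?thesis
 proof (cases "k < m")
 case True
 have L': "p = i | p = k | p = m" "c = i | c = k | c = m" "p' = i | p' = k | p' = m" using L by argo+
 have pp: "p = i" "p' = m" using three_labels[OF L' c(1,2) ik True] by auto
 have "x:C \<longleftrightarrow> x:Xk" for x unfolding Ceq pp using mX o(3-5) ne by (cases "x = m"; cases "x = i"; simp add: memY mem)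
 hence "C = Xk" by blast
 thus ?thesis using CB B'(2) by simp
 next
 case False
 hence mk: "m < k" using mX by simp
 have L': "p = i | p = m | p = k" "c = i | c = m | c = k" "p' = i | p' = m | p' = k" using L by argo+
 have pp: "p = i" "p' = k" using three_labels[OF L' c(1,2) mi mk] by auto
 have "x:A' - {k} \<longleftrightarrow> x:insert m Xi" for x using mX o(3-5) ne by (cases "x = k"; simp add: memY mem)
 hence r1: "A' - {k} = insert m Xi" by blast
 have "x:A' - {i} \<longleftrightarrow> x:insert m Xk" for x using mX o(3-5) ne by (cases "x = i"; simp add: memY mem)
 hence r2: "A' - {i} = insert m Xk" by blast
 note r = r1 r2
 have rB: "insert m Xi:B" "insert m Xk:B" using e r unfolding pp by simp_all
 have rc: "card (insert m Xi) = card X + 2" "card (insert m Xk) = card X + 2" using cd mem mX fX unfolding d by auto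
 show ?thesis
 proof (cases "j < m")
 case True
 hence False apply - by (rule WS_eq[OF ws rB(1) B'(5), of i j m k]) (use o(1,2) mk mi in "simp_all add: rc cd mem mX mj ne o(3-5)")
 thus ?thesis ..
 next
 case False
 hence "m < j" using mj by simp
 hence False apply - by (rule WS_eq[OF ws B'(3) rB(2), of i m j k]) (use o(1,2) mk mi in "simp_all add: rc cd mem mX mj ne o(3-5)")
 thus ?thesis ..
 qed
 qed
 qed (use mX in simp)
 qed
 qed
 have Xb: "Xi~:bots" "Xk~:bots" "Xik~:bots" "Xik~:tops" using B_not_terminal B' by blast+
 \<comment> \<open>A spectrum set \<open>insert w Y\<close> over the top of a lens must contain the
   label \<open>c\<close> of a middle vertex at its bottom, since \<open>p < c < p'\<close>; so
   there is at most one such set.\<close>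
 have toplow: False if K: "Tile C p p':K" and Y: "insert p (insert p' C) = Y" and u: "insert u Y:B" "insert v Y:B" "u~:Y" "v~:Y" "u ~= v" for C p p' Y u v
 proof -
 have kt: "p < p'" "p~:C" "p'~:C" "finite C" using K_tile[OF K] by auto
 obtain c where c: "p < c" "c < p'" "c~:C" "insert c C:B" using bot_mid[OF K] by metis
 have cY: "card (insert w Y) = card C + 3" if "w~:Y" for w using that kt unfolding Y[symmetric] by simp
 have bad: False if w: "insert w Y:B" "w~:Y" "w ~= c" for w
 proof (rule WS_less[OF ws c(4) w(1), of c p p'])
 show "card (insert c C) < card (insert w Y)" using cY[OF w(2)] kt c by simp
 show "c:insert c C" "p:insert w Y" "p':insert w Y" "p < c" "c < p'" using c unfolding Y[symmetric] by auto
 show "c~:insert w Y" using c w(3) unfolding Y[symmetric] by auto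
 show "p~:insert c C" "p'~:insert c C" using c kt by auto
 qed
 show False using bad[OF u(1,3)] bad[OF u(2,4)] u(5) by blast
 qed
 have memV: "v:B | v:bots | v:tops" if "te:W Un K" "v:tile_vertices te" for v te using B_I[OF that] by blast
 have kcases: "EX C p p'. Tile C p p':K & C = v" if "v:bots" for v using that by (metis bottom_Tile imageE tile.exhaust)
 have tcases: "EX C p p'. Tile C p p':K & insert p (insert p' C) = v" if "v:tops" for v using that by (metis top_Tile imageE tile.exhaust)
 have ijn: "i~:insert j X" "k~:insert j X" "insert i (insert j X) = Xij" "insert k (insert j X) = Xjk" using ne o unfolding d by auto
 have hj: "(ALL te:W Un K. insert j X~:tile_vertices te) | Tile (insert j X) i k:K"
 proof (rule disjCI)
 assume nK: "Tile (insert j X) i k~:K"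
 show "ALL te:W Un K. insert j X~:tile_vertices te"
 proof (intro ballI notI)
 fix te assume "te:W Un K" "insert j X:tile_vertices te"
 hence "insert j X:bots | insert j X:tops" using memV nB by blast
 thus False
 proof
 assume "insert j X:tops"
 then obtain C p p' where "Tile C p p':K" "insert p (insert p' C) = insert j X" using tcases by blast
 thus False using toplow[of C p p' "insert j X" i k] B' ijn ne by simp
 next
 assume "insert j X:bots"
 then obtain p p' where K: "Tile (insert j X) p p':K" using kcases by blast
 have kt: "p < p'" "p~:insert j X" "p'~:insert j X" using K_tile[OF K] by auto
 have out: "~ (l < i) & ~ (k < l)" if l: "insert l (insert j X):B" "l~:insert j X" for l
 proof -
 have cl: "card (insert l (insert j X)) = card X + 2" using l(2) fX o by simp
 have l2: "l~:X" "l ~= j" using l(2) by auto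
 have "~ l < i" by (rule notI, rule WS_eq[OF ws l(1) B'(4), of l i j k]) (use o(1,2) in "simp_all add: cl cd mem l2 ne o(3-5)")
 moreover have "~ k < l" by (rule notI, rule WS_eq[OF ws B'(4) l(1), of i j k l]) (use o(1,2) in "simp_all add: cl cd mem l2 ne o(3-5)")
 ultimately show ?thesis by blast
 qed
 have e: "insert p (insert j X):B" "insert p' (insert j X):B" using vertex_B(1,2)[of "insert j X" p p'] K by blast+
 have ee: "~ p < i" "~ k < p'" using out[OF e(1) kt(2)] out[OF e(2) kt(3)] by auto
 obtain c where c: "p < c" "c < p'" "c:insert j X" "insert p' (insert p (insert j X - {c})):B" using top_mid[OF K] by metis
 have cc: "card (insert p' (insert p (insert j X - {c}))) = card X + 2"
 proof -
 have "card (insert j X - {c}) = card X" using c(3) fX o by simp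
 thus ?thesis using kt fX by simp
 qed
 have pj: "p ~= j" "p~:X" "p' ~= j" "p'~:X" using kt by auto
 have "~ i < p" by (rule notI, rule WS_eq[OF ws B'(3) c(4), of i p c p']) (use c(1-3) kt(1) o(1,2) in "auto simp: cc cd mem o(3-5) ne pj")
 moreover have "~ p' < k" by (rule notI, rule WS_eq[OF ws c(4) B'(5), of p c p' k]) (use c(1-3) kt(1) o(1,2) in "auto simp: cc cd mem o(3-5) ne pj")
 ultimately have "p = i" "p' = k" using ee by auto
 thus False using K nK by simp
 qed
 qed
 qed
 \<comment> \<open>Two planar edges enter \<open>Xik\<close>, from \<open>Xi\<close> and from
   \<open>Xk\<close>. The value \<open>c = i\<close> means that \<open>Tile X i k\<close> is white;
   any other \<open>c\<close> yields the set \<open>insert k (Xi - {c})\<close> of the spectrum,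
   which keeps \<open>X\<close> from being a vertex.\<close>
 obtain c where c: "c:Xi" "c < k" "Tile (Xi - {c}) c k:W"
 using same_top_step[OF Vs(2,3)] ins o by auto
 have hb: "Tile X i k:W & (ALL A A'. (A, A'):edges --> Xik:{A, A'} -->
 (A, A'):{(Xi, Xik), (Xk, Xik), (Xik, insert i (insert j (insert k X)))})
 | (ALL te:W Un K. X~:tile_vertices te) & (ALL A'. (Xik, A'):edges --> A' = insert i (insert j (insert k X))) &
 (ALL te:K. Xik~:tile_vertices te)"
 proof (cases "c = i")
 case True
 hence b1: "Tile X i k:W" using c(3) o unfolding d by simp
 have inE: "A = Xi | A = Xk" if e: "(A, Xik):edges" for A
 proof -
 obtain m where m: "Xik = insert m A" "m~:A" using edge_props[OF e] by metis
 have Am: "A = Xik - {m}" "m:Xik" using m by auto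
 have nb: "A~:bots"
 proof
 assume "A:bots"
 then obtain C p p' where "Tile C p p':K" "C = A" using kcases by blast
 thus False using nolens Am by blast
 qed
 have VA: "V A m" unfolding V_def using m e nb Xb by auto
 have "m = i | m = k"
 by (rule single_in[of i X j k A m, folded d]) (use t1 t2 b1 Xb VA m in simp_all)
 moreover have "Xik - {i} = Xk" "Xik - {k} = Xi" using ne o unfolding d by auto
 ultimately show ?thesis using Am(1) by blast
 qed
 have "(A, A'):{(Xi, Xik), (Xk, Xik), (Xik, insert i (insert j (insert k X)))}" if "(A, A'):edges" "Xik:{A, A'}" for A A'
 using that inE[of A] outs[of A'] by blast
 thus ?thesis using b1 by blast
 next
 case ci: False
 hence cX: "c:X" using c(1) mem by auto
 have R: "insert k (Xi - {c}):B" using vertex_B(2)[of "Xi - {c}" c k] c(3) by blast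
 have cr: "card (insert k (Xi - {c})) = card X + 1" using card_exchange[OF B_finite[OF B'(1)] c(1)] cd(1) nonin by simp
 have ic: "i < c"
 proof (rule ccontr)
 assume "~ i < c"
 hence "c < i" using ci by simp
 hence False apply - by (rule WS_less[OF ws R B'(5), of i c j]) (use o(1,2) in "simp_all add: cr cd mem cX ci ne o(3-5)")
 thus False .
 qed
 have "X~:tile_vertices te" if te: "te:W Un K" for te
 proof
 assume "X:tile_vertices te"
 hence "X:B | X:bots | X:tops" using memV te by blast
 thus False
 proof (elim disjE)
 assume "X:B"
 thus False apply - by (rule WS_less[OF ws _ R, of X c i k]) (use ic c(2) in "simp_all add: cr cX mem o(3-5) ci ne")
 next
 assume "X:tops"
 then obtain C p p' where "Tile C p p':K" "insert p (insert p' C) = X" using tcases by blast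
 thus False using toplow[of C p p' X i k] B o ne by simp
 next
 assume "X:bots"
 then obtain p p' where K: "Tile X p p':K" using kcases by blast
 have kt: "p < p'" "p~:X" "p'~:X" using K_tile[OF K] by auto
 have lab: "l = i | l = k" if l: "insert l X:B" "l~:X" for l
 proof (rule ccontr)
 assume n: "~ (l = i | l = k)"
 have lj: "l ~= j" using l nB by blast
 have cl: "card (insert l X) = card X + 1" using l(2) fX by simp
 have "~ l < i" by (rule notI, rule WS_eq[OF ws l(1) R, of l i c k]) (use o(1,2) ic c(2) in "simp_all add: cl cr mem cX ci n l(2) o(3-5)")
 moreover have "~ k < l" by (rule notI, rule WS_eq[OF ws R l(1), of i c k l]) (use o(1,2) ic c(2) in "simp_all add: cl cr mem cX ci n l(2) o(3-5)")
 moreover have "~ (i < l & l < j)" by (rule notI, rule WS_less[OF ws l(1) B'(3), of l i j]) (use o(1,2) in "simp_all add: cl cd mem n lj l(2) o(3-5)")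
 moreover have "~ (j < l & l < k)" by (rule notI, rule WS_less[OF ws l(1) B'(5), of l j k]) (use o(1,2) in "simp_all add: cl cd mem n lj l(2) o(3-5)")
 ultimately show False using n lj by linarith
 qed
 obtain c' where c': "p < c'" "c' < p'" "c'~:X" "insert c' X:B" using bot_mid[OF K] by metis
 have e: "insert p X:B" "insert p' X:B" using vertex_B(1,2)[of X p p'] K by blast+
 show False using lab[OF e(1) kt(2)] lab[OF e(2) kt(3)] lab[OF c'(4,3)] c'(1,2) by auto
 qed
 qed
 moreover have "Xik~:tile_vertices \<kappa>" if k: "\<kappa>:K" for \<kappa>
 proof
 assume v: "Xik:tile_vertices \<kappa>"
 obtain C p p' where \<kappa>: "\<kappa> = Tile C p p'" by (cases \<kappa>) auto
 have K: "Tile C p p':K" using k \<kappa> by simp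
 have kt: "p~:C" "p'~:C" using K_tile[OF K] by auto
 have "C:bots" "insert p (insert p' C):tops" using K by (metis bottom_Tile imageI, metis top_Tile imageI)
 hence "Xik = insert p C | Xik = insert p' C" using v Xb unfolding \<kappa> tile_vertices_Tile by auto
 thus False
 proof
 assume "Xik = insert p C"
 hence "C = Xik - {p}" "p:Xik" using kt by auto
 thus False using nolens[OF K] by blast
 next
 assume "Xik = insert p' C"
 hence "C = Xik - {p'}" "p':Xik" using kt by auto
 thus False using nolens[OF K] by blast
 qed
 qed
 ultimately show ?thesis using outs by blast
 qed
 show ?thesis
 by (rule flip[OF o t1[unfolded d] t2[unfolded d] Xb(1)[unfolded d] Xb(2)[unfolded d] hb[unfolded d] hj])
qed

end

section \<open>Heights of tiles over one level\<close>
lemma finite_argmin: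
 fixes f :: "'a => 'b :: linorder"
 assumes "finite S" "S ~= {}"
 shows "EX m:S. ALL y:S. f m<=f y"
proof -
 have "Min (f ` S):f ` S" using assms by (intro Min_in) auto
 then obtain m where "m:S" "Min (f ` S) = f m" by blast
 thus ?thesis using assms(1) by (metis Min_le finite_imageI imageI)
qed

lemma finite_argmax:
 fixes f :: "'a => 'b :: linorder"
 assumes "finite S" "S ~= {}"
 shows "EX m:S. ALL y:S. f y<=f m"
proof -
 have "Max (f ` S):f ` S" using assms by (intro Max_in) auto
 then obtain m where "m:S" "Max (f ` S) = f m" by blast
 thus ?thesis using assms(1) by (metis Max_ge finite_imageI imageI)
qed

text \<open>For weights \<open>a\<close> and heights \<open>f\<close> of the labels, \<open>chord a f l m\<close> is the line through the points of \<open>l\<close> and \<open>m\<close>.\<close>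
definition chord :: "(nat => real) => (nat => real) => nat => nat => real => real" where
 "chord a f l m w = f l + (f m - f l) / (a m - a l) * (w - a l)"

definition concave_on :: "nat => (nat => real) => (nat => real) => bool" where
 "concave_on n a f \<longleftrightarrow> (ALL l m r. 1<=l --> l < m --> m < r --> r<=n --> chord a f l r (a m) < f m)"

text \<open>With \<open>X\<close> placed at abscissa \<open>wsum a X\<close> and height
  \<open>wsum f X\<close>, this is the height over \<open>x\<close> of the diagonal from the left to
  the right vertex of the tile, the section of the lifted tile at level
  \<open>card X + 1\<close>.\<close>

definition height :: "(nat => real) => (nat => real) => nat set => nat => nat => real => real" where
 "height a f X i j x = wsum f X + chord a f i j (x - wsum a X)"

definition covers :: "(nat => real) => nat set => nat => nat => real => bool" where
 "covers a X i j x \<longleftrightarrow> a i < x - wsum a X & x - wsum a X < a j"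

lemma chord_left: "chord a f l m (a l) = f l"
 and chord_right: "a l < a m ==> chord a f l m (a m) = f m"
 by (simp_all add: chord_def)

lemma chord_affine: "chord a f l m ((1 - s) * u + s * v) = (1 - s) * chord a f l m u + s * chord a f l m v"
proof -
 define k where "k = (f m - f l) / (a m - a l)"
 show ?thesis unfolding chord_def k_def[symmetric] by (simp add: algebra_simps)
qed

lemma chord_reflect:
 assumes "a l < a m"
 shows "chord a f l m (a l + a m - w) = f l + f m - chord a f l m w"
proof -
 define k where "k = (f m - f l) / (a m - a l)"
 have "k * (a m - a l) = f m - f l" unfolding k_def using assms by simp
 thus ?thesis unfolding chord_def k_def[symmetric] by (simp add: algebra_simps)
qed

text \<open>By concavity both ends of the shorter chord lie on or above the longer one, and at least
  one of them strictly above.\<close>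

lemma chord_less:
 assumes a: "increasing_on n a" and f: "concave_on n a f" and o: "1<=p" "p<=l" "l < m" "m<=q" "q<=n" "~ (l = p & m = q)"
 and w: "a l < w" "w < a m"
 shows "chord a f p q w < chord a f l m w"
proof -
 have apq: "a p < a q" "a l < a m" using increasing_onD[OF a, of p q] increasing_onD[OF a, of l m] o by auto
 define s where "s = (w - a l) / (a m - a l)"
 have s: "0 < s" "s < 1" "w = (1 - s) * a l + s * a m"
 proof -
 show "0 < s" "s < 1" using w apq unfolding s_def by auto
 have "s * (a m - a l) = w - a l" unfolding s_def using apq by simp
 thus "w = (1 - s) * a l + s * a m" by (simp add: algebra_simps)
 qed
 note fD = f[unfolded concave_on_def, rule_format]
 have L2: "chord a f p q (a l) < f l" if "l ~= p" by (rule fD) (use o(1-5) that in linarith)+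
 have L1: "chord a f p q (a l)<=f l"
 proof (cases "l = p")
 case True
 thus ?thesis by (simp add: chord_left)
 next
 case False
 thus ?thesis using L2 by simp
 qed
 have R2: "chord a f p q (a m) < f m" if "m ~= q" by (rule fD) (use o(1-5) that in linarith)+
 have R1: "chord a f p q (a m)<=f m"
 proof (cases "m = q")
 case True
 thus ?thesis using chord_right[OF apq(1), of f] by simp
 next
 case False
 thus ?thesis using R2 by simp
 qed
 note L = L1 L2 and R = R1 R2
 have "(1 - s) * chord a f p q (a l) + s * chord a f p q (a m) < (1 - s) * f l + s * f m"
 proof (cases "l = p")
 case True
 hence "s * chord a f p q (a m) < s * f m" using R(2) o(6) s by simp
 moreover have "(1 - s) * chord a f p q (a l)<=(1 - s) * f l" using L(1) s by simp
 ultimately show ?thesis by linarith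
 next
 case False
 hence "(1 - s) * chord a f p q (a l) < (1 - s) * f l" using L(2) s by simp
 moreover have "s * chord a f p q (a m)<=s * f m" using R(1) s by simp
 ultimately show ?thesis by linarith
 qed
 thus ?thesis unfolding s(3) chord_affine chord_left chord_right[OF apq(2)] by simp
qed

lemma chain_cover:
 fixes z :: "nat => real"
 shows "z 0 < x ==> x < z N ==> (ALL t<=N. x ~= z t) ==> EX t<N. z t < x & x < z (Suc t)"
proof (induction N)
 case (Suc N)
 show ?case
 proof (cases "x < z N")
 case True
 thus ?thesis using Suc.IH Suc.prems by (metis le_SucI less_SucI)
 next
 case False
 hence "z N < x" using Suc.prems(3) by (metis le_SucI linorder_neqE_linordered_idom order_refl)
 thus ?thesis using Suc.prems(2) by blast
 qed
qed simp

definition generic_pos :: "nat => (nat => real) => real => bool" where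
 "generic_pos n a x \<longleftrightarrow> (ALL v:Pow {1..n}. x ~= wsum a v)"

lemma eventually_generic: "eventually (generic_pos n a) (at u within S)"
 unfolding generic_pos_def by (intro eventually_ball_finite ballI eventually_neq_at_within) simp

lemma generic_between:
 assumes "u < v"
 obtains x where "u < x" "x < v" "generic_pos n a x"
proof -
 have "eventually (%x. x:{u<..<v} & generic_pos n a x) (at_right u)"
 by (intro eventually_conj eventually_generic eventually_at_right_real assms)
 moreover have "at_right u ~= bot" by simp
 ultimately have "EX x. x:{u<..<v} & generic_pos n a x" by (intro eventually_happens')
 then obtain x where "x:{u<..<v}" "generic_pos n a x" by blast
 thus ?thesis using that[of x] by simp
qed

lemma cont_height: "continuous (at u within S) (height a f X i j)"
 unfolding height_def chord_def by (intro continuous_intros)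

context gt
begin

text \<open>Over a lens, the diagonal of the black tile is one long chord, and the diagonals of the
  white tiles over its bottom form an inscribed concave polygon with the same ends.\<close>

lemma upper_height:
 assumes a: "increasing_on n a" and f: "concave_on n a f" and K: "Tile C p q:K" and t: "Tile C l m:W" "covers a C l m x"
 shows "height a f C p q x < height a f C l m x" "covers a C p q x"
proof -
 have k: "1<=p" "q<=n" "p < q" using K_tile[OF K] by auto
 have lm: "l < m" "1<=l" "m<=n" using W_tile[OF t(1)] by auto
 have lab: "p<=l" "m<=q" using bot_labels[OF K t(1)] by auto
 have ne: "~ (l = p & m = q)" using disj K t(1) by blast
 show "height a f C p q x < height a f C l m x"
 unfolding height_def using chord_less[OF a f k(1) lab(1) lm(1) lab(2) k(2) ne] t(2) unfolding covers_def by simp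
 have "a p<=a l" using increasing_onD[OF a, of p l] lab lm k by (cases "p = l") auto
 moreover have "a m<=a q" using increasing_onD[OF a, of m q] lab lm k by (cases "m = q") auto
 ultimately show "covers a C p q x" using t(2) unfolding covers_def by linarith
qed

lemma wsum_top:
 fixes a :: "nat => real"
 assumes "insert l (insert m D) = insert p (insert q C)" "finite C" "finite D" "l~:D" "m~:D" "l ~= m" "p~:C" "q~:C" "p ~= q"
 shows "wsum a D + a l + a m = wsum a C + a p + a q"
proof -
 have "wsum a (insert l (insert m D)) = a l + (a m + wsum a D)" using assms(3-6) by (simp add: wsum_insert)
 moreover have "wsum a (insert p (insert q C)) = a p + (a q + wsum a C)" using assms(2,7-9) by (simp add: wsum_insert)
 ultimately show ?thesis using assms(1) by simp
qed

text \<open>At the top the labels are subtracted from \<open>Y\<close>, so the polygon is turned by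
  \<open>chord_reflect\<close> and runs below the chord of the black tile.\<close>

lemma lower_height:
 assumes a: "increasing_on n a" and f: "concave_on n a f" and K: "Tile C p q:K"
 and t: "Tile D l m:W" "insert l (insert m D) = insert p (insert q C)" "covers a D l m x"
 shows "height a f D l m x < height a f C p q x" "covers a C p q x" "card D = card C"
proof -
 have k: "1<=p" "q<=n" "p < q" "p~:C" "q~:C" "finite C" using K_tile[OF K] by auto
 have lm: "l < m" "1<=l" "m<=n" "l~:D" "m~:D" "finite D" using W_tile[OF t(1)] by auto
 have lab: "p<=l" "m<=q" using top_labels[OF K t(1,2)] by auto
 have ne: "~ (l = p & m = q)"
 proof
 assume e: "l = p & m = q"
 have "z:D \<longleftrightarrow> z:C" for z using t(2) e k lm by (metis insert_iff)
 hence "D = C" by blast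
 thus False using disj K t(1) e by blast
 qed
 have apq: "a p < a q" "a l < a m" using increasing_onD[OF a, of p q] increasing_onD[OF a, of l m] k lm by auto
 note wa = wsum_top[OF t(2) k(6) lm(6) lm(4,5) _ k(4,5), of a] and wf = wsum_top[OF t(2) k(6) lm(6) lm(4,5) _ k(4,5), of f]
 define w where "w = a p + a q - (x - wsum a C)"
 have x: "x - wsum a D = a l + a m - w" unfolding w_def using wa k(3) lm(1) by simp
 have w: "a l < w" "w < a m" using t(3) x unfolding covers_def by linarith+
 have "chord a f p q w < chord a f l m w" by (rule chord_less[OF a f k(1) lab(1) lm(1) lab(2) k(2) ne w])
 moreover have "chord a f l m (x - wsum a D) = f l + f m - chord a f l m w" unfolding x by (rule chord_reflect[OF apq(2)])
 moreover have "chord a f p q (x - wsum a C) = f p + f q - chord a f p q w" using chord_reflect[OF apq(1), of f w] unfolding w_def by simp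
 ultimately show "height a f D l m x < height a f C p q x" unfolding height_def using wf k(3) lm(1) by simp
 have "a p<=a l" using increasing_onD[OF a, of p l] lab lm k by (cases "p = l") auto
 moreover have "a m<=a q" using increasing_onD[OF a, of m q] lab lm k by (cases "m = q") auto
 ultimately show "covers a C p q x" using w unfolding covers_def w_def by linarith
 show "card D = card C" using arg_cong[OF t(2), of card] k lm by simp
qed

lemma lens_lower:
 assumes a: "increasing_on n a" and f: "concave_on n a f" and K: "Tile C p q:K" and c: "covers a C p q x" "generic_pos n a x"
 obtains D l m where "Tile D l m:W" "insert l (insert m D) = insert p (insert q C)" "covers a D l m x"
proof (rule top_chain[OF K refl])
 define Y where "Y = insert p (insert q C)"
 fix N and g :: "nat => nat"
 assume "2<=N" and g: "g 0 = p" "g N = q" "!!t. t < N ==> g t < g (Suc t) & g t:insert p (insert q C) & g (Suc t):insert p (insert q C) &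
 Tile (insert p (insert q C) - {g (Suc t)} - {g t}) (g t) (g (Suc t)):W"
 note g = g[folded Y_def]
 have k: "C<={1..n}" "finite C" "p~:C" "q~:C" "p ~= q" "p:{1..n}" "q:{1..n}" using K_tile[OF K] by auto
 have fY: "finite Y" "Y<={1..n}" unfolding Y_def using k by auto
 have wY: "wsum a Y = a p + (a q + wsum a C)" unfolding Y_def using k by (simp add: wsum_insert)
 have gY: "g t:Y" if "t<=N" for t
 proof (cases "t < N")
 case False
 thus ?thesis using that g(2) unfolding Y_def by simp
 qed (use g(3) in blast)
 have gen: "ALL t<=N. wsum a Y - x ~= a (g t)"
 proof (intro allI impI notI)
 fix t assume t: "t<=N" "wsum a Y - x = a (g t)"
 have "x = wsum a (Y - {g t})" "Y - {g t}:Pow {1..n}" using wsum_remove[OF fY(1) gY[OF t(1)], of a] t(2) fY(2) by auto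
 thus False using c(2) unfolding generic_pos_def by blast
 qed
 obtain t where t: "t < N" "a (g t) < wsum a Y - x" "wsum a Y - x < a (g (Suc t))"
 using chain_cover[of "%t. a (g t)" "wsum a Y - x" N] gen c(1) g(1,2) wY unfolding covers_def by auto
 let ?D = "Y - {g (Suc t)} - {g t}"
 have gt: "g t < g (Suc t)" "g t:Y" "g (Suc t):Y" "Tile ?D (g t) (g (Suc t)):W" using g(3)[OF t(1)] by auto
 have top: "insert (g t) (insert (g (Suc t)) ?D) = Y" using gt(1-3) by auto
 have "g t:Y - {g (Suc t)}" using gt(1,2) by simp
 hence "wsum a Y = a (g (Suc t)) + (a (g t) + wsum a ?D)"
 using wsum_remove[OF fY(1) gt(3), of a] wsum_remove[of "Y - {g (Suc t)}" "g t" a] fY by simp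
 hence "covers a ?D (g t) (g (Suc t)) x" unfolding covers_def using t by simp
 thus ?thesis using that[of ?D "g t" "g (Suc t)"] gt(4) top unfolding Y_def by blast
qed

definition level_tiles :: "nat => (nat => real) => real => tile set" where
 "level_tiles h a x = {te:W. card (tile_base te) = h & covers a (tile_base te) (tile_fst te) (tile_snd te) x}"

lemma level_tiles_Tile: "Tile X i j:level_tiles h a x \<longleftrightarrow> Tile X i j:W & card X = h & covers a X i j x"
 unfolding level_tiles_def by simp

text \<open>Tiles with nonterminal bottom, called good below, behave as in a plane tiling: the spans
  of different ones of one level are disjoint.\<close>

lemma good_unique:
 assumes a: "increasing_on n a" and "Tile X i j:W" "X~:bots" "covers a X i j x" "Tile X' i' j':W" "X'~:bots" "covers a X' i' j' x" "card X' = card X"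
 shows "X' = X & i' = i & j' = j"
proof (rule lower_unique[OF assms(2,3,5,6,8) a])
 have t: "i~:X" "j~:X" "finite X" "i'~:X'" "j'~:X'" "finite X'" using W_tile[OF assms(2)] W_tile[OF assms(5)] by auto
 show "wsum a (insert i X) < wsum a (insert j' X')" "wsum a (insert i' X') < wsum a (insert j X)"
 using assms(4,7) t unfolding covers_def by (simp_all add: wsum_insert)
qed

text \<open>A lowest tile over \<open>x\<close> is not an upper tile of a lens, since the lens has a lower tile over \<open>x\<close>.\<close>
lemma second_lowest:
 assumes a: "increasing_on n a" and f: "concave_on n a f" and x: "generic_pos n a x"
 and G: "Tile X i j:level_tiles h a x" "X~:bots"
 and T: "Tile Z r s:level_tiles h a x" "Tile Z r s ~= Tile X i j"
 shows "EX C p q. Tile C p q:K & insert p (insert q C) = insert i (insert j X) & height a f C p q x < height a f Z r s x"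
proof -
 let ?H = "%te. height a f (tile_base te) (tile_fst te) (tile_snd te) x"
 let ?S = "level_tiles h a x - {Tile X i j}"
 have fS: "finite ?S" "?S ~= {}" using fin T unfolding level_tiles_def by auto
 obtain te where te: "te:?S" "ALL \<sigma>:?S. ?H te<=?H \<sigma>"
 using finite_argmin[OF fS, of ?H] by blast
 obtain D l m where d: "te = Tile D l m" by (cases te) auto
 have t: "Tile D l m:W" "card D = h" "covers a D l m x" "Tile D l m ~= Tile X i j" using te(1) unfolding d by (auto simp: level_tiles_Tile)
 have g: "Tile X i j:W" "card X = h" "covers a X i j x" using G(1) by (auto simp: level_tiles_Tile)
 have "D:bots"
 proof (rule ccontr)
 assume "D~:bots"
 thus False using good_unique[OF a g(1) G(2) g(3) t(1) _ t(3)] t g by simp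
 qed
 then obtain \<kappa> where k: "\<kappa>:K" "bottom \<kappa> = D" by auto
 obtain p q where \<kappa>: "\<kappa> = Tile D p q" using k(2) by (cases \<kappa>) auto
 have K: "Tile D p q:K" using k \<kappa> by simp
 note up = upper_height[OF a f K t(1,3)]
 obtain D' l' m' where lo: "Tile D' l' m':W" "insert l' (insert m' D') = insert p (insert q D)" "covers a D' l' m' x"
 by (rule lens_lower[OF a f K up(2) x])
 note low = lower_height[OF a f K lo]
 have "Tile D' l' m' = Tile X i j"
 proof (rule ccontr)
 assume "Tile D' l' m' ~= Tile X i j"
 hence "Tile D' l' m':?S" using lo low(3) t(2) by (simp add: level_tiles_Tile)
 hence "?H te<=height a f D' l' m' x" using bspec[OF te(2), of "Tile D' l' m'"] by simp
 thus False using up(1) low(1) unfolding d by simp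
 qed
 hence top: "insert p (insert q D) = insert i (insert j X)" using lo(2) by simp
 have "?H te<=height a f Z r s x" using bspec[OF te(2), of "Tile Z r s"] T by simp
 hence "height a f D p q x < height a f Z r s x" using up(1) unfolding d by simp
 thus ?thesis using K top by blast
qed

text \<open>Compare with a tile in the lower boundary of the lens over \<open>x\<close>: it is the
  good tile itself or lies above it by \<open>second_lowest\<close>.\<close>

lemma good_below_lens:
 assumes a: "increasing_on n a" and f: "concave_on n a f" and x: "generic_pos n a x"
 and G: "Tile X i j:W" "X~:bots" "covers a X i j x" and K: "Tile C p q:K" "covers a C p q x" "card C = card X"
 shows "height a f X i j x < height a f C p q x"
proof -
 obtain D l m where lo: "Tile D l m:W" "insert l (insert m D) = insert p (insert q C)" "covers a D l m x"
 by (rule lens_lower[OF a f K(1,2) x])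
 note low = lower_height[OF a f K(1) lo]
 have g: "Tile X i j:level_tiles (card X) a x" using G by (simp add: level_tiles_Tile)
 show ?thesis
 proof (cases "Tile D l m = Tile X i j")
 case True
 thus ?thesis using low(1) by simp
 next
 case False
 have "Tile D l m:level_tiles (card X) a x" using lo low(3) K(3) by (simp add: level_tiles_Tile)
 from second_lowest[OF a f x g G(2) this False] obtain C' p' q' where C': "Tile C' p' q':K"
 "insert p' (insert q' C') = insert i (insert j X)" "height a f C' p' q' x < height a f D l m x" by blast
 have "height a f X i j x < height a f C' p' q' x" by (rule lower_height(1)[OF a f C'(1) G(1) C'(2)[symmetric] G(3)])
 thus ?thesis using C'(3) low(1) by linarith
 qed
qed

text \<open>Black tiles are determined by their tops, so a lower tile of the second lens is not the
  good tile. By \<open>second_lowest\<close> it lies above a lens with the same top as the good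
  tile, which is the first lens.\<close>

lemma lens_below_lens:
 assumes a: "increasing_on n a" and f: "concave_on n a f" and x: "generic_pos n a x"
 and G: "Tile X i j:W" "X~:bots" "covers a X i j x" and L: "Tile C p q:K" "insert i (insert j X) = insert p (insert q C)"
 and M: "Tile C' p' q':K" "covers a C' p' q' x" "card C' = card C" "C' ~= C"
 shows "height a f C p q x < height a f C' p' q' x"
proof -
 obtain D l m where lo: "Tile D l m:W" "insert l (insert m D) = insert p' (insert q' C')" "covers a D l m x"
 by (rule lens_lower[OF a f M(1,2) x])
 note low = lower_height[OF a f M(1) lo] and lowL = lower_height[OF a f L(1) G(1) L(2) G(3)]
 have same: "Tile C1 p1 q1 = Tile C2 p2 q2" if "Tile C1 p1 q1:K" "Tile C2 p2 q2:K" "insert p1 (insert q1 C1) = insert p2 (insert q2 C2)" for C1 p1 q1 C2 p2 q2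
 using black_top_unique[OF that(1,2)] that(3) by (simp add: tile_vertices_Tile)
 have g: "Tile X i j:level_tiles (card X) a x" using G by (simp add: level_tiles_Tile)
 have ne: "Tile D l m ~= Tile X i j"
 proof
 assume "Tile D l m = Tile X i j"
 hence "insert p' (insert q' C') = insert p (insert q C)" using lo(2) L(2) by simp
 thus False using same[OF M(1) L(1)] M(4) by simp
 qed
 have "Tile D l m:level_tiles (card X) a x" using lo low(3) lowL(3) M(3) by (simp add: level_tiles_Tile)
 from second_lowest[OF a f x g G(2) this ne] obtain C2 p2 q2 where C2: "Tile C2 p2 q2:K"
 "insert p2 (insert q2 C2) = insert i (insert j X)" "height a f C2 p2 q2 x < height a f D l m x" by blast
 have "Tile C2 p2 q2 = Tile C p q" using same[OF C2(1) L(1)] C2(2) L(2) by simp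
 thus ?thesis using C2(3) low(1) by simp
qed

end

section \<open>Choices of heights and the order of tiles near a vertex\<close>

text \<open>The parabola makes the heights strictly concave. The second term is a fall of slope
  \<open>M\<close> beyond \<open>c\<close>, to the right for \<open>d = 1\<close> and to the left
  for \<open>d = - 1\<close>.\<close>

definition kink :: "real => real => real => real => real" where
 "kink M d c x = - x\<^sup>2 - M * max 0 (d * (x - c))"

lemma kink_concave:
 assumes a: "increasing_on n a" and M: "0<=M"
 shows "concave_on n a (%k. kink M d c (a k))"
 unfolding concave_on_def
proof (intro allI impI)
 fix l m r assume o: "1<=l" "l < m" "m < r" "r<=n"
 let ?f = "%k. kink M d c (a k)"
 have al: "a l < a m" "a m < a r" "a l < a r" using increasing_onD[OF a, of l m] increasing_onD[OF a, of m r] o by auto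
 define s where "s = (a m - a l) / (a r - a l)"
 have s: "0 < s" "s < 1" using al unfolding s_def by auto
 have "s * (a r - a l) = a m - a l" unfolding s_def using al by simp
 hence am: "a m = (1 - s) * a l + s * a r" by (simp add: algebra_simps)
 have "chord a ?f l r (a m) = (1 - s) * ?f l + s * ?f r"
 by (subst am) (simp only: chord_affine chord_left chord_right[OF al(3)])
 moreover have "(1 - s) * ?f l + s * ?f r < ?f m"
 proof -
 have "(a m)\<^sup>2 = (1 - s) * (a l)\<^sup>2 + s * (a r)\<^sup>2 - s * (1 - s) * (a r - a l)\<^sup>2"
 unfolding am by (simp add: power2_eq_square algebra_simps)
 moreover have "0 < s * (1 - s) * (a r - a l)\<^sup>2" using s al by simp
 ultimately have q: "(a m)\<^sup>2 < (1 - s) * (a l)\<^sup>2 + s * (a r)\<^sup>2" by linarith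
 have "d * (a m - c) = (1 - s) * (d * (a l - c)) + s * (d * (a r - c))" unfolding am by (simp add: algebra_simps)
 also have "\<dots><=(1 - s) * max 0 (d * (a l - c)) + s * max 0 (d * (a r - c))"
 using s by (intro add_mono mult_left_mono) auto
 finally have "max 0 (d * (a m - c))<=(1 - s) * max 0 (d * (a l - c)) + s * max 0 (d * (a r - c))" using s by simp
 hence "M * max 0 (d * (a m - c))<=M * ((1 - s) * max 0 (d * (a l - c)) + s * max 0 (d * (a r - c)))" using M by (rule mult_left_mono)
 thus ?thesis using q unfolding kink_def by (simp add: algebra_simps)
 qed
 ultimately show "chord a ?f l r (a m) < ?f m" by simp
qed

lemma kink_nonpos: "0<=M ==> kink M d c x<=0"
proof -
 assume "0<=M"
 hence "0<=M * max 0 (d * (x - c))" by simp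
 thus ?thesis unfolding kink_def using zero_le_power2[of x] by linarith
qed

lemma chord_nonpos:
 assumes "a p < w" "w < a q" "f p<=0" "f q<=0"
 shows "chord a f p q w<=0"
proof -
 define s where "s = (w - a p) / (a q - a p)"
 have s: "0 < s" "s < 1" using assms unfolding s_def by auto
 have "s * (a q - a p) = w - a p" unfolding s_def using assms by simp
 hence w: "w = (1 - s) * a p + s * a q" by (simp add: algebra_simps)
 have "a p < a q" using assms by simp
 hence "chord a f p q w = (1 - s) * f p + s * f q" unfolding w by (simp only: chord_affine chord_left chord_right)
 moreover have "(1 - s) * f p<=0" "s * f q<=0" using s assms by (simp_all add: mult_nonneg_nonpos)
 ultimately show ?thesis by linarith
qed

lemma cov_right: "u = wsum a X + a i ==> a i < a j ==> eventually (covers a X i j) (at_right u)"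
proof -
 assume u: "u = wsum a X + a i" "a i < a j"
 hence "eventually (%x. x:{u<..<wsum a X + a j}) (at_right u)" by (intro eventually_at_right_real) simp
 thus ?thesis by (rule eventually_mono) (use u in "auto simp: covers_def")
qed

lemma cov_left: "u = wsum a X + a j ==> a i < a j ==> eventually (covers a X i j) (at_left u)"
proof -
 assume u: "u = wsum a X + a j" "a i < a j"
 hence "eventually (%x. x:{wsum a X + a i<..<u}) (at_left u)" by (intro eventually_at_left_real) simp
 thus ?thesis by (rule eventually_mono) (use u in "auto simp: covers_def")
qed

lemma cov_mid: "a i < u - wsum a X ==> u - wsum a X < a j ==> eventually (covers a X i j) (at u within S)"
proof -
 assume u: "a i < u - wsum a X" "u - wsum a X < a j"
 have t: "((%x. x - wsum a X) \<longlongrightarrow> u - wsum a X) (at u within S)" by (intro tendsto_intros)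
 show ?thesis unfolding covers_def using order_tendstoD(1)[OF t u(1)] order_tendstoD(2)[OF t u(2)] by (rule eventually_conj)
qed

lemma height_limit:
 assumes "eventually (%x. height a f X i j x < height a f Z r s x) (at u within S)" "at u within S ~= bot"
 shows "height a f X i j u<=height a f Z r s u"
proof (rule tendsto_le[OF assms(2)])
 show "(height a f Z r s \<longlongrightarrow> height a f Z r s u) (at u within S)" "(height a f X i j \<longlongrightarrow> height a f X i j u) (at u within S)"
 using cont_height unfolding continuous_within by blast+
 show "eventually (%x. height a f X i j x<=height a f Z r s x) (at u within S)" using assms(1) by (rule eventually_mono) simp
qed

lemma height_left: "height a f X i j (wsum a X + a i) = wsum f X + f i"
 and height_right: "a i < a j ==> height a f X i j (wsum a X + a j) = wsum f X + f j"
 by (simp_all add: height_def chord_left chord_right)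

definition std_a :: "nat => real" where "std_a k = 2 ^ k"

lemma std_a_inc: "increasing_on n std_a"
 by (simp add: increasing_on_def std_a_def)

context gt
begin

text \<open>Near \<open>v\<close> the good tile is below the black one. In the limit its height is
  that of \<open>v\<close>, but by strict concavity a vertex inside the upper boundary of a lens is
  strictly above the diagonal of the black tile.\<close>

lemma good_not_upper:
 assumes G: "Tile X i j:W" "X~:bots" and v: "v = insert i X | v = insert j X"
 and K: "Tile C p q:K" "card C = card X" "v = insert b C" "b~:C" "p < b" "b < q"
 shows False
proof -
 let ?a = std_a and ?f = "%k. kink 0 0 0 (std_a k)"
 note a = std_a_inc[of n] and f = kink_concave[OF std_a_inc[of n] order_refl, of 0 0]
 have t: "i < j" "1<=i" "j<=n" "finite X" "i~:X" "j~:X" using W_tile[OF G(1)] by auto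
 have k: "1<=p" "q<=n" "finite C" using K_tile[OF K(1)] by auto
 have aij: "?a i < ?a j" using increasing_onD[OF a, of i j] t by simp
 define u where "u = wsum ?a v"
 have uC: "u = wsum ?a C + ?a b" unfolding u_def K(3) using wsum_insert[OF k(3) K(4), of ?a] by simp
 have pb: "?a p < ?a b" "?a b < ?a q" using increasing_onD[OF a, of p b] increasing_onD[OF a, of b q] k K by auto
 have fv: "wsum ?f v = wsum ?f C + ?f b" unfolding K(3) using wsum_insert[OF k(3) K(4), of ?f] by simp
 have hC: "height ?a ?f C p q u < wsum ?f v" using f k K(5,6) unfolding height_def uC fv concave_on_def by simp
 have main: False if S: "eventually (covers ?a X i j) (at u within S)" "at u within S ~= bot" "height ?a ?f X i j u = wsum ?f v" for S
 proof -
 have "eventually (covers ?a C p q) (at u within S)" using pb uC by (intro cov_mid) auto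
 with S(1) eventually_generic have "eventually (%x. (covers ?a X i j x & covers ?a C p q x) & generic_pos n ?a x) (at u within S)"
 by (intro eventually_conj)
 hence "eventually (%x. height ?a ?f X i j x < height ?a ?f C p q x) (at u within S)"
 by (rule eventually_mono) (use good_below_lens[OF a f _ G _ K(1) _ K(2)] in blast)
 hence "height ?a ?f X i j u<=height ?a ?f C p q u" using S(2) by (rule height_limit)
 thus False using hC S(3) by simp
 qed
 from v show False
 proof
 assume "v = insert i X"
 hence u: "u = wsum ?a X + ?a i" "wsum ?f v = wsum ?f X + ?f i" unfolding u_def using t by (simp_all add: wsum_insert)
 show False by (rule main[of "{u<..}"]) (use cov_right[OF u(1) aij] u(2) height_left[of ?a ?f X i j] in "simp_all add: u(1)")
 next
 assume "v = insert j X"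
 hence u: "u = wsum ?a X + ?a j" "wsum ?f v = wsum ?f X + ?f j" unfolding u_def using t by (simp_all add: wsum_insert)
 show False by (rule main[of "{..<u}"]) (use cov_left[OF u(1) aij] u(2) height_right[OF aij, of ?f X] in "simp_all add: u(1)")
 qed
qed

text \<open>Another tile near \<open>v\<close> would lie above the lens that sits on the good tile.
  In the limit its height is that of \<open>v\<close>, which as a vertex inside the lower boundary
  is strictly below the diagonal of the black tile.\<close>

lemma only_tile_at:
 assumes G: "Tile X i j:W" "X~:bots" and L: "Tile C p q:K" "insert i (insert j X) = insert p (insert q C)"
 and T: "Tile Z r s:W" "card Z = card X" "Tile Z r s ~= Tile X i j"
 and v: "v = insert i X & v = insert r Z | v = insert j X & v = insert s Z"
 and d: "insert d v = insert p (insert q C)" "d~:v" "p < d" "d < q"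
 shows False
proof -
 let ?a = std_a and ?f = "%k. kink 0 0 0 (std_a k)"
 note a = std_a_inc[of n] and f = kink_concave[OF std_a_inc[of n] order_refl, of 0 0]
 have t: "i < j" "1<=i" "j<=n" "finite X" "i~:X" "j~:X" using W_tile[OF G(1)] by auto
 have tz: "r < s" "1<=r" "s<=n" "finite Z" "r~:Z" "s~:Z" using W_tile[OF T(1)] by auto
 have k: "1<=p" "q<=n" "finite C" "p~:C" "q~:C" "p < q" using K_tile[OF L(1)] by auto
 have aij: "?a i < ?a j" "?a r < ?a s" "?a p < ?a q" using increasing_onD[OF a] t tz k by auto
 have fv: "finite v" using v t by auto
 have wv: "g d + wsum g v = g p + (g q + wsum g C)" for g :: "nat => real"
 proof -
 have "wsum g (insert d v) = g d + wsum g v" using wsum_insert[OF fv d(2)] .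
 moreover have "wsum g (insert p (insert q C)) = g p + (g q + wsum g C)" using k by (simp add: wsum_insert)
 ultimately show ?thesis using d(1) by simp
 qed
 define u where "u = wsum ?a v"
 have uC: "u - wsum ?a C = ?a p + ?a q - ?a d" unfolding u_def using wv[of ?a] by simp
 have "chord ?a ?f p q (?a d) < ?f d" using f k d(3,4) unfolding concave_on_def by simp
 hence hC: "wsum ?f v < height ?a ?f C p q u" unfolding height_def uC chord_reflect[OF aij(3)] using wv[of ?f] by simp
 have main: False if S: "eventually (covers ?a X i j) (at u within S)" "eventually (covers ?a Z r s) (at u within S)" "at u within S ~= bot"
 "height ?a ?f Z r s u = wsum ?f v" for S
 proof -
 have "eventually (%x. (covers ?a X i j x & covers ?a Z r s x) & generic_pos n ?a x) (at u within S)"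
 using S(1,2) eventually_generic by (intro eventually_conj)
 hence "eventually (%x. height ?a ?f C p q x < height ?a ?f Z r s x) (at u within S)"
 proof (rule eventually_mono)
 fix x assume x: "(covers ?a X i j x & covers ?a Z r s x) & generic_pos n ?a x"
 have g: "Tile X i j:level_tiles (card X) ?a x" "Tile Z r s:level_tiles (card X) ?a x" using x G T by (simp_all add: level_tiles_Tile)
 have gp: "generic_pos n ?a x" using x by blast
 obtain C2 p2 q2 where C2: "Tile C2 p2 q2:K" "insert p2 (insert q2 C2) = insert i (insert j X)" "height ?a ?f C2 p2 q2 x < height ?a ?f Z r s x"
 using second_lowest[OF a f gp g(1) G(2) g(2) T(3)] by blast
 have "Tile C2 p2 q2 = Tile C p q" using black_top_unique[OF C2(1) L(1)] C2(2) L(2) by (simp add: tile_vertices_Tile)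
 thus "height ?a ?f C p q x < height ?a ?f Z r s x" using C2(3) by simp
 qed
 hence "height ?a ?f C p q u<=height ?a ?f Z r s u" using S(3) by (rule height_limit)
 thus False using hC S(4) by simp
 qed
 from v show False
 proof (elim disjE conjE)
 assume e: "v = insert i X" "v = insert r Z"
 have u: "u = wsum ?a X + ?a i" "u = wsum ?a Z + ?a r" "wsum ?f v = wsum ?f Z + ?f r" unfolding u_def using wsum_insert[of X i ?a] wsum_insert[of Z r ?a] wsum_insert[of Z r ?f] t tz e by simp_all
 have h: "height ?a ?f Z r s u = wsum ?f v" unfolding u(2,3) by (rule height_left)
 show False by (rule main[OF cov_right[OF u(1) aij(1)] cov_right[OF u(2) aij(2)] _ h]) simp
 next
 assume e: "v = insert j X" "v = insert s Z"
 have u: "u = wsum ?a X + ?a j" "u = wsum ?a Z + ?a s" "wsum ?f v = wsum ?f Z + ?f s" unfolding u_def using wsum_insert[of X j ?a] wsum_insert[of Z s ?a] wsum_insert[of Z s ?f] t tz e by simp_all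
 have h: "height ?a ?f Z r s u = wsum ?f v" unfolding u(2,3) by (rule height_right[OF aij(2)])
 show False by (rule main[OF cov_left[OF u(1) aij(1)] cov_left[OF u(2) aij(2)] _ h]) simp
 qed
qed

section \<open>Two adjacent good tiles under a lens\<close>

text \<open>The lower boundary of some lens starts at its left vertex \<open>u\<close> with a good
  tile.\<close>

definition good_start :: "nat => nat set => bool" where
 "good_start h u \<longleftrightarrow> (EX C p q c. Tile C p q:K & card C = h & u = insert p C & c:C & c < q & Tile (u - {c}) c q:W & u - {c}~:bots)"

text \<open>If the first lower tile at \<open>u\<close> is not good, its bottom is the bottom of
  another lens. As \<open>u\<close> is not inside the upper boundary of that lens, it is its left
  vertex as well, and the label \<open>p\<close> has grown to \<open>c\<close>.\<close>

lemma descend_left: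
 assumes NI: "!!C p q b. Tile C p q:K ==> card C = h ==> b~:C ==> p < b ==> b < q ==> u ~= insert b C"
 shows "Tile C p q:K ==> card C = h ==> u = insert p C ==> good_start h u"
proof (induction "n - p" arbitrary: C p q rule: less_induct)
 case less
 have k: "p < q" "q<=n" "p~:C" "finite C" using K_tile[OF less.prems(1)] by auto
 obtain c where c: "c:C" "c < q" "Tile (insert p C - {c}) c q:W" using black_upper_left[OF less.prems(1)] by metis
 have cp: "c ~= p" using c k by blast
 have t: "Tile (u - {c}) c q:W" using c(3) less.prems(3) by simp
 show ?case
 proof (cases "u - {c}:bots")
 case False
 thus ?thesis unfolding good_start_def using less.prems c t by blast
 next
 case True
 then obtain \<kappa> where \<kappa>: "\<kappa>:K" "bottom \<kappa> = u - {c}" by auto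
 obtain r s where rs: "\<kappa> = Tile (u - {c}) r s" using \<kappa>(2) by (cases \<kappa>) auto
 have K: "Tile (u - {c}) r s:K" using \<kappa> rs by simp
 have lab: "r<=c" "q<=s" using bot_labels[OF K t] by auto
 have cu: "c:u" "finite u" using c less.prems(3) k by auto
 have card: "card (u - {c}) = h" using cu less.prems(2,3) k by simp
 have ins: "insert c (u - {c}) = u" using cu by blast
 have "~ r < c"
 proof
 assume "r < c"
 hence "u ~= insert c (u - {c})" using NI[OF K card, of c] lab c(2) by simp
 thus False using ins by simp
 qed
 hence rc: "r = c" using lab by simp
 have "insert c (insert q (insert p C - {c})) = insert p (insert q C)" using c cp by auto
 hence "p<=c" by (rule top_labels(1)[OF less.prems(1) c(3)])
 hence "n - c < n - p" using cp c(2) k by linarith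
 thus ?thesis using less.hyps[of c "u - {c}" s] K card ins unfolding rc by simp
 qed
qed

text \<open>Two extremal choices. The leftmost left vertex of a lens of this level is not inside an
  upper boundary, so \<open>descend_left\<close> yields a good start. At the rightmost good start,
  the second tile of the lower boundary is good too: otherwise its left vertex \<open>v\<close>, to
  which \<open>good_not_upper\<close> applies, would be a good start further right.\<close>

lemma two_good:
 assumes K0: "Tile C0 p0 q0:K" "card C0 = h"
 obtains C p q c b where "Tile C p q:K" "card C = h" "b < c" "c < q" "p<=b" "b:insert p (insert q C)" "c:C"
 "Tile (insert p (insert q C) - {c} - {q}) c q:W" "Tile (insert p (insert q C) - {c} - {b}) b c:W"
 "insert p (insert q C) - {c} - {q}~:bots" "insert p (insert q C) - {c} - {b}~:bots"
proof -
 let ?a = "%k. 2 ^ k :: int"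
 have pw: "(2 :: int) ^ x < 2 ^ y \<longleftrightarrow> x < y" for x y :: nat by simp
 define Ls where "Ls = {insert p C | C p q. Tile C p q:K & card C = h}"
 have Lsub: "Ls<=Pow {1..n}" unfolding Ls_def using K_tile by fastforce
 have fL: "finite Ls" "Ls ~= {}" using finite_subset[OF Lsub] K0 unfolding Ls_def by auto
 obtain u where u: "u:Ls" "ALL w:Ls. wsum ?a u<=wsum ?a w"
 using finite_argmin[OF fL, of "wsum ?a"] by blast
 obtain C1 p1 q1 where C1: "u = insert p1 C1" "Tile C1 p1 q1:K" "card C1 = h" using u(1) unfolding Ls_def by blast
 have g1: "good_start h u"
 proof (rule descend_left[OF _ C1(2,3,1)])
 fix C p q b assume k: "Tile C p q:K" "card C = h" "b~:C" "p < b" "b < q"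
 have fC: "finite C" "p~:C" using K_tile[OF k(1)] by auto
 have "insert p C:Ls" unfolding Ls_def using k by blast
 hence "wsum ?a u<=wsum ?a (insert p C)" using u(2) by blast
 moreover have "wsum ?a (insert p C) < wsum ?a (insert b C)" using fC k(3,4) by (simp add: wsum_insert)
 ultimately show "u ~= insert b C" by auto
 qed
 define Gs where "Gs = {u. good_start h u}"
 have "Gs<=Ls" unfolding Gs_def Ls_def good_start_def by blast
 hence fG: "finite Gs" "Gs ~= {}" using fL finite_subset g1 unfolding Gs_def by auto
 obtain u' where u': "u':Gs" "ALL w:Gs. wsum ?a w<=wsum ?a u'"
 using finite_argmax[OF fG, of "wsum ?a"] by blast
 obtain C p q c where s: "Tile C p q:K" "card C = h" "u' = insert p C" "c:C" "c < q" "Tile (u' - {c}) c q:W" "u' - {c}~:bots"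
 using u'(1) unfolding Gs_def good_start_def by blast
 have k: "p < q" "p~:C" "q~:C" "finite C" "q<=n" "C<={1..n}" "1<=p" using K_tile[OF s(1)] by auto
 define Y where "Y = insert p (insert q C)"
 have cp: "c ~= p" "c ~= q" using s k by auto
 have Y1: "u' - {c} = Y - {c} - {q}" unfolding s(3) Y_def using k cp by auto
 have fY: "finite Y" "c:Y" "q:Y" unfolding Y_def using k s by auto
 have top1: "insert c (insert q (u' - {c})) = Y" unfolding s(3) Y_def using s cp by auto
 obtain b where b: "b < c" "b:Y" "Tile (Y - {c} - {b}) b c:W" "p<=b"
 proof (rule top_chain[OF s(1) Y_def])
 fix N and g :: "nat => nat"
 assume g: "2<=N" "g 0 = p" "g N = q" "!!t. t < N ==> g t < g (Suc t) & g t:Y & g (Suc t):Y & Tile (Y - {g (Suc t)} - {g t}) (g t) (g (Suc t)):W"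
 and g5: "!!i j X. Tile X i j:W ==> insert i (insert j X) = Y ==> EX t<N. i = g t & j = g (Suc t)"
 obtain t where t: "t < N" "c = g t" "q = g (Suc t)" using g5[OF s(6) top1] by blast
 have "t ~= 0"
 proof
 assume "t = 0"
 hence "c = p" using t(2) g(2) by simp
 thus False using cp by simp
 qed
 then obtain t' where t': "t = Suc t'" by (cases t) auto
 have gg: "g t' < c" "g t':Y" "Tile (Y - {c} - {g t'}) (g t') c:W" using g(4)[of t'] t(1,2) t' by auto
 have "insert (g t') (insert c (Y - {c} - {g t'})) = insert p (insert q C)" using gg(1,2) fY unfolding Y_def by auto
 hence "p<=g t'" by (rule top_labels(1)[OF s(1) gg(3)])
 thus thesis using that gg by blast
 qed
 define v where "v = Y - {c}"
 have vq: "insert q (u' - {c}) = v" unfolding Y1 v_def using fY cp by auto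
 have cardX: "card (u' - {c}) = h" using s(2,3,4) k by simp
 have vb: "insert b (v - {b}) = v" "b:v" unfolding v_def using b by auto
 have cv: "card v = Suc h" using arg_cong[OF vq, of card] cardX k s(3) cp by (simp add: card_insert_if)
 have bad: "v - {b}~:bots"
 proof
 assume "v - {b}:bots"
 then obtain \<kappa> where \<kappa>: "\<kappa>:K" "bottom \<kappa> = v - {b}" by auto
 obtain r s' where rs: "\<kappa> = Tile (v - {b}) r s'" using \<kappa>(2) by (cases \<kappa>) auto
 have K: "Tile (v - {b}) r s':K" using \<kappa> rs by simp
 have lab: "r<=b" "c<=s'" using bot_labels[OF K b(3)[folded v_def]] by auto
 have cb: "card (v - {b}) = h" using cv vb(2) fY unfolding v_def by simp
 have NI: "v ~= insert b' C'" if "Tile C' p' q':K" "card C' = h" "b'~:C'" "p' < b'" "b' < q'" for C' p' q' b'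
 using good_not_upper[OF s(6,7), of v C' p' q' b'] that vq cardX by auto
 have "~ r < b"
 proof
 assume "r < b"
 hence "v ~= insert b (v - {b})" using NI[OF K cb, of b] lab b(1) by simp
 thus False using vb(1) by simp
 qed
 hence rb: "r = b" using lab by simp
 have "good_start h v" by (rule descend_left[OF NI K cb]) (use vb rb in auto)
 hence "wsum ?a v<=wsum ?a u'" using u'(2) unfolding Gs_def by blast
 moreover have "wsum ?a u' < wsum ?a v"
 proof -
 have "finite u'" "c:u'" "q~:u' - {c}" using s(3,4) k cp by auto
 hence "wsum ?a u' = 2 ^ c + wsum ?a (u' - {c})" "wsum ?a v = 2 ^ q + wsum ?a (u' - {c})"
 using wsum_remove[of u' c ?a] wsum_insert[of "u' - {c}" q ?a] vq by auto
 thus ?thesis using s(5) pw by simp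
 qed
 ultimately show False by simp
 qed
 show ?thesis
 by (rule that[of C p q b c]) (use s b bad Y1 in "auto simp: Y_def[symmetric] v_def")
qed

end

section \<open>Lenses that would lie beside or between good tiles\<close>

lemma std_double: "p < q ==> 2 * std_a p<=std_a q"
 using power_increasing[of "Suc p" q "2 :: real"] by (simp add: std_a_def)

lemma std_ge2: "1<=p ==> 2<=std_a p"
 using power_increasing[of 1 p "2 :: real"] by (simp add: std_a_def)

text \<open>The mirror image of \<open>std_a\<close>: gaps double towards the left.\<close>

definition co_a :: "nat => nat => real" where "co_a n k = - (2 ^ (n - k))"

lemma co_double: "p < q ==> q<=n ==> 2 * co_a n q >= co_a n p"
 using power_increasing[of "Suc (n - q)" "n - p" "2 :: real"] by (simp add: co_a_def)

lemma co_le: "co_a n p<=- 1"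
 by (simp add: co_a_def)

lemma co_a_inc: "increasing_on n (co_a n)"
 unfolding increasing_on_def
proof (intro allI impI)
 fix i j assume "1<=i" "i < j" "j<=n"
 thus "co_a n i < co_a n j" using co_double[of i j n] co_le[of n j] by linarith
qed

lemma chord_from_right: "a l < a m ==> chord a f l m w = f m - (f m - f l) / (a m - a l) * (a m - w)"
proof -
 assume l: "a l < a m"
 define k where "k = (f m - f l) / (a m - a l)"
 have "k * (a m - a l) = f m - f l" unfolding k_def using l by simp
 thus ?thesis unfolding chord_def k_def[symmetric] by (simp add: algebra_simps)
qed

context gt
begin

text \<open>Since \<open>2 * a i\<close> and \<open>2 * a s\<close> are at most \<open>a t\<close>,
  the span of the tile reaches over the lens. The fall of \<open>f\<close> beyond \<open>i\<close>
  makes the tile so steep that left of its right vertex it rises to at least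
  \<open>wsum f Q\<close>, while the lens stays at or below \<open>wsum f Q\<close>. This
  contradicts \<open>good_below_lens\<close>.\<close>

lemma lens_left_of_good:
 assumes G: "Tile Z s t:W" "Z~:bots" "insert t Z = insert i Q" "i~:Q" "i < t"
 and K: "Tile Q p q:K" "card Q = card Z" "q<=i"
 shows False
proof -
 let ?a = std_a
 define M where "M = 2 * (?a i)\<^sup>2"
 define f where "f = (%k. kink M 1 (?a i) (?a k))"
 have M0: "0<=M" unfolding M_def by simp
 note a = std_a_inc[of n]
 have fc: "concave_on n ?a f" unfolding f_def by (rule kink_concave[OF a M0])
 have g: "s < t" "1<=s" "t<=n" "finite Z" "t~:Z" using W_tile[OF G(1)] by auto
 have k: "p < q" "1<=p" "q<=n" "finite Q" using K_tile[OF K(1)] by auto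
 have wQ: "h t + wsum h Z = h i + wsum h Q" for h :: "nat => real"
 using arg_cong[OF G(3), of "wsum h"] wsum_insert[OF g(4,5), of h] wsum_insert[OF k(4) G(4), of h] by simp
 have qi: "?a q<=?a i" unfolding std_a_def using K(3) by simp
 have p2: "2<=?a p" "2 * ?a p<=?a q" "?a q<=?a i" "2 * ?a i<=?a t" "2 * ?a s<=?a t" "0 < ?a s"
 using std_ge2[OF k(2)] std_double[OF k(1)] qi std_double[OF G(5)] std_double[OF g(1)] std_ge2[OF g(2)]
 by linarith+
 \<comment> \<open>In the left half of the lens, \<open>z\<close> keeps a distance of at least 1
   from \<open>a i\<close>.\<close>
 obtain x where x: "wsum ?a Q + ?a p < x" "x < wsum ?a Q + (?a p / 2 + ?a q / 2)" "generic_pos n ?a x"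
 using generic_between[of "wsum ?a Q + ?a p" "wsum ?a Q + (?a p / 2 + ?a q / 2)" n ?a] p2 by auto
 define z where "z = x - wsum ?a Q"
 have z: "?a p < z" "z < (?a p / 2 + ?a q / 2)" using x unfolding z_def by linarith+
 have xZ: "x - wsum ?a Z = z - ?a i + ?a t" unfolding z_def using wQ[of ?a] by linarith
 have cK: "covers ?a Q p q x" unfolding covers_def z_def[symmetric] using z p2 by (intro conjI) linarith+
 have cG: "covers ?a Z s t x" unfolding covers_def xZ using z p2 by (intro conjI) linarith+
 have lt: "height ?a f Z s t x < height ?a f Q p q x" by (rule good_below_lens[OF a fc x(3) G(1,2) cG K(1) cK K(2)])
 have fn: "f l<=0" for l unfolding f_def by (rule kink_nonpos[OF M0])
 have "chord ?a f p q z<=0" by (rule chord_nonpos[OF _ _ fn fn]) (use z p2 in linarith)+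
 hence hK: "height ?a f Q p q x<=wsum f Q" unfolding height_def z_def[symmetric] by simp
 define \<sigma> where "\<sigma> = (f t - f s) / (?a t - ?a s)"
 have st: "?a s < ?a t" using p2 by linarith
 have hG: "height ?a f Z s t x = wsum f Q + f i - \<sigma> * (?a i - z)"
 unfolding height_def chord_from_right[of ?a, OF st] \<sigma>_def[symmetric] xZ using wQ[of f] by (simp add: algebra_simps)
 have fi: "f i = - (?a i)\<^sup>2" unfolding f_def kink_def by simp
 have "f t - f s<=- ((?a i)\<^sup>2 * (?a t - ?a s))"
 proof -
 have 1: "?a t - ?a s<=2 * (max 0 (?a t - ?a i) - max 0 (?a s - ?a i))" using p2 by (auto simp: max_def)
 have "(?a i)\<^sup>2 * (?a t - ?a s)<=(?a i)\<^sup>2 * (2 * (max 0 (?a t - ?a i) - max 0 (?a s - ?a i)))" using 1 by (rule mult_left_mono) simp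
 moreover have "(?a s)\<^sup>2<=(?a t)\<^sup>2" using p2 by (intro power_mono) auto
 ultimately show ?thesis unfolding f_def kink_def M_def by (simp add: algebra_simps)
 qed
 hence "\<sigma><=- (?a i)\<^sup>2" unfolding \<sigma>_def using st by (simp add: divide_le_eq)
 hence s1: "(?a i)\<^sup>2<=- \<sigma>" by simp
 have z1: "1<=?a i - z" using z p2 by linarith
 have "(?a i)\<^sup>2 * 1<=- \<sigma> * (?a i - z)" by (rule mult_mono[OF s1 z1]) (use s1 zero_le_power2[of "?a i"] in linarith)+
 thus False using lt hK hG fi by simp
qed

text \<open>The mirror image of \<open>lens_left_of_good\<close>. Here \<open>z\<close> is only at
  distance 1/2 from \<open>a k\<close>, which accounts for the factor 4 in \<open>M\<close> instead
  of 2.\<close>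

lemma lens_right_of_good:
 assumes G: "Tile Z s t:W" "Z~:bots" "insert s Z = insert k Q" "k~:Q" "s < k"
 and K: "Tile Q p q:K" "card Q = card Z" "k<=p"
 shows False
proof -
 let ?a = "co_a n"
 define M where "M = 4 * (?a k)\<^sup>2"
 define f where "f = (%l. kink M (- 1) (?a k) (?a l))"
 have M0: "0<=M" unfolding M_def by simp
 note a = co_a_inc[of n]
 have fc: "concave_on n ?a f" unfolding f_def by (rule kink_concave[OF a M0])
 have g: "s < t" "1<=s" "t<=n" "finite Z" "s~:Z" using W_tile[OF G(1)] by auto
 have kt: "p < q" "1<=p" "q<=n" "finite Q" using K_tile[OF K(1)] by auto
 have kn: "k<=n" using K(3) kt by linarith
 have wQ: "h s + wsum h Z = h k + wsum h Q" for h :: "nat => real"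
 using arg_cong[OF G(3), of "wsum h"] wsum_insert[OF g(4,5), of h] wsum_insert[OF kt(4) G(4), of h] by simp
 have p2: "?a q<=- 1" "?a p<=2 * ?a q" "?a s<=2 * ?a k" "?a s<=2 * ?a t" "?a t<=- 1"
 using co_le co_double[OF kt(1,3)] co_double[OF G(5) kn] co_double[OF g(1,3)] by auto
 have kp: "?a k<=?a p" using increasing_onD[OF a, of k p] K(3) kt g G(5) by (cases "k = p") auto
 obtain x where x: "wsum ?a Q + (?a p / 2 + ?a q / 2) < x" "x < wsum ?a Q + ?a q" "generic_pos n ?a x"
 using generic_between[of "wsum ?a Q + (?a p / 2 + ?a q / 2)" "wsum ?a Q + ?a q" n ?a] p2 by auto
 define z where "z = x - wsum ?a Q"
 have z: "(?a p / 2 + ?a q / 2) < z" "z < ?a q" using x unfolding z_def by linarith+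
 have xZ: "x - wsum ?a Z = z - ?a k + ?a s" unfolding z_def using wQ[of ?a] by linarith
 have cK: "covers ?a Q p q x" unfolding covers_def z_def[symmetric] using z p2 by (intro conjI) linarith+
 have cG: "covers ?a Z s t x" unfolding covers_def xZ using z p2 kp by (intro conjI) linarith+
 have lt: "height ?a f Z s t x < height ?a f Q p q x" by (rule good_below_lens[OF a fc x(3) G(1,2) cG K(1) cK K(2)])
 have fn: "f l<=0" for l unfolding f_def by (rule kink_nonpos[OF M0])
 have "chord ?a f p q z<=0" by (rule chord_nonpos[OF _ _ fn fn]) (use z p2 in linarith)+
 hence hK: "height ?a f Q p q x<=wsum f Q" unfolding height_def z_def[symmetric] by simp
 define \<sigma> where "\<sigma> = (f t - f s) / (?a t - ?a s)"
 have st: "?a s < ?a t" using p2 by linarith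
 have hG: "height ?a f Z s t x = wsum f Q + f k + \<sigma> * (z - ?a k)"
 unfolding height_def chord_def \<sigma>_def[symmetric] xZ using wQ[of f] by (simp add: algebra_simps)
 have fk: "f k = - (?a k)\<^sup>2" unfolding f_def kink_def by simp
 have "2 * (?a k)\<^sup>2 * (?a t - ?a s)<=f t - f s"
 proof -
 have 1: "?a t - ?a s<=2 * (max 0 (?a k - ?a s) - max 0 (?a k - ?a t))" using p2 by (auto simp: max_def)
 have "2 * (?a k)\<^sup>2 * (?a t - ?a s)<=2 * (?a k)\<^sup>2 * (2 * (max 0 (?a k - ?a s) - max 0 (?a k - ?a t)))" using 1 by (rule mult_left_mono) simp
 moreover have "(- ?a t)\<^sup>2<=(- ?a s)\<^sup>2" using p2 by (intro power_mono) auto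
 ultimately show ?thesis unfolding f_def kink_def M_def by (simp add: algebra_simps)
 qed
 hence s1: "2 * (?a k)\<^sup>2<=\<sigma>" unfolding \<sigma>_def using st by (simp add: le_divide_eq)
 have z1: "1 / 2<=z - ?a k" using z p2 kp by linarith
 have "2 * (?a k)\<^sup>2 * (1 / 2)<=\<sigma> * (z - ?a k)" by (rule mult_mono[OF s1 z1]) (use s1 zero_le_power2[of "?a k"] in linarith)+
 thus False using lt hK hG fk by simp
qed

text \<open>The lens above the two good tiles has to stay below the inner one by
  \<open>lens_below_lens\<close>. Heights that fall to the left of \<open>i\<close> lower only its
  label \<open>p\<close>; its chord becomes so steep that it passes above the inner lens.\<close>

lemma lens_inside:
 assumes o: "i < j" "j < k" "i~:X" "j~:X" "k~:X" "finite X"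
 and G: "Tile (insert i X) j k:W" "insert i X~:bots" "Tile (insert k X) i j:W" "insert k X~:bots"
 and L: "Tile C p k:K" "insert p (insert k C) = insert i (insert j (insert k X))" "p < i" "C ~= insert j X"
 and M: "Tile (insert j X) p' q':K" "i<=p'" "q'<=k"
 shows False
proof -
 let ?a = std_a and ?Q = "insert j X"
 \<comment> \<open>With \<open>a k = 2 ^ k\<close>, the part \<open>8 ^ k\<close> pays for a slope
   of \<open>4 ^ k\<close> over a length of at most \<open>2 ^ k\<close>, and \<open>4 ^ k\<close>
   pays for the height \<open>- (a k)^2\<close> of the label \<open>k\<close>.\<close>
 define m where "m = 8 ^ k + (4 :: real) ^ k"
 define f where "f = (%l. kink m (- 1) (?a i) (?a l))"
 have M0: "0<=m" unfolding m_def by simp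
 note a = std_a_inc[of n]
 have fc: "concave_on n ?a f" unfolding f_def by (rule kink_concave[OF a M0])
 have kt: "p' < q'" "1<=p'" "q'<=n" using K_tile[OF M(1)] by auto
 have lt: "p < k" "1<=p" "p~:C" "k~:C" "finite C" using K_tile[OF L(1)] by auto
 have wX: "wsum h (insert i X) = h i + wsum h X" "wsum h ?Q = h j + wsum h X" "wsum h (insert k X) = h k + wsum h X"
 "wsum h (insert i (insert k X)) = h i + (h k + wsum h X)" for h :: "nat => real" using o by (simp_all add: wsum_insert)
 have wC: "h p + (h k + wsum h C) = h i + (h k + wsum h ?Q)" for h :: "nat => real"
 proof -
 have "wsum h (insert p (insert k C)) = h p + (h k + wsum h C)" using lt by (simp add: wsum_insert)
 moreover have "wsum h (insert i (insert j (insert k X))) = h i + (h k + wsum h ?Q)" using o by (simp add: wsum_insert)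
 ultimately show ?thesis using L(2) by simp
 qed
 have p2: "2<=?a p'" "2 * ?a p'<=?a q'" "?a i<=?a p'" "?a q'<=?a k" "2 * ?a p<=?a i" "2<=?a p" "?a i < ?a j" "?a j < ?a k"
 proof -
 show "?a i<=?a p'" "?a q'<=?a k" "?a i < ?a j" "?a j < ?a k" unfolding std_a_def using M(2,3) o(1,2) by simp_all
 qed (rule std_ge2[OF kt(2)] std_double[OF kt(1)] std_double[OF L(3)] std_ge2[OF lt(2)])+
 obtain x where x: "wsum ?a ?Q + (?a p' / 2 + ?a q' / 2) < x" "x < wsum ?a ?Q + ?a q'" "generic_pos n ?a x"
 using generic_between[of "wsum ?a ?Q + (?a p' / 2 + ?a q' / 2)" "wsum ?a ?Q + ?a q'" n ?a] p2 by auto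
 define z where "z = x - wsum ?a ?Q"
 have z: "(?a p' / 2 + ?a q' / 2) < z" "z < ?a q'" using x unfolding z_def by linarith+
 have cM: "covers ?a ?Q p' q' x" unfolding covers_def z_def[symmetric] using z p2 by (intro conjI) linarith+
 have cards: "card (insert i X) = card ?Q" "card (insert k X) = card ?Q" using o by simp_all
 have Y1: "insert j (insert k (insert i X)) = insert p (insert k C)" "insert i (insert j (insert k X)) = insert p (insert k C)" using L(2) by auto
 have lt2: "height ?a f C p k x < height ?a f ?Q p' q' x"
 proof -
 have ne: "x ~= wsum ?a (insert i (insert k X))"
 proof
 assume e: "x = wsum ?a (insert i (insert k X))"
 have "insert i (insert k X):Pow {1..n}" using W_tile[OF G(1)] W_tile[OF G(3)] by auto
 thus False using x(3) e unfolding generic_pos_def by blast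
 qed
 then consider "covers ?a (insert i X) j k x" | "covers ?a (insert k X) i j x"
 unfolding covers_def using z p2 wX[of ?a] unfolding z_def by (cases "x < wsum ?a (insert i (insert k X))") (auto simp: algebra_simps)
 thus ?thesis
 proof cases
 case 1
 have "card ?Q = card C" using lower_height(3)[OF a fc L(1) G(1) Y1(1) 1] cards by simp
 thus ?thesis using lens_below_lens[OF a fc x(3) G(1,2) 1 L(1) Y1(1) M(1) cM] L(4) by blast
 next
 case 2
 have "card ?Q = card C" using lower_height(3)[OF a fc L(1) G(3) Y1(2) 2] cards by simp
 thus ?thesis using lens_below_lens[OF a fc x(3) G(3,4) 2 L(1) Y1(2) M(1) cM] L(4) by blast
 qed
 qed
 have fn: "f l<=0" for l unfolding f_def by (rule kink_nonpos[OF M0])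
 have "chord ?a f p' q' z<=0" by (rule chord_nonpos[OF _ _ fn fn]) (use z p2 in linarith)+
 hence hM: "height ?a f ?Q p' q' x<=wsum f ?Q" unfolding height_def z_def[symmetric] by simp
 define \<sigma> where "\<sigma> = (f k - f p) / (?a k - ?a p)"
 have pk: "?a p < ?a k" using p2 by linarith
 have xC: "x - wsum ?a C = z - ?a i + ?a p" unfolding z_def using wC[of ?a] by linarith
 have hL: "height ?a f C p k x = wsum f ?Q + f i + \<sigma> * (z - ?a i)"
 unfolding height_def chord_def \<sigma>_def[symmetric] xC using wC[of f] by (simp add: algebra_simps)
 have fi: "f i = - (?a i)\<^sup>2" unfolding f_def kink_def by simp
 have ak: "(?a k)\<^sup>2 = 4 ^ k" "?a k = 2 ^ k" unfolding std_a_def by (simp_all add: power2_eq_square power_mult_distrib[symmetric])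
 have "4 ^ k * (?a k - ?a p)<=f k - f p"
 proof -
 have "m * 2<=m * (?a i - ?a p)" using p2 M0 by (intro mult_left_mono) auto
 moreover have "f k - f p >= - ((?a k)\<^sup>2) + m * (?a i - ?a p)" unfolding f_def kink_def using p2 by simp
 moreover have "(4 :: real) ^ k * (?a k - ?a p)<=4 ^ k * 2 ^ k" using p2 unfolding ak(2)[symmetric] by (intro mult_left_mono) auto
 moreover have "(4 :: real) ^ k * 2 ^ k = 8 ^ k" by (simp add: power_mult_distrib[symmetric])
 moreover have "0<=(8 :: real) ^ k" by simp
 ultimately show ?thesis using ak(1) m_def zero_le_power[of "4 :: real" k] by linarith
 qed
 hence s1: "4 ^ k<=\<sigma>" unfolding \<sigma>_def using pk by (simp add: le_divide_eq)
 have "(?a i)\<^sup>2<=(?a k)\<^sup>2" using p2 by (intro power_mono) auto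
 hence s2: "(?a i)\<^sup>2<=\<sigma>" using s1 ak by linarith
 have z1: "1<=z - ?a i" using z p2 by linarith
 have "(?a i)\<^sup>2 * 1<=\<sigma> * (z - ?a i)" by (rule mult_mono[OF s2 z1]) (use s2 zero_le_power2[of "?a i"] in linarith)+
 thus False using lt2 hM hL fi by simp
qed

text \<open>Move left across the edges that enter \<open>v\<close>; their labels increase until a
  tile has \<open>v\<close> as right vertex. The excluded initial interval is the case of the left
  boundary. In \<open>right_good\<close> the walk goes right and labels decrease.\<close>

lemma left_good:
 "V A t ==> v = insert t A ==> v ~= {1..card v} ==> EX Z s u. Tile Z s u:W & Z~:bots & insert u Z = v & t<=u"
proof (induction "n - t" arbitrary: A t rule: less_induct)
 case less
 have Ab: "A~:bots" "v~:tops" "t~:A" "finite A" using less.prems V_subset[OF less.prems(1)] unfolding V_def by auto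
 have "(A, insert t A)~:LB n"
 proof
 assume "(A, insert t A):LB n"
 note LB_levelD[OF this]
 moreover have "card v = Suc (card A)" using less.prems(2) Ab by simp
 ultimately show False using less.prems(2,3) by simp
 qed
 with less.prems(1) show ?case
 proof (rule white_left)
 fix m assume "m < t" "Tile A m t:W"
 thus ?thesis using Ab less.prems(2) by blast
 next
 fix c assume c: "c:A" "t < c" "Tile (A - {c}) t c:W"
 have top: "insert t (insert c (A - {c})) = v" using c(1) less.prems(2) by auto
 have "V (insert t (A - {c})) c" using V_upper(1)[OF c(3)] top Ab(2) by simp
 moreover have "v = insert c (insert t (A - {c}))" using top by auto
 moreover have "n - c < n - t" using c(2) W_tile[OF c(3)] by linarith
 ultimately have "EX Z s u. Tile Z s u:W & Z~:bots & insert u Z = v & c<=u" using less.hyps less.prems(3) by blast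
 then obtain Z s u where "Tile Z s u:W" "Z~:bots" "insert u Z = v" "c<=u" by blast
 thus ?thesis using c(2) by (intro exI[of _ Z] exI[of _ s] exI[of _ u]) auto
 qed
qed

lemma right_good:
 "V A t ==> v = insert t A ==> v ~= {n - card v + 1..n} ==> EX Z s u. Tile Z s u:W & Z~:bots & insert s Z = v & s<=t"
proof (induction t arbitrary: A rule: less_induct)
 case (less t)
 have Ab: "A~:bots" "v~:tops" "t~:A" "finite A" using less.prems V_subset[OF less.prems(1)] unfolding V_def by auto
 have "(A, insert t A)~:RB n"
 proof
 assume "(A, insert t A):RB n"
 note rb = RB_levelD[OF this]
 have "card v = Suc (card A)" using less.prems(2) Ab by simp
 hence "n - card v + 1 = n - card A" using rb by (simp add: Suc_diff_Suc)
 thus False using rb less.prems(2,3) by simp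
 qed
 with less.prems(1) show ?case
 proof (rule white_right)
 fix m assume "t < m" "Tile A t m:W"
 thus ?thesis using Ab less.prems(2) by blast
 next
 fix c assume c: "c:A" "c < t" "Tile (A - {c}) c t:W"
 have top: "insert c (insert t (A - {c})) = v" using c(1) less.prems(2) by auto
 have "V (insert t (A - {c})) c" using V_upper(2)[OF c(3)] top Ab(2) by simp
 hence "EX Z s u. Tile Z s u:W & Z~:bots & insert s Z = v & s<=c" using less.IH[OF c(2)] less.prems(3) top by blast
 then obtain Z s u where "Tile Z s u:W" "Z~:bots" "insert s Z = v" "s<=c" by blast
 thus ?thesis using c(2) by (intro exI[of _ Z] exI[of _ s] exI[of _ u]) auto
 qed
qed

end

section \<open>Existence of a lowering flip\<close>

context gt
begin

definition lowerable :: bool where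
 "lowerable \<longleftrightarrow> (EX X i j k W' K'. i < j & j < k & i~:X & j~:X & k~:X & insert i X:B & insert k X:B &
 insert i (insert j X):B & insert i (insert k X):B & insert j (insert k X):B & insert j X~:B &
 gt n W' K' & spectrum W' K' = B - {insert i (insert k X)} Un {insert j X})"

lemma bots_tile: "A:bots ==> EX p q. Tile A p q:K"
 by (metis bottom_Tile imageE tile.exhaust)

lemma tops_tile: "A:tops ==> EX C p q. Tile C p q:K & insert p (insert q C) = A"
 by (metis top_Tile imageE tile.exhaust)

lemma EW_flip:
 assumes E: "EW X i j k" and nb: "insert i X~:bots" "insert k X~:bots"
 and ins: "!!A. (A, insert i (insert k X)):edges ==> A~:bots"
 and outs: "!!A'. (insert i (insert k X), A'):edges ==> A' = insert i (insert j (insert k X))"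
 and hj: "(ALL te:W Un K. insert j X~:tile_vertices te) | Tile (insert j X) i k:K" and nB: "insert j X~:B"
 shows lowerable
proof -
 have o: "i < j" "j < k" "i~:X" "j~:X" "k~:X" and t: "Tile (insert i X) j k:W" "Tile (insert k X) i j:W" "Tile X i k:W"
 using E unfolding EW_def by auto
 let ?v = "insert i (insert k X)"
 have tv: "Tile (insert i X) j k:W Un K" "Tile (insert k X) i j:W Un K" using t by blast+
 have comm: "insert k (insert i X) = ?v" "insert j (insert i X) = insert i (insert j X)" by auto
 have vt: "?v~:tops" using side_nonterminal(4)[OF tv(1)] comm by simp
 have inE: "A = insert i X | A = insert k X" if e: "(A, ?v):edges" for A
 proof -
 obtain m where m: "?v = insert m A" "m~:A" using edge_props[OF e] by metis
 have VA: "V A m" unfolding V_def using m e ins[OF e] vt by auto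
 have "m = i | m = k" by (rule single_in[OF t nb vt VA]) (use m in simp)
 moreover have "A = ?v - {m}" using m by auto
 moreover have "?v - {i} = insert k X" "?v - {k} = insert i X" using o by auto
 ultimately show ?thesis by blast
 qed
 have hb: "ALL A A'. (A, A'):edges --> ?v:{A, A'} --> (A, A'):{(insert i X, ?v), (insert k X, ?v), (?v, insert i (insert j (insert k X)))}"
 using inE outs by blast
 obtain W' K' where W': "gt n W' K'" "spectrum W' K' = B - {?v} Un {insert j X}"
 using flip[OF o t(1,2) nb _ hj] t(3) hb by blast
 have "insert i X:B" "insert k X:B" "insert i (insert j X):B" "?v:B" "insert j (insert k X):B"
 using vertex_B(3)[OF tv(1) nb(1)] vertex_B(3)[OF tv(2) nb(2)] vertex_B(1,2)[OF tv(1)] vertex_B(2)[OF tv(2)] comm by simp_all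
 thus ?thesis unfolding lowerable_def using o nB W' by blast
qed

text \<open>As a vertex of the spectrum, \<open>insert j X\<close> would have an outgoing planar
  edge and lie strictly between the left and right vertex of \<open>Tile X i k\<close>, against
  \<open>bottom_between\<close>.\<close>

lemma EW_low_nonvertex:
 assumes E: "EW X i j k" and nt: "!!d. insert d (insert j X)~:tops"
 shows "insert j X~:B"
proof
 assume jB: "insert j X:B"
 have o: "i < j" "j < k" "i~:X" "j~:X" "k~:X" and t: "Tile (insert i X) j k:W" "Tile X i k:W"
 using E unfolding EW_def by auto
 have fX: "finite X" "1<=i" "k<=n" using W_tile[OF t(2)] by auto
 have vt: "insert i (insert k X)~:tops"
 proof -
 have "Tile (insert i X) j k:W Un K" "insert k (insert i X) = insert i (insert k X)" using t by auto
 thus ?thesis using side_nonterminal(4)[of "insert i X" j k] by simp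
 qed
 have "i:{1..n}" "i~:insert j X" using fX o by auto
 hence "insert j X ~= {1..n}" by metis
 then obtain d where "V (insert j X) d | interior_lower (insert j X) d" using B_out[OF jB] by blast
 thus False
 proof
 assume "interior_lower (insert j X) d"
 then obtain C p q where "Tile C p q:K" "insert d (insert j X) = insert p (insert q C)" unfolding interior_lower_def by blast
 hence "insert d (insert j X):tops" by (metis imageI top_Tile)
 thus False using nt by blast
 next
 assume "V (insert j X) d"
 thus False
 proof (rule bottom_between[OF t(2) vt _ _ pow2_increasing])
 show "card (insert j X) = Suc (card X)" using fX o by simp
 show "wsum (%k. 2 ^ k :: int) (insert i X) < wsum (%k. 2 ^ k) (insert j X)" "wsum (%k. 2 ^ k :: int) (insert j X) < wsum (%k. 2 ^ k) (insert k X)"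
 using fX o by (simp_all add: wsum_insert)
 qed
 qed
qed

text \<open>Black bottoms have at least \<open>card X + 2\<close> elements and black tops at least
  \<open>card X + 4\<close>, so no terminal vertex can interfere.\<close>

lemma EW_low:
 assumes nolow: "!!C p q. Tile C p q:K ==> g<=Suc (card C)" and E: "EW X i j k" and c: "card X + 2 < g"
 shows lowerable
proof -
 have o: "i < j" "j < k" "i~:X" "j~:X" "k~:X" and t: "Tile (insert i X) j k:W" "Tile (insert k X) i j:W" "Tile X i k:W"
 using E unfolding EW_def by auto
 have fX: "finite X" using W_tile[OF t(3)] by auto
 have cb: "A~:bots" if "card A<=card X + 1" for A using bots_tile[of A] nolow that c by fastforce
 have ct: "A~:tops" if "card A<=card X + 3" for A
 proof
 assume "A:tops"
 then obtain C p q where C: "Tile C p q:K" "insert p (insert q C) = A" using tops_tile by blast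
 have "card A = card C + 2" using K_tile[OF C(1)] unfolding C(2)[symmetric] by simp
 thus False using nolow[OF C(1)] c that by simp
 qed
 let ?v = "insert i (insert k X)"
 have cv: "card ?v = card X + 2" "finite ?v" using fX o by auto
 have vb: "?v~:bots"
 proof -
 have "Tile X i k:W Un K" using t by blast
 thus ?thesis using side_nonterminal(6) by blast
 qed
 show ?thesis
 proof (rule EW_flip[OF E])
 show "insert i X~:bots" "insert k X~:bots" using cb fX o by simp_all
 show "A~:bots" if e: "(A, ?v):edges" for A
 proof -
 obtain m where m: "?v = insert m A" "m~:A" using edge_props[OF e] by metis
 have "finite A" using cv(2) m(1) by simp
 hence "card ?v = Suc (card A)" unfolding m(1) using m(2) by simp
 thus ?thesis using cb[of A] cv by simp
 qed
 show "A' = insert i (insert j (insert k X))" if e: "(?v, A'):edges" for A'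
 proof -
 obtain m where m: "A' = insert m ?v" "m~:?v" using edge_props[OF e] by metis
 have "A'~:tops" by (rule ct) (use m cv in simp)
 hence "V ?v m" unfolding V_def using m e vb by simp
 moreover have "insert j ?v~:tops" by (rule ct) (use cv in "simp add: card_insert_if")
 moreover have "?v = insert k (insert i X)" "?v = insert i (insert k X)" by auto
 ultimately have "m = j" using single_out[OF t(1,2)] by blast
 thus ?thesis unfolding m(1) by auto
 qed
 have nt: "insert d (insert j X)~:tops" for d by (rule ct) (use fX o in "simp add: card_insert_if")
 show jB: "insert j X~:B" by (rule EW_low_nonvertex[OF E nt])
 have "insert j X~:bots" "insert j X~:tops" using cb[of "insert j X"] ct[of "insert j X"] fX o by simp_all
 thus "(ALL te:W Un K. insert j X~:tile_vertices te) | Tile (insert j X) i k:K" using jB B_I by blast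
 qed
qed

text \<open>Now a lens sits directly on the two good tiles. A terminal start of an edge into
  \<open>v\<close>, or a second edge out of \<open>v\<close>, would give a further tile with
  \<open>v\<close> as left or right vertex; this is excluded by \<open>only_tile_at\<close> or
  \<open>good_not_upper\<close>. A lens with bottom \<open>insert j X\<close> has its labels between
  \<open>i\<close> and \<open>k\<close> by \<open>good_not_upper\<close> and the two lemmas on
  lenses beside a good tile; it is then \<open>Tile (insert j X) i k\<close> or excluded by
  \<open>lens_inside\<close>.\<close>

lemma EW_level:
 assumes nolow: "!!C p q. Tile C p q:K ==> card X + 1<=card C" and E: "EW X i j k"
 and nb: "insert i X~:bots" "insert k X~:bots"
 and L: "Tile C p k:K" "insert p (insert k C) = insert i (insert j (insert k X))" "p<=i"
 shows lowerable
proof -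
 have o: "i < j" "j < k" "i~:X" "j~:X" "k~:X" and t: "Tile (insert i X) j k:W" "Tile (insert k X) i j:W" "Tile X i k:W"
 using E unfolding EW_def by auto
 have fX: "finite X" "1<=i" "k<=n" using W_tile[OF t(3)] by auto
 have ct: "A~:tops" if "card A<=card X + 2" for A
 proof
 assume "A:tops"
 then obtain C p q where C: "Tile C p q:K" "insert p (insert q C) = A" using tops_tile by blast
 have "card A = card C + 2" using K_tile[OF C(1)] unfolding C(2)[symmetric] by simp
 thus False using nolow[OF C(1)] that by simp
 qed
 define v where "v = insert i (insert k X)"
 define Y where "Y = insert i (insert j (insert k X))"
 have cv: "card v = card X + 2" "finite v" "j~:v" "i:v" using fX o unfolding v_def by auto
 have cX: "card (insert i X) = card X + 1" "card (insert k X) = card X + 1" "card (insert j X) = card X + 1" using fX o by auto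
 have vb: "v~:bots"
 proof -
 have "Tile X i k:W Un K" using t by blast
 thus ?thesis using side_nonterminal(6) unfolding v_def by blast
 qed
 have ve: "v = insert k (insert i X)" "v = insert i (insert k X)" unfolding v_def by auto
 have Ye: "insert j (insert k (insert i X)) = insert p (insert k C)" "insert i (insert j (insert k X)) = insert p (insert k C)"
 "insert j v = insert p (insert k C)" "insert j v = Y" unfolding v_def Y_def using L(2) by auto
 have Yt: "Y:tops" using L unfolding Y_def by (metis imageI top_Tile)
 have pj: "p < j" "j < k" using L(3) o by auto
 have rightside: False if "Tile Z r s:W" "card Z = card X + 1" "Tile Z r s ~= Tile (insert k X) i j" "v = insert r Z" for Z r s
 using only_tile_at[OF t(2) nb(2) L(1) Ye(2) that(1) _ that(3), of v j] that(2,4) cX ve(2) Ye(3) cv(3) pj by simp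
 have leftside: False if "Tile Z r s:W" "card Z = card X + 1" "Tile Z r s ~= Tile (insert i X) j k" "v = insert s Z" for Z r s
 using only_tile_at[OF t(1) nb(1) L(1) Ye(1) that(1) _ that(3), of v j] that(2,4) cX ve(1) Ye(3) cv(3) pj by simp
 show ?thesis
 proof (rule EW_flip[OF E nb], unfold v_def[symmetric])
 fix A assume e: "(A, v):edges"
 show "A~:bots"
 proof
 assume "A:bots"
 then obtain r s where K: "Tile A r s:K" using bots_tile by blast
 obtain m where m: "v = insert m A" "m~:A" using edge_props[OF e] by metis
 have fA: "finite A" using cv(2) m(1) by simp
 hence cA: "card A = card X + 1" using cv(1) m by simp
 have Ab: "A ~= insert i X" "A ~= insert k X" using `A:bots` nb by blast+
 obtain m1 m2 where ends: "Tile A r m1:W" "Tile A m2 s:W" using bot_ends[OF K] by metis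
 have mm: "r<=m" "m<=s"
 proof -
 show "r<=m"
 proof (rule bot_chain[OF K])
 fix N and g :: "nat => nat" assume g: "g 0 = r" "g N = s" "!!t. t < N ==> g t < g (Suc t) & Tile A (g t) (g (Suc t)):W"
 and g6: "!!m. m~:A ==> (A, insert m A):edges ==> m:g ` {..N}"
 obtain t where t: "t<=N" "m = g t" using g6[OF m(2)] e m(1) by auto
 have "ALL t<N. g t < g (Suc t)" using g(3) by blast
 thus ?thesis using chain_less[of N g 0 t] t g(1) by (cases "t = 0") auto
 qed
 show "m<=s"
 proof (rule bot_chain[OF K])
 fix N and g :: "nat => nat" assume g: "g 0 = r" "g N = s" "!!t. t < N ==> g t < g (Suc t) & Tile A (g t) (g (Suc t)):W"
 and g6: "!!m. m~:A ==> (A, insert m A):edges ==> m:g ` {..N}"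
 obtain t where t: "t<=N" "m = g t" using g6[OF m(2)] e m(1) by auto
 have "ALL t<N. g t < g (Suc t)" using g(3) by blast
 thus ?thesis using chain_less[of N g t N] t g(2) by (cases "t = N") auto
 qed
 qed
 consider "m = r" | "m = s" | "r < m" "m < s" using mm by linarith
 thus False
 proof cases
 case 1
 thus False using rightside[OF ends(1) cA] m(1) Ab by simp
 next
 case 2
 thus False using leftside[OF ends(2) cA] m(1) Ab by simp
 next
 case 3
 thus False using good_not_upper[OF t(2) nb(2) _ K _ m(1) m(2)] ve(2) cA cX by simp
 qed
 qed
 next
 fix A' assume e: "(v, A'):edges"
 obtain m where m: "A' = insert m v" "m~:v" using edge_props[OF e] by metis
 have "m = j"
 proof (rule ccontr)
 assume mj: "m ~= j"
 have AY: "A' ~= Y"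
 proof
 assume "A' = Y"
 hence "j:insert m v" using m(1) Ye(4) by auto
 thus False using mj cv(3) by simp
 qed
 show False
 proof (cases "A':tops")
 case True
 then obtain D r s where K: "Tile D r s:K" "A' = insert r (insert s D)" using tops_tile by metis
 have fA: "finite A'" "card A' = card X + 3" using m cv by auto
 have vA: "A' - {m} = v" "m:A'" using m by auto
 show False
 proof (rule top_chain[OF K])
 fix N and g :: "nat => nat" assume g: "2<=N" "g 0 = r" "g N = s"
 "!!t. t < N ==> g t < g (Suc t) & g t:A' & g (Suc t):A' & Tile (A' - {g (Suc t)} - {g t}) (g t) (g (Suc t)):W"
 and g6: "!!m. m:A' ==> (A' - {m}, A'):edges ==> m:g ` {..N}"
 obtain t where tt: "t<=N" "m = g t" using g6[OF vA(2)] e vA(1) by auto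
 have gen: "card (A' - {g (Suc u)} - {g u}) = card X + 1" "insert (g (Suc u)) (A' - {g (Suc u)} - {g u}) = A' - {g u}"
 "insert (g u) (A' - {g (Suc u)} - {g u}) = A' - {g (Suc u)}" "insert (g u) (insert (g (Suc u)) (A' - {g (Suc u)} - {g u})) = A'" if "u < N" for u
 proof -
 have gu: "g u < g (Suc u)" "g u:A'" "g (Suc u):A'" using g(4)[OF that] by auto
 thus "insert (g (Suc u)) (A' - {g (Suc u)} - {g u}) = A' - {g u}" "insert (g u) (A' - {g (Suc u)} - {g u}) = A' - {g (Suc u)}"
 "insert (g u) (insert (g (Suc u)) (A' - {g (Suc u)} - {g u})) = A'" by auto
 have "g u:A' - {g (Suc u)}" using gu by simp
 thus "card (A' - {g (Suc u)} - {g u}) = card X + 1" using fA gu by simp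
 qed
 show False
 proof (cases "t < N")
 case True
 have "Tile (A' - {g (Suc t)} - {g t}) (g t) (g (Suc t)) ~= Tile (insert i X) j k"
 proof
 assume "Tile (A' - {g (Suc t)} - {g t}) (g t) (g (Suc t)) = Tile (insert i X) j k"
 hence e: "A' - {g (Suc t)} - {g t} = insert i X & g t = j & g (Suc t) = k" by (rule tile.inject[THEN iffD1])
 hence "insert j (insert k (insert i X)) = A'" using gen(4)[OF True] e by metis
 thus False using AY Ye by simp
 qed
 thus False using leftside[of "A' - {g (Suc t)} - {g t}" "g t" "g (Suc t)"] g(4)[OF True] gen[OF True] vA(1) tt(2) by simp
 next
 case False
 hence "t = N" using tt by simp
 then obtain u where u: "t = Suc u" "u < N" using g(1) by (cases t) auto
 have "Tile (A' - {g (Suc u)} - {g u}) (g u) (g (Suc u)) ~= Tile (insert k X) i j"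
 proof
 assume "Tile (A' - {g (Suc u)} - {g u}) (g u) (g (Suc u)) = Tile (insert k X) i j"
 hence e: "A' - {g (Suc u)} - {g u} = insert k X & g u = i & g (Suc u) = j" by (rule tile.inject[THEN iffD1])
 hence "insert i (insert j (insert k X)) = A'" using gen(4)[OF u(2)] e by metis
 thus False using AY Y_def by simp
 qed
 thus False using rightside[of "A' - {g (Suc u)} - {g u}" "g u" "g (Suc u)"] g(4)[OF u(2)] gen[OF u(2)] vA(1) tt(2) u(1) by simp
 qed
 qed
 next
 case False
 hence Vm: "V v m" unfolding V_def using m e vb by simp
 define D where "D = {d. V v d}"
 have "D<={1..n}" using V_subset unfolding D_def by blast
 hence D: "finite D" "D ~= {}" using Vm finite_subset unfolding D_def by blast+
 \<comment> \<open>The tile right of the last planar edge out of \<open>v\<close> has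
   \<open>v\<close> as its left vertex. It differs from \<open>Tile (insert k X) i j\<close>, whose
   top is terminal.\<close>
 define q where "q = Max D"
 have q: "V v q" using Max_in[OF D] unfolding q_def D_def by blast
 have qmax: "d<=q" if "V v d" for d unfolding q_def by (rule Max_ge[OF D(1)]) (use that D_def in simp)
 have "(v, insert q v)~:RB n"
 proof
 assume "(v, insert q v):RB n"
 note rb = RB_levelD[OF this]
 have "n - card v + 1<=i" using rb cv(4) by (metis atLeastAtMost_iff)
 hence "j:{n - card v + 1..n}" using o fX by simp
 thus False using rb cv(3) by metis
 qed
 with q show False
 proof (rule white_right)
 fix m2 assume "q < m2" "Tile v q m2:W"
 thus False using qmax[of m2] V_lower(2)[of v q m2] vb by fastforce
 next
 fix c assume c: "c:v" "c < q" "Tile (v - {c}) c q:W"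
 have ins: "insert c (v - {c}) = v" using c(1) by blast
 have nt: "insert q v~:tops" using q unfolding V_def by blast
 have "Tile (v - {c}) c q ~= Tile (insert k X) i j"
 proof
 assume "Tile (v - {c}) c q = Tile (insert k X) i j"
 hence "q = j" by simp
 thus False using nt Yt Ye(4) by simp
 qed
 moreover have "card (v - {c}) = card X + 1" using c(1) cv by simp
 ultimately show False using rightside[OF c(3)] ins by simp
 qed
 qed
 qed
 thus "A' = insert i (insert j (insert k X))" using m Ye(4) unfolding Y_def by simp
 next
 have nt: "insert d (insert j X)~:tops" for d by (rule ct) (use fX o in "simp add: card_insert_if")
 show jB: "insert j X~:B" by (rule EW_low_nonvertex[OF E nt])
 have jt: "insert j X~:tops" by (rule ct) (use cX in simp)
 show "(ALL te:W Un K. insert j X~:tile_vertices te) | Tile (insert j X) i k:K"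
 proof (rule disjCI)
 assume nK: "Tile (insert j X) i k~:K"
 show "ALL te:W Un K. insert j X~:tile_vertices te"
 proof (intro ballI notI)
 fix te assume "te:W Un K" "insert j X:tile_vertices te"
 hence "insert j X:bots" using jB jt B_I by blast
 then obtain p' q' where K: "Tile (insert j X) p' q':K" using bots_tile by blast
 have kt: "p' < q'" "1<=p'" "q'<=n" "p'~:insert j X" "q'~:insert j X" using K_tile[OF K] by auto
 have ev: "insert j (insert i X) = insert i (insert j X)" "insert j (insert k X) = insert k (insert j X)" by auto
 have c1: "~ (p' < i & i < q')"
 using good_not_upper[OF t(1) nb(1) _ K, of "insert j (insert i X)" i] cX ev(1) o by auto
 have c2: "~ (p' < k & k < q')"
 using good_not_upper[OF t(2) nb(2) _ K, of "insert j (insert k X)" k] cX ev(2) o by auto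
 have c3: "i < q'"
 proof (rule ccontr)
 assume n: "~ i < q'"
 have pi: "p' < i" using n kt by simp
 let ?u = "insert j (insert i X)"
 have "?u ~= {1..card ?u}"
 proof
 assume u: "?u = {1..card ?u}"
 have "i:{1..card ?u}" using u by blast
 hence "p':{1..card ?u}" using pi kt by simp
 hence "p':?u" using u by metis
 thus False using kt pi by auto
 qed
 then obtain Z s u where Z: "Tile Z s u:W" "Z~:bots" "insert u Z = ?u" "j<=u"
 using left_good[OF V_lower(1)[OF t(1) nb(1)] refl] by blast
 have "card Z = card X + 1" using arg_cong[OF Z(3), of card] W_tile[OF Z(1)] fX o by simp
 thus False using lens_left_of_good[OF Z(1,2) _ _ _ K, of i] Z(3,4) ev(1) o n cX by simp
 qed
 have c4: "p' < k"
 proof (rule ccontr)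
 assume n: "~ p' < k"
 have pi: "k < q'" using n kt by simp
 let ?u = "insert j (insert k X)"
 have "?u ~= {n - card ?u + 1..n}"
 proof
 assume u: "?u = {n - card ?u + 1..n}"
 have "k:{n - card ?u + 1..n}" using u by blast
 hence "q':{n - card ?u + 1..n}" using pi kt by simp
 hence "q':?u" using u by metis
 thus False using kt pi by auto
 qed
 then obtain Z s u where Z: "Tile Z s u:W" "Z~:bots" "insert s Z = ?u" "s<=j"
 using right_good[OF V_lower(2)[OF t(2) nb(2)] refl] by blast
 have "card Z = card X + 1" using arg_cong[OF Z(3), of card] W_tile[OF Z(1)] fX o by simp
 thus False using lens_right_of_good[OF Z(1,2) _ _ _ K, of k] Z(3,4) ev(2) o n cX by simp
 qed
 have ip: "i<=p'" "q'<=k" using c1 c2 c3 c4 by linarith+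
 have Ck: "p~:C" "k~:C" "p < k" using K_tile[OF L(1)] by auto
 have memC: "x:C \<longleftrightarrow> x ~= p & x ~= k & (x = i | x = j | x = k | x:X)" for x using L(2) Ck by (metis insert_iff)
 show False
 proof (cases "p = i")
 case True
 have "x:C \<longleftrightarrow> x:insert j X" for x unfolding memC True using o by auto
 hence "C = insert j X" by blast
 thus False using L(1) nK True by simp
 next
 case False
 hence pi: "p < i" using L(3) by simp
 have "i:C" unfolding memC using False o by auto
 hence "C ~= insert j X" using o by auto
 thus False using lens_inside[OF o fX(1) t(1) nb(1) t(2) nb(2) L(1,2) pi _ K ip] by blast
 qed
 qed
 qed
 qed
qed

text \<open>With black tiles present, take the lowest level of black bottoms. The two good tiles of
  \<open>two_good\<close> meet in \<open>v = Y - {c}\<close> and start \<open>descent\<close>, which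
  ends either strictly below all black tiles (\<open>EW_low\<close>) or at \<open>v\<close> itself
  (\<open>EW_level\<close>).\<close>

lemma lower_exists:
 assumes "B ~= intervals n"
 shows lowerable
proof (cases "K = {}")
 case True
 then obtain X i j k where E: "EW X i j k" using spectrum_intervals[OF True] assms by blast
 have "Tile X i k:W" using E unfolding EW_def by blast
 hence "card X<=n" using W_tile card_mono[of "{1..n}" X] by fastforce
 hence "card X + 2 < n + 3" by simp
 thus ?thesis using EW_low[OF _ E, of "n + 3"] True by blast
next
 case False
 obtain \<kappa> where k: "\<kappa>:K" "ALL \<sigma>:K. card (bottom \<kappa>)<=card (bottom \<sigma>)" using finite_argmin[OF fin(2) False, of "%te. card (bottom te)"] by blast
 obtain C0 p0 q0 where \<kappa>: "\<kappa> = Tile C0 p0 q0" by (cases \<kappa>) auto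
 define h where "h = card C0"
 have nolow: "h<=card C" if "Tile C p q:K" for C p q using bspec[OF k(2) that] unfolding \<kappa> h_def by simp
 have "Tile C0 p0 q0:K" using k \<kappa> by simp
 then obtain C p q c b where s: "Tile C p q:K" "card C = h" "b < c" "c < q" "p<=b" "b:insert p (insert q C)" "c:C"
 "Tile (insert p (insert q C) - {c} - {q}) c q:W" "Tile (insert p (insert q C) - {c} - {b}) b c:W"
 "insert p (insert q C) - {c} - {q}~:bots" "insert p (insert q C) - {c} - {b}~:bots"
 by (rule two_good[OF _ h_def[symmetric]])
 define Y where "Y = insert p (insert q C)"
 define v where "v = Y - {c}"
 note s' = s(6,8-11)[folded Y_def, folded v_def]
 have kt: "p~:C" "q~:C" "p < q" "finite C" using K_tile[OF s(1)] by auto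
 have cY: "card Y = h + 2" "finite Y" "c:Y" "q:Y" using kt s(2,7) unfolding Y_def by auto
 have cv: "card v = Suc h" unfolding v_def using cY by simp
 have mem: "b:v" "q:v" "c~:v" using s'(1) s(3,4) cY unfolding v_def by auto
 have bq: "b ~= q" using s(3,4) by simp
 have h1: "1<=h"
 proof -
 have "C ~= {}" using s(7) by blast
 hence "0 < card C" using kt(4) by (simp add: card_gt_0_iff)
 thus ?thesis using s(2) by simp
 qed
 have "EX X i j k. EW X i j k & (card X + 2 < card v | X = v - {q} - {b} & i = b & j = c & k = q)"
 by (rule descent[of "Suc h" v b c q, OF _ _ s(3,4) mem s'(2-5)]) (use nolow cv in auto)
 then obtain X i j k where E: "EW X i j k" "card X + 2 < card v | X = v - {q} - {b} & i = b & j = c & k = q" by blast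
 from E(2) show ?thesis
 proof
 assume l: "card X + 2 < card v"
 show ?thesis by (rule EW_low[OF _ E(1), of "Suc h"]) (use nolow cv l in auto)
 next
 assume e: "X = v - {q} - {b} & i = b & j = c & k = q"
 have ijk: "i = b" "j = c" "k = q" and X1: "X = v - {q} - {b}" "X = v - {b} - {q}" using e by blast+
 have bv: "b:v - {q}" "q:v - {b}" using mem bq by simp_all
 have X: "insert b X = v - {q}" "insert q X = v - {b}"
 by (simp only: X1(1) insert_Diff[OF bv(1)], simp only: X1(2) insert_Diff[OF bv(2)])
 have "card X = card v - 1 - 1" by (simp only: X1(1) card_Diff_singleton[OF bv(1)] card_Diff_singleton[OF mem(2)])
 hence cX: "card X + 1<=h" using cv h1 by simp
 have nl: "card X + 1<=card C'" if "Tile C' p' q':K" for C' p' q' using nolow[OF that] cX by simp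
 have "insert b (insert c (insert q X)) = insert c (insert b (v - {b}))" unfolding X(2) by (rule insert_commute)
 hence Y3: "insert b (insert c (insert q X)) = Y" unfolding insert_Diff[OF mem(1)] unfolding v_def insert_Diff[OF cY(3)] .
 show ?thesis
 proof (rule EW_level[OF nl E(1)])
 show "insert i X~:bots" unfolding ijk X by (rule s'(4))
 show "insert k X~:bots" unfolding ijk X by (rule s'(5))
 show "Tile C p k:K" unfolding ijk by (rule s(1))
 show "insert p (insert k C) = insert i (insert j (insert k X))" unfolding ijk Y3 unfolding Y_def by (rule refl)
 show "p<=i" unfolding ijk by (rule s(5))
 qed
 qed
qed

end

section \<open>Induction over flips and both directions\<close>

lemma interval_convex: "I:intervals n ==> q:I ==> r:I ==> q < p ==> p < r ==> p:I"
 unfolding intervals_def by auto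

lemma intervals_ws:
 assumes "A:intervals n" "A':intervals n"
 shows "ws A A'"
proof -
 have "~ encloses C I" "~ alternates C I" if "I:intervals n" for C I
 unfolding encloses_def alternates_def using interval_convex[OF that] by blast+
 thus ?thesis unfolding ws_def using assms by blast
qed

lemma ws_refl: "ws A A"
 unfolding ws_def alternates_def by blast

lemma sum_card_lowered:
 assumes "finite S" "Y:S" "Y'~:S" "card Y' < card Y"
 shows "sum card (S - {Y} Un {Y'}) < sum card S"
proof -
 have "sum card S = card Y + sum card (S - {Y})" using assms by (simp add: sum.remove)
 moreover have "sum card (insert Y' (S - {Y})) = card Y' + sum card (S - {Y})" using assms by (intro sum.insert) auto
 ultimately show ?thesis using assms(4) by simp
qed

lemma union_insert: "Z Un {a} = insert a Z" "Z Un {a, b} = insert a (insert b Z)"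
 by auto

text \<open>The spectrum is obtained from the lowered one by a raising flip, and this flip is the
  situation of \<open>ws_flip\<close>: weak separation of the lowered spectrum carries over to the
  new set. So both claims go through one induction.\<close>

lemma gt_main:
 "gt n W K ==> (ALL A:spectrum W K. ALL A':spectrum W K. ws A A') & semi_normal_TP_basis n (spectrum W K)"
proof (induction "sum card (spectrum W K)" arbitrary: W K rule: less_induct)
 case less
 interpret gt n W K by (rule less.prems)
 show ?case
 proof (cases "B = intervals n")
 case True
 have "ws A A'" if "A:B" "A':B" for A A' using intervals_ws that unfolding True by blast
 thus ?thesis using intervals_TP_basis[of n] unfolding semi_normal_TP_basis_def True by blast
 next
 case False
 obtain X i j k W' K' where p: "i < j & j < k & i~:X & j~:X & k~:X & insert i X:B & insert k X:B &
 insert i (insert j X):B & insert i (insert k X):B & insert j (insert k X):B & insert j X~:B &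
 gt n W' K' & spectrum W' K' = B - {insert i (insert k X)} Un {insert j X}"
 using lower_exists[OF False] unfolding lowerable_def by - (elim exE, rule that)
 have o: "i < j" "j < k" "i~:X" "j~:X" "k~:X"
 and m: "insert i X:B" "insert k X:B" "insert i (insert j X):B" "insert i (insert k X):B" "insert j (insert k X):B"
 and nB: "insert j X~:B" and g: "gt n W' K'" and S: "spectrum W' K' = B - {insert i (insert k X)} Un {insert j X}"
 using p by blast+
 define Y where "Y = insert i (insert k X)"
 define B' where "B' = B - {Y} Un {insert j X}"
 note S' = S[folded Y_def, folded B'_def]
 have sub: "X<={1..n}" "i:{1..n}" "j:{1..n}" "k:{1..n}" using B_subset[OF m(3)] B_subset[OF m(2)] by auto
 have fX: "finite X" using B_finite[OF m(1)] by simp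
 have fB: "finite B" by (rule finite_subset[of _ "Pow {1..n}"]) (use B_subset in auto)
 have YB: "Y:B" using m(4) unfolding Y_def .
 have cY: "card Y = card X + 2" unfolding Y_def using fX o by simp
 have cj: "card (insert j X) = card X + 1" using fX o by simp
 have "sum card B' < sum card B" unfolding B'_def by (rule sum_card_lowered[OF fB YB nB]) (use cY cj in simp)
 hence IH: "!!A A'. A:B' ==> A':B' ==> ws A A'" "semi_normal_TP_basis n B'"
 using less.hyps[of W' K'] g unfolding S' by blast+
 have ne: "insert i X ~= Y" "insert k X ~= Y" "insert i (insert j X) ~= Y" "insert j (insert k X) ~= Y" "insert j X ~= Y"
 proof -
 show "insert i X ~= Y" "insert k X ~= Y" "insert j X ~= Y" using cY fX o by (auto dest!: arg_cong[of _ _ card])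
 have "j~:Y" unfolding Y_def using o by simp
 thus "insert i (insert j X) ~= Y" "insert j (insert k X) ~= Y" by blast+
 qed
 have m': "insert i X:B'" "insert k X:B'" "insert i (insert j X):B'" "insert j (insert k X):B'" "insert j X:B'" "Y~:B'"
 unfolding B'_def using m ne by blast+
 have wY: "ws Z Y" if "Z:B" for Z
 proof (cases "Z = Y")
 case True
 thus ?thesis by (simp add: ws_refl)
 next
 case False
 hence Z: "Z:B'" "Z ~= insert j X" using that nB unfolding B'_def by blast+
 show ?thesis unfolding Y_def
 by (rule ws_flip[OF fX B_finite[OF that] o IH(1)[OF Z(1) m'(1)] IH(1)[OF Z(1) m'(5)] IH(1)[OF Z(1) m'(2)]
 IH(1)[OF Z(1) m'(3)] IH(1)[OF Z(1) m'(4)] Z(2)])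
 qed
 have ws: "ws A A'" if "A:B" "A':B" for A A'
 proof (cases "A = Y | A' = Y")
 case True
 thus ?thesis using wY that ws_sym by blast
 next
 case False
 hence "A:B'" "A':B'" using that unfolding B'_def by blast+
 thus ?thesis by (rule IH(1))
 qed
 have BB: "B = B' - {insert j X} Un {Y}"
 proof (rule set_eqI)
 fix x show "x:B \<longleftrightarrow> x:B' - {insert j X} Un {Y}" unfolding B'_def using nB YB by blast
 qed
 have flip: "TP_flip n B' B" unfolding TP_flip_def union_insert
 proof (intro conjI exI disjI1)
 show "TP_basis n B'" using IH(2) unfolding semi_normal_TP_basis_def by blast
 show "i < j" "j < k" by (rule o)+
 show "{i, j, k}<={1..n}" using sub by simp
 show "X<={1..n} - {i, j, k}" using sub o by blast
 show "{insert i (insert j X), insert k X, insert i X, insert j (insert k X)}<=B'" using m' by simp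
 show "insert j X:B'" by (rule m')
 show "insert i (insert k X)~:B'" using m'(6) unfolding Y_def .
 show "B = insert (insert i (insert k X)) (B' - {insert j X})" using BB unfolding Y_def by simp
 qed
 hence "semi_normal_TP_basis n B"
 using IH(2) TP_flip_TP_basis[OF flip] unfolding semi_normal_TP_basis_def by (meson rtranclp.rtrancl_into_rtrancl)
 thus ?thesis using ws by blast
 qed
qed

lemma lower_realised:
 assumes g: "gt n W K" and T4: "axiom_T4 (W Un K)" and o: "i < j" "j < k" "i~:X" "j~:X" "k~:X"
 and B: "insert i X:spectrum W K" "insert k X:spectrum W K" "insert i (insert j X):spectrum W K"
 "insert i (insert k X):spectrum W K" "insert j (insert k X):spectrum W K" "insert j X~:spectrum W K"
 shows "EX W' K'. gt n W' K' & spectrum W' K' = spectrum W K - {insert i (insert k X)} Un {insert j X} & axiom_T4 (W' Un K')"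
proof -
 interpret gt n W K by (rule g)
 have WS unfolding WS_def using gt_main[OF g] by blast
 then obtain W' K' where r: "gt n W' K'" "spectrum W' K' = B - {insert i (insert k X)} Un {insert j X}" "exchange X i j k (W Un K) (W' Un K')"
 using lowering[OF _ o B] by blast
 have "(\<Union>te\<in>W Un K. cube_square te) homeomorphic (\<Union>te\<in>W' Un K'. cube_square te)"
 by (rule exchange_homeomorphic[OF o r(3), of n]) (use sub fin gt.sub[OF r(1)] gt.fin[OF r(1)] in auto)
 hence "axiom_T4 (W' Un K')" using T4 unfolding axiom_T4_def by (meson homeomorphic_sym homeomorphic_trans)
 thus ?thesis using r by blast
qed

lemma (in gt) dual_T4: "axiom_T4 (W Un K) ==> axiom_T4 (dual_tile n ` W Un dual_tile n ` K)"
 using dual_complex_homeomorphic unfolding axiom_T4_def by (meson homeomorphic_sym homeomorphic_trans)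

text \<open>Raising at \<open>X\<close> is lowering of the complements at the complement
  \<open>Z\<close> of \<open>Xijk\<close>: there \<open>Zik\<close> is the complement of
  \<open>Xj\<close>, and \<open>Zj\<close> is the complement of \<open>Xik\<close>.\<close>

lemma raise_realised:
 assumes g: "gt n W K" and T4: "axiom_T4 (W Un K)" and o: "i < j" "j < k" "i~:X" "j~:X" "k~:X"
 and B: "insert i X:spectrum W K" "insert k X:spectrum W K" "insert i (insert j X):spectrum W K"
 "insert j X:spectrum W K" "insert j (insert k X):spectrum W K" "insert i (insert k X)~:spectrum W K"
 shows "EX W' K'. gt n W' K' & spectrum W' K' = spectrum W K - {insert j X} Un {insert i (insert k X)} & axiom_T4 (W' Un K')"
proof -
 interpret gt n W K by (rule g)
 let ?d = "dual_set n" and ?D = "dual_tile n"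
 define Y where "Y = insert i (insert k X)"
 define Z where "Z = ?d (insert i (insert j (insert k X)))"
 have sub: "X<={1..n}" "i:{1..n}" "j:{1..n}" "k:{1..n}" using B_subset[OF B(3)] B_subset[OF B(2)] by auto
 have YS: "Y<={1..n}" unfolding Y_def using sub by simp
 have Z2: "Z = ?d (insert k (insert i (insert j X)))" "Z = ?d (insert j (insert i (insert k X)))"
 unfolding Z_def by (simp_all add: insert_commute)
 have Z1: "insert i Z = ?d (insert j (insert k X))" unfolding Z_def by (rule dual_insert_remove) (use sub o in auto)
 have Z3: "insert k Z = ?d (insert i (insert j X))" unfolding Z2(1) by (rule dual_insert_remove) (use sub o in auto)
 have Z4: "insert j Z = ?d Y" unfolding Z2(2) Y_def by (rule dual_insert_remove) (use sub o in auto)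
 have Z5: "insert i (insert j Z) = ?d (insert k X)" unfolding Z4 Y_def by (rule dual_insert_remove) (use sub o in auto)
 have Z6: "insert j (insert k Z) = ?d (insert i X)" unfolding Z3 insert_commute[of i j X] by (rule dual_insert_remove) (use sub o in auto)
 have Z7: "insert i (insert k Z) = ?d (insert j X)" unfolding Z3 by (rule dual_insert_remove) (use sub o in auto)
 have nZ: "i~:Z" "j~:Z" "k~:Z" unfolding Z_def dual_set_def by simp_all
 note Bs = dual_spectrum
 have nY: "?d Y~:?d ` B"
 proof
 assume "?d Y:?d ` B"
 then obtain A where A: "A:B" "?d Y = ?d A" by blast
 hence "Y = A" using dual_inj[OF YS B_subset] by blast
 thus False using A B(6) unfolding Y_def by simp
 qed
 have D: "insert i Z:spectrum (?D ` W) (?D ` K)" "insert k Z:spectrum (?D ` W) (?D ` K)" "insert i (insert j Z):spectrum (?D ` W) (?D ` K)"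
 "insert i (insert k Z):spectrum (?D ` W) (?D ` K)" "insert j (insert k Z):spectrum (?D ` W) (?D ` K)" "insert j Z~:spectrum (?D ` W) (?D ` K)"
 proof -
 show "insert i Z:spectrum (?D ` W) (?D ` K)" unfolding Bs Z1 by (rule imageI[OF B(5)])
 show "insert k Z:spectrum (?D ` W) (?D ` K)" unfolding Bs Z3 by (rule imageI[OF B(3)])
 show "insert i (insert j Z):spectrum (?D ` W) (?D ` K)" unfolding Bs Z5 by (rule imageI[OF B(2)])
 show "insert i (insert k Z):spectrum (?D ` W) (?D ` K)" unfolding Bs Z7 by (rule imageI[OF B(4)])
 show "insert j (insert k Z):spectrum (?D ` W) (?D ` K)" unfolding Bs Z6 by (rule imageI[OF B(1)])
 show "insert j Z~:spectrum (?D ` W) (?D ` K)" unfolding Bs Z4 by (rule nY)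
 qed
 obtain W1 K1 where r: "gt n W1 K1" "spectrum W1 K1 = ?d ` B - {?d (insert j X)} Un {?d Y}" "axiom_T4 (W1 Un K1)"
 using lower_realised[OF dual_gt dual_T4[OF T4] o(1,2) nZ D] unfolding Bs Z7 Z4 by blast
 have jS: "insert j X<={1..n}" using sub by simp
 have "?d ` (?d ` B - {?d (insert j X)} Un {?d Y}) = B - {insert j X} Un {Y}"
 proof (intro equalityI subsetI)
 fix x assume "x:?d ` (?d ` B - {?d (insert j X)} Un {?d Y})"
 then obtain y where y: "x = ?d y" "y = ?d Y | y:?d ` B & y ~= ?d (insert j X)" by blast
 from y(2) show "x:B - {insert j X} Un {Y}"
 proof
 assume "y = ?d Y"
 thus ?thesis using y(1) dual_dual[OF YS] by simp
 next
 assume a: "y:?d ` B & y ~= ?d (insert j X)"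
 then obtain A where A: "A:B" "y = ?d A" by blast
 have "x = A" unfolding y(1) A(2) by (rule dual_dual[OF B_subset[OF A(1)]])
 thus ?thesis using a A by blast
 qed
 next
 fix x assume "x:B - {insert j X} Un {Y}"
 then consider "x = Y" | "x:B" "x ~= insert j X" by blast
 thus "x:?d ` (?d ` B - {?d (insert j X)} Un {?d Y})"
 proof cases
 case 1
 show ?thesis by (rule image_eqI[of _ _ "?d Y"]) (use 1 dual_dual[OF YS] in simp_all)
 next
 case 2
 have "?d x ~= ?d (insert j X)" using dual_inj[OF B_subset[OF 2(1)] jS] 2(2) by simp
 hence "?d x:?d ` B - {?d (insert j X)} Un {?d Y}" using 2(1) by blast
 moreover have "x = ?d (?d x)" by (rule dual_dual[OF B_subset[OF 2(1)], symmetric])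
 ultimately show ?thesis by (rule rev_image_eqI)
 qed
 qed
 hence "spectrum (?D ` W1) (?D ` K1) = B - {insert j X} Un {Y}" using gt.dual_spectrum[OF r(1)] r(2) by simp
 thus ?thesis using gt.dual_gt[OF r(1)] gt.dual_T4[OF r(1,3)] unfolding Y_def by blast
qed

lemma semi_normal_realised:
 assumes n: "2<=n" and "(TP_flip n)\<^sup>*\<^sup>* (intervals n) B"
 shows "EX W K. gt n W K & spectrum W K = B & axiom_T4 (W Un K)"
 using assms(2)
proof (induction rule: rtranclp_induct)
 case base
 show ?case using std_gt[OF n] std_spectrum[OF n] std_complex_disc[OF n] by (intro exI[of _ "std_tiles n"] exI[of _ "{}"]) simp
next
 case (step B B')
 obtain W K where WK: "gt n W K" "spectrum W K = B" "axiom_T4 (W Un K)" using step.IH by blast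
 have "EX i j k X. i < j & j < k & {i, j, k}<={1..n} & X<={1..n} - {i, j, k} &
 {X Un {i, j}, X Un {k}, X Un {i}, X Un {j, k}}<=B &
 (X Un {j}:B & X Un {i, k}~:B & B' = B - {X Un {j}} Un {X Un {i, k}} |
 X Un {i, k}:B & X Un {j}~:B & B' = B - {X Un {i, k}} Un {X Un {j}})"
 using step.hyps(2) unfolding TP_flip_def by (rule conjunct2)
 then obtain i j k X where p: "i < j & j < k & {i, j, k}<={1..n} & X<={1..n} - {i, j, k} &
 {insert i (insert j X), insert k X, insert i X, insert j (insert k X)}<=B &
 (insert j X:B & insert i (insert k X)~:B & B' = insert (insert i (insert k X)) (B - {insert j X}) |
 insert i (insert k X):B & insert j X~:B & B' = insert (insert j X) (B - {insert i (insert k X)}))"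
 unfolding union_insert by - (elim exE, rule that)
 have o: "i < j" "j < k" "X<={1..n} - {i, j, k}"
 and m: "{insert i (insert j X), insert k X, insert i X, insert j (insert k X)}<=B"
 and d: "insert j X:B & insert i (insert k X)~:B & B' = insert (insert i (insert k X)) (B - {insert j X}) |
 insert i (insert k X):B & insert j X~:B & B' = insert (insert j X) (B - {insert i (insert k X)})"
 using p by argo+
 have x: "i~:X" "j~:X" "k~:X" using o(3) by blast+
 have m': "insert i X:B" "insert k X:B" "insert i (insert j X):B" "insert j (insert k X):B" using m by simp_all
 from d show ?case
 proof
 assume a: "insert j X:B & insert i (insert k X)~:B & B' = insert (insert i (insert k X)) (B - {insert j X})"
 show ?thesis using raise_realised[OF WK(1,3) o(1,2) x, unfolded WK(2)] m' a by simp
 next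
 assume a: "insert i (insert k X):B & insert j X~:B & B' = insert (insert j X) (B - {insert i (insert k X)})"
 show ?thesis using lower_realised[OF WK(1,3) o(1,2) x, unfolded WK(2)] m' a by simp
 qed
qed

theorem theorem2p2:
  fixes n :: nat and a :: "nat \<Rightarrow> real"
  assumes "2 \<le> n" and "generic_generators n a"
  shows "(\<forall>W K. g_tiling n a W K \<longrightarrow> semi_normal_TP_basis n (spectrum W K)) \<and>
         (\<forall>B. semi_normal_TP_basis n B \<longrightarrow> (\<exists>W K. g_tiling n a W K \<and> spectrum W K = B))"
proof (intro conjI allI impI)
 fix W K assume "g_tiling n a W K"
 thus "semi_normal_TP_basis n (spectrum W K)" using gt_main[OF g_tiling_gt[OF assms]] by blast
next
 fix B assume "semi_normal_TP_basis n B"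
 then obtain W K where "gt n W K" "spectrum W K = B" "axiom_T4 (W Un K)"
 using semi_normal_realised[OF assms(1)] unfolding semi_normal_TP_basis_def by blast
 thus "EX W K. g_tiling n a W K & spectrum W K = B" using gt_g_tiling[OF assms(2)] by blast
qed

end
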